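(* Let $T>0$. Let $s\in(0,1)$, $\alpha\in[0,1)$ be such that $\alpha+2s\notin\{1,2\}$, and let $f\in C^{\alpha+2s}_H(X)$, $g\in C^{0,\alpha}_H([0,T]\times X)$. Then the mild solution $v$ to $$v_t(t,x)+(-L)^sv(t,\cdot)(x)=g(t,x),\quad 0\le t\le T,\ x\in X;\qquad v(0,x)=f(x),\quad x\in X,\qquad( * )$$ where $-(-L)^s$ is the fractional power of the Gross Laplacian described in the context, belongs to $C^{0,\alpha+2s}_H([0,T]\times X)$, and there is $C>0$, independent of $f$ and $g$, such that $$\|v\|_{C^{0,\alpha+2s}_H([0,T]\times X)}\le C\big(\|f\|_{C^{\alpha+2s}_H(X)}+\|g\|_{C^{0,\alpha}_H([0,T]\times X)}\big).$$ Let $s\in(0,1)$, $\alpha\in[0,1)$ be such that $\alpha+2s=:k\in\{1,2\}$. Then for every $f\in Z^k_H(X)$, $g\in C^{0,\alpha}_H([0,T]\times X)$ the mild solution to $( * )$ belongs to $Z^{0,k}_H([0,T]\times X)$, and there is $C>0$, independent of $f$ and $g$, such that $$\|v\|_{Z^{0,k}_H([0,T]\times X)}\le C\big(\|f\|_{Z^k_H(X)}+\|g\|_{C^{0,\alpha}_H([0,T]\times X)}\big).$$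
   Context: The semigroup. $X$ is a real separable Hilbert space and $Q\in\mathcal{L}(X)$ is a self-adjoint positive operator with finite trace. $H=Q^{1/2}(X)$ with norm $\|h\|_H=\|Q^{-1/2}h\|$ ($Q^{-1/2}$ the pseudo-inverse of $Q^{1/2}$), the Cameron–Martin space of the centered Gaussian measure $\mathcal{N}(0,Q)$. $P_tf(x)=\int_Xf(x+y)\,\mathcal{N}(0,tQ)(dy)$, $t>0$, $f\in C_b(X)$; its generator $L$ (a realization of the Gross Laplacian $\frac12\mathrm{Tr}(QD^2u)$) is the closed operator in $C_b(X)$ with $R(\lambda,L)f(x)=\int_0^\infty e^{-\lambda t}P_tf(x)\,dt$, $\lambda>0$. For $s\in(0,1)$, $t>0$, let $\eta^{(s)}_t:(0,\infty)\to\mathbb{R}$ be the inverse Laplace transform of $\lambda\mapsto e^{-t\lambda^s}$, i.e. $\int_0^\infty e^{-\lambda\sigma}\eta^{(s)}_t(\sigma)\,d\sigma=e^{-t\lambda^s}$, and $S_tf(x)=\int_0^\infty P_\sigma f(x)\,\eta^{(s)}_t(\sigma)\,d\sigma$, $S_0=I$. By definition $-(-L)^s$ is the generator of $S_t$, i.e. the closed operator in $C_b(X)$ whose resolvent at $\lambda>0$ is $f\mapsto\int_0^\infty e^{-\lambda t}S_tf(\cdot)\,dt$. The mild solution of $( * )$ is by definition $v(t,x)=S_tf(x)+\int_0^tS_{t-r}g(r,\cdot)(x)\,dr$. Function spaces. $C_b$: bounded continuous real functions with sup norm. For a Banach space $Y$, $F:X\to Y$ is $H$-Gateaux differentiable at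 $x$ if $\partial F/\partial h(x)=\lim_{t\to0}(F(x+th)-F(x))/t$ exists for all $h\in H$ and $D_HF(x):h\mapsto\partial F/\partial h(x)$ belongs to $\mathcal{L}(H,Y)$. $\mathcal{L}^n(H)$: continuous $n$-linear maps $H^n\to\mathbb{R}$ with the usual norm, identified with $\mathcal{L}(H,\mathcal{L}^{n-1}(H))$; $D^n_Hf(x)$ is the $H$-Gateaux derivative at $x$ of $D^{n-1}_Hf:X\to\mathcal{L}^{n-1}(H)$. $C^n_H(X)$ ($n\in\mathbb{N}=\{1,2,\dots\}$): $f\in C_b(X)$ having $H$-Gateaux derivatives up to order $n$ at every point with $x\mapsto D^k_Hf(x)(h_1,\dots,h_k)$ continuous and bounded for all $k\le n$, $h_i\in H$; norm $\|f\|_\infty+\sum_{k=1}^n\sup_x\|D^k_Hf(x)\|_{\mathcal{L}^k(H)}$. For $\sigma\in(0,1)$, $[F]_{C^\sigma_H(X,Y)}=\sup_{x\in X,h\in H\setminus\{0\}}\|F(x+h)-F(x)\|_Y/\|h\|_H^\sigma$; $C^\sigma_H(X)=\{f\in C_b(X):[f]_{C^\sigma_H(X)}<\infty\}$ with norm $\|f\|_\infty+[f]_{C^\sigma_H(X)}$; $C^{\sigma+n}_H(X)=\{f\in C^n_H(X):[D^n_Hf]_{C^\sigma_H(X,\mathcal{L}^n(H))}<\infty\}$ with norm $\|f\|_{C^n_H(X)}+[D^n_Hf]_{C^\sigma_H(X,\mathcal{L}^n(H))}$. $[F]_{Z^1_H(X,Y)}=\sup_{x\in X,h\in H\setminus\{0\}}\|F(x+2h)-2F(x+h)+F(x)\|_Y/\|h\|_H$;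 $Z^1_H(X)=\{f\in C_b(X):[f]_{Z^1_H(X)}<\infty\}$ with norm $\|f\|_\infty+[f]_{Z^1_H(X)}$; $Z^2_H(X)=\{f\in C^1_H(X):[D_Hf]_{Z^1_H(X,\mathcal{L}^1(H))}<\infty\}$ with norm $\|f\|_{C^1_H(X)}+[D_Hf]_{Z^1_H(X,\mathcal{L}^1(H))}$. For $\gamma>0$, $C^{0,\gamma}_H([0,T]\times X)$: bounded continuous $g:[0,T]\times X\to\mathbb{R}$ with $g(t,\cdot)\in C^\gamma_H(X)$ for all $t$, norm $\sup_t\|g(t,\cdot)\|_{C^\gamma_H(X)}<\infty$, and, if $\gamma\ge1$, $(t,x)\mapsto\frac{\partial^kg}{\partial h_1\cdots\partial h_k}(t,x)$ continuous on $[0,T]\times X$ for all $k\le[\gamma]$, $h_i\in H$. $C^{0,0}_H([0,T]\times X):=C_b([0,T]\times X)$. $Z^{0,k}_H([0,T]\times X)$: bounded continuous $g$ with $g(t,\cdot)\in Z^k_H(X)$ for all $t$, norm $\sup_t\|g(t,\cdot)\|_{Z^k_H(X)}<\infty$, and, if $k\ge2$, $g\in C^{0,k-1}_H([0,T]\times X)$. *)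

theory Defs
  imports "HOL-Probability.Probability"
begin

section \<open>Operators on the Hilbert space\<close>

definition positive_operator :: "('a::real_inner \<Rightarrow> 'a) \<Rightarrow> bool" where
  "positive_operator Q \<longleftrightarrow> bounded_linear Q \<and> (\<forall>x y. Q x \<bullet> y = x \<bullet> Q y) \<and> (\<forall>x. 0 \<le> Q x \<bullet> x)"

definition orthonormal_basis :: "'a::real_inner set \<Rightarrow> bool" where
  "orthonormal_basis B \<longleftrightarrow>
     pairwise orthogonal B \<and> (\<forall>e\<in>B. norm e = 1) \<and> closure (span B) = UNIV"

text \<open>For a positive operator the trace does not depend on the orthonormal basis.\<close>

definition finite_trace :: "('a::real_inner \<Rightarrow> 'a) \<Rightarrow> bool" where
  "finite_trace Q \<longleftrightarrow> (\<exists>B. orthonormal_basis B \<and> (\<lambda>e. Q e \<bullet> e) summable_on B)"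

text \<open>A positive operator on a Hilbert space has exactly one positive square root.\<close>

definition op_sqrt :: "('a::real_inner \<Rightarrow> 'a) \<Rightarrow> 'a \<Rightarrow> 'a" where
  "op_sqrt Q = (SOME R. positive_operator R \<and> (\<forall>x. R (R x) = Q x))"

text \<open>The pseudo-inverse picks the preimage orthogonal to the kernel; it is meant for
  arguments in the range of \<open>R\<close>.\<close>

definition pseudo_inverse :: "('a::real_inner \<Rightarrow> 'a) \<Rightarrow> 'a \<Rightarrow> 'a" where
  "pseudo_inverse R h = (THE z. R z = h \<and> (\<forall>w. R w = 0 \<longrightarrow> z \<bullet> w = 0))"

definition CM_space :: "('a::real_inner \<Rightarrow> 'a) \<Rightarrow> 'a set" where
  "CM_space Q = range (op_sqrt Q)"

definition CM_norm :: "('a::real_inner \<Rightarrow> 'a) \<Rightarrow> 'a \<Rightarrow> real" where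
  "CM_norm Q h = norm (pseudo_inverse (op_sqrt Q) h)"

section \<open>Semigroups, generators and mild solutions\<close>

definition Cb :: "('a::topological_space \<Rightarrow> real) set" where
  "Cb = {f. continuous_on UNIV f \<and> bounded (range f)}"

text \<open>The centered Gaussian measure \<open>N(0,Q)\<close> is determined by its characteristic function.\<close>

definition gaussian :: "('a::real_inner \<Rightarrow> 'a) \<Rightarrow> 'a measure" where
  "gaussian Q = (SOME \<mu>. prob_space \<mu> \<and> sets \<mu> = sets borel \<and>
     (\<forall>x. (LINT y|\<mu>. cis (x \<bullet> y)) = complex_of_real (exp (- (Q x \<bullet> x) / 2))))"

definition heat_sg :: "('a::real_inner \<Rightarrow> 'a) \<Rightarrow> real \<Rightarrow> ('a \<Rightarrow> real) \<Rightarrow> 'a \<Rightarrow> real" where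
  "heat_sg Q t f x = (LINT y|gaussian (\<lambda>z. t *\<^sub>R Q z). f (x + y))"

text \<open>The inverse Laplace transform of \<open>l \<mapsto> exp (- t l\<^sup>s)\<close>: its values on the positive half-line
  are determined up to a null set, which is immaterial under the integral in \<open>frac_sg\<close>.\<close>

definition subordinator_density :: "real \<Rightarrow> real \<Rightarrow> real \<Rightarrow> real" where
  "subordinator_density s t = (SOME \<eta>. \<forall>l>0.
     set_integrable lborel {0<..} (\<lambda>\<sigma>. exp (- l * \<sigma>) * \<eta> \<sigma>) \<and>
     (LBINT \<sigma>:{0<..}. exp (- l * \<sigma>) * \<eta> \<sigma>) = exp (- t * l powr s))"

definition frac_sg ::
  "('a::real_inner \<Rightarrow> 'a) \<Rightarrow> real \<Rightarrow> real \<Rightarrow> ('a \<Rightarrow> real) \<Rightarrow> 'a \<Rightarrow> real" where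
  "frac_sg Q s t f x =
     (if t = 0 then f x
      else (LBINT \<sigma>:{0<..}. heat_sg Q \<sigma> f x * subordinator_density s t \<sigma>))"

text \<open>Graph of the operator \<open>A\<close> in \<open>Cb\<close> with resolvent
  \<open>R(l,A) f = \<integral>\<^sub>0\<^sup>\<infinity> exp (- l t) S\<^sub>t f dt\<close> for all \<open>l > 0\<close>:
  \<open>A u = w\<close> iff \<open>u = R(l,A) (l u - w)\<close>.\<close>

definition generator ::
  "(real \<Rightarrow> ('a::topological_space \<Rightarrow> real) \<Rightarrow> 'a \<Rightarrow> real) \<Rightarrow> (('a \<Rightarrow> real) \<times> ('a \<Rightarrow> real)) set" where
  "generator S = {(u, w). u \<in> Cb \<and> w \<in> Cb \<and>
     (\<forall>l>0. \<forall>x. u x = (LBINT t:{0<..}. exp (- l * t) * S t (\<lambda>y. l * u y - w y) x))}"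

definition gross_laplacian ::
  "('a::real_inner \<Rightarrow> 'a) \<Rightarrow> (('a \<Rightarrow> real) \<times> ('a \<Rightarrow> real)) set" where
  "gross_laplacian Q = generator (heat_sg Q)"

text \<open>The operator \<open>-(-L)\<^sup>s\<close>, where \<open>L\<close> is \<open>gross_laplacian Q\<close>. The Cauchy problem
  \<open>v\<^sub>t + (-L)\<^sup>s v = g\<close>, \<open>v(0) = f\<close> enters the notion of mild solution only through the
  semigroup \<open>frac_sg Q s\<close> that this operator generates.\<close>

definition neg_frac_gross_laplacian ::
  "('a::real_inner \<Rightarrow> 'a) \<Rightarrow> real \<Rightarrow> (('a \<Rightarrow> real) \<times> ('a \<Rightarrow> real)) set" where
  "neg_frac_gross_laplacian Q s = generator (frac_sg Q s)"

definition mild_solution ::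
  "(real \<Rightarrow> ('a \<Rightarrow> real) \<Rightarrow> 'a \<Rightarrow> real) \<Rightarrow> ('a \<Rightarrow> real) \<Rightarrow> (real \<Rightarrow> 'a \<Rightarrow> real) \<Rightarrow>
    real \<Rightarrow> 'a \<Rightarrow> real" where
  "mild_solution S f g t x = S t f x + (LBINT r:{0..t}. S (t - r) (g r) x)"

section \<open>Multilinear forms and derivatives along \<open>H\<close>\<close>

text \<open>\<open>H\<close> is a subset of \<open>'a\<close> with its own norm and not a type, so a continuous \<open>n\<close>-linear form
  on \<open>H\<close> is encoded as a function on lists that vanishes off the \<open>n\<close>-element lists in \<open>H\<close>.
  The space of \<open>0\<close>-linear forms is the real line. All norms and seminorms below take values in
  \<open>ennreal\<close>.\<close>

definition H_tuples :: "('a::real_inner \<Rightarrow> 'a) \<Rightarrow> nat \<Rightarrow> 'a list set" where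
  "H_tuples Q n = {hs. length hs = n \<and> set hs \<subseteq> CM_space Q}"

definition form_norm :: "('a::real_inner \<Rightarrow> 'a) \<Rightarrow> nat \<Rightarrow> ('a list \<Rightarrow> real) \<Rightarrow> ennreal" where
  "form_norm Q n M = (SUP hs\<in>{hs \<in> H_tuples Q n. \<forall>h\<in>set hs. CM_norm Q h \<le> 1}. ennreal \<bar>M hs\<bar>)"

definition multilinear_forms :: "('a::real_inner \<Rightarrow> 'a) \<Rightarrow> nat \<Rightarrow> ('a list \<Rightarrow> real) set" where
  "multilinear_forms Q n = {M.
     (\<forall>hs. hs \<notin> H_tuples Q n \<longrightarrow> M hs = 0) \<and>
     (\<forall>hs\<in>H_tuples Q n. \<forall>i<n. \<forall>h\<in>CM_space Q. \<forall>k\<in>CM_space Q. \<forall>a b.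
        M (hs[i := a *\<^sub>R h + b *\<^sub>R k]) = a * M (hs[i := h]) + b * M (hs[i := k])) \<and>
     form_norm Q n M < \<infinity>}"

text \<open>\<open>G\<close> is the \<open>H\<close>-Gateaux derivative at \<open>x\<close> of a map \<open>F\<close> from \<open>X\<close> to the \<open>n\<close>-linear forms;
  linear maps from \<open>H\<close> to \<open>n\<close>-linear forms are identified with \<open>(n+1)\<close>-linear forms, and the
  difference quotients converge in the norm of \<open>n\<close>-linear forms.\<close>

definition has_H_derivative ::
  "('a::real_inner \<Rightarrow> 'a) \<Rightarrow> nat \<Rightarrow> ('a \<Rightarrow> 'a list \<Rightarrow> real) \<Rightarrow> 'a \<Rightarrow> ('a list \<Rightarrow> real) \<Rightarrow> bool" where
  "has_H_derivative Q n F x G \<longleftrightarrow> G \<in> multilinear_forms Q (Suc n) \<and>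
     (\<forall>h\<in>CM_space Q.
        ((\<lambda>t. form_norm Q n (\<lambda>hs. (F (x + t *\<^sub>R h) hs - F x hs) / t - G (h # hs)))
          \<longlongrightarrow> 0) (at 0))"

primrec DH :: "('a::real_inner \<Rightarrow> 'a) \<Rightarrow> nat \<Rightarrow> ('a \<Rightarrow> real) \<Rightarrow> 'a \<Rightarrow> 'a list \<Rightarrow> real" where
  "DH Q 0 f = (\<lambda>x hs. if hs = [] then f x else 0)"
| "DH Q (Suc n) f = (\<lambda>x. THE G. has_H_derivative Q n (DH Q n f) x G)"

section \<open>Function spaces\<close>

definition sup_norm :: "('a \<Rightarrow> real) \<Rightarrow> ennreal" where
  "sup_norm f = (SUP x. ennreal \<bar>f x\<bar>)"

text \<open>\<open>CHn Q 0\<close> is \<open>Cb\<close>.\<close>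

definition CHn :: "('a::real_inner \<Rightarrow> 'a) \<Rightarrow> nat \<Rightarrow> ('a \<Rightarrow> real) set" where
  "CHn Q n = {f \<in> Cb.
     (\<forall>k<n. \<forall>x. \<exists>G. has_H_derivative Q k (DH Q k f) x G) \<and>
     (\<forall>k\<in>{1..n}. \<forall>hs\<in>H_tuples Q k. (\<lambda>x. DH Q k f x hs) \<in> Cb)}"

definition CHn_norm :: "('a::real_inner \<Rightarrow> 'a) \<Rightarrow> nat \<Rightarrow> ('a \<Rightarrow> real) \<Rightarrow> ennreal" where
  "CHn_norm Q n f = sup_norm f + (\<Sum>k=1..n. SUP x. form_norm Q k (DH Q k f x))"

definition holder_seminorm ::
  "('a::real_inner \<Rightarrow> 'a) \<Rightarrow> nat \<Rightarrow> real \<Rightarrow> ('a \<Rightarrow> 'a list \<Rightarrow> real) \<Rightarrow> ennreal" where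
  "holder_seminorm Q n \<sigma> F = (SUP x. SUP h\<in>CM_space Q - {0}.
     form_norm Q n (\<lambda>hs. F (x + h) hs - F x hs) / ennreal (CM_norm Q h powr \<sigma>))"

definition zygmund_seminorm ::
  "('a::real_inner \<Rightarrow> 'a) \<Rightarrow> nat \<Rightarrow> ('a \<Rightarrow> 'a list \<Rightarrow> real) \<Rightarrow> ennreal" where
  "zygmund_seminorm Q n F = (SUP x. SUP h\<in>CM_space Q - {0}.
     form_norm Q n (\<lambda>hs. F (x + 2 *\<^sub>R h) hs - 2 * F (x + h) hs + F x hs)
       / ennreal (CM_norm Q h))"

text \<open>For \<open>\<gamma> \<ge> 0\<close>, with \<open>CH Q 0 = Cb\<close>, and \<open>CH Q n = CHn Q n\<close> for integer \<open>n\<close>.\<close>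

definition CH_norm :: "('a::real_inner \<Rightarrow> 'a) \<Rightarrow> real \<Rightarrow> ('a \<Rightarrow> real) \<Rightarrow> ennreal" where
  "CH_norm Q \<gamma> f = (let n = nat \<lfloor>\<gamma>\<rfloor> in CHn_norm Q n f +
     (if \<gamma> = real n then 0 else holder_seminorm Q n (\<gamma> - real n) (DH Q n f)))"

definition CH :: "('a::real_inner \<Rightarrow> 'a) \<Rightarrow> real \<Rightarrow> ('a \<Rightarrow> real) set" where
  "CH Q \<gamma> = (let n = nat \<lfloor>\<gamma>\<rfloor> in {f \<in> CHn Q n.
     \<gamma> \<noteq> real n \<longrightarrow> holder_seminorm Q n (\<gamma> - real n) (DH Q n f) < \<infinity>})"

text \<open>The Zygmund spaces, for \<open>k \<ge> 1\<close>.\<close>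

definition ZH_norm :: "('a::real_inner \<Rightarrow> 'a) \<Rightarrow> nat \<Rightarrow> ('a \<Rightarrow> real) \<Rightarrow> ennreal" where
  "ZH_norm Q k f = CHn_norm Q (k - 1) f + zygmund_seminorm Q (k - 1) (DH Q (k - 1) f)"

definition ZH :: "('a::real_inner \<Rightarrow> 'a) \<Rightarrow> nat \<Rightarrow> ('a \<Rightarrow> real) set" where
  "ZH Q k = {f \<in> CHn Q (k - 1). zygmund_seminorm Q (k - 1) (DH Q (k - 1) f) < \<infinity>}"

text \<open>Functions on \<open>[0,T] \<times> X\<close> are represented by functions on \<open>real \<times> X\<close> (curried) of which
  only the values for \<open>t \<in> {0..T}\<close> matter.\<close>

definition CbT :: "real \<Rightarrow> (real \<Rightarrow> 'a::topological_space \<Rightarrow> real) set" where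
  "CbT T = {g. continuous_on ({0..T} \<times> UNIV) (\<lambda>(t, x). g t x) \<and>
               bounded ((\<lambda>(t, x). g t x) ` ({0..T} \<times> UNIV))}"

definition CHT_norm ::
  "('a::real_inner \<Rightarrow> 'a) \<Rightarrow> real \<Rightarrow> real \<Rightarrow> (real \<Rightarrow> 'a \<Rightarrow> real) \<Rightarrow> ennreal" where
  "CHT_norm Q T \<gamma> g = (SUP t\<in>{0..T}. CH_norm Q \<gamma> (g t))"

definition CHT :: "('a::real_inner \<Rightarrow> 'a) \<Rightarrow> real \<Rightarrow> real \<Rightarrow> (real \<Rightarrow> 'a \<Rightarrow> real) set" where
  "CHT Q T \<gamma> = {g \<in> CbT T.
     (\<forall>t\<in>{0..T}. g t \<in> CH Q \<gamma>) \<and> CHT_norm Q T \<gamma> g < \<infinity> \<and>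
     (\<forall>k\<in>{1..nat \<lfloor>\<gamma>\<rfloor>}. \<forall>hs\<in>H_tuples Q k.
        continuous_on ({0..T} \<times> UNIV) (\<lambda>(t, x). DH Q k (g t) x hs))}"

definition ZHT_norm ::
  "('a::real_inner \<Rightarrow> 'a) \<Rightarrow> real \<Rightarrow> nat \<Rightarrow> (real \<Rightarrow> 'a \<Rightarrow> real) \<Rightarrow> ennreal" where
  "ZHT_norm Q T k g = (SUP t\<in>{0..T}. ZH_norm Q k (g t))"

definition ZHT :: "('a::real_inner \<Rightarrow> 'a) \<Rightarrow> real \<Rightarrow> nat \<Rightarrow> (real \<Rightarrow> 'a \<Rightarrow> real) set" where
  "ZHT Q T k = {g \<in> CbT T.
     (\<forall>t\<in>{0..T}. g t \<in> ZH Q k) \<and> ZHT_norm Q T k g < \<infinity> \<and>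
     (k \<ge> 2 \<longrightarrow> g \<in> CHT Q T (real (k - 1)))}"

end

theory Submission
  imports Defs "HOL-Complex_Analysis.Complex_Analysis" "HOL-Real_Asymp.Real_Asymp"
begin

text \<open>
  By the Cameron--Martin formula the heat semigroup is differentiable along \<open>H\<close>, with
  \<open>\<bar>\<partial>P\<^sub>t f/\<partial>h\<bar> \<le> c t\<^bsup>(\<alpha> - 1)/2\<^esup> \<parallel>h\<parallel>\<^sub>H [f]\<^sub>\<alpha>\<close>. Integration against the stable density, whose negative moments
  are finite, turns this into \<open>\<bar>\<partial>S\<^sub>t f/\<partial>h\<bar> \<le> c t\<^bsup>- (1 - \<alpha>)/(2s)\<^esup> \<parallel>h\<parallel>\<^sub>H [f]\<^sub>\<alpha>\<close>, and the semigroup property gives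
  \<open>t\<^bsup>- (j - \<alpha>)/(2s)\<^esup>\<close> for derivatives and differences of total order \<open>j\<close>. In the convolution
  \<open>\<integral> S\<^sub>r g(t - r) dr\<close> one bounds a difference of step \<open>l\<close> of the \<open>j\<close>-th derivative by its supremum for
  \<open>r \<le> \<parallel>l\<parallel>\<^sub>H\<^bsup>2s\<^esup>\<close> and by derivatives of higher order for larger \<open>r\<close>; both parts are of size
  \<open>\<parallel>l\<parallel>\<^sub>H\<^bsup>\<alpha> + 2s - j\<^esup>\<close>. First differences give the Hoelder and second differences the Zygmund spaces. The
  term \<open>S\<^sub>t f\<close> inherits the regularity of \<open>f\<close> because \<open>S\<^sub>t\<close> commutes with translations. The stable density
  is obtained by bending the Bromwich contour of its Laplace transform.
\<close>

section \<open>Square roots of positive operators\<close>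

text \<open>The Gaussian measure, the subordinator density, the operator square root and the forms
  \<open>DH\<close> are specified through \<open>SOME\<close> or \<open>THE\<close>. A large part of
  the work is to show that such objects exist and that what is used of them does not depend on the
  choice. Differentiation takes place along one line at a time: \<open>N(0,Q)\<close> is the
  convolution of a one-dimensional Gaussian along a unit vector of \<open>H\<close> with a
  complementary Gaussian, and only the scalar factor is shifted. The semigroups are in general not
  strongly continuous in sup norm. Limits therefore run through bounded sequences that converge
  continuously (\<open>cconv\<close>), a mode of convergence that all the operators respect. The
  stable density is a contour integral whose sign is not visible, so estimates use the integral of
  its absolute value and \<open>S t\<close> is bounded by a constant \<open>C\<close> instead of 1.
  Membership of \<open>f\<close> in \<open>CH\<close> or \<open>ZH\<close> bounds derivatives only
  for each fixed choice of directions; interpolation between the supremum and the top seminorm makes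
  these bounds uniform over unit directions.\<close>

lemma positive_operator_Cauchy_Schwarz:
  assumes "positive_operator B"
  shows "(B x \<bullet> y)\<^sup>2 \<le> (B x \<bullet> x) * (B y \<bullet> y)"
proof -
  interpret bounded_linear B using assms by (simp add: positive_operator_def)
  have sym: "B u \<bullet> v = u \<bullet> B v" and pos: "0 \<le> B u \<bullet> u" for u v
    using assms by (auto simp: positive_operator_def)
  define a b c where "a = B x \<bullet> x" and "b = B x \<bullet> y" and "c = B y \<bullet> y"
  have quad: "0 \<le> a + 2 * b * t + c * t\<^sup>2" for t
  proof -
    have "B (x + t *\<^sub>R y) \<bullet> (x + t *\<^sub>R y) = a + 2 * b * t + c * t\<^sup>2"
      using sym[of y x] by (simp add: a_def b_def c_def add scaleR inner_add_left inner_add_right inner_commute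
          power2_eq_square algebra_simps)
    then show ?thesis using pos by metis
  qed
  have "c \<ge> 0" using pos c_def by simp
  show ?thesis
  proof (cases "c = 0")
    case True
    have "b = 0"
    proof (rule ccontr)
      assume "b \<noteq> 0"
      then show False using quad[of "- (a + 1) / (2 * b)"] True by simp
    qed
    then show ?thesis using True by (simp add: b_def c_def)
  next
    case False
    have "0 \<le> a + 2 * b * (- b / c) + c * (- b / c)\<^sup>2" by (rule quad)
    also have "\<dots> = a - b\<^sup>2 / c" using False by (simp add: field_simps power2_eq_square)
    finally have "b\<^sup>2 / c \<le> a" by simp
    then show ?thesis using False \<open>c \<ge> 0\<close>
      by (simp add: a_def b_def c_def field_simps)
  qed
qed

text \<open>These are the coefficients of the binomial series of \<open>sqrt (1 - x)\<close>,
  written with the rising factorial so that the signs can be read off: 1 at index 0, nonpositive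
  afterwards.\<close>

definition sqrt_coeff :: "nat \<Rightarrow> real" where
  "sqrt_coeff n = pochhammer (- 1 / 2) n / fact n"

lemma sqrt_coeff_0 [simp]: "sqrt_coeff 0 = 1"
  by (simp add: sqrt_coeff_def)

lemma sqrt_coeff_nonpos: "n > 0 \<Longrightarrow> sqrt_coeff n \<le> 0"
proof -
  assume "n > 0"
  then obtain m where n: "n = Suc m" by (cases n) auto
  have "pochhammer (1 / 2 :: real) m \<ge> 0" by (rule pochhammer_nonneg) simp
  then show ?thesis by (simp add: sqrt_coeff_def n pochhammer_rec divide_nonpos_pos)
qed

lemma sqrt_coeff_gbinomial: "sqrt_coeff n = (- 1) ^ n * ((1 / 2) gchoose n)"
  by (simp add: sqrt_coeff_def gbinomial_pochhammer power_add[symmetric] flip: mult_2)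

text \<open>Up to sign the partial sums are binomial coefficients of exponent -1/2. This settles the
  end point \<open>x = 1\<close>: it yields absolute summability, and later the positivity of the
  root.\<close>

lemma sum_sqrt_coeff_nonneg: "0 \<le> (\<Sum>k\<le>m. sqrt_coeff k)"
proof -
  have "(\<Sum>k\<le>m. sqrt_coeff k) = (\<Sum>k\<le>m. ((1 / 2) gchoose k) * (- 1) ^ k)"
    by (simp add: sqrt_coeff_gbinomial mult.commute)
  also have "\<dots> = (- 1) ^ m * ((1 / 2 - 1) gchoose m)"
    by (rule gbinomial_sum_lower_neg)
  also have "\<dots> = pochhammer (1 / 2) m / fact m"
    by (simp add: gbinomial_pochhammer power_add[symmetric] flip: mult_2)
  also have "\<dots> \<ge> 0" by (intro divide_nonneg_pos pochhammer_nonneg) auto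
  finally show ?thesis .
qed

lemma summable_abs_sqrt_coeff: "summable (\<lambda>n. \<bar>sqrt_coeff n\<bar>)"
proof (rule bounded_imp_summable[where B = 2])
  fix m
  have "(\<Sum>k\<le>m. \<bar>sqrt_coeff k\<bar>) = (\<Sum>k\<le>m. (if k = 0 then 2 else 0) - sqrt_coeff k)"
    by (intro sum.cong) (auto simp: abs_of_nonpos sqrt_coeff_nonpos)
  also have "\<dots> = 2 - (\<Sum>k\<le>m. sqrt_coeff k)" by (simp add: sum_subtractf)
  also have "\<dots> \<le> 2" using sum_sqrt_coeff_nonneg[of m] by simp
  finally show "(\<Sum>k\<le>m. \<bar>sqrt_coeff k\<bar>) \<le> 2" .
qed simp

lemma summable_sqrt_coeff: "summable sqrt_coeff"
  using summable_abs_sqrt_coeff by (rule summable_rabs_cancel)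

lemma suminf_sqrt_coeff_nonneg: "0 \<le> suminf sqrt_coeff"
proof -
  have "(\<lambda>m. \<Sum>k\<le>m. sqrt_coeff k) \<longlonglongrightarrow> suminf sqrt_coeff"
    using summable_LIMSEQ' summable_sqrt_coeff by blast
  then show ?thesis using sum_sqrt_coeff_nonneg by (intro LIMSEQ_le_const) auto
qed

text \<open>Vandermonde's identity with 1/2 + 1/2 = 1; it says that the square of the series is
  \<open>1 - x\<close>.\<close>

lemma sqrt_coeff_convolution:
  "(\<Sum>k\<le>n. sqrt_coeff k * sqrt_coeff (n - k)) = (if n = 0 then 1 else if n = 1 then - 1 else 0)"
proof -
  have "(\<Sum>k\<le>n. sqrt_coeff k * sqrt_coeff (n - k))
      = (\<Sum>k=0..n. (- 1) ^ n * (((1 / 2) gchoose k) * ((1 / 2) gchoose (n - k))))"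
    by (intro sum.cong)
      (auto simp: sqrt_coeff_gbinomial power_add[symmetric] atMost_atLeast0 algebra_simps)
  also have "\<dots> = (- 1) ^ n * ((1 / 2 + 1 / 2 :: real) gchoose n)"
    by (simp only: sum_distrib_left[symmetric] gbinomial_Vandermonde)
  also have "(1 / 2 + 1 / 2 :: real) gchoose n = of_nat (1 choose n)"
    using binomial_gbinomial[of 1 n, where 'a = real] by simp
  finally show ?thesis by (auto simp: binomial_eq_0)
qed

text \<open>The root of \<open>I - B\<close> is the binomial series in \<open>B\<close>, which
  converges absolutely for every contraction, norm 1 included.\<close>

lemma contraction_sqrt_exists:
  fixes B :: "'a::{real_inner, banach} \<Rightarrow> 'a"
  assumes "bounded_linear B" and sym: "\<And>x y. B x \<bullet> y = x \<bullet> B y" and le: "\<And>x. norm (B x) \<le> norm x"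
  shows "\<exists>R. positive_operator R \<and> (\<forall>x. R (R x) = x - B x)"
proof -
  interpret B: bounded_linear B by fact
  define d where "d = sqrt_coeff"
  have lin: "bounded_linear (\<lambda>x. (B ^^ n) x)" for n
  proof (induction n)
    case (Suc n)
    then show ?case using bounded_linear_compose[OF \<open>bounded_linear B\<close>] by simp
  qed (simp add: bounded_linear_ident)
  have nle: "norm ((B ^^ n) x) \<le> norm x" for n x
    by (induction n) (auto intro: order_trans[OF le])
  have symn: "(B ^^ n) x \<bullet> y = x \<bullet> (B ^^ n) y" for n x y
    by (induction n arbitrary: x y) (simp_all add: sym funpow_swap1)
  define R where "R x = (\<Sum>n. d n *\<^sub>R (B ^^ n) x)" for x
  have sd: "summable (\<lambda>n. \<bar>d n\<bar>)" using summable_abs_sqrt_coeff d_def by simp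
  have bound: "norm (d n *\<^sub>R (B ^^ n) x) \<le> \<bar>d n\<bar> * norm x" for n x
    using nle by (auto intro!: mult_mono)
  have ns: "summable (\<lambda>n. norm (d n *\<^sub>R (B ^^ n) x))" for x
    by (rule summable_comparison_test'[where g = "\<lambda>n. \<bar>d n\<bar> * norm x"])
      (use bound in \<open>auto intro: summable_mult2 sd\<close>)
  have sm: "summable (\<lambda>n. d n *\<^sub>R (B ^^ n) x)" for x
    using ns by (rule summable_norm_cancel)
  have inner: "R x \<bullet> y = (\<Sum>n. d n * ((B ^^ n) x \<bullet> y))"
    and inner_sm: "summable (\<lambda>n. d n * ((B ^^ n) x \<bullet> y))" for x y
  proof -
    have "(\<lambda>n. (d n *\<^sub>R (B ^^ n) x) \<bullet> y) sums (R x \<bullet> y)"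
      unfolding R_def by (intro bounded_linear.sums[OF bounded_linear_inner_left] summable_sums sm)
    then show "R x \<bullet> y = (\<Sum>n. d n * ((B ^^ n) x \<bullet> y))"
      "summable (\<lambda>n. d n * ((B ^^ n) x \<bullet> y))"
      by (auto simp: sums_iff)
  qed
  have Rbl: "bounded_linear R"
  proof (rule bounded_linear_intro)
    show "R (x + y) = R x + R y" for x y
      unfolding R_def using linear_add[OF bounded_linear.linear[OF lin]]
      by (subst suminf_add[OF sm sm]) (simp add: scaleR_add_right)
    show "R (r *\<^sub>R x) = r *\<^sub>R R x" for r x
      unfolding R_def using linear_cmul[OF bounded_linear.linear[OF lin]]
      by (simp add: bounded_linear.suminf[OF bounded_linear_scaleR_right sm] mult.commute)
    show "norm (R x) \<le> norm x * (\<Sum>n. \<bar>d n\<bar>)" for x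
    proof -
      have "norm (R x) \<le> (\<Sum>n. norm (d n *\<^sub>R (B ^^ n) x))"
        unfolding R_def by (rule summable_norm[OF ns])
      also have "\<dots> \<le> (\<Sum>n. \<bar>d n\<bar> * norm x)"
        by (intro suminf_le bound ns summable_mult2 sd)
      also have "\<dots> = norm x * (\<Sum>n. \<bar>d n\<bar>)"
        by (subst suminf_mult2[OF sd, symmetric]) (rule mult.commute)
      finally show ?thesis .
    qed
  qed
  have "positive_operator R"
    unfolding positive_operator_def
  proof (intro conjI allI Rbl)
    show "R x \<bullet> y = x \<bullet> R y" for x y
    proof -
      have "(B ^^ n) x \<bullet> y = (B ^^ n) y \<bullet> x" for n by (metis symn inner_commute)
      then show ?thesis using inner[of x y] inner[of y x] by (simp add: inner_commute[of x])
    qed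
    show "0 \<le> R x \<bullet> x" for x
    proof -
      \<comment> \<open>Coefficients beyond the first are nonpositive and
        \<open>(B ^^ n) x \<bullet> x\<close> is at most the square of \<open>norm x\<close>.
        Replacing the inner products by that square can only lower the sum, and what is left is a
        nonnegative multiple of the sum of the coefficients.\<close>
      have "0 \<le> (\<Sum>n. d n * (norm x)\<^sup>2)"
        using suminf_sqrt_coeff_nonneg summable_sqrt_coeff
        by (simp add: d_def suminf_mult2[symmetric])
      also have "\<dots> \<le> (\<Sum>n. d n * ((B ^^ n) x \<bullet> x))"
      proof (intro suminf_le inner_sm summable_mult2)
        fix n
        show "d n * (norm x)\<^sup>2 \<le> d n * ((B ^^ n) x \<bullet> x)"
        proof (cases "n = 0")
          case False
          then have "d n \<le> 0" by (simp add: d_def sqrt_coeff_nonpos)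
          moreover have "(B ^^ n) x \<bullet> x \<le> (norm x)\<^sup>2"
            using norm_cauchy_schwarz[of "(B ^^ n) x" x] mult_right_mono[OF nle[of n x] norm_ge_zero[of x]]
            by (simp add: power2_eq_square)
          ultimately show ?thesis by (rule mult_left_mono_neg[rotated])
        qed (simp add: power2_norm_eq_inner)
      qed (use summable_sqrt_coeff d_def in simp)
      finally show ?thesis by (simp add: inner)
    qed
  qed
  moreover have "R (R x) = x - B x" for x
  proof -
    \<comment> \<open>The double family behind \<open>R (R x)\<close>. It is absolutely summable,
      which permits regrouping along \<open>n + m = k\<close>, where the convolution identity leaves
      only \<open>k = 0\<close> and \<open>k = 1\<close>.\<close>
    define F where "F = (\<lambda>(n, m). (d n * d m) *\<^sub>R (B ^^ (n + m)) x)"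
    have dsum: "(\<lambda>n. norm (d n)) summable_on UNIV"
      using sd by (subst summable_on_UNIV_nonneg_real_iff) auto
    have "(\<lambda>(n, m). \<bar>d n\<bar> * (\<bar>d m\<bar> * norm x)) summable_on (UNIV \<times> UNIV)"
    proof (rule summable_on_SigmaI)
      show "((\<lambda>m. case (n, m) of (n, m) \<Rightarrow> \<bar>d n\<bar> * (\<bar>d m\<bar> * norm x)) has_sum
          (\<bar>d n\<bar> * ((\<Sum>\<^sub>\<infinity>m. \<bar>d m\<bar>) * norm x))) UNIV" for n
        using dsum by (auto intro!: has_sum_cmult_right has_sum_cmult_left)
      show "(\<lambda>n. \<bar>d n\<bar> * ((\<Sum>\<^sub>\<infinity>m. \<bar>d m\<bar>) * norm x)) summable_on UNIV"
        using dsum by (auto intro!: summable_on_cmult_left)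
    qed auto
    then have "(\<lambda>p. norm (F p)) summable_on (UNIV \<times> UNIV)"
    proof (rule summable_on_comparison_test)
      show "norm (F p) \<le> (case p of (n, m) \<Rightarrow> \<bar>d n\<bar> * (\<bar>d m\<bar> * norm x))" for p
        using nle by (auto simp: F_def abs_mult mult.assoc split: prod.split intro!: mult_left_mono)
    qed auto
    then have Fs: "F summable_on (UNIV \<times> UNIV)"
      by (rule Infinite_Sum.abs_summable_summable)
    have isum: "(\<Sum>\<^sub>\<infinity>n. d n *\<^sub>R (B ^^ n) y) = R y" "(\<lambda>n. d n *\<^sub>R (B ^^ n) y) summable_on UNIV" for y
      using norm_summable_imp_has_sum[OF ns summable_sums[OF sm], of y]
      by (auto simp: R_def infsumI dest: has_sum_imp_summable)
    have "R (R x) = (\<Sum>\<^sub>\<infinity>n. d n *\<^sub>R (B ^^ n) (R x))" by (simp add: isum)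
    also have "\<dots> = (\<Sum>\<^sub>\<infinity>n. \<Sum>\<^sub>\<infinity>m. F (n, m))"
    proof (rule infsum_cong)
      fix n
      have hs: "((\<lambda>m. d m *\<^sub>R (B ^^ m) x) has_sum R x) UNIV"
        using norm_summable_imp_has_sum[OF ns summable_sums[OF sm]] by (simp add: R_def)
      have "((\<lambda>m. d n *\<^sub>R (B ^^ n) (d m *\<^sub>R (B ^^ m) x)) has_sum d n *\<^sub>R (B ^^ n) (R x)) UNIV"
        by (rule has_sum_bounded_linear[OF _ hs, where h = "\<lambda>y. d n *\<^sub>R (B ^^ n) y"])
          (intro bounded_linear_intros lin)
      then have "((\<lambda>m. F (n, m)) has_sum d n *\<^sub>R (B ^^ n) (R x)) UNIV"
        by (simp add: F_def linear_cmul[OF bounded_linear.linear[OF lin]] funpow_add)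
      then show "d n *\<^sub>R (B ^^ n) (R x) = (\<Sum>\<^sub>\<infinity>m. F (n, m))" by (simp add: infsumI)
    qed
    also have "\<dots> = infsum F (UNIV \<times> UNIV)" by (rule infsum_Sigma_banach[OF Fs])
    also have "\<dots> = infsum (\<lambda>(k, i). F (i, k - i)) (Sigma UNIV (\<lambda>k. {..k}))"
      by (rule infsum_reindex_bij_witness[where j = "\<lambda>(n, m). (n + m, n)" and i = "\<lambda>(k, i). (i, k - i)"])
        auto
    also have "\<dots> = (\<Sum>\<^sub>\<infinity>k. \<Sum>\<^sub>\<infinity>i\<in>{..k}. F (i, k - i))"
    proof (rule infsum_Sigma'_banach[symmetric])
      have "F summable_on (UNIV \<times> UNIV) \<longleftrightarrow> (\<lambda>(k, i). F (i, k - i)) summable_on (Sigma UNIV (\<lambda>k. {..k}))"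
        by (rule summable_on_reindex_bij_witness[where j = "\<lambda>(n, m). (n + m, n)" and i = "\<lambda>(k, i). (i, k - i)"])
          auto
      with Fs show "(\<lambda>(k, i). F (i, k - i)) summable_on (Sigma UNIV (\<lambda>k. {..k}))" by simp
    qed
    also have "\<dots> = (\<Sum>\<^sub>\<infinity>k. (\<Sum>i\<le>k. d i * d (k - i)) *\<^sub>R (B ^^ k) x)"
      by (intro infsum_cong) (simp add: F_def scaleR_sum_left)
    also have "\<dots> = (\<Sum>\<^sub>\<infinity>k. (if k = 0 then 1 else if k = 1 then - 1 else 0) *\<^sub>R (B ^^ k) x)"
      by (simp only: d_def sqrt_coeff_convolution)
    also have "\<dots> = (\<Sum>\<^sub>\<infinity>k\<in>{0, 1}. (if k = 0 then 1 else if k = 1 then - 1 else 0) *\<^sub>R (B ^^ k) x)"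
      by (rule infsum_cong_neutral) auto
    also have "\<dots> = x - B x" by simp
    finally show ?thesis .
  qed
  ultimately show ?thesis by blast
qed

text \<open>With a bound \<open>K\<close> of \<open>Q\<close>, the operator
  \<open>B = I - Q / K\<close> is a positive contraction and \<open>Q = K (I - B)\<close>.\<close>

lemma positive_operator_sqrt_exists:
  fixes Q :: "'a::{real_inner, banach} \<Rightarrow> 'a"
  assumes "positive_operator Q"
  shows "\<exists>R. positive_operator R \<and> (\<forall>x. R (R x) = Q x)"
proof -
  interpret Q: bounded_linear Q using assms by (simp add: positive_operator_def)
  have sym: "Q u \<bullet> v = u \<bullet> Q v" and pos: "0 \<le> Q u \<bullet> u" for u v
    using assms by (auto simp: positive_operator_def)
  obtain K where K: "K > 0" "\<And>x. norm (Q x) \<le> norm x * K"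
    using Q.pos_bounded by blast
  define B where "B x = x - (1 / K) *\<^sub>R Q x" for x
  have Bbl: "bounded_linear B"
    unfolding B_def by (intro bounded_linear_intros Q.bounded_linear)
  have Bsym: "B x \<bullet> y = x \<bullet> B y" for x y
    by (simp add: B_def inner_diff_left inner_diff_right sym)
  have Bpos: "0 \<le> B x \<bullet> x" for x
  proof -
    have "Q x \<bullet> x \<le> norm (Q x) * norm x" by (rule norm_cauchy_schwarz)
    also have "\<dots> \<le> (norm x * K) * norm x" using K by (intro mult_right_mono) auto
    finally show ?thesis using K(1)
      by (simp add: B_def inner_diff_left field_simps power2_eq_square flip: power2_norm_eq_inner)
  qed
  have Ble: "B x \<bullet> x \<le> x \<bullet> x" for x
    using pos[of x] K by (simp add: B_def inner_diff_left)
  have Bop: "positive_operator B" using Bbl Bsym Bpos by (auto simp: positive_operator_def)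
  have "norm (B x) \<le> norm x" for x
  proof (cases "B x = 0")
    case False
    \<comment> \<open>From the quadratic form to the norm: the Cauchy-Schwarz inequality of the form
      of \<open>B\<close>, applied to \<open>x\<close> and \<open>B x\<close>, has the fourth power
      of \<open>norm (B x)\<close> on the left.\<close>
    have "(B x \<bullet> B x)\<^sup>2 \<le> (B x \<bullet> x) * (B (B x) \<bullet> B x)"
      by (rule positive_operator_Cauchy_Schwarz[OF Bop])
    also have "\<dots> \<le> (x \<bullet> x) * (B x \<bullet> B x)" using Ble Bpos by (intro mult_mono) auto
    finally have "B x \<bullet> B x \<le> x \<bullet> x" using False by (simp add: power2_eq_square)
    then show ?thesis by (simp add: norm_le)
  qed simp
  then obtain R where R: "positive_operator R" "\<And>x. R (R x) = x - B x"
    using contraction_sqrt_exists[OF Bbl Bsym] by blast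
  interpret R: bounded_linear R using R by (simp add: positive_operator_def)
  have "positive_operator (\<lambda>x. sqrt K *\<^sub>R R x)"
    using R(1) K by (auto simp: positive_operator_def intro!: bounded_linear_intros)
  moreover have "sqrt K *\<^sub>R R (sqrt K *\<^sub>R R x) = Q x" for x
    using K by (simp add: R.scaleR R(2) B_def)
  ultimately show ?thesis by (intro exI[of _ "\<lambda>x. sqrt K *\<^sub>R R x"]) auto
qed

lemma op_sqrt:
  fixes Q :: "'a::{real_inner, banach} \<Rightarrow> 'a"
  assumes "positive_operator Q"
  shows "positive_operator (op_sqrt Q)" and "op_sqrt Q (op_sqrt Q x) = Q x"
  using someI_ex[OF positive_operator_sqrt_exists[OF assms]] by (auto simp: op_sqrt_def)

section \<open>The Cameron--Martin space\<close>

text \<open>Existence is the projection theorem: the preimage of least norm is orthogonal to the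
  kernel. It arises as the limit of a minimising sequence.\<close>

lemma pseudo_inverse_ex1:
  fixes R :: "'a::{real_inner, banach} \<Rightarrow> 'a"
  assumes "bounded_linear R" and "h \<in> range R"
  shows "\<exists>!z. R z = h \<and> (\<forall>w. R w = 0 \<longrightarrow> z \<bullet> w = 0)"
proof -
  interpret R: bounded_linear R by fact
  define S where "S = {z. R z = h}"
  have Sne: "S \<noteq> {}" using assms by (auto simp: S_def)
  define d where "d = (INF z\<in>S. norm z)"
  have bdd: "bdd_below (norm ` S)" by (rule bdd_belowI[where m = 0]) auto
  have dle: "d \<le> norm z" if "z \<in> S" for z
    unfolding d_def using that bdd by (intro cINF_lower) auto
  have d0: "0 \<le> d" unfolding d_def using Sne by (intro cINF_greatest) auto
  have "\<exists>z\<in>S. norm z < d + 1 / Suc n" for n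
    using cINF_less_iff[OF Sne bdd, of "d + 1 / Suc n"] by (simp add: d_def)
  then obtain z where z: "\<And>n. z n \<in> S" "\<And>n. norm (z n) < d + 1 / Suc n" by metis
  \<comment> \<open>Parallelogram law; the midpoint of \<open>u\<close> and \<open>v\<close> is
    again a preimage and so has norm at least \<open>d\<close>.\<close>
  have par: "(norm (u - v))\<^sup>2 \<le> 2 * (norm u)\<^sup>2 + 2 * (norm v)\<^sup>2 - 4 * d\<^sup>2" if "u \<in> S" "v \<in> S" for u v
  proof -
    have "(1 / 2) *\<^sub>R (u + v) \<in> S" using that
      by (simp add: S_def R.scaleR R.add flip: scaleR_2)
    then have "d \<le> norm ((1 / 2) *\<^sub>R (u + v))" by (rule dle)
    then have "2 * d \<le> norm (u + v)" by simp
    then have "(2 * d)\<^sup>2 \<le> (norm (u + v))\<^sup>2" using d0 by (intro power_mono) auto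
    then show ?thesis
      by (simp add: power2_norm_eq_inner inner_add_left inner_add_right inner_diff_left inner_diff_right
          inner_commute power_mult_distrib)
  qed
  have lim: "(\<lambda>n. d + 1 / Suc n) \<longlonglongrightarrow> d"
    using tendsto_add[OF tendsto_const LIMSEQ_inverse_real_of_nat, of d] by (simp add: inverse_eq_divide)
  have "(\<lambda>n. norm (z n)) \<longlonglongrightarrow> d"
    by (rule tendsto_sandwich[OF _ _ tendsto_const lim]) (use z dle in \<open>auto intro!: always_eventually intro: less_imp_le\<close>)
  have "Cauchy z"
  proof (rule metric_CauchyI)
    fix e :: real assume "e > 0"
    have "(\<lambda>n. 4 * (norm (z n))\<^sup>2 - 4 * d\<^sup>2) \<longlonglongrightarrow> 4 * d\<^sup>2 - 4 * d\<^sup>2"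
      using \<open>(\<lambda>n. norm (z n)) \<longlonglongrightarrow> d\<close> by (intro tendsto_intros)
    then have "eventually (\<lambda>n. 4 * (norm (z n))\<^sup>2 - 4 * d\<^sup>2 < e\<^sup>2) sequentially"
      by (rule order_tendstoD) (use \<open>e > 0\<close> in simp)
    then obtain N where N: "\<And>n. n \<ge> N \<Longrightarrow> 4 * (norm (z n))\<^sup>2 - 4 * d\<^sup>2 < e\<^sup>2"
      by (auto simp: eventually_sequentially)
    show "\<exists>M. \<forall>m\<ge>M. \<forall>n\<ge>M. dist (z m) (z n) < e"
    proof (intro exI allI impI)
      fix m n assume "m \<ge> N" "n \<ge> N"
      then have "(norm (z m - z n))\<^sup>2 < e\<^sup>2"
        using par[OF z(1) z(1), of m n] N[of m] N[of n] by linarith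
      then show "dist (z m) (z n) < e" using \<open>e > 0\<close>
        by (simp add: dist_norm power2_less_imp_less)
    qed
  qed
  then obtain w where w: "z \<longlonglongrightarrow> w" using Cauchy_convergent convergent_def by blast
  have "R w = h"
    using R.tendsto[OF w] z(1) by (simp add: S_def LIMSEQ_const_iff)
  have "norm w = d"
    using LIMSEQ_unique[OF tendsto_norm[OF w] \<open>(\<lambda>n. norm (z n)) \<longlonglongrightarrow> d\<close>] .
  have orth: "w \<bullet> v = 0" if "R v = 0" for v
  proof (cases "v = 0")
    case False
    \<comment> \<open>This \<open>t\<close> minimises the norm of \<open>w + t v\<close> along the
      kernel vector \<open>v\<close>. Since \<open>w\<close> already has least norm, the gain must
      vanish.\<close>
    define t where "t = - (w \<bullet> v) / (v \<bullet> v)"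
    have "w + t *\<^sub>R v \<in> S" using \<open>R w = h\<close> that by (simp add: S_def R.add R.scaleR)
    then have "(norm w)\<^sup>2 \<le> (norm (w + t *\<^sub>R v))\<^sup>2"
      using dle \<open>norm w = d\<close> by (intro power_mono) auto
    also have "\<dots> = (norm w)\<^sup>2 + 2 * t * (w \<bullet> v) + t\<^sup>2 * (v \<bullet> v)"
      by (simp add: power2_norm_eq_inner inner_add_left inner_add_right inner_commute[of v w]
          power2_eq_square[of t] algebra_simps)
    also have "\<dots> = (norm w)\<^sup>2 - (w \<bullet> v)\<^sup>2 / (v \<bullet> v)"
      using False by (simp add: t_def field_simps power2_eq_square)
    finally have "(w \<bullet> v)\<^sup>2 / (v \<bullet> v) \<le> 0" by simp
    moreover have "0 < v \<bullet> v" using False by simp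
    ultimately show ?thesis by (simp add: divide_le_0_iff not_le)
  qed simp
  show ?thesis
  proof (rule ex1I[of _ w])
    show "R w = h \<and> (\<forall>v. R v = 0 \<longrightarrow> w \<bullet> v = 0)" using orth \<open>R w = h\<close> by blast
    fix u assume u: "R u = h \<and> (\<forall>v. R v = 0 \<longrightarrow> u \<bullet> v = 0)"
    have "R (u - w) = 0" using u \<open>R w = h\<close> by (simp add: R.diff)
    then have "(u - w) \<bullet> (u - w) = 0" using u orth by (simp add: inner_diff_left)
    then show "u = w" by simp
  qed
qed

context
  fixes Q :: "'a::{real_inner, banach} \<Rightarrow> 'a"
  assumes Q: "positive_operator Q"
begin

lemma bounded_linear_op_sqrt: "bounded_linear (op_sqrt Q)"
  using op_sqrt(1)[OF Q] by (simp add: positive_operator_def)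

lemma CM_representative:
  assumes "h \<in> CM_space Q"
  obtains z where "op_sqrt Q z = h" "norm z = CM_norm Q h"
  using theI'[OF pseudo_inverse_ex1[OF bounded_linear_op_sqrt, of h]] assms
  by (auto simp: CM_space_def CM_norm_def pseudo_inverse_def)

lemma pseudo_inverse_scaleR:
  assumes "h \<in> CM_space Q"
  shows "pseudo_inverse (op_sqrt Q) (a *\<^sub>R h) = a *\<^sub>R pseudo_inverse (op_sqrt Q) h"
proof -
  interpret R: bounded_linear "op_sqrt Q" by (rule bounded_linear_op_sqrt)
  have h: "h \<in> range (op_sqrt Q)" using assms by (simp add: CM_space_def)
  have "a *\<^sub>R h \<in> range (op_sqrt Q)" using h by (auto simp flip: R.scaleR)
  from pseudo_inverse_ex1[OF bounded_linear_op_sqrt this] show ?thesis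
    unfolding pseudo_inverse_def
    by (rule the1_equality)
      (use theI'[OF pseudo_inverse_ex1[OF bounded_linear_op_sqrt h]] in \<open>auto simp: R.scaleR\<close>)
qed

lemma CM_space_0 [simp]: "0 \<in> CM_space Q"
  and CM_space_scaleR [intro]: "h \<in> CM_space Q \<Longrightarrow> a *\<^sub>R h \<in> CM_space Q"
  and CM_space_add [intro]: "h \<in> CM_space Q \<Longrightarrow> k \<in> CM_space Q \<Longrightarrow> h + k \<in> CM_space Q"
proof -
  interpret R: bounded_linear "op_sqrt Q" by (rule bounded_linear_op_sqrt)
  show "0 \<in> CM_space Q" unfolding CM_space_def by (rule range_eqI[of _ _ 0]) (simp add: R.zero)
  show "h \<in> CM_space Q \<Longrightarrow> a *\<^sub>R h \<in> CM_space Q"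
    by (auto simp: CM_space_def simp flip: R.scaleR)
  show "h \<in> CM_space Q \<Longrightarrow> k \<in> CM_space Q \<Longrightarrow> h + k \<in> CM_space Q"
    by (auto simp: CM_space_def simp flip: R.add)
qed

lemma CM_norm_scaleR: "h \<in> CM_space Q \<Longrightarrow> CM_norm Q (a *\<^sub>R h) = \<bar>a\<bar> * CM_norm Q h"
  by (simp add: CM_norm_def pseudo_inverse_scaleR)

lemma CM_norm_nonneg [simp]: "0 \<le> CM_norm Q h"
  by (simp add: CM_norm_def)

lemma CM_norm_pos: "h \<in> CM_space Q \<Longrightarrow> h \<noteq> 0 \<Longrightarrow> 0 < CM_norm Q h"
proof -
  assume "h \<in> CM_space Q" "h \<noteq> 0"
  then obtain z where "op_sqrt Q z = h" "norm z = CM_norm Q h" using CM_representative by blast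
  then show ?thesis using \<open>h \<noteq> 0\<close> linear_0[OF bounded_linear.linear[OF bounded_linear_op_sqrt]]
    by (metis zero_less_norm_iff)
qed

end

section \<open>Orthonormal bases\<close>

text \<open>Distinct basis vectors are at distance \<open>sqrt 2\<close>, so the balls of radius 1/2
  around them are disjoint open sets, of which a second countable space has only countably
  many.\<close>

lemma orthonormal_basis_countable:
  fixes B :: "'a::{real_inner, second_countable_topology} set"
  assumes "orthonormal_basis B"
  shows "countable B"
proof -
  have far: "sqrt 2 \<le> dist e e'" if "e \<in> B" "e' \<in> B" "e \<noteq> e'" for e e'
  proof -
    have "e \<bullet> e' = 0" "norm e = 1" "norm e' = 1"
      using assms that by (auto simp: orthonormal_basis_def pairwise_def orthogonal_def)
    then have "(dist e e')\<^sup>2 = 2"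
      by (simp add: dist_norm power2_norm_eq_inner inner_diff_left inner_diff_right inner_commute norm_eq_1)
    then show ?thesis by (simp add: real_le_lsqrt real_sqrt_unique)
  qed
  have dj: "ball e (1 / 2) \<inter> ball e' (1 / 2) = {}" if "e \<in> B" "e' \<in> B" "e \<noteq> e'" for e e'
  proof -
    have "1 \<le> dist e e'" using far[OF that] by (rule order_trans[rotated]) simp
    then show ?thesis by (intro disjoint_ballI) simp
  qed
  have inj: "inj_on (\<lambda>e. ball e (1 / 2 :: real)) B"
  proof (rule inj_onI, rule ccontr)
    fix e e' assume "e \<in> B" "e' \<in> B" "ball e (1 / 2 :: real) = ball e' (1 / 2)" "e \<noteq> e'"
    then show False using dj[of e e'] centre_in_ball[of e "1 / 2"] by auto
  qed
  have "countable ((\<lambda>e. ball e (1 / 2)) ` B)"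
    by (rule countable_disjoint_open_subsets) (use dj in \<open>auto simp: pairwise_def disjnt_def\<close>)
  then show ?thesis using inj by (rule countable_image_inj_on)
qed

text \<open>Among combinations over a finite set \<open>G\<close> the Fourier sum is nearest to
  \<open>x\<close>. An approximant from the dense span therefore bounds the remainder for every
  larger \<open>G\<close>.\<close>

lemma orthonormal_basis_Parseval:
  fixes B :: "'a::real_inner set"
  assumes B: "orthonormal_basis B"
  shows "((\<lambda>e. (x \<bullet> e)\<^sup>2) has_sum (norm x)\<^sup>2) B"
proof -
  have orth: "e \<bullet> e' = (if e = e' then 1 else 0)" if "e \<in> B" "e' \<in> B" for e e'
    using B that by (auto simp: orthonormal_basis_def pairwise_def orthogonal_def norm_eq_1)
  have dist2: "(norm (x - (\<Sum>e\<in>G. a e *\<^sub>R e)))\<^sup>2 = (norm x)\<^sup>2 - (\<Sum>e\<in>G. (x \<bullet> e)\<^sup>2) + (\<Sum>e\<in>G. (a e - x \<bullet> e)\<^sup>2)"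
    if G: "finite G" "G \<subseteq> B" for G a
  proof -
    have "(\<Sum>e\<in>G. a e *\<^sub>R e) \<bullet> (\<Sum>e\<in>G. a e *\<^sub>R e) = (\<Sum>e\<in>G. \<Sum>e'\<in>G. a e * (a e' * (if e' = e then 1 else 0)))"
      unfolding inner_sum_left inner_sum_right
      by (intro sum.cong refl) (use G orth in \<open>auto simp: subset_iff\<close>)
    also have "\<dots> = (\<Sum>e\<in>G. (a e)\<^sup>2)"
      using G by (intro sum.cong refl) (simp add: power2_eq_square if_distrib[of "\<lambda>c. _ * c"] cong: if_cong)
    finally have "(norm (x - (\<Sum>e\<in>G. a e *\<^sub>R e)))\<^sup>2 = (norm x)\<^sup>2 - 2 * (\<Sum>e\<in>G. a e * (x \<bullet> e)) + (\<Sum>e\<in>G. (a e)\<^sup>2)"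
      by (simp add: power2_norm_eq_inner inner_diff_left inner_diff_right inner_commute inner_sum_right)
    also have "\<dots> = (norm x)\<^sup>2 - (\<Sum>e\<in>G. (x \<bullet> e)\<^sup>2) + (\<Sum>e\<in>G. (a e - x \<bullet> e)\<^sup>2)"
      by (simp add: power2_diff sum.distrib sum_subtractf sum_distrib_left mult_ac)
    finally show ?thesis .
  qed
  show ?thesis
    unfolding has_sum_def tendsto_iff eventually_finite_subsets_at_top
  proof (intro allI impI)
    fix \<epsilon> :: real assume "\<epsilon> > 0"
    have "x \<in> closure (span B)" using B by (simp add: orthonormal_basis_def)
    then obtain y where y: "y \<in> span B" "dist y x < sqrt \<epsilon>"
      using \<open>\<epsilon> > 0\<close> by (meson closure_approachable real_sqrt_gt_zero)
    obtain F r where F: "finite F" "F \<subseteq> B" "y = (\<Sum>e\<in>F. r e *\<^sub>R e)"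
      using y(1) by (auto simp: span_explicit)
    show "\<exists>X. finite X \<and> X \<subseteq> B \<and> (\<forall>Y. finite Y \<and> X \<subseteq> Y \<and> Y \<subseteq> B \<longrightarrow>
        dist (\<Sum>e\<in>Y. (x \<bullet> e)\<^sup>2) ((norm x)\<^sup>2) < \<epsilon>)"
    proof (intro exI[of _ F] conjI allI impI F)
      fix G assume G: "finite G \<and> F \<subseteq> G \<and> G \<subseteq> B"
      have up: "0 \<le> (norm x)\<^sup>2 - (\<Sum>e\<in>G. (x \<bullet> e)\<^sup>2)"
      proof -
        have "(norm (x - (\<Sum>e\<in>G. (x \<bullet> e) *\<^sub>R e)))\<^sup>2 = (norm x)\<^sup>2 - (\<Sum>e\<in>G. (x \<bullet> e)\<^sup>2)"
          using dist2[of G "\<lambda>e. x \<bullet> e"] G by simp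
        then show ?thesis by (metis zero_le_power2)
      qed
      have "y = (\<Sum>e\<in>G. (if e \<in> F then r e else 0) *\<^sub>R e)"
        unfolding F(3) using G F by (intro sum.mono_neutral_cong_left) auto
      then have "(norm x)\<^sup>2 - (\<Sum>e\<in>G. (x \<bullet> e)\<^sup>2) \<le> (norm (x - y))\<^sup>2"
        using dist2[of G "\<lambda>e. if e \<in> F then r e else 0"] G by (simp add: sum_nonneg)
      also have "\<dots> < (sqrt \<epsilon>)\<^sup>2"
        using y(2) by (intro power_strict_mono) (auto simp: dist_norm norm_minus_commute)
      finally show "dist (\<Sum>e\<in>G. (x \<bullet> e)\<^sup>2) ((norm x)\<^sup>2) < \<epsilon>"
        using up \<open>\<epsilon> > 0\<close> by (simp add: dist_real_def)
    qed
  qed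
qed

text \<open>The basis is enumerated by natural numbers and padded with zero vectors, so that finite
  and infinite dimension are treated alike. The second property is the trace condition, because the
  square of \<open>norm (op_sqrt Q x)\<close> is \<open>Q x \<bullet> x\<close>.\<close>

lemma Parseval_sequence:
  fixes Q :: "'a::{real_inner, banach, second_countable_topology} \<Rightarrow> 'a"
  assumes Q: "positive_operator Q" and tr: "finite_trace Q"
  obtains e :: "nat \<Rightarrow> 'a" where "\<And>x. (\<lambda>k. (x \<bullet> e k)\<^sup>2) sums (norm x)\<^sup>2"
    and "summable (\<lambda>k. (norm (op_sqrt Q (e k)))\<^sup>2)"
proof -
  obtain B where B: "orthonormal_basis B" "(\<lambda>e. Q e \<bullet> e) summable_on B"
    using tr by (auto simp: finite_trace_def)
  have cB: "countable B" by (rule orthonormal_basis_countable[OF B(1)])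
  define I where "I = to_nat_on B ` B"
  define e where "e k = (if k \<in> I then from_nat_into B k else 0)" for k
  have bij: "bij_betw (to_nat_on B) B I"
    using inj_on_to_nat_on[OF cB] by (simp add: I_def bij_betw_def)
  have eB: "e (to_nat_on B b) = b" if "b \<in> B" for b
    using that cB by (simp add: e_def I_def)
  have transfer: "((\<lambda>k. F (e k)) has_sum s) UNIV" if "(F has_sum s) B" "F 0 = 0" for F :: "'a \<Rightarrow> real" and s
  proof -
    have "((\<lambda>b. F (e (to_nat_on B b))) has_sum s) B"
      using that(1) by (rule has_sum_cong[THEN iffD1, rotated]) (simp add: eB)
    then have "((\<lambda>k. F (e k)) has_sum s) I"
      using has_sum_reindex_bij_betw[OF bij, of "\<lambda>k. F (e k)" s] by simp
    then show ?thesis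
      by (rule has_sum_cong_neutral[THEN iffD1, rotated -1]) (auto simp: e_def that)
  qed
  show thesis
  proof (rule that)
    show "(\<lambda>k. (x \<bullet> e k)\<^sup>2) sums (norm x)\<^sup>2" for x
      using transfer[OF orthonormal_basis_Parseval[OF B(1)], of x] by (intro has_sum_imp_sums) simp
    have *: "(norm (op_sqrt Q x))\<^sup>2 = Q x \<bullet> x" for x
      using op_sqrt[OF Q] by (simp add: power2_norm_eq_inner positive_operator_def inner_commute)
    have "((\<lambda>e. Q e \<bullet> e) has_sum (\<Sum>\<^sub>\<infinity>e\<in>B. Q e \<bullet> e)) B"
      using B(2) by simp
    from transfer[OF this] show "summable (\<lambda>k. (norm (op_sqrt Q (e k)))\<^sup>2)"
      unfolding * by (intro has_sum_imp_sums[THEN sums_summable]) simp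
  qed
qed

section \<open>Gaussian measures\<close>

text \<open>\<open>q\<close> is the quadratic form of the covariance. Keeping it as a bare function
  makes scaled, summed and split covariances equally easy to state.\<close>

definition gaussian_law :: "('a::real_inner \<Rightarrow> real) \<Rightarrow> 'a measure \<Rightarrow> bool" where
  "gaussian_law q \<mu> \<longleftrightarrow> prob_space \<mu> \<and> sets \<mu> = sets borel \<and>
     (\<forall>x. (LINT y|\<mu>. cis (x \<bullet> y)) = complex_of_real (exp (- q x / 2)))"

abbreviation std_normal_seq :: "(nat \<Rightarrow> real) measure" where
  "std_normal_seq \<equiv> Pi\<^sub>M UNIV (\<lambda>_. std_normal_distribution)"

lemma prob_space_std_normal: "prob_space std_normal_distribution"
  using real_dist_normal_dist real_distribution.axioms(1) by blast

lemma prob_space_std_normal_seq: "prob_space std_normal_seq"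
  by (intro prob_space_PiM prob_space_std_normal)

lemma measurable_std_normal_seq [measurable]: "(\<lambda>u. u i) \<in> borel_measurable std_normal_seq"
proof -
  have "(\<lambda>u. u i) \<in> measurable std_normal_seq std_normal_distribution"
    by (rule measurable_component_singleton) simp
  then show ?thesis by simp
qed

lemma distr_std_normal_seq: "distr std_normal_seq borel (\<lambda>u. u i) = std_normal_distribution"
proof -
  have "distr std_normal_seq borel (\<lambda>u. u i) = distr std_normal_seq std_normal_distribution (\<lambda>u. u i)"
    by (rule distr_cong) auto
  also have "\<dots> = std_normal_distribution"
    by (rule distr_PiM_component[OF prob_space_std_normal]) simp
  finally show ?thesis .
qed

lemma indep_vars_std_normal_seq:
  "prob_space.indep_vars std_normal_seq (\<lambda>_. borel) (\<lambda>i u. u i) UNIV"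
proof -
  interpret prob_space std_normal_seq by (rule prob_space_std_normal_seq)
  show ?thesis
  proof (subst indep_vars_iff_distr_eq_PiM')
    have "distr std_normal_seq (Pi\<^sub>M UNIV (\<lambda>_. borel)) (\<lambda>x. \<lambda>i\<in>UNIV. x i)
        = distr std_normal_seq std_normal_seq (\<lambda>x. x)"
      by (rule distr_cong) (simp_all add: fun_eq_iff cong: sets_PiM_cong)
    also have "\<dots> = std_normal_seq" by (rule distr_id)
    finally show "distr std_normal_seq (Pi\<^sub>M UNIV (\<lambda>_. borel)) (\<lambda>x. \<lambda>i\<in>UNIV. x i)
        = Pi\<^sub>M UNIV (\<lambda>i. distr std_normal_seq borel (\<lambda>u. u i))"
      by (simp add: distr_std_normal_seq)
  qed auto
qed

lemma std_normal_seq_moments: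
  "integrable std_normal_seq (\<lambda>u. u i * u j)"
  "(LINT u|std_normal_seq. u i * u j) = (if i = j then 1 else 0)"
proof -
  interpret prob_space std_normal_seq by (rule prob_space_std_normal_seq)
  have int: "integrable std_normal_seq (\<lambda>u. f (u i))" "(LINT u|std_normal_seq. f (u i)) = (LINT x|std_normal_distribution. f x)"
    if "integrable std_normal_distribution f" for f :: "real \<Rightarrow> real" and i
  proof -
    have [measurable]: "f \<in> borel_measurable borel" using borel_measurable_integrable[OF that] by simp
    show "integrable std_normal_seq (\<lambda>u. f (u i))"
      using that by (subst (asm) distr_std_normal_seq[of i, symmetric], subst (asm) integrable_distr_eq) auto
    show "(LINT u|std_normal_seq. f (u i)) = (LINT x|std_normal_distribution. f x)"
      by (subst distr_std_normal_seq[of i, symmetric], subst integral_distr) auto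
  qed
  have m1: "integrable std_normal_distribution (\<lambda>x. x)" "(LINT x|std_normal_distribution. x) = 0"
    using integrable_std_normal_distribution_moment[of 1] integral_std_normal_distribution_moment_odd[of 1] by auto
  have m2: "integrable std_normal_distribution (\<lambda>x. x * x)" "(LINT x|std_normal_distribution. x * x) = 1"
    using integrable_std_normal_distribution_moment[of 2] std_normal_distribution_even_moments[of 1]
    by (auto simp: power2_eq_square)
  have ind: "indep_var borel (\<lambda>u. u i) borel (\<lambda>u. u j)" if "i \<noteq> j"
  proof -
    have "{i, j} = {i} \<union> {j}" by auto
    then have "indep_vars (\<lambda>_. borel) (\<lambda>i u. u i) ({i} \<union> {j})"
      using indep_vars_subset[OF indep_vars_std_normal_seq, of "{i, j}"] by simp
    have "indep_var borel ((\<lambda>u. u i) \<circ> (\<lambda>u. restrict u {i})) borel ((\<lambda>u. u j) \<circ> (\<lambda>u. restrict u {j}))"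
      using that by (intro indep_var_compose[OF indep_var_restrict[OF indep_vars_std_normal_seq, of "{i}" "{j}"]]) auto
    then show ?thesis by (simp add: comp_def)
  qed
  show "integrable std_normal_seq (\<lambda>u. u i * u j)"
    "(LINT u|std_normal_seq. u i * u j) = (if i = j then 1 else 0)"
    using int[OF m1(1)] int[OF m2(1)] m1 m2 indep_var_integrable[OF ind] indep_var_lebesgue_integral[OF ind]
    by (cases "i = j"; simp)+
qed

lemma char_finite_std_normal_sum:
  assumes "finite A"
  shows "(LINT u|std_normal_seq. cis (\<Sum>k\<in>A. c k * u k)) = complex_of_real (exp (- (\<Sum>k\<in>A. (c k)\<^sup>2) / 2))"
proof -
  interpret prob_space std_normal_seq by (rule prob_space_std_normal_seq)
  have ind: "indep_vars (\<lambda>_. borel) (\<lambda>i u. c i * u i) A"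
    using indep_vars_compose2[OF indep_vars_subset[OF indep_vars_std_normal_seq, of A], of "\<lambda>i x. c i * x" "\<lambda>_. borel"]
    by simp
  have "(LINT u|std_normal_seq. cis (\<Sum>k\<in>A. c k * u k))
      = char (distr std_normal_seq borel (\<lambda>u. \<Sum>k\<in>A. c k * u k)) 1"
    by (simp add: char_def integral_distr cis_conv_exp)
  also have "\<dots> = (\<Prod>k\<in>A. char (distr std_normal_seq borel (\<lambda>u. c k * u k)) 1)"
    by (rule char_distr_sum[OF ind])
  also have "\<dots> = (\<Prod>k\<in>A. complex_of_real (exp (- (c k)\<^sup>2 / 2)))"
  proof (rule prod.cong)
    fix k
    have "char (distr std_normal_seq borel (\<lambda>u. c k * u k)) 1
        = char (distr std_normal_seq borel (\<lambda>u. u k)) (c k)"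
      by (simp add: char_def integral_distr)
    then show "char (distr std_normal_seq borel (\<lambda>u. c k * u k)) 1 = complex_of_real (exp (- (c k)\<^sup>2 / 2))"
      by (simp add: distr_std_normal_seq char_std_normal_distribution)
  qed simp
  also have "\<dots> = complex_of_real (exp (\<Sum>k\<in>A. - (c k)\<^sup>2 / 2))"
    using assms by (simp add: exp_sum)
  also have "(\<Sum>k\<in>A. - (c k)\<^sup>2 / 2) = - (\<Sum>k\<in>A. (c k)\<^sup>2) / 2"
    by (simp add: sum_divide_distrib sum_negf)
  finally show ?thesis .
qed

text \<open>The arithmetic-geometric mean inequality passes from the norm to its square, whose mean
  is a finite sum because the coordinates are orthonormal. The free parameter \<open>c\<close> is
  later matched with the size of a block of the series.\<close>

lemma expectation_norm_gaussian_sum: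
  fixes a :: "nat \<Rightarrow> 'a::{real_inner, banach, second_countable_topology}"
  assumes "finite A" and "c > 0"
  shows "(\<integral>\<^sup>+ u. ennreal (norm (\<Sum>k\<in>A. u k *\<^sub>R a k)) \<partial>std_normal_seq)
    \<le> ennreal ((c + (\<Sum>k\<in>A. (norm (a k))\<^sup>2) / c) / 2)"
proof -
  interpret prob_space std_normal_seq by (rule prob_space_std_normal_seq)
  define U where "U u = (\<Sum>k\<in>A. u k *\<^sub>R a k)" for u :: "nat \<Rightarrow> real"
  have U2: "(norm (U u))\<^sup>2 = (\<Sum>k\<in>A. \<Sum>j\<in>A. (a k \<bullet> a j) * (u k * u j))" for u
    by (simp add: U_def power2_norm_eq_inner inner_sum_left inner_sum_right sum_distrib_left mult_ac inner_commute)
  have int: "integrable std_normal_seq (\<lambda>u. (norm (U u))\<^sup>2)"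
    unfolding U2 by (intro Bochner_Integration.integrable_sum integrable_mult_right std_normal_seq_moments)
  have "(LINT u|std_normal_seq. (norm (U u))\<^sup>2) = (\<Sum>k\<in>A. \<Sum>j\<in>A. (a k \<bullet> a j) * (if k = j then 1 else 0))"
    unfolding U2 by (simp add: Bochner_Integration.integral_sum std_normal_seq_moments)
  also have "\<dots> = (\<Sum>k\<in>A. (norm (a k))\<^sup>2)"
    using assms(1) by (simp add: if_distrib[of "\<lambda>c. _ * c"] power2_norm_eq_inner cong: if_cong)
  finally have E: "(LINT u|std_normal_seq. (norm (U u))\<^sup>2) = (\<Sum>k\<in>A. (norm (a k))\<^sup>2)" .
  have "(\<integral>\<^sup>+ u. ennreal (norm (U u)) \<partial>std_normal_seq)
      \<le> (\<integral>\<^sup>+ u. ennreal ((c + (norm (U u))\<^sup>2 / c) / 2) \<partial>std_normal_seq)"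
  proof (intro nn_integral_mono ennreal_leI)
    fix u
    have "0 \<le> (norm (U u) - c)\<^sup>2 / c" using assms by simp
    also have "\<dots> = (norm (U u))\<^sup>2 / c + c - 2 * norm (U u)"
      using assms by (simp add: power2_diff field_simps power2_eq_square)
    finally show "norm (U u) \<le> (c + (norm (U u))\<^sup>2 / c) / 2" by simp
  qed
  also have "\<dots> = ennreal (LINT u|std_normal_seq. (c + (norm (U u))\<^sup>2 / c) / 2)"
    using assms int by (intro nn_integral_eq_integral) auto
  also have "\<dots> = ennreal ((c + (\<Sum>k\<in>A. (norm (a k))\<^sup>2) / c) / 2)"
    using int E by (simp add: prob_space)
  finally show ?thesis by (simp add: U_def)
qed

text \<open>The measure is the law of the random series with terms \<open>u k *\<^sub>R a k\<close>.
  Convergence is established along a subsequence of the partial sums: the blocks between consecutive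
  indices \<open>N j\<close> have expected norm at most \<open>(1 / 2) ^ j\<close>, so their norms
  are almost surely summable.\<close>

lemma gaussian_law_exists:
  fixes a :: "nat \<Rightarrow> 'a::{real_inner, banach, second_countable_topology}"
  assumes sm: "summable (\<lambda>k. (norm (a k))\<^sup>2)"
  obtains \<mu> where "gaussian_law (\<lambda>x. \<Sum>k. (x \<bullet> a k)\<^sup>2) \<mu>"
proof -
  interpret prob_space std_normal_seq by (rule prob_space_std_normal_seq)
  define s where "s n = (\<Sum>k<n. (norm (a k))\<^sup>2)" for n
  have "Cauchy s" using sm by (simp add: s_def[abs_def] summable_iff_convergent convergent_Cauchy)
  then have "\<exists>N. \<forall>m\<ge>N. \<forall>n\<ge>N. dist (s m) (s n) < (1 / 4) ^ j" for j
    by (rule metric_CauchyD) simp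
  then obtain N0 where N0: "\<And>j m n. m \<ge> N0 j \<Longrightarrow> n \<ge> N0 j \<Longrightarrow> dist (s m) (s n) < (1 / 4) ^ j"
    by metis
  \<comment> \<open>The sum of successors makes \<open>N\<close> strictly increasing, the last term
    makes it dominate \<open>N0\<close>.\<close>
  define N where "N j = (\<Sum>i<j. Suc (N0 i)) + N0 j" for j
  have N_ge: "N0 j \<le> N j" for j by (simp add: N_def)
  have N_less: "N j < N (Suc j)" for j by (simp add: N_def)
  have smN: "strict_mono N" using N_less by (simp add: strict_mono_Suc_iff)
  define U where "U j u = (\<Sum>k\<in>{N j..<N (Suc j)}. u k *\<^sub>R a k)" for j and u :: "nat \<Rightarrow> real"
  have [measurable]: "U j \<in> borel_measurable std_normal_seq" for j
    unfolding U_def by measurable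
  have EU: "(\<integral>\<^sup>+ u. ennreal (norm (U j u)) \<partial>std_normal_seq) \<le> ennreal ((1 / 2) ^ j)" for j
  proof -
    have "(\<Sum>k\<in>{N j..<N (Suc j)}. (norm (a k))\<^sup>2) = s (N (Suc j)) - s (N j)"
      using N_less[of j] by (simp add: s_def sum_diff_nat_ivl lessThan_atLeast0)
    also have "\<dots> \<le> dist (s (N (Suc j))) (s (N j))" by (simp add: dist_real_def)
    also have "\<dots> \<le> (1 / 4) ^ j"
      using N0[of j "N (Suc j)" "N j"] N_ge[of j] N_less[of j] by simp
    \<comment> \<open>Here \<open>c = (1 / 2) ^ j\<close>: a block of squared size at most
      \<open>(1 / 4) ^ j\<close> contributes at most \<open>(1 / 2) ^ j\<close> to the second term
      of the average, as much as the first.\<close>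
    finally have "((1 / 2) ^ j + (\<Sum>k\<in>{N j..<N (Suc j)}. (norm (a k))\<^sup>2) / (1 / 2) ^ j) / 2
        \<le> ((1 / 2) ^ j + (1 / 4) ^ j / (1 / 2) ^ j) / 2"
      by (intro divide_right_mono add_left_mono) auto
    also have "\<dots> = (1 / 2 :: real) ^ j"
      by (simp add: power_divide[symmetric] power_mult_distrib[symmetric] flip: power_divide)
    finally show ?thesis
      using expectation_norm_gaussian_sum[of "{N j..<N (Suc j)}" "(1 / 2) ^ j" a]
      by (auto simp: U_def intro: order_trans ennreal_leI)
  qed
  have "(\<integral>\<^sup>+ u. (\<Sum>j. ennreal (norm (U j u))) \<partial>std_normal_seq)
      = (\<Sum>j. \<integral>\<^sup>+ u. ennreal (norm (U j u)) \<partial>std_normal_seq)"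
    by (rule nn_integral_suminf) measurable
  also have "\<dots> \<le> (\<Sum>j. ennreal ((1 / 2) ^ j))" by (intro suminf_le EU) auto
  also have "\<dots> = ennreal (\<Sum>j. (1 / 2) ^ j)" by (rule suminf_ennreal2) auto
  finally have "(\<integral>\<^sup>+ u. (\<Sum>j. ennreal (norm (U j u))) \<partial>std_normal_seq) \<noteq> \<infinity>"
    by (auto simp: top_unique)
  then have "AE u in std_normal_seq. (\<Sum>j. ennreal (norm (U j u))) \<noteq> \<infinity>"
    by (intro nn_integral_PInf_AE) auto
  then have AEs: "AE u in std_normal_seq. summable (\<lambda>j. U j u)"
    by eventually_elim (auto intro!: summable_norm_cancel[OF summable_suminf_not_top])
  define Z where "Z u = (\<Sum>k<N 0. u k *\<^sub>R a k) + (\<Sum>j. U j u)" for u :: "nat \<Rightarrow> real"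
  have [measurable]: "Z \<in> borel_measurable std_normal_seq" unfolding Z_def by measurable
  have AElim: "AE u in std_normal_seq. (\<lambda>n. \<Sum>k<N n. u k *\<^sub>R a k) \<longlonglongrightarrow> Z u"
    using AEs
  proof eventually_elim
    case (elim u)
    have eq: "(\<Sum>k<N n. u k *\<^sub>R a k) = (\<Sum>k<N 0. u k *\<^sub>R a k) + (\<Sum>j<n. U j u)" for n
    proof (induction n)
      case (Suc n)
      have "{..<N (Suc n)} = {..<N n} \<union> {N n..<N (Suc n)}" using N_less[of n] by auto
      then have "(\<Sum>k<N (Suc n). u k *\<^sub>R a k) = (\<Sum>k<N n. u k *\<^sub>R a k) + U n u"
        unfolding U_def by (simp add: sum.union_disjoint ivl_disj_int)
      with Suc show ?case by (simp add: add.assoc)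
    qed simp
    have "(\<lambda>n. (\<Sum>k<N 0. u k *\<^sub>R a k) + (\<Sum>j<n. U j u)) \<longlonglongrightarrow> Z u"
      unfolding Z_def using summable_LIMSEQ[OF elim] by (intro tendsto_intros)
    then show ?case by (subst eq)
  qed
  define \<mu> where "\<mu> = distr std_normal_seq borel Z"
  have "gaussian_law (\<lambda>x. \<Sum>k. (x \<bullet> a k)\<^sup>2) \<mu>"
    unfolding gaussian_law_def
  proof (intro conjI allI)
    show "prob_space \<mu>" unfolding \<mu>_def by (rule prob_space_distr) measurable
    show "sets \<mu> = sets borel" by (simp add: \<mu>_def)
    fix x :: 'a
    have "summable (\<lambda>k. (norm x)\<^sup>2 * (norm (a k))\<^sup>2)" using sm by (rule summable_mult)
    then have sx: "summable (\<lambda>k. (x \<bullet> a k)\<^sup>2)"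
      by (rule summable_comparison_test'[where N = 0])
        (metis Cauchy_Schwarz_ineq power2_norm_eq_inner real_norm_def abs_of_nonneg zero_le_power2)
    have cisL: "(\<lambda>n. cis (t n)) \<longlonglongrightarrow> cis l" if "t \<longlonglongrightarrow> l" for t :: "nat \<Rightarrow> real" and l
      using that by (intro tendsto_intros)
    have "(\<lambda>n. LINT u|std_normal_seq. cis (x \<bullet> (\<Sum>k<N n. u k *\<^sub>R a k)))
        \<longlonglongrightarrow> (LINT u|std_normal_seq. cis (x \<bullet> Z u))"
    proof (rule integral_dominated_convergence[where w = "\<lambda>_. 1"])
      show "AE u in std_normal_seq. (\<lambda>n. cis (x \<bullet> (\<Sum>k<N n. u k *\<^sub>R a k))) \<longlonglongrightarrow> cis (x \<bullet> Z u)"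
        using AElim by eventually_elim (intro cisL tendsto_intros)
    qed (auto simp: cis_conv_exp)
    moreover have "(LINT u|std_normal_seq. cis (x \<bullet> (\<Sum>k<N n. u k *\<^sub>R a k)))
        = complex_of_real (exp (- (\<Sum>k<N n. (x \<bullet> a k)\<^sup>2) / 2))" for n
      using char_finite_std_normal_sum[of "{..<N n}" "\<lambda>k. x \<bullet> a k"]
      by (simp add: inner_sum_right mult.commute)
    moreover have "(\<lambda>n. complex_of_real (exp (- (\<Sum>k<N n. (x \<bullet> a k)\<^sup>2) / 2)))
        \<longlonglongrightarrow> complex_of_real (exp (- (\<Sum>k. (x \<bullet> a k)\<^sup>2) / 2))"
      using LIMSEQ_subseq_LIMSEQ[OF summable_LIMSEQ[OF sx] smN]
      by (intro tendsto_intros) (auto simp: comp_def)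
    ultimately have "(LINT u|std_normal_seq. cis (x \<bullet> Z u)) = complex_of_real (exp (- (\<Sum>k. (x \<bullet> a k)\<^sup>2) / 2))"
      by (simp add: LIMSEQ_unique)
    then show "(LINT y|\<mu>. cis (x \<bullet> y)) = complex_of_real (exp (- (\<Sum>k. (x \<bullet> a k)\<^sup>2) / 2))"
      by (simp add: \<mu>_def integral_distr cis_conv_exp)
  qed
  then show thesis by (rule that)
qed

declare measurable_std_normal_seq [measurable del]

section \<open>Finite Borel measures are determined by their characters\<close>

lemma borel_measurable_cis [measurable (raw)]:
  "f \<in> borel_measurable M \<Longrightarrow> (\<lambda>x. cis (f x)) \<in> borel_measurable M"
  by (rule measurable_compose[OF _ borel_measurable_continuous_onI[of cis]]) (auto intro!: continuous_intros)

text \<open>Levy's uniqueness theorem concerns probability measures. The common mass, read off at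
  \<open>t = 0\<close>, is normalised away, and the zero measure is treated apart.\<close>

lemma finite_measure_eqI_char:
  assumes "finite_measure M" "finite_measure N" and sets: "sets M = sets borel" "sets N = sets borel"
    and eq: "\<And>t. (LINT x|M. cis (t * x)) = (LINT x|N. cis (t * x))"
  shows "M = N"
proof -
  interpret M: finite_measure M by fact
  interpret N: finite_measure N by fact
  define c where "c = measure M (space M)"
  have cN: "measure N (space N) = c"
    using eq[of 0] by (simp add: c_def)
  have emM: "emeasure M (space M) = ennreal c" and emN: "emeasure N (space N) = ennreal c"
    by (simp_all add: M.emeasure_eq_measure N.emeasure_eq_measure c_def cN)
  show ?thesis
  proof (cases "c = 0")
    case True
    have z: "emeasure K A = 0" if "emeasure K (space K) = 0" for K :: "real measure" and A
      using that emeasure_space[of K A] by simp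
    show ?thesis
      by (rule measure_eqI) (use sets z emM emN True in auto)
  next
    case False
    then have "c > 0" using measure_nonneg[of M "space M"] by (simp add: c_def less_le)
    define D where "D K = density K (\<lambda>_. ennreal (1 / c))" for K :: "real measure"
    have rd: "real_distribution (D K)" if "emeasure K (space K) = ennreal c" "sets K = sets borel" for K
    proof -
      have "space K = UNIV" using sets_eq_imp_space_eq[OF that(2)] by simp
      have "prob_space (D K)"
      proof (rule prob_spaceI)
        have "emeasure (D K) (space (D K)) = ennreal (1 / c) * emeasure K (space K)"
          by (simp add: D_def emeasure_density_const)
        also have "\<dots> = 1" using that \<open>c > 0\<close> by (simp flip: ennreal_mult)
        finally show "emeasure (D K) (space (D K)) = 1" .
      qed
      then show ?thesis using that by (simp add: real_distribution_def real_distribution_axioms_def D_def)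
    qed
    have ch: "char (D K) t = (1 / c) *\<^sub>R (LINT x|K. cis (t * x))" if "sets K = sets borel" for K t
    proof -
      have [measurable_cong]: "sets K = sets borel" by fact
      have "(LINT x|D K. cis (t * x)) = (LINT x|K. (1 / c) *\<^sub>R cis (t * x))"
        unfolding D_def using \<open>c > 0\<close> by (intro integral_density) auto
      then show ?thesis by (simp add: char_def cis_conv_exp)
    qed
    have "D M = D N"
      by (rule Levy_uniqueness[OF rd[OF emM] rd[OF emN]]) (use sets eq in \<open>auto simp: ch fun_eq_iff\<close>)
    show ?thesis
    proof (rule measure_eqI)
      fix A assume "A \<in> sets M"
      have "emeasure K A = ennreal c * emeasure (D K) A" if "A \<in> sets K" for K
        using that \<open>c > 0\<close> by (simp add: D_def emeasure_density_const flip: mult.assoc ennreal_mult)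
      then show "emeasure M A = emeasure N A"
        using \<open>A \<in> sets M\<close> sets \<open>D M = D N\<close> by simp
    qed (simp add: sets)
  qed
qed

lemma integrable_cis_inner [intro]:
  fixes M :: "'a::{real_inner, second_countable_topology} measure"
  assumes "finite_measure M" and [measurable_cong]: "sets M = sets borel"
  shows "integrable M (\<lambda>y. cis (x \<bullet> y))"
proof -
  interpret finite_measure M by fact
  show ?thesis
    by (rule integrable_const_bound[where B = 1]) auto
qed

text \<open>The weights \<open>1 + cos (x \<bullet> y + m)\<close> turn information about characters into information
  about nonnegative measures on the line, to which Levy's one-dimensional theorem applies.\<close>

lemma restrict_half_space_char_eq:
  fixes M N :: "'a::{real_inner, second_countable_topology} measure"
  assumes fin: "finite_measure M" "finite_measure N"
    and sets: "sets M = sets borel" "sets N = sets borel"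
    and eq: "\<And>x. (LINT y|M. cis (x \<bullet> y)) = (LINT y|N. cis (x \<bullet> y))"
  shows "(LINT y|M. indicator {y. b \<bullet> y \<le> r} y *\<^sub>R cis (x \<bullet> y)) = (LINT y|N. indicator {y. b \<bullet> y \<le> r} y *\<^sub>R cis (x \<bullet> y))"
proof -
  define w where "w x m y = 1 + cos (x \<bullet> y + m)" for x y :: 'a and m
  have w0: "0 \<le> w x m y" "w x m y \<le> 2" for x m y
    unfolding w_def using cos_ge_minus_one[of "x \<bullet> y + m"] cos_le_one[of "x \<bullet> y + m"] by linarith+
  have wm [measurable]: "w x m \<in> borel_measurable borel" for x m
    unfolding w_def by measurable
  \<comment> \<open>The image on the line of the weighted measure. Its character at \<open>t\<close>
    involves those of \<open>K\<close> only at \<open>t b\<close>, \<open>t b + x\<close> and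
    \<open>t b - x\<close>, so these images agree for \<open>M\<close> and \<open>N\<close>, and
    with them the masses of half lines.\<close>
  define P where "P K x m = distr (density K (w x m)) borel (\<lambda>y. b \<bullet> y)" for K x m
  have w_cis: "complex_of_real (w x m y) * cis (t * (b \<bullet> y)) =
      cis ((t *\<^sub>R b) \<bullet> y) + (1 / 2) *\<^sub>R (cis m * cis ((t *\<^sub>R b + x) \<bullet> y)) + (1 / 2) *\<^sub>R (cis (- m) * cis ((t *\<^sub>R b - x) \<bullet> y))" for x m t y
  proof -
    have "complex_of_real (cos u) = (1 / 2) *\<^sub>R (cis u + cis (- u))" for u
      by (simp add: complex_eq_iff)
    then have "complex_of_real (w x m y) = 1 + (1 / 2) *\<^sub>R (cis (x \<bullet> y + m) + cis (- (x \<bullet> y + m)))"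
      by (simp add: w_def)
    then show ?thesis
      by (simp add: cis_mult inner_add_left inner_diff_left algebra_simps scaleR_conv_of_real)
  qed
  have ch: "(LINT z|P K x m. cis (t * z)) = (LINT y|K. cis ((t *\<^sub>R b) \<bullet> y))
      + (1 / 2) *\<^sub>R (cis m * (LINT y|K. cis ((t *\<^sub>R b + x) \<bullet> y))) + (1 / 2) *\<^sub>R (cis (- m) * (LINT y|K. cis ((t *\<^sub>R b - x) \<bullet> y)))"
    and finP: "finite_measure (P K x m)"
    if K: "finite_measure K" "sets K = sets borel" for K x m t
  proof -
    interpret finite_measure K by fact
    have [measurable_cong]: "sets K = sets borel" by fact
    have "(LINT z|P K x m. cis (t * z)) = (LINT y|density K (w x m). cis (t * (b \<bullet> y)))"
      unfolding P_def by (rule integral_distr) auto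
    also have "\<dots> = (LINT y|K. w x m y *\<^sub>R cis (t * (b \<bullet> y)))"
      by (rule integral_density) (auto simp: w0)
    also have "\<dots> = (LINT y|K. cis ((t *\<^sub>R b) \<bullet> y) + (1 / 2) *\<^sub>R (cis m * cis ((t *\<^sub>R b + x) \<bullet> y)) + (1 / 2) *\<^sub>R (cis (- m) * cis ((t *\<^sub>R b - x) \<bullet> y)))"
      by (simp only: scaleR_conv_of_real[of "w _ _ _"] w_cis)
    also have "\<dots> = (LINT y|K. cis ((t *\<^sub>R b) \<bullet> y))
      + (1 / 2) *\<^sub>R (cis m * (LINT y|K. cis ((t *\<^sub>R b + x) \<bullet> y))) + (1 / 2) *\<^sub>R (cis (- m) * (LINT y|K. cis ((t *\<^sub>R b - x) \<bullet> y)))"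
    proof -
      have "(LINT y|K. f y + (1 / 2) *\<^sub>R (c * g y) + (1 / 2) *\<^sub>R (d * h y))
        = (LINT y|K. f y) + (1 / 2) *\<^sub>R (c * (LINT y|K. g y)) + (1 / 2) *\<^sub>R (d * (LINT y|K. h y))"
        if "integrable K f" "integrable K g" "integrable K h" for f g h :: "'a \<Rightarrow> complex" and c d
        using that by simp
      then show ?thesis using integrable_cis_inner[OF K] by blast
    qed
    finally show "(LINT z|P K x m. cis (t * z)) = (LINT y|K. cis ((t *\<^sub>R b) \<bullet> y))
      + (1 / 2) *\<^sub>R (cis m * (LINT y|K. cis ((t *\<^sub>R b + x) \<bullet> y))) + (1 / 2) *\<^sub>R (cis (- m) * (LINT y|K. cis ((t *\<^sub>R b - x) \<bullet> y)))" .
    have "(\<integral>\<^sup>+ y. ennreal (w x m y) \<partial>K) \<le> (\<integral>\<^sup>+ y. 2 \<partial>K)"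
      using w0 by (intro nn_integral_mono) (auto simp flip: ennreal_numeral intro: ennreal_leI)
    also have "\<dots> < \<infinity>" using emeasure_finite by (simp add: ennreal_mult_eq_top_iff less_top[symmetric])
    finally have "finite_measure (density K (w x m))"
      by (intro finite_measureI) (simp add: emeasure_density nn_integral_cong[of K "\<lambda>y. ennreal (w x m y) * indicator (space K) y" "\<lambda>y. ennreal (w x m y)"])
    then show "finite_measure (P K x m)"
      unfolding P_def by (rule finite_measure.finite_measure_distr) measurable
  qed
  have PMN: "P M x m = P N x m" for x m
  proof (rule finite_measure_eqI_char)
    show "(LINT z|P M x m. cis (t * z)) = (LINT z|P N x m. cis (t * z))" for t
      by (simp only: ch[OF fin(1) sets(1)] ch[OF fin(2) sets(2)] eq)
  qed (use fin sets finP in \<open>auto simp: P_def\<close>)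
  define J where "J K f = (LINT y|K. indicator {y. b \<bullet> y \<le> r} y * f y)" for K and f :: "'a \<Rightarrow> real"
  have mP: "measure (P K x m) {..r} = J K (w x m)" if K: "finite_measure K" "sets K = sets borel" for K x m
  proof -
    have [measurable_cong]: "sets K = sets borel" by fact
    have "measure (P K x m) {..r} = (LINT z|P K x m. indicator {..r} z)"
      using finite_measure.emeasure_finite[OF finP[OF K]] by (simp add: P_def)
    also have "\<dots> = (LINT y|density K (w x m). indicator {..r} (b \<bullet> y))"
      unfolding P_def by (rule integral_distr) auto
    also have "\<dots> = (LINT y|K. w x m y *\<^sub>R indicator {..r} (b \<bullet> y))"
      by (rule integral_density) (auto simp: w0)
    also have "\<dots> = J K (w x m)"
      unfolding J_def by (intro Bochner_Integration.integral_cong) (auto simp: indicator_def)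
    finally show ?thesis .
  qed
  have JMN: "J M (w x m) = J N (w x m)" for x m
    using mP[OF fin(1) sets(1)] mP[OF fin(2) sets(2)] PMN by metis
  have int: "integrable K (\<lambda>y. indicator {y. b \<bullet> y \<le> r} y * f y)"
    if K: "finite_measure K" "sets K = sets borel" and f: "f \<in> borel_measurable borel" "\<And>y. \<bar>f y\<bar> \<le> 2" for K and f :: "'a \<Rightarrow> real"
  proof -
    interpret finite_measure K by fact
    have [measurable_cong]: "sets K = sets borel" by fact
    note f(1)[measurable]
    show ?thesis
      by (rule integrable_const_bound[where B = 2]) (use f in \<open>auto simp: indicator_def\<close>)
  qed
  have Jw: "J K (w x m) = J K (\<lambda>_. 1) + J K (\<lambda>y. cos (x \<bullet> y + m))"
    if K: "finite_measure K" "sets K = sets borel" for K x m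
    unfolding J_def w_def distrib_left
    by (rule Bochner_Integration.integral_add; rule int[OF K]) (auto intro: order_trans[OF abs_cos_le_one])
  \<comment> \<open>The weight \<open>w 0 0\<close> is the constant 2. It yields the mass of the
    half space, which is then subtracted from \<open>Jw\<close> to isolate the cosine.\<close>
  have J1: "J K (w 0 0) = 2 * J K (\<lambda>_. 1)" for K
    unfolding J_def w_def by (simp only: Bochner_Integration.integral_mult_right_zero[symmetric])
      (simp add: mult.commute)
  have Jcos: "J M (\<lambda>y. cos (x \<bullet> y + m)) = J N (\<lambda>y. cos (x \<bullet> y + m))" for x m
    using JMN[of x m] JMN[of 0 0] Jw[OF fin(1) sets(1), of x m] Jw[OF fin(2) sets(2), of x m] J1[of M] J1[of N] by simp
  \<comment> \<open>The phase \<open>m = 0\<close> gives the real part, and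
    \<open>m = - pi / 2\<close> turns the cosine into the sine.\<close>
  have KK: "(LINT y|K. indicator {y. b \<bullet> y \<le> r} y *\<^sub>R cis (x \<bullet> y))
      = complex_of_real (J K (\<lambda>y. cos (x \<bullet> y + 0))) + \<i> * complex_of_real (J K (\<lambda>y. cos (x \<bullet> y + (- pi / 2))))"
    if K: "finite_measure K" "sets K = sets borel" for K
  proof -
    have "indicator {y. b \<bullet> y \<le> r} y *\<^sub>R cis (x \<bullet> y) = complex_of_real (indicator {y. b \<bullet> y \<le> r} y * cos (x \<bullet> y + 0))
       + \<i> * complex_of_real (indicator {y. b \<bullet> y \<le> r} y * cos (x \<bullet> y + (- pi / 2)))" for y
      by (simp add: complex_eq_iff cos_diff)
    then have "(LINT y|K. indicator {y. b \<bullet> y \<le> r} y *\<^sub>R cis (x \<bullet> y)) =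
       (LINT y|K. complex_of_real (indicator {y. b \<bullet> y \<le> r} y * cos (x \<bullet> y + 0))
       + \<i> * complex_of_real (indicator {y. b \<bullet> y \<le> r} y * cos (x \<bullet> y + (- pi / 2))))" by simp
    also have "\<dots> = (LINT y|K. complex_of_real (indicator {y. b \<bullet> y \<le> r} y * cos (x \<bullet> y + 0)))
       + (LINT y|K. \<i> * complex_of_real (indicator {y. b \<bullet> y \<le> r} y * cos (x \<bullet> y + (- pi / 2))))"
      by (intro Bochner_Integration.integral_add integrable_mult_right integrable_of_real int[OF K])
        (auto intro: order_trans[OF abs_cos_le_one])
    finally show ?thesis unfolding J_def by (simp only: integral_mult_right_zero integral_complex_of_real)
  qed
  show ?thesis unfolding KK[OF fin(1) sets(1)] KK[OF fin(2) sets(2)] Jcos ..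
qed

text \<open>A closed ball is an intersection of half spaces over a countable dense set of
  directions, and an open set is a countable union of closed balls with centres in that set and
  rational radii. The generators are finite intersections, indexed by lists, so that the family is
  closed under intersection.\<close>

lemma borel_eq_sigma_half_spaces:
  "sets (borel :: 'a::{real_inner, second_countable_topology} measure)
    = sigma_sets UNIV {{y. \<forall>(b, r)\<in>set L. b \<bullet> y \<le> r} | L. True}" (is "_ = sigma_sets UNIV ?E")
proof (rule antisym)
  have "{y. \<forall>(b, r)\<in>set L. b \<bullet> y \<le> r} \<in> sets borel" for L :: "('a \<times> real) list"
  proof -
    have "{y. \<forall>(b, r)\<in>set L. b \<bullet> y \<le> r} = (\<Inter>(b, r)\<in>set L. {y. b \<bullet> y \<le> r})" by auto
    moreover have "closed \<dots>" by (auto intro!: closed_INT closed_Collect_le continuous_intros)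
    ultimately show ?thesis by simp
  qed
  then show "sigma_sets UNIV ?E \<subseteq> sets borel"
    by (intro sets.sigma_sets_subset[of _ borel, simplified]) auto
  interpret sigma_algebra UNIV "sigma_sets UNIV ?E" by (rule sigma_algebra_sigma_sets) auto
  obtain D :: "'a set" where D: "countable D" "\<And>X. open X \<Longrightarrow> X \<noteq> {} \<Longrightarrow> \<exists>d\<in>D. d \<in> X"
    by (rule countable_dense_setE) blast
  have half: "{y. b \<bullet> y \<le> r} \<in> sigma_sets UNIV ?E" for b r
    by (rule sigma_sets.Basic) (auto intro: exI[of _ "[(b, r)]"])
  have cball: "cball c r \<in> sigma_sets UNIV ?E" if "0 \<le> r" for c :: 'a and r
  proof -
    \<comment> \<open>The inequality is homogeneous in \<open>d\<close>, so \<open>D\<close> may be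
      dense in the whole space instead of the sphere. The set \<open>S\<close> of admissible
      directions is closed, which extends the inequality to \<open>d = y - c\<close>.\<close>
    have "cball c r = (\<Inter>d\<in>D. {y. d \<bullet> y \<le> r * norm d + d \<bullet> c})"
    proof (intro equalityI subsetI)
      fix y assume y: "y \<in> cball c r"
      have "d \<bullet> y \<le> r * norm d + d \<bullet> c" for d
      proof -
        have "d \<bullet> (y - c) \<le> norm d * norm (y - c)" by (rule norm_cauchy_schwarz)
        also have "\<dots> \<le> norm d * r" using y by (intro mult_left_mono) (auto simp: dist_norm norm_minus_commute)
        finally show ?thesis by (simp add: inner_diff_right mult.commute)
      qed
      then show "y \<in> (\<Inter>d\<in>D. {y. d \<bullet> y \<le> r * norm d + d \<bullet> c})" by simp
    next
      fix y assume y: "y \<in> (\<Inter>d\<in>D. {y. d \<bullet> y \<le> r * norm d + d \<bullet> c})"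
      define S where "S = {d. d \<bullet> y \<le> r * norm d + d \<bullet> c}"
      have "closed S" unfolding S_def by (intro closed_Collect_le continuous_intros)
      moreover have "D \<subseteq> S" using y by (auto simp: S_def)
      ultimately have "S = UNIV"
        using D(2)[of "- S"] by (auto simp: open_Compl)
      then have "y - c \<in> S" by simp
      then have "(y - c) \<bullet> (y - c) \<le> r * norm (y - c)" by (simp add: S_def inner_diff_right)
      then have "norm (y - c) * norm (y - c) \<le> r * norm (y - c)"
        by (simp add: power2_norm_eq_inner[symmetric] power2_eq_square)
      then show "y \<in> cball c r" using that
        by (cases "y = c") (auto simp: dist_norm norm_minus_commute)
    qed
    then show ?thesis by (simp only:) (rule countable_INT''[OF sigma_sets_top D(1) half])
  qed
  have "U \<in> sigma_sets UNIV ?E" if "open U" for U :: "'a set"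
  proof -
    define I where "I = {p \<in> D \<times> \<rat>. 0 \<le> snd p \<and> cball (fst p) (snd p) \<subseteq> U}"
    have "U = (\<Union>p\<in>I. cball (fst p) (snd p))"
    proof (intro equalityI subsetI)
      fix x assume "x \<in> U"
      then obtain e where e: "e > 0" "ball x e \<subseteq> U" using \<open>open U\<close> openE by blast
      obtain q where q: "q \<in> \<rat>" "0 < q" "q < e / 2" using Rats_dense_in_real[of 0 "e / 2"] e by auto
      obtain d where d: "d \<in> D" "d \<in> ball x q" using D(2)[of "ball x q"] q by auto
      have "cball d q \<subseteq> U"
      proof
        fix z assume "z \<in> cball d q"
        then have "dist x z < e" using d q dist_triangle[of x z d] by (auto simp: dist_commute)
        then show "z \<in> U" using e by auto
      qed
      then show "x \<in> (\<Union>p\<in>I. cball (fst p) (snd p))"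
        using d q by (intro UN_I[of "(d, q)"]) (auto simp: I_def dist_commute)
    qed (auto simp: I_def)
    moreover have "countable I"
      by (rule countable_subset[of _ "D \<times> \<rat>"]) (auto simp: I_def D(1) countable_rat)
    then have "(\<Union>p\<in>I. cball (fst p) (snd p)) \<in> sigma_sets UNIV ?E"
      by (rule countable_UN'') (rule cball, simp add: I_def)
    ultimately show ?thesis by simp
  qed
  then have "sigma_sets UNIV {S :: 'a set. open S} \<subseteq> sigma_sets UNIV ?E"
    by (intro sigma_sets_mono) auto
  then show "sets (borel :: 'a measure) \<subseteq> sigma_sets UNIV ?E"
    by (simp add: borel_def)
qed

text \<open>Restriction to one half space preserves equality of characters, so induction over the
  list of half spaces gives equality on a generating family stable under intersection. The measures
  are generalised because each step passes to restricted ones.\<close>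

lemma finite_measure_eqI_inner_char:
  fixes M N :: "'a::{real_inner, second_countable_topology} measure"
  assumes fin: "finite_measure M" "finite_measure N"
    and sets: "sets M = sets borel" "sets N = sets borel"
    and eq: "\<And>x. (LINT y|M. cis (x \<bullet> y)) = (LINT y|N. cis (x \<bullet> y))"
  shows "M = N"
proof -
  have E: "emeasure M {y. \<forall>(b, r)\<in>set L. b \<bullet> y \<le> r} = emeasure N {y. \<forall>(b, r)\<in>set L. b \<bullet> y \<le> r}" for L :: "('a \<times> real) list"
    using fin sets eq
  proof (induction L arbitrary: M N)
    case Nil
    interpret M: finite_measure M by fact
    interpret N: finite_measure N by fact
    have "measure M (space M) = measure N (space N)"
      using Nil(5)[of 0] by simp
    then show ?case using sets_eq_imp_space_eq[OF Nil(3)] sets_eq_imp_space_eq[OF Nil(4)]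
      by (simp add: M.emeasure_eq_measure N.emeasure_eq_measure)
  next
    case (Cons p L)
    obtain b r where p: "p = (b, r)" by (cases p)
    define R where "R K = density K (indicator {y. b \<bullet> y \<le> r} :: 'a \<Rightarrow> ennreal)" for K
    have half [measurable]: "{y. b \<bullet> y \<le> r} \<in> sets borel"
      by (intro borel_closed closed_Collect_le continuous_intros)
    have LB: "{y. \<forall>(b, r)\<in>set L. b \<bullet> y \<le> r} \<in> sets borel"
      unfolding borel_eq_sigma_half_spaces by (rule sigma_sets.Basic) auto
    have R: "finite_measure (R K)" "sets (R K) = sets borel"
      "emeasure (R K) {y. \<forall>(b, r)\<in>set L. b \<bullet> y \<le> r} = emeasure K {y. \<forall>(b, r)\<in>set (p # L). b \<bullet> y \<le> r}"
      "(LINT y|R K. cis (x \<bullet> y)) = (LINT y|K. indicator {y. b \<bullet> y \<le> r} y *\<^sub>R cis (x \<bullet> y))"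
      if K: "finite_measure K" "sets K = sets borel" for K x
    proof -
      have [measurable_cong]: "sets K = sets borel" by fact
      show "sets (R K) = sets borel" using K by (simp add: R_def)
      have em: "emeasure (R K) A = emeasure K ({y. b \<bullet> y \<le> r} \<inter> A)" if "A \<in> sets borel" for A
        using that K by (simp add: R_def emeasure_density flip: indicator_inter_arith)
      show "finite_measure (R K)"
        by (rule finite_measureI)
          (use K em finite_measure.emeasure_finite[OF K(1)] sets_eq_imp_space_eq[OF K(2)] in \<open>simp add: R_def\<close>)
      show "emeasure (R K) {y. \<forall>(b, r)\<in>set L. b \<bullet> y \<le> r} = emeasure K {y. \<forall>(b, r)\<in>set (p # L). b \<bullet> y \<le> r}"
        by (subst em[OF LB]) (auto simp: p intro: arg_cong[where f = "emeasure K"])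
      have "R K = density K (\<lambda>y. ennreal (indicator {y. b \<bullet> y \<le> r} y))"
        by (simp add: R_def ennreal_indicator)
      then show "(LINT y|R K. cis (x \<bullet> y)) = (LINT y|K. indicator {y. b \<bullet> y \<le> r} y *\<^sub>R cis (x \<bullet> y))"
        by (simp add: integral_density cis_conv_exp)
    qed
    have "emeasure (R M) {y. \<forall>(b, r)\<in>set L. b \<bullet> y \<le> r} = emeasure (R N) {y. \<forall>(b, r)\<in>set L. b \<bullet> y \<le> r}"
    proof (rule Cons.IH)
      show "(LINT y|R M. cis (x \<bullet> y)) = (LINT y|R N. cis (x \<bullet> y))" for x
        unfolding R(4)[OF Cons.prems(1,3)] R(4)[OF Cons.prems(2,4)]
        by (rule restrict_half_space_char_eq[OF Cons.prems])
    qed (use R Cons.prems in auto)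
    then show ?case using R(3)[OF Cons.prems(1,3)] R(3)[OF Cons.prems(2,4)] by simp
  qed
  show ?thesis
  proof (rule measure_eqI_generator_eq[where E = "{{y. \<forall>(b, r)\<in>set L. b \<bullet> y \<le> r} | L. True}" and A = "\<lambda>_. UNIV"])
    show "Int_stable {{y :: 'a. \<forall>(b, r)\<in>set L. b \<bullet> y \<le> r} | L. True}"
    proof (rule Int_stableI)
      fix A B :: "'a set"
      assume "A \<in> {{y. \<forall>(b, r)\<in>set L. b \<bullet> y \<le> r} | L. True}" "B \<in> {{y. \<forall>(b, r)\<in>set L. b \<bullet> y \<le> r} | L. True}"
      then obtain L L' where "A = {y. \<forall>(b, r)\<in>set L. b \<bullet> y \<le> r}" "B = {y. \<forall>(b, r)\<in>set L'. b \<bullet> y \<le> r}" by auto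
      then have "A \<inter> B = {y. \<forall>(b, r)\<in>set (L @ L'). b \<bullet> y \<le> r}" by auto
      then show "A \<inter> B \<in> {{y. \<forall>(b, r)\<in>set L. b \<bullet> y \<le> r} | L. True}" by blast
    qed
    show "range (\<lambda>_. UNIV) \<subseteq> {{y :: 'a. \<forall>(b, r)\<in>set L. b \<bullet> y \<le> r} | L. True}"
      by (auto intro!: exI[of _ "[]"])
    show "emeasure M UNIV \<noteq> \<infinity>"
      using finite_measure.emeasure_finite[OF fin(1)] sets_eq_imp_space_eq[OF sets(1)] by simp
  qed (use E sets borel_eq_sigma_half_spaces[where 'a = 'a] in auto)
qed

section \<open>Operations on Gaussian laws and the splitting along one direction\<close>

lemma gaussian_law_unique:
  fixes \<mu> :: "'a::{real_inner, second_countable_topology} measure"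
  assumes "gaussian_law q \<mu>" "gaussian_law q \<mu>'"
  shows "\<mu> = \<mu>'"
  using assms by (intro finite_measure_eqI_inner_char) (auto simp: gaussian_law_def prob_space_def)

lemma gaussian_law_prob_space: "gaussian_law q \<mu> \<Longrightarrow> prob_space \<mu>"
  by (auto simp: gaussian_law_def)

lemma gaussian_law_scaleR:
  fixes \<mu> :: "'a::{real_inner, second_countable_topology} measure"
  assumes "gaussian_law q \<mu>"
  shows "gaussian_law (\<lambda>x. q (c *\<^sub>R x)) (distr \<mu> borel (\<lambda>y. c *\<^sub>R y))"
proof -
  have [measurable_cong]: "sets \<mu> = sets borel" and char: "\<And>x. (LINT y|\<mu>. cis (x \<bullet> y)) = complex_of_real (exp (- q x / 2))"
    using assms by (auto simp: gaussian_law_def)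
  have "(LINT y|distr \<mu> borel (\<lambda>y. c *\<^sub>R y). cis (x \<bullet> y)) = (LINT y|\<mu>. cis (x \<bullet> (c *\<^sub>R y)))" for x
    by (rule integral_distr) auto
  then show ?thesis
    using char[of "c *\<^sub>R _"] prob_space.prob_space_distr[OF gaussian_law_prob_space[OF assms], of "\<lambda>y. c *\<^sub>R y" borel]
    by (simp add: gaussian_law_def)
qed

lemma gaussian_law_add:
  fixes \<mu> \<nu> :: "'a::{real_inner, second_countable_topology} measure"
  assumes \<mu>: "gaussian_law q \<mu>" and \<nu>: "gaussian_law q' \<nu>"
  shows "gaussian_law (\<lambda>x. q x + q' x) (distr (\<mu> \<Otimes>\<^sub>M \<nu>) borel (\<lambda>(y, z). y + z))"
proof -
  have [measurable_cong]: "sets \<mu> = sets borel" "sets \<nu> = sets borel"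
    and char: "\<And>x. (LINT y|\<mu>. cis (x \<bullet> y)) = complex_of_real (exp (- q x / 2))"
     "\<And>x. (LINT y|\<nu>. cis (x \<bullet> y)) = complex_of_real (exp (- q' x / 2))"
    using \<mu> \<nu> by (auto simp: gaussian_law_def)
  interpret \<mu>: prob_space \<mu> by (rule gaussian_law_prob_space[OF \<mu>])
  interpret \<nu>: prob_space \<nu> by (rule gaussian_law_prob_space[OF \<nu>])
  interpret P: pair_prob_space \<mu> \<nu> ..
  have "(LINT y|distr (\<mu> \<Otimes>\<^sub>M \<nu>) borel (\<lambda>(y, z). y + z). cis (x \<bullet> y)) = complex_of_real (exp (- (q x + q' x) / 2))" for x
  proof -
    have "(LINT y|distr (\<mu> \<Otimes>\<^sub>M \<nu>) borel (\<lambda>(y, z). y + z). cis (x \<bullet> y)) = (LINT p|(\<mu> \<Otimes>\<^sub>M \<nu>). cis (x \<bullet> (case p of (y, z) \<Rightarrow> y + z)))"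
      by (rule integral_distr) auto
    also have "\<dots> = (LINT p|(\<mu> \<Otimes>\<^sub>M \<nu>). (case p of (y, z) \<Rightarrow> cis (x \<bullet> y) * cis (x \<bullet> z)))"
      by (simp add: cis_mult inner_add_right split_beta)
    also have "\<dots> = (LINT y|\<mu>. (LINT z|\<nu>. cis (x \<bullet> y) * cis (x \<bullet> z)))"
    proof (rule P.integral_fst[symmetric])
      show "integrable (\<mu> \<Otimes>\<^sub>M \<nu>) (\<lambda>(y, z). cis (x \<bullet> y) * cis (x \<bullet> z))"
        by (rule P.integrable_const_bound[where B = 1]) (auto simp: split_beta norm_mult)
    qed
    also have "\<dots> = complex_of_real (exp (- q x / 2)) * complex_of_real (exp (- q' x / 2))"
      by (simp add: char)
    finally show ?thesis by (simp flip: of_real_mult exp_add add: add_divide_distrib)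
  qed
  then show ?thesis
    using P.prob_space_distr[of "\<lambda>(y, z). y + z" borel] by (simp add: gaussian_law_def)
qed

lemma gaussian_law_line:
  fixes a :: "'a::{real_inner, second_countable_topology}"
  shows
  "gaussian_law (\<lambda>x. (x \<bullet> a)\<^sup>2) (distr std_normal_distribution borel (\<lambda>u. u *\<^sub>R a))"
proof -
  have "(LINT y|distr std_normal_distribution borel (\<lambda>u. u *\<^sub>R a). cis (x \<bullet> y)) = complex_of_real (exp (- (x \<bullet> a)\<^sup>2 / 2))" for x
  proof -
    have "(LINT y|distr std_normal_distribution borel (\<lambda>u. u *\<^sub>R a). cis (x \<bullet> y)) = (LINT u|std_normal_distribution. cis (x \<bullet> (u *\<^sub>R a)))"
      by (rule integral_distr) measurable
    also have "\<dots> = char std_normal_distribution (x \<bullet> a)"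
      by (simp add: char_def cis_conv_exp mult.commute)
    finally show ?thesis by (simp add: char_std_normal_distribution)
  qed
  moreover have "prob_space (distr std_normal_distribution borel (\<lambda>u. u *\<^sub>R a))"
    by (rule prob_space.prob_space_distr[OF prob_space_std_normal]) measurable
  ultimately show ?thesis by (simp add: gaussian_law_def)
qed

context
  fixes Q :: "'a::{real_inner, banach, second_countable_topology} \<Rightarrow> 'a"
  assumes Q: "positive_operator Q" and tr: "finite_trace Q"
begin

text \<open>The part of the Gaussian measure that is left when the one-dimensional component in the
  unit direction \<open>op_sqrt Q z\<close> of the Cameron--Martin space is split off.\<close>

lemma gaussian_law_complement_exists:
  assumes "norm z \<le> 1"
  obtains \<nu> where "gaussian_law (\<lambda>x. Q x \<bullet> x - (x \<bullet> op_sqrt Q z)\<^sup>2) \<nu>"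
proof -
  define R where "R = op_sqrt Q"
  have R: "positive_operator R" "\<And>x. R (R x) = Q x" using op_sqrt[OF Q] by (simp_all add: R_def)
  interpret R: bounded_linear R using R(1) by (simp add: positive_operator_def)
  have Rsym: "R x \<bullet> y = x \<bullet> R y" for x y using R(1) by (simp add: positive_operator_def)
  obtain e where e: "\<And>x. (\<lambda>k. (x \<bullet> e k)\<^sup>2) sums (norm x)\<^sup>2" "summable (\<lambda>k. (norm (R (e k)))\<^sup>2)"
    using Parseval_sequence[OF Q tr] R_def by blast
  \<comment> \<open>\<open>c\<close> solves \<open>c^2 - 2 c = - norm z ^ 2\<close>, so that
    \<open>I - c u u^T\<close> is the symmetric square root of \<open>I - z z^T\<close>, where
    \<open>u\<close> is the direction of \<open>z\<close>. Each \<open>a k\<close> is the image of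
    \<open>e k\<close> under this root followed by \<open>op_sqrt Q\<close>, which produces the
    required covariance.\<close>
  define c where "c = 1 - sqrt (1 - (norm z)\<^sup>2)"
  define u where "u = (if z = 0 then 0 else (1 / norm z) *\<^sub>R z)"
  have zu: "z = norm z *\<^sub>R u" by (simp add: u_def)
  have nu: "u \<bullet> u = (if z = 0 then 0 else 1)" by (simp add: u_def power2_norm_eq_inner[symmetric] power2_eq_square)
  have nz: "(norm z)\<^sup>2 \<le> 1" using assms by (simp add: power_le_one)
  have c2: "c\<^sup>2 - 2 * c = - (norm z)\<^sup>2" using nz by (simp add: c_def power2_diff)
  define a where "a k = R (e k - (c * (e k \<bullet> u)) *\<^sub>R u)" for k
  have "(norm (a k))\<^sup>2 \<le> 2 * (norm (R (e k)))\<^sup>2 + 2 * ((c * norm (R u))\<^sup>2 * (u \<bullet> e k)\<^sup>2)" for k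
  proof -
    have *: "(norm (p - q))\<^sup>2 \<le> 2 * (norm p)\<^sup>2 + 2 * (norm q)\<^sup>2" for p q :: 'a
    proof -
      have "(norm (p - q))\<^sup>2 + (norm (p + q))\<^sup>2 = 2 * (norm p)\<^sup>2 + 2 * (norm q)\<^sup>2"
        by (simp add: power2_norm_eq_inner inner_add_left inner_add_right inner_diff_left inner_diff_right inner_commute)
      then show ?thesis using zero_le_power2[of "norm (p + q)"] by linarith
    qed
    have "a k = R (e k) - (c * (e k \<bullet> u)) *\<^sub>R R u" by (simp add: a_def R.diff R.scaleR)
    then show ?thesis
      using *[of "R (e k)" "(c * (e k \<bullet> u)) *\<^sub>R R u"] by (simp add: power_mult_distrib inner_commute mult_ac)
  qed
  moreover have "summable (\<lambda>k. 2 * (norm (R (e k)))\<^sup>2 + 2 * ((c * norm (R u))\<^sup>2 * (u \<bullet> e k)\<^sup>2))"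
    using e by (intro summable_add summable_mult) (auto simp: sums_iff)
  ultimately have "summable (\<lambda>k. (norm (a k))\<^sup>2)"
    by (intro summable_comparison_test'[where N = 0 and f = "\<lambda>k. (norm (a k))\<^sup>2"]) auto
  then obtain \<nu> where \<nu>: "gaussian_law (\<lambda>x. \<Sum>k. (x \<bullet> a k)\<^sup>2) \<nu>" by (rule gaussian_law_exists)
  have "(\<Sum>k. (x \<bullet> a k)\<^sup>2) = Q x \<bullet> x - (x \<bullet> R z)\<^sup>2" for x
  proof -
    define w where "w = R x - (c * (R x \<bullet> u)) *\<^sub>R u"
    have "x \<bullet> a k = w \<bullet> e k" for k
      by (simp add: a_def w_def flip: Rsym) (simp add: inner_diff_left inner_diff_right inner_commute)
    then have "(\<Sum>k. (x \<bullet> a k)\<^sup>2) = (norm w)\<^sup>2" using e(1)[of w] by (simp add: sums_iff)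
    also have "\<dots> = (norm (R x))\<^sup>2 + (R x \<bullet> u)\<^sup>2 * (c\<^sup>2 * (u \<bullet> u) - 2 * c)"
      by (simp add: w_def power2_norm_eq_inner inner_diff_left inner_diff_right inner_commute
          power2_eq_square[of "_ \<bullet> _"] power2_eq_square[of c] algebra_simps)
    also have "\<dots> = (norm (R x))\<^sup>2 - (norm z)\<^sup>2 * (R x \<bullet> u)\<^sup>2"
      using c2 nu by (cases "z = 0") (simp_all add: u_def)
    also have "(norm z)\<^sup>2 * (R x \<bullet> u)\<^sup>2 = (R x \<bullet> z)\<^sup>2"
      using arg_cong[OF zu, of "\<lambda>v. R x \<bullet> v"] by (simp add: power_mult_distrib)
    finally show ?thesis using R(2) by (simp add: power2_norm_eq_inner Rsym inner_commute[of _ x])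
  qed
  then show thesis using that[of \<nu>] \<nu> by (simp add: R_def)
qed

text \<open>The direction \<open>z = 0\<close> removes nothing and gives \<open>N(0,Q)\<close>
  itself; scaling by \<open>sqrt t\<close> turns it into \<open>N(0,tQ)\<close>. The choice in
  \<open>gaussian\<close> thus has a witness.\<close>

lemma gaussian_law_gaussian:
  assumes "0 \<le> t"
  shows "gaussian_law (\<lambda>x. t * (Q x \<bullet> x)) (gaussian (\<lambda>z. t *\<^sub>R Q z))"
proof -
  obtain \<nu> where \<nu>: "gaussian_law (\<lambda>x. Q x \<bullet> x - (x \<bullet> op_sqrt Q 0)\<^sup>2) \<nu>"
    using gaussian_law_complement_exists[of 0] by auto
  have "op_sqrt Q 0 = 0" using bounded_linear_op_sqrt[OF Q] by (simp add: linear_0 bounded_linear.linear)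
  moreover have "Q (c *\<^sub>R x) = c *\<^sub>R Q x" for c x
    using Q by (simp add: positive_operator_def linear_cmul bounded_linear.linear)
  ultimately have "gaussian_law (\<lambda>x. t * (Q x \<bullet> x)) (distr \<nu> borel (\<lambda>y. sqrt t *\<^sub>R y))"
    using gaussian_law_scaleR[OF \<nu>, of "sqrt t"] assms by (simp add: mult.assoc[symmetric])
  then have "\<exists>\<mu>. gaussian_law (\<lambda>x. t * (Q x \<bullet> x)) \<mu>" by blast
  then show ?thesis
    unfolding gaussian_def gaussian_law_def inner_scaleR_left by (rule someI_ex)
qed

end

section \<open>The heat semigroup and its derivative along the Cameron--Martin space\<close>

text \<open>Dominated convergence for the difference quotients at 0, which \<open>w\<close>
  dominates. Measurability of \<open>G'\<close> comes from the same limit along the steps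
  \<open>1 / (n + 1)\<close>.\<close>

lemma has_real_derivative_integral:
  fixes G :: "'b \<Rightarrow> real \<Rightarrow> real"
  assumes int: "\<And>\<tau>. \<bar>\<tau>\<bar> \<le> 1 \<Longrightarrow> integrable M (\<lambda>\<omega>. G \<omega> \<tau>)"
    and deriv: "\<And>\<omega>. \<omega> \<in> space M \<Longrightarrow> (G \<omega> has_real_derivative G' \<omega>) (at 0)"
    and bound: "\<And>\<omega> \<tau>. \<omega> \<in> space M \<Longrightarrow> \<bar>\<tau>\<bar> \<le> 1 \<Longrightarrow> \<bar>G \<omega> \<tau> - G \<omega> 0\<bar> \<le> \<bar>\<tau>\<bar> * w \<omega>"
    and w: "integrable M w"
  shows "integrable M G'" and "((\<lambda>\<tau>. LINT \<omega>|M. G \<omega> \<tau>) has_real_derivative (LINT \<omega>|M. G' \<omega>)) (at 0)"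
proof -
  have q: "integrable M G' \<and> (\<lambda>n. LINT \<omega>|M. (G \<omega> (X n) - G \<omega> 0) / X n) \<longlonglongrightarrow> (LINT \<omega>|M. G' \<omega>)"
    if X: "X \<longlonglongrightarrow> 0" "\<And>n. X n \<noteq> 0" "\<And>n. \<bar>X n\<bar> \<le> 1" for X
  proof -
    have *: "(\<lambda>n. (G \<omega> (X n) - G \<omega> 0) / X n) \<longlonglongrightarrow> G' \<omega>" if "\<omega> \<in> space M" for \<omega>
      using deriv[OF that] X unfolding DERIV_def tendsto_at_iff_sequentially by (auto simp: comp_def)
    then have 1: "AE \<omega> in M. (\<lambda>n. (G \<omega> (X n) - G \<omega> 0) / X n) \<longlonglongrightarrow> G' \<omega>" by auto
    have [measurable]: "(\<lambda>\<omega>. G \<omega> \<tau>) \<in> borel_measurable M" if "\<bar>\<tau>\<bar> \<le> 1" for \<tau>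
      using int[OF that] by simp
    have m: "(\<lambda>\<omega>. (G \<omega> (X n) - G \<omega> 0) / X n) \<in> borel_measurable M" for n
      using X(3)[of n] by measurable
    have m': "G' \<in> borel_measurable M"
      by (rule borel_measurable_LIMSEQ_real[OF *]) (assumption, rule m)
    have b: "AE \<omega> in M. norm ((G \<omega> (X n) - G \<omega> 0) / X n) \<le> w \<omega>" for n
      using bound[OF _ X(3)[of n]] X(2)[of n] by (auto simp: field_simps abs_mult intro!: AE_I2)
    show ?thesis
      using integrable_dominated_convergence[OF m' m w 1 b] integral_dominated_convergence[OF m' m w 1 b] by blast
  qed
  have "(\<lambda>n. 1 / real (Suc n)) \<longlonglongrightarrow> 0" using LIMSEQ_inverse_real_of_nat by (simp add: inverse_eq_divide)
  then show "integrable M G'" using q[of "\<lambda>n. 1 / real (Suc n)"] by simp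
  show "((\<lambda>\<tau>. LINT \<omega>|M. G \<omega> \<tau>) has_real_derivative (LINT \<omega>|M. G' \<omega>)) (at 0)"
    unfolding DERIV_def tendsto_at_iff_sequentially
  proof (intro allI impI)
    fix X :: "nat \<Rightarrow> real" assume X: "\<forall>i. X i \<in> UNIV - {0}" "X \<longlonglongrightarrow> 0"
    have "eventually (\<lambda>n. \<bar>X n\<bar> < 1) sequentially"
      using tendsto_rabs_zero[OF X(2)] by (rule order_tendstoD(2)) simp
    then obtain N where N: "\<And>n. n \<ge> N \<Longrightarrow> \<bar>X n\<bar> < 1" by (auto simp: eventually_sequentially)
    have "(\<lambda>n. LINT \<omega>|M. (G \<omega> (X (n + N)) - G \<omega> 0) / X (n + N)) \<longlonglongrightarrow> (LINT \<omega>|M. G' \<omega>)"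
    proof -
      have "(\<lambda>n. X (n + N)) \<longlonglongrightarrow> 0" using X(2) by (rule LIMSEQ_ignore_initial_segment)
      moreover have "\<bar>X (n + N)\<bar> \<le> 1" for n using N[of "n + N"] by simp
      ultimately show ?thesis using q[of "\<lambda>n. X (n + N)"] X(1) by auto
    qed
    moreover have "(LINT \<omega>|M. (G \<omega> (X (n + N)) - G \<omega> 0) / X (n + N))
        = ((LINT \<omega>|M. G \<omega> (X (n + N))) - (LINT \<omega>|M. G \<omega> 0)) / X (n + N)" for n
      using int[of "X (n + N)"] int[of 0] N[of "n + N"] by (simp add: less_imp_le)
    ultimately have "(\<lambda>n. ((LINT \<omega>|M. G \<omega> (X (n + N))) - (LINT \<omega>|M. G \<omega> 0)) / X (n + N)) \<longlonglongrightarrow> (LINT \<omega>|M. G' \<omega>)"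
      by (simp only:)
    then show "((\<lambda>h. ((LINT \<omega>|M. G \<omega> (0 + h)) - (LINT \<omega>|M. G \<omega> 0)) / h) \<circ> X) \<longlonglongrightarrow> (LINT \<omega>|M. G' \<omega>)"
      by - (rule LIMSEQ_offset[where k = N], simp add: comp_def)
  qed
qed

lemma CbE:
  assumes "f \<in> Cb"
  obtains K where "K \<ge> 0" "\<And>x. \<bar>f x\<bar> \<le> K"
proof -
  obtain K where "\<And>x. \<bar>f x\<bar> \<le> K" using assms by (auto simp: Cb_def bounded_iff)
  then show thesis using that[of K] by (meson abs_ge_zero order_trans)
qed

lemma CbI: "continuous_on UNIV f \<Longrightarrow> (\<And>x. \<bar>f x\<bar> \<le> K) \<Longrightarrow> f \<in> Cb"
  by (auto simp: Cb_def bounded_iff)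

lemma Cb_continuous: "f \<in> Cb \<Longrightarrow> continuous_on A f"
  by (auto simp: Cb_def intro: continuous_on_subset)

lemma Cb_measurable: "f \<in> Cb \<Longrightarrow> f \<in> borel_measurable borel"
  by (intro borel_measurable_continuous_onI Cb_continuous)

lemma Cb_LIMSEQ: "f \<in> Cb \<Longrightarrow> X \<longlonglongrightarrow> x \<Longrightarrow> (\<lambda>n. f (X n)) \<longlonglongrightarrow> f x"
  using continuous_on_tendsto_compose[of UNIV f] Cb_continuous by fastforce

lemma integrable_std_normal_exp: "integrable std_normal_distribution (\<lambda>u. exp (c * u))"
proof -
  have "integrable lborel (\<lambda>u. exp (c\<^sup>2 / 2) * normal_density c 1 u)"
    by (intro integrable_mult_right integrable_normal_density) simp
  moreover have "exp (c\<^sup>2 / 2) * normal_density c 1 u = std_normal_density u *\<^sub>R exp (c * u)" for u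
    by (simp add: normal_density_def power2_diff exp_add[symmetric] field_simps power2_eq_square
        flip: exp_add)
  ultimately show ?thesis by (subst integrable_density) auto
qed

text \<open>The Cameron-Martin formula in dimension one: translate the integral and complete the
  square.\<close>

lemma std_normal_shift:
  assumes [measurable]: "F \<in> borel_measurable borel"
  shows "(LINT u|std_normal_distribution. F (u + s)) = (LINT u|std_normal_distribution. F u * exp (u * s - s\<^sup>2 / 2))"
proof -
  have "(LINT u|std_normal_distribution. F (u + s)) = (LINT u|lborel. std_normal_density u *\<^sub>R F (u + s))"
    by (rule integral_density) auto
  also have "\<dots> = (LINT u|lborel. std_normal_density (u - s) *\<^sub>R F u)"
    using lborel_integral_real_affine[of 1 "\<lambda>u. std_normal_density (u - s) *\<^sub>R F u" s] by (simp add: add.commute)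
  also have "\<dots> = (LINT u|lborel. std_normal_density u *\<^sub>R (F u * exp (u * s - s\<^sup>2 / 2)))"
    by (intro Bochner_Integration.integral_cong refl)
      (simp add: normal_density_def power2_diff field_simps power2_eq_square exp_add[symmetric] exp_minus exp_diff flip: exp_add)
  also have "\<dots> = (LINT u|std_normal_distribution. F u * exp (u * s - s\<^sup>2 / 2))"
    by (rule integral_density[symmetric]) auto
  finally show ?thesis .
qed

lemma integrable_std_normal_exp_abs: "integrable std_normal_distribution (\<lambda>u. exp (c * \<bar>u\<bar>))"
proof (rule Bochner_Integration.integrable_bound)
  show "integrable std_normal_distribution (\<lambda>u. exp (c * u) + exp (- c * u))"
    using integrable_std_normal_exp[of c] integrable_std_normal_exp[of "- c"] by (intro Bochner_Integration.integrable_add) auto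
  have "exp (c * \<bar>u\<bar>) \<le> exp (c * u) + exp (- c * u)" for u
    by (cases "0 \<le> u") (simp_all add: add_increasing add_increasing2)
  then show "AE u in std_normal_distribution. norm (exp (c * \<bar>u\<bar>)) \<le> norm (exp (c * u) + exp (- c * u))"
    by (intro AE_I2) (simp add: add_nonneg_nonneg)
qed simp

lemma abs_exp_minus_one_le: "\<bar>exp v - 1\<bar> \<le> \<bar>v\<bar> * exp \<bar>v\<bar>" for v :: real
proof -
  have 1: "exp v - 1 \<le> \<bar>v\<bar> * exp \<bar>v\<bar>"
  proof -
    have "1 - v \<le> exp (- v)" using exp_ge_add_one_self[of "- v"] by simp
    then have "exp v * (1 - v) \<le> exp v * exp (- v)" by (rule mult_left_mono) simp
    then have "exp v - 1 \<le> v * exp v" by (simp add: exp_minus algebra_simps)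
    also have "\<dots> \<le> \<bar>v\<bar> * exp \<bar>v\<bar>" by (intro mult_mono) auto
    finally show ?thesis .
  qed
  have 2: "1 - exp v \<le> \<bar>v\<bar> * exp \<bar>v\<bar>"
  proof -
    have "1 - exp v \<le> - v" using exp_ge_add_one_self[of v] by linarith
    also have "\<dots> \<le> \<bar>v\<bar> * 1" by simp
    also have "\<dots> \<le> \<bar>v\<bar> * exp \<bar>v\<bar>" by (intro mult_left_mono) auto
    finally show ?thesis .
  qed
  show ?thesis using 1 2 by (simp add: abs_le_iff)
qed

text \<open>\<open>gauss_deriv \<nu> a r f x\<close> is the derivative of \<open>heat_sg Q r f\<close> at \<open>x\<close> in a unit direction \<open>a\<close>
  of the Cameron--Martin space, \<open>\<nu>\<close> being the law of the component complementary to \<open>a\<close>; the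
  weight \<open>u / sqrt r\<close> comes from the Cameron--Martin density.\<close>

definition gauss_deriv :: "'a::{real_inner, banach, second_countable_topology} measure \<Rightarrow> 'a \<Rightarrow> real \<Rightarrow> ('a \<Rightarrow> real) \<Rightarrow> 'a \<Rightarrow> real" where
  "gauss_deriv \<nu> a r f x =
     (LINT p|(std_normal_distribution \<Otimes>\<^sub>M \<nu>). fst p * f (x + sqrt r *\<^sub>R (fst p *\<^sub>R a + snd p))) / sqrt r"

context
  fixes Q :: "'a::{real_inner, banach, second_countable_topology} \<Rightarrow> 'a"
  assumes Q: "positive_operator Q" and tr: "finite_trace Q"
begin

text \<open>All times are brought to the single measure \<open>gaussian Q\<close>, so that limits in
  the time become limits of integrands.\<close>

lemma heat_sg_scale:
  assumes "0 \<le> r" and [measurable]: "f \<in> borel_measurable borel"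
  shows "heat_sg Q r f x = (LINT y|gaussian Q. f (x + sqrt r *\<^sub>R y))"
proof -
  have Qs: "Q (c *\<^sub>R x) = c *\<^sub>R Q x" for c x
    using Q by (simp add: positive_operator_def linear_cmul bounded_linear.linear)
  have 1: "gaussian_law (\<lambda>x. Q x \<bullet> x) (gaussian Q)" using gaussian_law_gaussian[OF Q tr, of 1] by simp
  have [measurable_cong]: "sets (gaussian Q) = sets borel" using 1 by (simp add: gaussian_law_def)
  have "gaussian_law (\<lambda>x. r * (Q x \<bullet> x)) (distr (gaussian Q) borel (\<lambda>y. sqrt r *\<^sub>R y))"
    using gaussian_law_scaleR[OF 1, of "sqrt r"] assms Qs by (simp add: mult.assoc[symmetric])
  then have "gaussian (\<lambda>z. r *\<^sub>R Q z) = distr (gaussian Q) borel (\<lambda>y. sqrt r *\<^sub>R y)"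
    using gaussian_law_unique gaussian_law_gaussian[OF Q tr assms(1)] by blast
  then show ?thesis by (simp add: heat_sg_def integral_distr)
qed

lemma prob_space_gaussian: "prob_space (gaussian Q)"
  and sets_gaussian: "sets (gaussian Q) = sets borel"
  using gaussian_law_gaussian[OF Q tr, of 1] by (simp_all add: gaussian_law_def)

lemma heat_sg_semigroup:
  assumes "0 \<le> r" "0 \<le> \<tau>" "f \<in> Cb"
  shows "heat_sg Q r (heat_sg Q \<tau> f) x = heat_sg Q (r + \<tau>) f x"
proof -
  define \<mu> where "\<mu> t = gaussian (\<lambda>z. t *\<^sub>R Q z)" for t
  have law: "gaussian_law (\<lambda>x. t * (Q x \<bullet> x)) (\<mu> t)" if "0 \<le> t" for t
    using gaussian_law_gaussian[OF Q tr that] by (simp add: \<mu>_def)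
  have [measurable_cong]: "sets (\<mu> r) = sets borel" "sets (\<mu> \<tau>) = sets borel"
    using law assms by (auto simp: gaussian_law_def)
  interpret S: prob_space "\<mu> r" using law assms gaussian_law_prob_space by blast
  interpret T: prob_space "\<mu> \<tau>" using law assms gaussian_law_prob_space by blast
  interpret P: pair_prob_space "\<mu> r" "\<mu> \<tau>" ..
  have [measurable]: "f \<in> borel_measurable borel" by (rule Cb_measurable[OF assms(3)])
  obtain K where K: "\<And>x. \<bar>f x\<bar> \<le> K" using CbE[OF assms(3)] by blast
  have "gaussian_law (\<lambda>x. (r + \<tau>) * (Q x \<bullet> x)) (distr (\<mu> r \<Otimes>\<^sub>M \<mu> \<tau>) borel (\<lambda>(y, z). y + z))"
    using gaussian_law_add[OF law[OF assms(1)] law[OF assms(2)]] by (simp add: distrib_right)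
  then have "\<mu> (r + \<tau>) = distr (\<mu> r \<Otimes>\<^sub>M \<mu> \<tau>) borel (\<lambda>(y, z). y + z)"
    using gaussian_law_unique law[of "r + \<tau>"] assms by simp
  then have "heat_sg Q (r + \<tau>) f x = (LINT y|distr (\<mu> r \<Otimes>\<^sub>M \<mu> \<tau>) borel (\<lambda>(y, z). y + z). f (x + y))"
    by (simp add: heat_sg_def \<mu>_def)
  also have "\<dots> = (LINT p|(\<mu> r \<Otimes>\<^sub>M \<mu> \<tau>). f (x + (case p of (y, z) \<Rightarrow> y + z)))"
    by (rule integral_distr) auto
  also have "\<dots> = (LINT p|(\<mu> r \<Otimes>\<^sub>M \<mu> \<tau>). (case p of (y, z) \<Rightarrow> f (x + (y + z))))"
    by (simp add: split_beta)
  also have "\<dots> = (LINT y|\<mu> r. (LINT z|\<mu> \<tau>. f (x + (y + z))))"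
    by (rule P.integral_fst[symmetric], rule P.integrable_const_bound[where B = K]) (auto simp: K)
  finally show ?thesis by (simp add: heat_sg_def \<mu>_def add.assoc)
qed

context
  fixes z :: 'a and \<nu> a
  assumes z: "norm z = 1" and a: "a = op_sqrt Q z"
    and \<nu>: "gaussian_law (\<lambda>x. Q x \<bullet> x - (x \<bullet> a)\<^sup>2) \<nu>"
begin

lemma sets_complement: "sets \<nu> = sets borel"
  using \<nu> by (simp add: gaussian_law_def)

lemma pair_prob_space_complement: "pair_prob_space std_normal_distribution \<nu>"
  unfolding pair_prob_space_def pair_sigma_finite_def
  using prob_space_std_normal gaussian_law_prob_space[OF \<nu>]
  by (auto intro: prob_space_imp_sigma_finite)

lemma complement_fst:
  fixes g :: "real \<Rightarrow> real"
  assumes "integrable std_normal_distribution g"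
  shows "integrable (std_normal_distribution \<Otimes>\<^sub>M \<nu>) (\<lambda>p. g (fst p))"
    and "(LINT p|(std_normal_distribution \<Otimes>\<^sub>M \<nu>). g (fst p)) = (LINT u|std_normal_distribution. g u)"
proof -
  interpret pair_prob_space std_normal_distribution \<nu> by (rule pair_prob_space_complement)
  have [measurable_cong]: "sets \<nu> = sets borel" by (rule sets_complement)
  have d: "distr (std_normal_distribution \<Otimes>\<^sub>M \<nu>) std_normal_distribution fst = std_normal_distribution"
    by (rule M2.distr_pair_fst)
  show "integrable (std_normal_distribution \<Otimes>\<^sub>M \<nu>) (\<lambda>p. g (fst p))"
    by (rule integrable_distr[where M' = std_normal_distribution and f = g and T = fst]) (simp_all only: d assms measurable_fst)
  show "(LINT p|(std_normal_distribution \<Otimes>\<^sub>M \<nu>). g (fst p)) = (LINT u|std_normal_distribution. g u)"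
    using integral_distr[of fst "std_normal_distribution \<Otimes>\<^sub>M \<nu>" std_normal_distribution g] borel_measurable_integrable[OF assms]
    by (simp only: d measurable_fst)
qed

text \<open>\<open>N(0,Q)\<close> is the law of \<open>u a + y\<close> with \<open>u\<close>
  standard normal and \<open>y\<close> independent of law \<open>\<nu>\<close>, because the
  covariance forms add up.\<close>

lemma heat_sg_split:
  assumes "0 \<le> r" "f \<in> Cb"
  shows "heat_sg Q r f x = (LINT p|(std_normal_distribution \<Otimes>\<^sub>M \<nu>). f (x + sqrt r *\<^sub>R (fst p *\<^sub>R a + snd p)))"
proof -
  interpret pair_prob_space std_normal_distribution \<nu> by (rule pair_prob_space_complement)
  have [measurable_cong]: "sets \<nu> = sets borel" by (rule sets_complement)
  have [measurable]: "f \<in> borel_measurable borel" by (rule Cb_measurable[OF assms(2)])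
  define \<mu>1 where "\<mu>1 = distr std_normal_distribution borel (\<lambda>u. u *\<^sub>R a)"
  have [measurable_cong]: "sets \<mu>1 = sets borel" by (simp add: \<mu>1_def)
  have "gaussian_law (\<lambda>x. Q x \<bullet> x) (distr (\<mu>1 \<Otimes>\<^sub>M \<nu>) borel (\<lambda>(y, z). y + z))"
    using gaussian_law_add[OF gaussian_law_line[of a] \<nu>] by (simp add: \<mu>1_def)
  then have "gaussian Q = distr (\<mu>1 \<Otimes>\<^sub>M \<nu>) borel (\<lambda>(y, z). y + z)"
    using gaussian_law_unique gaussian_law_gaussian[OF Q tr, of 1] by simp
  also have "\<mu>1 \<Otimes>\<^sub>M \<nu> = distr (std_normal_distribution \<Otimes>\<^sub>M \<nu>) (borel \<Otimes>\<^sub>M borel) (\<lambda>(u, y). (u *\<^sub>R a, y))"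
  proof -
    have "\<nu> = distr \<nu> borel (\<lambda>y. y)" by (rule distr_id2[symmetric]) (simp add: sets_complement)
    then have "\<mu>1 \<Otimes>\<^sub>M \<nu> = distr std_normal_distribution borel (\<lambda>u. u *\<^sub>R a) \<Otimes>\<^sub>M distr \<nu> borel (\<lambda>y. y)"
      by (simp add: \<mu>1_def)
    also have "\<dots> = distr (std_normal_distribution \<Otimes>\<^sub>M \<nu>) (borel \<Otimes>\<^sub>M borel) (\<lambda>(u, y). (u *\<^sub>R a, y))"
      by (rule pair_measure_distr)
        (auto intro!: prob_space_imp_sigma_finite prob_space.prob_space_distr[OF gaussian_law_prob_space[OF \<nu>]])
    finally show ?thesis .
  qed
  finally have g: "gaussian Q = distr (std_normal_distribution \<Otimes>\<^sub>M \<nu>) borel (\<lambda>p. fst p *\<^sub>R a + snd p)"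
    by (simp add: distr_distr comp_def split_beta)
  show ?thesis
    unfolding heat_sg_scale[OF assms(1) Cb_measurable[OF assms(2)]] g by (rule integral_distr) auto
qed

text \<open>After the splitting, translation by \<open>\<tau> a\<close> is translation of the scalar
  variable by \<open>\<tau> / sqrt r\<close>, and Fubini's theorem reduces the formula to the
  line.\<close>

lemma heat_sg_Cameron_Martin:
  assumes "0 < r" "f \<in> Cb"
  shows "heat_sg Q r f (x + \<tau> *\<^sub>R a) = (LINT p|(std_normal_distribution \<Otimes>\<^sub>M \<nu>).
    f (x + sqrt r *\<^sub>R (fst p *\<^sub>R a + snd p)) * exp (fst p * (\<tau> / sqrt r) - (\<tau> / sqrt r)\<^sup>2 / 2))"
    and "integrable (std_normal_distribution \<Otimes>\<^sub>M \<nu>)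
      (\<lambda>p. f (x + sqrt r *\<^sub>R (fst p *\<^sub>R a + snd p)) * exp (fst p * (\<tau> / sqrt r) - (\<tau> / sqrt r)\<^sup>2 / 2))"
proof -
  interpret pair_prob_space std_normal_distribution \<nu> by (rule pair_prob_space_complement)
  have [measurable_cong]: "sets \<nu> = sets borel" by (rule sets_complement)
  have [measurable]: "f \<in> borel_measurable borel" by (rule Cb_measurable[OF assms(2)])
  obtain K where K: "\<And>x. \<bar>f x\<bar> \<le> K" using CbE[OF assms(2)] by blast
  define s where "s = \<tau> / sqrt r"
  have \<tau>: "\<tau> = sqrt r * s" using assms by (simp add: s_def)
  have int1: "integrable (std_normal_distribution \<Otimes>\<^sub>M \<nu>) (\<lambda>p. f (x + \<tau> *\<^sub>R a + sqrt r *\<^sub>R (fst p *\<^sub>R a + snd p)))"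
    by (rule integrable_const_bound[where B = K]) (auto simp: K)
  have ie: "integrable (std_normal_distribution \<Otimes>\<^sub>M \<nu>) (\<lambda>p. exp (s * fst p))"
    by (rule complement_fst(1)[OF integrable_std_normal_exp])
  have "integrable (std_normal_distribution \<Otimes>\<^sub>M \<nu>) (\<lambda>p. K * (exp (s * fst p) * exp (- s\<^sup>2 / 2)))"
    using ie by auto
  then show int2: "integrable (std_normal_distribution \<Otimes>\<^sub>M \<nu>)
      (\<lambda>p. f (x + sqrt r *\<^sub>R (fst p *\<^sub>R a + snd p)) * exp (fst p * (\<tau> / sqrt r) - (\<tau> / sqrt r)\<^sup>2 / 2))"
    unfolding s_def[symmetric]
  proof (rule Bochner_Integration.integrable_bound)
    have "\<bar>f q * exp (u * s - s\<^sup>2 / 2)\<bar> \<le> \<bar>K * (exp (s * u) * exp (- s\<^sup>2 / 2))\<bar>" for q u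
    proof -
      have "\<bar>f q\<bar> * exp (u * s - s\<^sup>2 / 2) \<le> \<bar>K\<bar> * (exp (s * u) * exp (- s\<^sup>2 / 2))"
        using K[of q] by (intro mult_mono) (auto simp: mult.commute simp flip: exp_add)
      then show ?thesis by (simp add: abs_mult)
    qed
    then show "AE p in std_normal_distribution \<Otimes>\<^sub>M \<nu>. norm (f (x + sqrt r *\<^sub>R (fst p *\<^sub>R a + snd p)) * exp (fst p * s - s\<^sup>2 / 2))
         \<le> norm (K * (exp (s * fst p) * exp (- s\<^sup>2 / 2)))"
      by (intro AE_I2) simp
  qed auto
  have "heat_sg Q r f (x + \<tau> *\<^sub>R a) = (LINT p|(std_normal_distribution \<Otimes>\<^sub>M \<nu>). f (x + \<tau> *\<^sub>R a + sqrt r *\<^sub>R (fst p *\<^sub>R a + snd p)))"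
    using assms by (intro heat_sg_split) auto
  also have "\<dots> = (LINT y|\<nu>. (LINT u|std_normal_distribution. f (x + \<tau> *\<^sub>R a + sqrt r *\<^sub>R (u *\<^sub>R a + y))))"
    using integral_snd[of "\<lambda>u y. f (x + \<tau> *\<^sub>R a + sqrt r *\<^sub>R (u *\<^sub>R a + y))"] int1 by (simp add: case_prod_unfold)
  also have "\<dots> = (LINT y|\<nu>. (LINT u|std_normal_distribution. f (x + sqrt r *\<^sub>R (u *\<^sub>R a + y)) * exp (u * s - s\<^sup>2 / 2)))"
  proof (rule Bochner_Integration.integral_cong[OF refl])
    fix y
    have "(LINT u|std_normal_distribution. f (x + sqrt r *\<^sub>R ((u + s) *\<^sub>R a + y)))
      = (LINT u|std_normal_distribution. f (x + sqrt r *\<^sub>R (u *\<^sub>R a + y)) * exp (u * s - s\<^sup>2 / 2))"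
      by (rule std_normal_shift) auto
    then show "(LINT u|std_normal_distribution. f (x + \<tau> *\<^sub>R a + sqrt r *\<^sub>R (u *\<^sub>R a + y)))
      = (LINT u|std_normal_distribution. f (x + sqrt r *\<^sub>R (u *\<^sub>R a + y)) * exp (u * s - s\<^sup>2 / 2))"
      by (simp add: \<tau> algebra_simps)
  qed
  also have "\<dots> = (LINT p|(std_normal_distribution \<Otimes>\<^sub>M \<nu>). f (x + sqrt r *\<^sub>R (fst p *\<^sub>R a + snd p)) * exp (fst p * s - s\<^sup>2 / 2))"
    using integral_snd[of "\<lambda>u y. f (x + sqrt r *\<^sub>R (u *\<^sub>R a + y)) * exp (u * s - s\<^sup>2 / 2)"] int2
    by (simp add: case_prod_unfold s_def)
  finally show "heat_sg Q r f (x + \<tau> *\<^sub>R a) = (LINT p|(std_normal_distribution \<Otimes>\<^sub>M \<nu>).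
    f (x + sqrt r *\<^sub>R (fst p *\<^sub>R a + snd p)) * exp (fst p * (\<tau> / sqrt r) - (\<tau> / sqrt r)\<^sup>2 / 2))"
    by (simp add: s_def)
qed

lemma heat_sg_has_derivative:
  assumes "0 < r" "f \<in> Cb"
  shows "((\<lambda>\<tau>. heat_sg Q r f (x + \<tau> *\<^sub>R a)) has_real_derivative gauss_deriv \<nu> a r f x) (at 0)"
proof -
  obtain K where K: "K \<ge> 0" "\<And>x. \<bar>f x\<bar> \<le> K" using CbE[OF assms(2)] by blast
  define g where "g p = f (x + sqrt r *\<^sub>R (fst p *\<^sub>R a + snd p))" for p
  define G where "G p s = g p * exp (fst p * s - s\<^sup>2 / 2)" for p :: "real \<times> 'a" and s
  have rep: "heat_sg Q r f (x + \<tau> *\<^sub>R a) = (LINT p|(std_normal_distribution \<Otimes>\<^sub>M \<nu>). G p (\<tau> / sqrt r))" for \<tau>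
    using heat_sg_Cameron_Martin(1)[OF assms] by (simp add: G_def g_def)
  have "((\<lambda>s. LINT p|(std_normal_distribution \<Otimes>\<^sub>M \<nu>). G p s) has_real_derivative
      (LINT p|(std_normal_distribution \<Otimes>\<^sub>M \<nu>). g p * fst p)) (at 0)"
  proof (rule has_real_derivative_integral(2))
    show "integrable (std_normal_distribution \<Otimes>\<^sub>M \<nu>) (\<lambda>p. G p s)" for s
      using heat_sg_Cameron_Martin(2)[OF assms, of x "sqrt r * s"] assms by (simp add: G_def g_def)
    show "(G p has_real_derivative g p * fst p) (at 0)" for p
      unfolding G_def by (auto intro!: derivative_eq_intros)
    \<comment> \<open>The dominating function comes from
      \<open>\<bar>exp v - 1\<bar> \<le> \<bar>v\<bar> exp \<bar>v\<bar>\<close> and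
      \<open>\<bar>v\<bar> \<le> \<bar>s\<bar> (\<bar>u\<bar> + 1)\<close> with
      \<open>u = fst p\<close>; the factor \<open>\<bar>u\<bar> + 1\<close> is absorbed by
      \<open>exp \<bar>u\<bar>\<close>.\<close>
    show "integrable (std_normal_distribution \<Otimes>\<^sub>M \<nu>) (\<lambda>p. K * (exp 1 * exp (2 * \<bar>fst p\<bar>)))"
      by (intro integrable_mult_right complement_fst(1)[OF integrable_std_normal_exp_abs])
    fix p :: "real \<times> 'a" and s :: real assume s: "\<bar>s\<bar> \<le> 1"
    define v where "v = fst p * s - s\<^sup>2 / 2"
    have "\<bar>v\<bar> \<le> \<bar>fst p\<bar> * \<bar>s\<bar> + s\<^sup>2 / 2"
      unfolding v_def using abs_triangle_ineq4[of "fst p * s" "s\<^sup>2 / 2"] by (simp add: abs_mult)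
    also have "s\<^sup>2 / 2 \<le> \<bar>s\<bar> * \<bar>s\<bar>" by (simp add: power2_eq_square)
    also have "\<bar>s\<bar> * \<bar>s\<bar> \<le> 1 * \<bar>s\<bar>" using s by (intro mult_right_mono) auto
    finally have v1: "\<bar>v\<bar> \<le> \<bar>s\<bar> * (\<bar>fst p\<bar> + 1)" by (simp add: algebra_simps)
    also have "\<dots> \<le> 1 * (\<bar>fst p\<bar> + 1)" using s by (intro mult_right_mono) auto
    finally have v2: "\<bar>v\<bar> \<le> \<bar>fst p\<bar> + 1" by simp
    have "\<bar>exp v - 1\<bar> \<le> \<bar>v\<bar> * exp \<bar>v\<bar>" by (rule abs_exp_minus_one_le)
    also have "\<dots> \<le> (\<bar>s\<bar> * (\<bar>fst p\<bar> + 1)) * exp (\<bar>fst p\<bar> + 1)"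
      using v1 v2 by (intro mult_mono) auto
    also have "\<dots> \<le> (\<bar>s\<bar> * exp \<bar>fst p\<bar>) * exp (\<bar>fst p\<bar> + 1)"
      using exp_ge_add_one_self[of "\<bar>fst p\<bar>"] by (intro mult_right_mono mult_left_mono) (auto simp: add.commute)
    also have "\<dots> = \<bar>s\<bar> * (exp 1 * exp (2 * \<bar>fst p\<bar>))"
      by (simp add: exp_add[symmetric])
    finally have e: "\<bar>exp v - 1\<bar> \<le> \<bar>s\<bar> * (exp 1 * exp (2 * \<bar>fst p\<bar>))" .
    have "\<bar>G p s - G p 0\<bar> = \<bar>g p\<bar> * \<bar>exp v - 1\<bar>"
      by (simp add: G_def v_def abs_mult[symmetric] right_diff_distrib)
    also have "\<dots> \<le> K * (\<bar>s\<bar> * (exp 1 * exp (2 * \<bar>fst p\<bar>)))"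
      using K e by (intro mult_mono) (auto simp: g_def)
    finally show "\<bar>G p s - G p 0\<bar> \<le> \<bar>s\<bar> * (K * (exp 1 * exp (2 * \<bar>fst p\<bar>)))" by (simp add: mult_ac)
  qed
  then have "((\<lambda>s. LINT p|(std_normal_distribution \<Otimes>\<^sub>M \<nu>). G p s) has_real_derivative
      (LINT p|(std_normal_distribution \<Otimes>\<^sub>M \<nu>). g p * fst p)) (at (0 / sqrt r))" by simp
  then have "((\<lambda>\<tau>. LINT p|(std_normal_distribution \<Otimes>\<^sub>M \<nu>). G p (\<tau> / sqrt r)) has_real_derivative
      (LINT p|(std_normal_distribution \<Otimes>\<^sub>M \<nu>). g p * fst p) * (1 / sqrt r)) (at 0)"
    by (rule DERIV_chain2[where g = "\<lambda>\<tau>. \<tau> / sqrt r"]) (rule DERIV_cdivide[OF DERIV_ident])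
  then show ?thesis by (simp add: rep gauss_deriv_def g_def mult.commute)
qed

text \<open>\<open>d = 1\<close> is the integrand of the derivative; \<open>d = 0\<close> freezes
  the component along \<open>a\<close> and serves for the subtraction in the next bound.\<close>

lemma gauss_deriv_integrable:
  assumes "f \<in> Cb"
  shows "integrable (std_normal_distribution \<Otimes>\<^sub>M \<nu>) (\<lambda>p. fst p * f (x + c *\<^sub>R (d *\<^sub>R fst p *\<^sub>R a + snd p)))"
proof -
  interpret pair_prob_space std_normal_distribution \<nu> by (rule pair_prob_space_complement)
  have [measurable_cong]: "sets \<nu> = sets borel" by (rule sets_complement)
  have [measurable]: "f \<in> borel_measurable borel" by (rule Cb_measurable[OF assms])
  obtain K where K: "K \<ge> 0" "\<And>x. \<bar>f x\<bar> \<le> K" using CbE[OF assms] by blast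
  have i: "integrable (std_normal_distribution \<Otimes>\<^sub>M \<nu>) (\<lambda>p. fst p * K)"
    using complement_fst(1)[OF integrable_std_normal_distribution_moment[of 1]] by simp
  show ?thesis
    by (rule Bochner_Integration.integrable_bound[OF i]) (use K in \<open>auto intro!: AE_I2 mult_left_mono simp: abs_mult\<close>)
qed

text \<open>The weight \<open>u\<close> has mean zero, so the value of \<open>f\<close> without the
  component along \<open>a\<close> may be subtracted. What remains is an oscillation of
  \<open>f\<close> along \<open>a\<close> over the distance \<open>sqrt r \<bar>u\<bar>\<close>. The
  factor 2 is the mean of \<open>1 + u^2\<close>, which majorises
  \<open>\<bar>u\<bar> * \<bar>u\<bar> powr \<alpha>\<close>.\<close>

lemma gauss_deriv_bound:
  assumes "0 < r" "f \<in> Cb" "0 \<le> \<alpha>" "\<alpha> < 1" "0 \<le> K"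
    and osc: "\<And>x t. \<bar>f (x + t *\<^sub>R a) - f x\<bar> \<le> K * \<bar>t\<bar> powr \<alpha>"
  shows "\<bar>gauss_deriv \<nu> a r f x\<bar> \<le> 2 * K * r powr ((\<alpha> - 1) / 2)"
proof -
  interpret pair_prob_space std_normal_distribution \<nu> by (rule pair_prob_space_complement)
  have [measurable_cong]: "sets \<nu> = sets borel" by (rule sets_complement)
  have [measurable]: "f \<in> borel_measurable borel" by (rule Cb_measurable[OF assms(2)])
  define g where "g p = f (x + sqrt r *\<^sub>R (fst p *\<^sub>R a + snd p))" for p
  define g0 where "g0 y = f (x + sqrt r *\<^sub>R y)" for y
  have i1: "integrable (std_normal_distribution \<Otimes>\<^sub>M \<nu>) (\<lambda>p. fst p * g p)"
    using gauss_deriv_integrable[OF assms(2), of x "sqrt r" 1] by (simp add: g_def)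
  have i0: "integrable (std_normal_distribution \<Otimes>\<^sub>M \<nu>) (\<lambda>p. fst p * g0 (snd p))"
    using gauss_deriv_integrable[OF assms(2), of x "sqrt r" 0] by (simp add: g0_def)
  have "(LINT p|(std_normal_distribution \<Otimes>\<^sub>M \<nu>). fst p * g0 (snd p)) = (LINT y|\<nu>. (LINT u|std_normal_distribution. u * g0 y))"
    using integral_snd[of "\<lambda>u y. u * g0 y"] i0 by (simp add: case_prod_unfold)
  also have "\<dots> = 0" using integral_std_normal_distribution_moment_odd[of 1] by simp
  finally have z: "(LINT p|(std_normal_distribution \<Otimes>\<^sub>M \<nu>). fst p * g0 (snd p)) = 0" .
  define w where "w u = K * r powr (\<alpha> / 2) * (1 + u\<^sup>2)" for u :: real
  have iw: "integrable std_normal_distribution w"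
    unfolding w_def using integrable_std_normal_distribution_moment[of 2] prob_space.finite_measure[OF prob_space_std_normal]
    by (intro integrable_mult_right Bochner_Integration.integrable_add) (auto intro: finite_measure.integrable_const)
  have "(LINT u|std_normal_distribution. w u) = K * r powr (\<alpha> / 2) * (1 + (LINT u|std_normal_distribution. u\<^sup>2))"
    unfolding w_def using integrable_std_normal_distribution_moment[of 2] M1.prob_space by (simp add: M1.integrable_const)
  also have "(LINT u|std_normal_distribution. u\<^sup>2) = 1"
    using std_normal_distribution_even_moments[of 1] by simp
  finally have Ew: "(LINT u|std_normal_distribution. w u) = 2 * K * r powr (\<alpha> / 2)" by simp
  have wb: "\<bar>fst p * g p - fst p * g0 (snd p)\<bar> \<le> w (fst p)" for p
  proof -
    define u where "u = fst p"
    have "\<bar>g p - g0 (snd p)\<bar> \<le> K * \<bar>sqrt r * u\<bar> powr \<alpha>"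
      using osc[of "x + sqrt r *\<^sub>R snd p" "sqrt r * u"] by (simp add: g_def g0_def u_def algebra_simps)
    also have "\<dots> = K * (r powr (\<alpha> / 2) * \<bar>u\<bar> powr \<alpha>)"
      using assms by (simp add: abs_mult powr_mult powr_half_sqrt[symmetric] powr_powr)
    finally have "\<bar>u\<bar> * \<bar>g p - g0 (snd p)\<bar> \<le> \<bar>u\<bar> * (K * (r powr (\<alpha> / 2) * \<bar>u\<bar> powr \<alpha>))"
      by (rule mult_left_mono) simp
    also have "\<dots> = K * r powr (\<alpha> / 2) * (\<bar>u\<bar> * \<bar>u\<bar> powr \<alpha>)" by simp
    also have "\<dots> \<le> K * r powr (\<alpha> / 2) * (1 + u\<^sup>2)"
    proof (intro mult_left_mono)
      show "\<bar>u\<bar> * \<bar>u\<bar> powr \<alpha> \<le> 1 + u\<^sup>2"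
      proof (cases "\<bar>u\<bar> \<le> 1")
        case True
        then have "\<bar>u\<bar> powr \<alpha> \<le> 1" using assms by (auto intro: powr_le1)
        then have "\<bar>u\<bar> * \<bar>u\<bar> powr \<alpha> \<le> 1 * 1" using True by (intro mult_mono) auto
        then show ?thesis using zero_le_power2[of u] by linarith
      next
        case False
        then have "\<bar>u\<bar> powr \<alpha> \<le> \<bar>u\<bar> powr 1" using assms by (intro powr_mono) auto
        then have "\<bar>u\<bar> * \<bar>u\<bar> powr \<alpha> \<le> \<bar>u\<bar> * \<bar>u\<bar>" using False by (intro mult_left_mono) auto
        then show ?thesis by (simp add: power2_eq_square)
      qed
    qed (use assms in auto)
    finally show ?thesis by (simp add: w_def u_def abs_mult[symmetric] right_diff_distrib)
  qed
  have "(LINT p|(std_normal_distribution \<Otimes>\<^sub>M \<nu>). fst p * g p) = (LINT p|(std_normal_distribution \<Otimes>\<^sub>M \<nu>). fst p * g p - fst p * g0 (snd p))"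
    using i1 i0 z by simp
  also have "\<bar>\<dots>\<bar> \<le> (LINT p|(std_normal_distribution \<Otimes>\<^sub>M \<nu>). w (fst p))"
    unfolding real_norm_def[symmetric]
    by (rule order_trans[OF integral_norm_bound integral_mono])
      (use wb in \<open>auto intro!: integrable_norm Bochner_Integration.integrable_diff i1 i0 complement_fst(1)[OF iw]\<close>)
  also have "\<dots> = 2 * K * r powr (\<alpha> / 2)" using complement_fst(2)[OF iw] Ew by simp
  finally have "\<bar>LINT p|(std_normal_distribution \<Otimes>\<^sub>M \<nu>). fst p * g p\<bar> / sqrt r \<le> 2 * K * r powr (\<alpha> / 2) / sqrt r"
    using assms by (intro divide_right_mono) auto
  also have "\<dots> = 2 * K * r powr ((\<alpha> - 1) / 2)"
    using assms by (simp add: powr_half_sqrt[symmetric] powr_diff diff_divide_distrib)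
  finally show ?thesis using assms by (simp add: gauss_deriv_def g_def)
qed

end

end

text \<open>Continuous convergence of uniformly bounded sequences, which all the operators below
  preserve.\<close>

definition cconv :: "(nat \<Rightarrow> 'a::topological_space \<Rightarrow> real) \<Rightarrow> ('a \<Rightarrow> real) \<Rightarrow> bool" where
  "cconv F f \<longleftrightarrow> (\<forall>n. F n \<in> Cb) \<and> f \<in> Cb \<and> (\<exists>K. \<forall>n x. \<bar>F n x\<bar> \<le> K) \<and>
     (\<forall>X x. X \<longlonglongrightarrow> x \<longrightarrow> (\<lambda>n. F n (X n)) \<longlonglongrightarrow> f x)"

lemma cconv_const: "f \<in> Cb \<Longrightarrow> cconv (\<lambda>_. f) f"
  unfolding cconv_def by (metis CbE Cb_LIMSEQ)

lemma cconvD: "cconv F f \<Longrightarrow> X \<longlonglongrightarrow> x \<Longrightarrow> (\<lambda>n. F n (X n)) \<longlonglongrightarrow> f x"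
  and cconv_Cb: "cconv F f \<Longrightarrow> F n \<in> Cb" "cconv F f \<Longrightarrow> f \<in> Cb"
  by (auto simp: cconv_def)

lemma cconvE:
  assumes "cconv F f"
  obtains K where "K \<ge> 0" "\<And>n x. \<bar>F n x\<bar> \<le> K" "\<And>x. \<bar>f x\<bar> \<le> K"
proof -
  obtain K where K: "\<And>n x. \<bar>F n x\<bar> \<le> K" using assms by (auto simp: cconv_def)
  have "\<bar>f x\<bar> \<le> K" for x
    by (rule LIMSEQ_le_const2[OF tendsto_rabs[OF cconvD[OF assms tendsto_const]]]) (use K in auto)
  moreover have "0 \<le> K" using K[of 0] abs_ge_zero order_trans by blast
  ultimately show thesis using that K by blast
qed

lemma CbI_sequentially:
  fixes f :: "'a::metric_space \<Rightarrow> real"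
  assumes "\<And>X x. X \<longlonglongrightarrow> x \<Longrightarrow> (\<lambda>n. f (X n)) \<longlonglongrightarrow> f x" "\<And>x. \<bar>f x\<bar> \<le> K"
  shows "f \<in> Cb"
  using assms by (intro CbI) (auto simp: continuous_on_sequentially comp_def)

lemma cconvI:
  fixes f :: "'a::metric_space \<Rightarrow> real"
  assumes "\<And>n. F n \<in> Cb" "f \<in> Cb" "\<And>n x. \<bar>F n x\<bar> \<le> K"
    "\<And>X x. X \<longlonglongrightarrow> x \<Longrightarrow> (\<lambda>n. F n (X n)) \<longlonglongrightarrow> f x"
  shows "cconv F f"
  using assms by (auto simp: cconv_def)

section \<open>Bounds and limits for the heat semigroup and its derivative\<close>

context
  fixes Q :: "'a::{real_inner, banach, second_countable_topology} \<Rightarrow> 'a"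
  assumes Q: "positive_operator Q" and tr: "finite_trace Q"
begin

lemma heat_sg_bound:
  assumes "0 \<le> v" "f \<in> borel_measurable borel" "\<And>x. \<bar>f x\<bar> \<le> K"
  shows "\<bar>heat_sg Q v f x\<bar> \<le> K"
proof -
  interpret prob_space "gaussian Q" by (rule prob_space_gaussian[OF Q tr])
  have [measurable_cong]: "sets (gaussian Q) = sets borel" by (rule sets_gaussian[OF Q tr])
  have [measurable]: "f \<in> borel_measurable borel" by fact
  have "\<bar>LINT y|gaussian Q. f (x + sqrt v *\<^sub>R y)\<bar> \<le> (LINT y|gaussian Q. \<bar>f (x + sqrt v *\<^sub>R y)\<bar>)"
    by (rule integral_abs_bound)
  also have "\<dots> \<le> K"
    by (rule integral_le_const, rule integrable_const_bound[where B = K]) (use assms in auto)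
  finally show ?thesis using heat_sg_scale[OF Q tr assms(1,2)] by simp
qed

lemma heat_sg_LIMSEQ:
  assumes F: "cconv F f" and v: "v \<longlonglongrightarrow> v0" "\<And>n. 0 \<le> v n" and X: "X \<longlonglongrightarrow> x"
  shows "(\<lambda>n. heat_sg Q (v n) (F n) (X n)) \<longlonglongrightarrow> heat_sg Q v0 f x"
proof -
  interpret prob_space "gaussian Q" by (rule prob_space_gaussian[OF Q tr])
  have [measurable_cong]: "sets (gaussian Q) = sets borel" by (rule sets_gaussian[OF Q tr])
  have [measurable]: "F n \<in> borel_measurable borel" "f \<in> borel_measurable borel" for n
    using cconv_Cb[OF F] Cb_measurable by auto
  have v0: "0 \<le> v0" using v by (intro LIMSEQ_le_const) auto
  obtain K where K: "K \<ge> 0" "\<And>n x. \<bar>F n x\<bar> \<le> K" using cconvE[OF F] by metis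
  have "(\<lambda>n. LINT y|gaussian Q. F n (X n + sqrt (v n) *\<^sub>R y)) \<longlonglongrightarrow> (LINT y|gaussian Q. f (x + sqrt v0 *\<^sub>R y))"
  proof (rule integral_dominated_convergence[where w = "\<lambda>_. K"])
    show "AE y in gaussian Q. (\<lambda>n. F n (X n + sqrt (v n) *\<^sub>R y)) \<longlonglongrightarrow> f (x + sqrt v0 *\<^sub>R y)"
      by (intro AE_I2 cconvD[OF F] tendsto_intros X v)
  qed (use K in auto)
  then show ?thesis using heat_sg_scale[OF Q tr] v v0 by simp
qed

lemma heat_sg_Cb:
  assumes "0 \<le> v" "f \<in> Cb"
  shows "heat_sg Q v f \<in> Cb"
proof -
  obtain K where "\<And>x. \<bar>f x\<bar> \<le> K" using CbE[OF assms(2)] by blast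
  then show ?thesis
    using heat_sg_bound[OF assms(1) Cb_measurable[OF assms(2)]] heat_sg_LIMSEQ[OF cconv_const[OF assms(2)] tendsto_const assms(1)]
    by (intro CbI_sequentially[where K = K]) auto
qed

lemma heat_sg_lincomb:
  assumes "0 \<le> v" "f \<in> Cb" "g \<in> Cb"
  shows "heat_sg Q v (\<lambda>y. c * f y + d * g y) x = c * heat_sg Q v f x + d * heat_sg Q v g x"
proof -
  interpret prob_space "gaussian Q" by (rule prob_space_gaussian[OF Q tr])
  have [measurable_cong]: "sets (gaussian Q) = sets borel" by (rule sets_gaussian[OF Q tr])
  note [measurable] = Cb_measurable[OF assms(2)] Cb_measurable[OF assms(3)]
  have i: "integrable (gaussian Q) (\<lambda>y. h (x + sqrt v *\<^sub>R y))" if "h \<in> Cb" for h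
  proof -
    obtain K where "\<And>x. \<bar>h x\<bar> \<le> K" using CbE[OF \<open>h \<in> Cb\<close>] by blast
    moreover have [measurable]: "h \<in> borel_measurable borel" by (rule Cb_measurable[OF \<open>h \<in> Cb\<close>])
    ultimately show ?thesis by (intro integrable_const_bound[where B = K]) auto
  qed
  show ?thesis using i[OF assms(2)] i[OF assms(3)] assms by (simp add: heat_sg_scale[OF Q tr])
qed

lemma heat_sg_translate: "heat_sg Q v (\<lambda>y. f (y + h)) x = heat_sg Q v f (x + h)"
  by (simp add: heat_sg_def add_ac)

context
  fixes z :: 'a and \<nu> a
  assumes z: "norm z = 1" and a: "a = op_sqrt Q z"
    and \<nu>: "gaussian_law (\<lambda>x. Q x \<bullet> x - (x \<bullet> a)\<^sup>2) \<nu>"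
begin

lemma gauss_deriv_LIMSEQ:
  assumes F: "cconv F f" and v: "v \<longlonglongrightarrow> v0" "0 < v0" and X: "X \<longlonglongrightarrow> x"
  shows "(\<lambda>n. gauss_deriv \<nu> a (v n) (F n) (X n)) \<longlonglongrightarrow> gauss_deriv \<nu> a v0 f x"
proof -
  have [measurable_cong]: "sets \<nu> = sets borel" by (rule sets_complement[OF Q tr z a \<nu>])
  have [measurable]: "F n \<in> borel_measurable borel" "f \<in> borel_measurable borel" for n
    using cconv_Cb[OF F] Cb_measurable by auto
  obtain K where K: "K \<ge> 0" "\<And>n x. \<bar>F n x\<bar> \<le> K" using cconvE[OF F] by metis
  have "(\<lambda>n. LINT p|(std_normal_distribution \<Otimes>\<^sub>M \<nu>). fst p * F n (X n + sqrt (v n) *\<^sub>R (fst p *\<^sub>R a + snd p)))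
    \<longlonglongrightarrow> (LINT p|(std_normal_distribution \<Otimes>\<^sub>M \<nu>). fst p * f (x + sqrt v0 *\<^sub>R (fst p *\<^sub>R a + snd p)))"
  proof (rule integral_dominated_convergence[where w = "\<lambda>p. \<bar>fst p\<bar> * K"])
    show "AE p in std_normal_distribution \<Otimes>\<^sub>M \<nu>. (\<lambda>n. fst p * F n (X n + sqrt (v n) *\<^sub>R (fst p *\<^sub>R a + snd p)))
      \<longlonglongrightarrow> fst p * f (x + sqrt v0 *\<^sub>R (fst p *\<^sub>R a + snd p))"
      by (intro AE_I2 tendsto_mult tendsto_const cconvD[OF F] tendsto_intros X v)
    show "integrable (std_normal_distribution \<Otimes>\<^sub>M \<nu>) (\<lambda>p. \<bar>fst p\<bar> * K)"
      using complement_fst(1)[OF Q tr z a \<nu>, of "\<lambda>u. \<bar>u\<bar> * K"] integrable_std_normal_distribution_moment[of 1]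
      by simp
  qed (use K in \<open>auto simp: abs_mult intro!: mult_left_mono\<close>)
  then show ?thesis unfolding gauss_deriv_def using v by (intro tendsto_divide tendsto_intros) auto
qed


end

end

section \<open>Integrals on half lines\<close>

lemma einterval_0_infinity: "einterval 0 \<infinity> = {0<..}"
  by (auto simp: einterval_def zero_ereal_def)

lemma set_lebesgue_integral_FTC_Ioi:
  fixes f :: "real \<Rightarrow> 'b::euclidean_space"
  assumes "\<And>x. 0 < x \<Longrightarrow> (F has_vector_derivative f x) (at x)"
    and "\<And>x. 0 < x \<Longrightarrow> isCont f x" and "set_integrable lborel {0<..} f"
    and "(F \<longlongrightarrow> A) (at_right 0)" and "(F \<longlongrightarrow> B) at_top"
  shows "(LBINT x:{0<..}. f x) = B - A"
proof -
  have "(LBINT x=0..\<infinity>. f x) = B - A"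
    by (rule interval_integral_FTC_integrable[where F = F])
      (use assms in \<open>auto simp: einterval_0_infinity zero_ereal_def ereal_tendsto_simps1\<close>)
  then show ?thesis
    by (simp add: interval_lebesgue_integral_def einterval_0_infinity zero_ereal_def)
qed

lemma powr_integral_at_0:
  fixes a R :: real
  assumes "a < 1" "0 < R"
  shows "set_integrable lborel {0<..R} (\<lambda>r. r powr - a)" and "(LBINT r:{0<..R}. r powr - a) = R powr (1 - a) / (1 - a)"
proof -
  have hi: "((\<lambda>r. r powr - a) has_integral (R powr (1 - a) / (1 - a))) {0..R}"
    using has_integral_powr_from_0[of "- a" R] assms by (simp add: add.commute)
  have hi': "((\<lambda>r. r powr - a) has_integral (R powr (1 - a) / (1 - a))) {0<..R}"
  proof (rule has_integral_spike_set_eq[THEN iffD1, OF _ _ hi])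
    show "negligible {x \<in> {0..R} - {0<..R}. x powr - a \<noteq> 0}" "negligible {x \<in> {0<..R} - {0..R}. x powr - a \<noteq> 0}"
      by (auto intro: negligible_subset[of "{0}"])
  qed
  have "(\<lambda>r. r powr - a) absolutely_integrable_on {0<..R}"
    using hi' by (intro nonnegative_absolutely_integrable_1) (auto simp: integrable_on_def)
  then show si: "set_integrable lborel {0<..R} (\<lambda>r. r powr - a)"
    unfolding set_integrable_def by (subst (asm) integrable_completion) auto
  show "(LBINT r:{0<..R}. r powr - a) = R powr (1 - a) / (1 - a)"
    using set_borel_integral_eq_integral(2)[OF si] hi' by (simp add: integral_unique)
qed

lemma powr_integral_at_top:
  fixes b R :: real
  assumes "1 < b" "0 < R"
  shows "set_integrable lborel {R<..} (\<lambda>r. r powr - b)" and "(LBINT r:{R<..}. r powr - b) = R powr (1 - b) / (b - 1)"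
proof -
  have lim: "((\<lambda>r. - (r powr (1 - b)) / (b - 1)) \<longlongrightarrow> 0) at_top"
    using tendsto_neg_powr[of "1 - b" "\<lambda>x. x", OF _ filterlim_ident] assms
    by (intro tendsto_divide_zero tendsto_minus_cancel_left[THEN iffD1]) auto
  have F: "((\<lambda>r. - (r powr (1 - b)) / (b - 1)) has_real_derivative x powr - b) (at x)"
    if "ereal R < ereal x" "ereal x < \<infinity>" for x
  proof -
    have "((\<lambda>r. - (r powr (1 - b)) / (b - 1)) has_real_derivative - ((1 - b) * x powr (1 - b - 1)) / (b - 1)) (at x)"
      using that assms by (intro DERIV_cdivide DERIV_minus has_real_derivative_powr) auto
    moreover have "- ((1 - b) * X) / (b - 1) = X" for X using assms by (simp add: field_simps)
    ultimately show ?thesis by simp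
  qed
  have f: "isCont (\<lambda>r. r powr - b) x" if "ereal R < ereal x" "ereal x < \<infinity>" for x
    using that assms by (auto intro!: continuous_intros)
  have nonneg: "AE x in lborel. ereal R < ereal x \<longrightarrow> ereal x < \<infinity> \<longrightarrow> 0 \<le> x powr - b" by simp
  have "((\<lambda>r. - (r powr (1 - b)) / (b - 1)) \<longlongrightarrow> - (R powr (1 - b)) / (b - 1)) (at R)"
    using assms by (intro tendsto_intros) auto
  then have A: "(((\<lambda>r. - (r powr (1 - b)) / (b - 1)) \<circ> real_of_ereal) \<longlongrightarrow> - (R powr (1 - b)) / (b - 1)) (at_right (ereal R))"
    by (simp add: ereal_tendsto_simps1 filterlim_at_split)
  have B: "(((\<lambda>r. - (r powr (1 - b)) / (b - 1)) \<circ> real_of_ereal) \<longlongrightarrow> 0) (at_left \<infinity>)"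
    using lim by (simp add: ereal_tendsto_simps1)
  have R: "ereal R < \<infinity>" by simp
  have e: "einterval (ereal R) \<infinity> = {R<..}" by (auto simp: einterval_def)
  show "set_integrable lborel {R<..} (\<lambda>r. r powr - b)"
    using interval_integral_FTC_nonneg(1)[OF R F f nonneg A B] by (simp add: e)
  show "(LBINT r:{R<..}. r powr - b) = R powr (1 - b) / (b - 1)"
    using interval_integral_FTC_nonneg(2)[OF R F f nonneg A B] by (simp add: interval_integral_to_infinity_eq)
qed

lemma set_integrable_powr_exp:
  fixes c s :: real
  assumes "0 < c" "0 \<le> s"
  shows "set_integrable lborel {0<..} (\<lambda>r. r powr s * exp (- c * r))"
proof -
  have "(\<lambda>t. complex_of_real t powr (of_real (s + 1) - 1) / of_real (exp (c * t))) absolutely_integrable_on {0<..}"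
    using assms by (intro absolutely_integrable_Gamma_integral) auto
  then have "(\<lambda>t. cmod (complex_of_real t powr (of_real (s + 1) - 1) / of_real (exp (c * t)))) absolutely_integrable_on {0<..}"
    by (rule set_integrable_norm)
  then have "(\<lambda>r. r powr s * exp (- c * r)) absolutely_integrable_on {0<..}"
    by (rule set_integrable_cong[THEN iffD1, rotated -1]) (auto simp: norm_powr_real_powr norm_divide exp_minus field_simps)
  then show ?thesis
    unfolding set_integrable_def by (subst (asm) integrable_completion) auto
qed

lemma power_fact_le_exp: "0 \<le> y \<Longrightarrow> y ^ m / fact m \<le> exp y" for y :: real
proof -
  assume "0 \<le> y"
  then have "(\<Sum>n\<in>{m}. y ^ n /\<^sub>R fact n) \<le> (\<Sum>n. y ^ n /\<^sub>R fact n)"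
    by (intro sum_le_suminf sums_summable[OF exp_converges]) auto
  then show ?thesis using exp_converges[of y] by (simp add: sums_iff field_simps)
qed

text \<open>The exponential series gives \<open>exp y \<ge> y ^ m / fact m\<close>. With
  \<open>s m \<ge> 2\<close> and \<open>y = c * r powr s\<close> this is decay like
  \<open>r powr - 2\<close>.\<close>

lemma set_integrable_exp_powr:
  fixes c s :: real
  assumes "0 < c" "0 < s"
  shows "set_integrable lborel {0<..} (\<lambda>r. exp (- c * r powr s))"
proof -
  define m where "m = nat \<lceil>2 / s\<rceil>"
  have "2 / s \<le> m" unfolding m_def by (rule real_nat_ceiling_ge)
  then have m: "2 \<le> s * m" using assms by (simp add: field_simps)
  define w where "w r = indicator {0<..1} r + (fact m / c ^ m) * (indicator {1<..} r *\<^sub>R r powr - 2)" for r :: real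
  have wi: "integrable lborel w"
    unfolding w_def using powr_integral_at_top(1)[of 2 1, unfolded set_integrable_def]
    by (intro Bochner_Integration.integrable_add integrable_mult_right) (auto simp: integrable_indicator_iff)
  show ?thesis
    unfolding set_integrable_def
  proof (rule Bochner_Integration.integrable_bound[OF wi])
    have "exp (- c * r powr s) \<le> (fact m / c ^ m) * r powr - 2" if "1 < r" for r
    proof -
      have r0: "0 < c * r powr s" using that assms by simp
      have "(c * r powr s) ^ m / fact m \<le> exp (c * r powr s)"
        using r0 by (intro power_fact_le_exp) simp
      moreover have "c ^ m * r powr 2 \<le> (c * r powr s) ^ m"
      proof -
        have "(r powr s) ^ m = r powr (s * m)" using that by (simp add: powr_power mult.commute)
        moreover have "r powr 2 \<le> r powr (s * m)" using that m by (intro powr_mono) auto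
        ultimately show ?thesis using assms by (simp add: power_mult_distrib)
      qed
      ultimately have "c ^ m * r powr 2 / fact m \<le> exp (c * r powr s)"
        by (meson divide_right_mono fact_ge_zero order_trans)
      then have "1 \<le> exp (c * r powr s) * (fact m / c ^ m) * r powr - 2"
        using assms that by (simp add: field_simps powr_minus)
      then show ?thesis using assms by (simp add: exp_minus field_simps)
    qed
    moreover have "exp (- c * r powr s) \<le> 1" for r using assms by simp
    ultimately show "AE r in lborel. norm (indicator {0<..} r *\<^sub>R exp (- c * r powr s)) \<le> norm (w r)"
      using assms by (intro AE_I2) (auto simp: w_def indicator_def)
  qed auto
qed

section \<open>Rotating the ray of integration\<close>

lemma set_integrable_LIMSEQ_Icc:
  fixes f :: "real \<Rightarrow> 'b::{banach, second_countable_topology}"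
  assumes f: "set_integrable lborel {0<..} f" and a: "a \<longlonglongrightarrow> 0" "\<And>n. 0 < a n" and b: "filterlim b at_top sequentially"
  shows "(\<lambda>n. LBINT r:{a n..b n}. f r) \<longlonglongrightarrow> (LBINT r:{0<..}. f r)"
proof -
  have fm: "(\<lambda>r. indicator {0<..} r *\<^sub>R f r) \<in> borel_measurable lborel"
    using f by (simp add: set_integrable_def)
  have eq: "indicator {a n..b n} r *\<^sub>R f r = indicator {a n..b n} r *\<^sub>R (indicator {0<..} r *\<^sub>R f r)" for n r
    using a(2)[of n] by (auto simp: indicator_def)
  show ?thesis
    unfolding set_lebesgue_integral_def
  proof (rule integral_dominated_convergence[where w = "\<lambda>r. norm (indicator {0<..} r *\<^sub>R f r)"])
    show "integrable lborel (\<lambda>r. norm (indicator {0<..} r *\<^sub>R f r))"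
      using integrable_norm[OF f[unfolded set_integrable_def]] .
    show "(\<lambda>r. indicator {a n..b n} r *\<^sub>R f r) \<in> borel_measurable lborel" for n
      unfolding eq using fm by measurable
    show "AE r in lborel. norm (indicator {a n..b n} r *\<^sub>R f r) \<le> norm (indicator {0<..} r *\<^sub>R f r)" for n
      unfolding eq by (auto simp: indicator_def)
    show "AE r in lborel. (\<lambda>n. indicator {a n..b n} r *\<^sub>R f r) \<longlonglongrightarrow> indicator {0<..} r *\<^sub>R f r"
    proof (intro AE_I2)
      fix r :: real
      show "(\<lambda>n. indicator {a n..b n} r *\<^sub>R f r) \<longlonglongrightarrow> indicator {0<..} r *\<^sub>R f r"
      proof (cases "0 < r")
        case True
        have "eventually (\<lambda>n. a n < r) sequentially" using order_tendstoD(2)[OF a(1) True] .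
        moreover have "eventually (\<lambda>n. r \<le> b n) sequentially" using b by (simp add: filterlim_at_top)
        ultimately have "eventually (\<lambda>n. indicator {a n..b n} r *\<^sub>R f r = indicator {0<..} r *\<^sub>R f r) sequentially"
          by eventually_elim (use True in \<open>auto simp: indicator_def\<close>)
        then show ?thesis by (rule tendsto_eventually)
      next
        case False
        have z: "indicator {a n..b n} r *\<^sub>R f r = 0" for n using a(2)[of n] False by (simp add: indicator_def)
        show ?thesis unfolding z using False by simp
      qed
    qed
  qed (use fm in simp)
qed

text \<open>Cauchy's theorem for a sector, reduced to the imaginary part. A primitive
  \<open>F\<close> of \<open>K\<close> exists on the half plane around the bisecting ray, which
  contains both rays because \<open>m < pi\<close>. Along the positive axis \<open>Im F\<close> is
  constant since \<open>K\<close> is real there, and the arcs at small and large radii contribute at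
  most \<open>b r * m\<close>.\<close>

lemma ray_integral_imaginary_part:
  assumes m: "0 < m" "m < pi"
    and K: "K holomorphic_on {z. 0 < Re (z * cis (- (m / 2)))}"
    and real: "\<And>r. 0 < r \<Longrightarrow> Im (K (complex_of_real r)) = 0"
    and \<delta>: "0 < \<delta>"
    and b: "\<And>r \<phi>. 0 < r \<Longrightarrow> r < \<delta> \<or> \<Delta> < r \<Longrightarrow> 0 \<le> \<phi> \<Longrightarrow> \<phi> \<le> m \<Longrightarrow> r * cmod (K (r *\<^sub>R cis \<phi>)) \<le> b r"
    and b0: "(b \<longlongrightarrow> 0) (at_right 0)" and binf: "(b \<longlongrightarrow> 0) at_top"
    and int: "set_integrable lborel {0<..} (\<lambda>r. cis m * K (r *\<^sub>R cis m))"
  shows "Im (LBINT r:{0<..}. cis m * K (r *\<^sub>R cis m)) = 0"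
proof -
  define U where "U = {z. 0 < Re (z * cis (- (m / 2)))}"
  have "convex U"
    unfolding convex_alt
  proof (intro ballI allI impI)
    fix x y and u :: real assume xy: "x \<in> U" "y \<in> U" and u: "0 \<le> u \<and> u \<le> 1"
    have "Re (((1 - u) *\<^sub>R x + u *\<^sub>R y) * cis (- (m / 2))) = (1 - u) * Re (x * cis (- (m / 2))) + u * Re (y * cis (- (m / 2)))"
      by (simp add: algebra_simps)
    moreover have "0 < \<dots>"
      using xy u unfolding U_def
      by (cases "u = 0"; cases "u = 1") (auto intro!: add_pos_nonneg add_pos_pos)
    ultimately show "(1 - u) *\<^sub>R x + u *\<^sub>R y \<in> U" by (simp add: U_def)
  qed
  moreover have "open U" unfolding U_def by (intro open_Collect_less continuous_intros)
  ultimately obtain F where F: "\<And>x. x \<in> U \<Longrightarrow> (F has_field_derivative K x) (at x within U)"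
    using holomorphic_convex_primitive'[of U K] K by (auto simp: U_def)
  then have F: "\<And>x. x \<in> U \<Longrightarrow> (F has_field_derivative K x) (at x)"
    by (metis at_within_open[OF _ \<open>open U\<close>])
  have inU: "r *\<^sub>R cis \<phi> \<in> U" if "0 < r" "0 \<le> \<phi>" "\<phi> \<le> m" for r \<phi>
  proof -
    have "0 < cos (\<phi> - m / 2)" using that m by (intro cos_gt_zero_pi) auto
    moreover have "Re (r *\<^sub>R cis \<phi> * cis (- (m / 2))) = r * cos (\<phi> - m / 2)"
      by (simp add: cos_diff algebra_simps)
    ultimately show ?thesis using that by (simp add: U_def del: times_complex.sel)
  qed
  have Kc: "continuous_on U K" using K by (simp add: U_def holomorphic_on_imp_continuous_on)
  have ray: "((\<lambda>r. F (r *\<^sub>R cis \<phi>)) has_vector_derivative cis \<phi> * K (r *\<^sub>R cis \<phi>)) (at r within A)"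
    if "0 < r" "0 \<le> \<phi>" "\<phi> \<le> m" for r \<phi> A
  proof -
    have "((\<lambda>r. r *\<^sub>R cis \<phi>) has_vector_derivative cis \<phi>) (at r within A)"
      by (auto intro!: derivative_eq_intros)
    from field_vector_diff_chain_within[OF this, of F "K (r *\<^sub>R cis \<phi>)"] F[OF inU[OF that]]
    show ?thesis by (auto simp: comp_def intro: has_field_derivative_at_within)
  qed
  have arc: "cmod (F (r *\<^sub>R cis m) - F (complex_of_real r)) \<le> b r * m" if "0 < r" and r: "r < \<delta> \<or> \<Delta> < r" for r
  proof -
    have "cmod (F (r *\<^sub>R cis m) - F (r *\<^sub>R cis 0)) \<le> b r * norm (m - 0)"
    proof (rule differentiable_bound[of "{0..m}" "\<lambda>\<phi>. F (r *\<^sub>R cis \<phi>)" "\<lambda>\<phi> h. h *\<^sub>R (r *\<^sub>R (\<i> * cis \<phi>) * K (r *\<^sub>R cis \<phi>))"])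
      fix \<phi> assume \<phi>: "\<phi> \<in> {0..m}"
      have "(cis has_vector_derivative \<i> * cis \<phi>) (at \<phi> within {0..m})"
        unfolding cis_conv_exp by (auto intro!: derivative_eq_intros has_vector_derivative_real_field simp: mult.commute)
      then have "((\<lambda>\<phi>. r *\<^sub>R cis \<phi>) has_vector_derivative r *\<^sub>R (\<i> * cis \<phi>)) (at \<phi> within {0..m})"
        by (auto intro!: derivative_eq_intros)
      from field_vector_diff_chain_within[OF this, of F "K (r *\<^sub>R cis \<phi>)"] F[OF inU[of r \<phi>]] \<phi> \<open>0 < r\<close>
      show "((\<lambda>\<phi>. F (r *\<^sub>R cis \<phi>)) has_derivative (\<lambda>h. h *\<^sub>R (r *\<^sub>R (\<i> * cis \<phi>) * K (r *\<^sub>R cis \<phi>)))) (at \<phi> within {0..m})"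
        by (auto simp: comp_def has_vector_derivative_def intro: has_field_derivative_at_within)
      show "onorm (\<lambda>h. h *\<^sub>R (r *\<^sub>R (\<i> * cis \<phi>) * K (r *\<^sub>R cis \<phi>))) \<le> b r"
      proof (rule onorm_le)
        fix h :: real
        have "norm (h *\<^sub>R (r *\<^sub>R (\<i> * cis \<phi>) * K (r *\<^sub>R cis \<phi>))) = (r * cmod (K (r *\<^sub>R cis \<phi>))) * norm h"
          using \<open>0 < r\<close> by (simp add: norm_mult abs_mult)
        also have "\<dots> \<le> b r * norm h" using b[of r \<phi>] \<phi> \<open>0 < r\<close> r by (intro mult_right_mono) auto
        finally show "norm (h *\<^sub>R (r *\<^sub>R (\<i> * cis \<phi>) * K (r *\<^sub>R cis \<phi>))) \<le> b r * norm h" .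
      qed
    qed (use m in auto)
    then show ?thesis using m by (simp add: of_real_def)
  qed
  have base: "Im (F (complex_of_real R)) = Im (F (complex_of_real r))" if "0 < r" "r < R" for r R
  proof -
    have "\<exists>z>r. z < R \<and> Im (F (complex_of_real R)) - Im (F (complex_of_real r)) = (R - r) * Im (K (complex_of_real z))"
    proof (rule MVT2[OF \<open>r < R\<close>, of "\<lambda>x. Im (F (complex_of_real x))" "\<lambda>x. Im (K (complex_of_real x))"])
      fix x assume "r \<le> x" "x \<le> R"
      then have "((\<lambda>r. F (r *\<^sub>R cis 0)) has_vector_derivative cis 0 * K (x *\<^sub>R cis 0)) (at x)"
        by (intro ray) (use m that \<open>r \<le> x\<close> in auto)
      then have "((\<lambda>r. Im (F (r *\<^sub>R cis 0))) has_vector_derivative Im (cis 0 * K (x *\<^sub>R cis 0))) (at x)"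
        by (rule bounded_linear.has_vector_derivative[OF bounded_linear_Im])
      then show "((\<lambda>x. Im (F (complex_of_real x))) has_real_derivative Im (K (complex_of_real x))) (at x)"
        by (simp add: has_real_derivative_iff_has_vector_derivative of_real_def)
    qed
    then show ?thesis using real \<open>0 < r\<close> by auto
  qed
  have fin: "\<bar>Im (LBINT r:{\<epsilon>..R}. cis m * K (r *\<^sub>R cis m))\<bar> \<le> (b R + b \<epsilon>) * m" if "0 < \<epsilon>" "\<epsilon> < R" and "\<epsilon> < \<delta>" "\<Delta> < R" for \<epsilon> R
  proof -
    have "(LBINT r:{\<epsilon>..R}. cis m * K (r *\<^sub>R cis m)) = F (R *\<^sub>R cis m) - F (\<epsilon> *\<^sub>R cis m)"
      unfolding set_lebesgue_integral_def
    proof (rule integral_FTC_Icc)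
      show "continuous_on {\<epsilon>..R} (\<lambda>r. cis m * K (r *\<^sub>R cis m))"
        using inU that m by (intro continuous_intros continuous_on_compose2[OF Kc]) auto
    qed (use that m ray in auto)
    then have "\<bar>Im (LBINT r:{\<epsilon>..R}. cis m * K (r *\<^sub>R cis m))\<bar>
       = \<bar>Im (F (R *\<^sub>R cis m) - F (complex_of_real R)) - Im (F (\<epsilon> *\<^sub>R cis m) - F (complex_of_real \<epsilon>))\<bar>"
      using base[OF that(1,2)] by simp
    also have "\<dots> \<le> \<bar>Im (F (R *\<^sub>R cis m) - F (complex_of_real R))\<bar> + \<bar>Im (F (\<epsilon> *\<^sub>R cis m) - F (complex_of_real \<epsilon>))\<bar>"
      by (rule abs_triangle_ineq4)
    also have "\<dots> \<le> b R * m + b \<epsilon> * m"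
      using that by (intro add_mono order_trans[OF abs_Im_le_cmod arc]) auto
    finally show ?thesis by (simp add: distrib_right)
  qed
  define \<epsilon> where "\<epsilon> n = 1 / real (n + 2)" for n
  define R where "R n = real (n + 2)" for n
  have \<epsilon>: "\<epsilon> \<longlonglongrightarrow> 0" unfolding \<epsilon>_def by real_asymp
  have R: "filterlim R at_top sequentially" unfolding R_def by real_asymp
  have pos: "0 < \<epsilon> n" "\<epsilon> n < R n" for n
  proof -
    show "0 < \<epsilon> n" by (simp add: \<epsilon>_def)
    have "\<epsilon> n < 1" by (simp add: \<epsilon>_def)
    also have "1 < R n" by (simp add: R_def)
    finally show "\<epsilon> n < R n" .
  qed
  have \<epsilon>0: "filterlim \<epsilon> (at_right 0) sequentially"
    using \<epsilon> pos(1) by (auto simp: filterlim_at intro!: always_eventually) (metis less_irrefl)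
  have "(\<lambda>n. \<bar>Im (LBINT r:{\<epsilon> n..R n}. cis m * K (r *\<^sub>R cis m))\<bar>) \<longlonglongrightarrow> 0"
  proof (rule tendsto_sandwich[OF _ _ tendsto_const])
    show "eventually (\<lambda>n. \<bar>Im (LBINT r:{\<epsilon> n..R n}. cis m * K (r *\<^sub>R cis m))\<bar> \<le> (b (R n) + b (\<epsilon> n)) * m) sequentially"
    proof -
      have "eventually (\<lambda>n. \<epsilon> n < \<delta>) sequentially" "eventually (\<lambda>n. \<Delta> < R n) sequentially"
        using order_tendstoD(2)[OF \<epsilon> \<delta>] R by (auto simp: filterlim_at_top_dense)
      then show ?thesis by eventually_elim (use fin pos in blast)
    qed
    have "(\<lambda>n. (b (R n) + b (\<epsilon> n)) * m) \<longlonglongrightarrow> (0 + 0) * m"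
      by (intro tendsto_intros filterlim_compose[OF binf R] filterlim_compose[OF b0 \<epsilon>0])
    then show "(\<lambda>n. (b (R n) + b (\<epsilon> n)) * m) \<longlonglongrightarrow> 0" by simp
  qed simp
  moreover have "(\<lambda>n. \<bar>Im (LBINT r:{\<epsilon> n..R n}. cis m * K (r *\<^sub>R cis m))\<bar>) \<longlonglongrightarrow> \<bar>Im (LBINT r:{0<..}. cis m * K (r *\<^sub>R cis m))\<bar>"
    using pos by (intro tendsto_intros set_integrable_LIMSEQ_Icc int \<epsilon> R) auto
  ultimately show ?thesis using LIMSEQ_unique by fastforce
qed

section \<open>The one-sided stable density\<close>

text \<open>Needed are an angle between \<open>pi / 2\<close> and \<open>pi\<close> and an
  \<open>s\<close>-fold multiple below \<open>pi / 2\<close>. This choice satisfies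
  \<open>s * stable_angle s = pi - stable_angle s\<close>.\<close>

definition stable_angle :: "real \<Rightarrow> real" where
  "stable_angle s = pi / (1 + s)"

text \<open>Inverse Laplace transform of \<open>\<lambda> \<mapsto> exp (- \<lambda>\<^sup>s)\<close> with the Bromwich contour bent to the two rays
  of angle \<open>\<plusminus> stable_angle s\<close>, on which both \<open>exp (v z)\<close> and \<open>exp (- z\<^sup>s)\<close> decay.\<close>

definition stable_integrand :: "real \<Rightarrow> real \<Rightarrow> real \<Rightarrow> complex" where
  "stable_integrand s v r = cis (stable_angle s) *
     exp (complex_of_real (v * r) * cis (stable_angle s) - complex_of_real (r powr s) * cis (s * stable_angle s))"

text \<open>The two rays are complex conjugate, so their contributions to the Bromwich integral,
  with its factor \<open>1 / (2 pi i)\<close>, combine to the imaginary part over the upper ray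
  divided by \<open>pi\<close>.\<close>

definition stable_density :: "real \<Rightarrow> real \<Rightarrow> real" where
  "stable_density s v = Im (LBINT r:{0<..}. stable_integrand s v r) / pi"

context
  fixes s :: real
  assumes s: "0 < s" "s < 1"
begin

lemma stable_angle: "pi / 2 < stable_angle s" "stable_angle s < pi" "0 < stable_angle s"
  "s * stable_angle s < pi / 2" "0 < s * stable_angle s"
  using s pi_gt_zero by (auto simp: stable_angle_def field_simps)

lemma cos_stable_angle: "cos (stable_angle s) < 0" "0 < cos (s * stable_angle s)"
proof -
  have "0 < cos (pi - stable_angle s)" using stable_angle by (intro cos_gt_zero) auto
  then show "cos (stable_angle s) < 0" by simp
  show "0 < cos (s * stable_angle s)" using stable_angle by (intro cos_gt_zero) auto
qed

lemma norm_stable_integrand: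
  "norm (stable_integrand s v r) = exp (v * r * cos (stable_angle s)) * exp (- cos (s * stable_angle s) * r powr s)"
  by (simp add: stable_integrand_def norm_mult exp_add[symmetric] mult.commute flip: exp_add)

lemma measurable_stable_integrand [measurable]:
  "(\<lambda>p. stable_integrand s (fst p) (snd p)) \<in> borel_measurable (borel \<Otimes>\<^sub>M borel)"
  "(\<lambda>r. stable_integrand s v r) \<in> borel_measurable borel"
  unfolding stable_integrand_def by measurable

lemma set_integrable_stable_integrand:
  assumes "0 \<le> v"
  shows "set_integrable lborel {0<..} (stable_integrand s v)"
  unfolding set_integrable_def
proof (rule Bochner_Integration.integrable_bound)
  show "integrable lborel (\<lambda>r. indicator {0<..} r *\<^sub>R exp (- cos (s * stable_angle s) * r powr s))"
    using set_integrable_exp_powr[OF cos_stable_angle(2) s(1)] by (simp add: set_integrable_def)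
  have "v * r * cos (stable_angle s) \<le> 0" if "0 < r" for r
    using that assms cos_stable_angle(1) by (intro mult_nonneg_nonpos) auto
  then show "AE r in lborel. norm (indicator {0<..} r *\<^sub>R stable_integrand s v r)
      \<le> norm (indicator {0<..} r *\<^sub>R exp (- cos (s * stable_angle s) * r powr s))"
    by (intro AE_I2) (auto simp: norm_stable_integrand indicator_def mult_le_cancel_right1)
qed measurable

lemma measurable_stable_density [measurable]: "stable_density s \<in> borel_measurable borel"
  unfolding stable_density_def set_lebesgue_integral_def by measurable

lemma stable_density_bounded:
  obtains C where "0 \<le> C" "\<And>v. 0 < v \<Longrightarrow> \<bar>stable_density s v\<bar> \<le> C"
proof
  define C where "C = (LBINT r:{0<..}. exp (- cos (s * stable_angle s) * r powr s))"
  show "0 \<le> C / pi" unfolding C_def set_lebesgue_integral_def by (intro divide_nonneg_pos integral_nonneg) auto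
  fix v :: real assume "0 < v"
  have "cmod (LBINT r:{0<..}. stable_integrand s v r) \<le> (LBINT r:{0<..}. norm (stable_integrand s v r))"
    using set_integrable_stable_integrand[of v] \<open>0 < v\<close> by (intro set_integral_norm_bound) auto
  also have "\<dots> \<le> C" unfolding C_def
  proof (rule set_integral_mono)
    show "set_integrable lborel {0<..} (\<lambda>r. norm (stable_integrand s v r))"
      using set_integrable_norm[OF set_integrable_stable_integrand[of v]] \<open>0 < v\<close> by simp
    show "set_integrable lborel {0<..} (\<lambda>r. exp (- cos (s * stable_angle s) * r powr s))"
      by (rule set_integrable_exp_powr[OF cos_stable_angle(2) s(1)])
    fix r :: real assume "r \<in> {0<..}"
    then have "v * r * cos (stable_angle s) \<le> 0"
      using \<open>0 < v\<close> cos_stable_angle(1) by (intro mult_nonneg_nonpos) auto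
    then show "norm (stable_integrand s v r) \<le> exp (- cos (s * stable_angle s) * r powr s)"
      by (simp add: norm_stable_integrand mult_le_cancel_right1)
  qed
  finally have "\<bar>Im (LBINT r:{0<..}. stable_integrand s v r)\<bar> \<le> C"
    using abs_Im_le_cmod order_trans by blast
  then show "\<bar>stable_density s v\<bar> \<le> C / pi"
    by (simp add: stable_density_def divide_right_mono)
qed

lemma exp_ray_integral:
  assumes "Re w < 0"
  shows "set_integrable lborel {0<..} (\<lambda>r. exp (complex_of_real r * w))"
    and "(LBINT r:{0<..}. exp (complex_of_real r * w)) = - 1 / w"
proof -
  have w: "w \<noteq> 0" using assms by auto
  have "set_integrable lborel {0<..} (\<lambda>r. r powr 0 * exp (- (- Re w) * r))"
    by (rule set_integrable_powr_exp) (use assms in auto)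
  then have e: "set_integrable lborel {0<..} (\<lambda>r. exp (Re w * r))"
    by (rule set_integrable_cong[THEN iffD1, rotated -1]) auto
  show i: "set_integrable lborel {0<..} (\<lambda>r. exp (complex_of_real r * w))"
    unfolding set_integrable_def
    by (rule Bochner_Integration.integrable_bound[OF e[unfolded set_integrable_def]])
      (auto intro!: AE_I2 simp: indicator_def mult.commute)
  have F: "((\<lambda>r. exp (complex_of_real r * w) / w) has_vector_derivative exp (complex_of_real x * w)) (at x)" for x
  proof -
    have "((\<lambda>z. exp (z * w) / w) has_field_derivative exp (complex_of_real x * w)) (at (complex_of_real x))"
      using w by (auto intro!: derivative_eq_intros)
    then show ?thesis by (rule has_vector_derivative_real_field)
  qed
  have "((\<lambda>r. exp (complex_of_real r * w) / w) \<longlongrightarrow> exp (complex_of_real 0 * w) / w) (at_right 0)"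
    using w by (intro tendsto_intros) auto
  then have A: "((\<lambda>r. exp (complex_of_real r * w) / w) \<longlongrightarrow> 1 / w) (at_right 0)" by simp
  have "((\<lambda>r. exp (Re w * r) / cmod w) \<longlongrightarrow> 0) at_top"
  proof -
    have "((\<lambda>r. exp (c * r) / d) \<longlongrightarrow> 0) at_top" if "c < 0" "0 < d" for c d :: real
      using that by real_asymp
    then show ?thesis using assms w by simp
  qed
  then have B: "((\<lambda>r. exp (complex_of_real r * w) / w) \<longlongrightarrow> 0) at_top"
    by - (rule tendsto_norm_zero_cancel, simp add: norm_divide mult.commute)
  have "(LBINT r:{0<..}. exp (complex_of_real r * w)) = 0 - 1 / w"
    by (rule set_lebesgue_integral_FTC_Ioi[OF F _ i A B]) (auto intro!: continuous_intros)
  then show "(LBINT r:{0<..}. exp (complex_of_real r * w)) = - 1 / w" by simp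
qed

lemma norm_exp_diff_one_le:
  assumes "Re w \<le> 0"
  shows "cmod (exp w - 1) \<le> cmod w"
proof -
  have "cmod (exp w - exp 0) \<le> 1 * cmod (w - 0)"
  proof (rule field_differentiable_bound[of "{z. Re z \<le> 0}" exp exp])
    show "convex {z. Re z \<le> 0}" by (rule convex_halfspace_Re_le)
  qed (use assms in \<open>auto intro: DERIV_exp has_field_derivative_at_within\<close>)
  then show ?thesis by simp
qed

text \<open>Since \<open>exp (v z)\<close> alone contributes the real number \<open>- 1 / v\<close>, the factor \<open>exp (- z\<^sup>s)\<close> may be
  replaced by \<open>exp (- z\<^sup>s) - 1 = O(\<bar>z\<bar>\<^sup>s)\<close>.\<close>

lemma stable_density_decay:
  obtains C where "0 \<le> C" "\<And>v. 0 < v \<Longrightarrow> \<bar>stable_density s v\<bar> \<le> C * v powr (- 1 - s)"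
proof
  define m where "m = stable_angle s"
  define c where "c = - cos m"
  have c: "0 < c" using cos_stable_angle by (simp add: c_def m_def)
  define C where "C = (LBINT r:{0<..}. r powr s * exp (- c * r))"
  show "0 \<le> C / pi" unfolding C_def set_lebesgue_integral_def by (intro divide_nonneg_pos integral_nonneg) auto
  fix v :: real assume v: "0 < v"
  define w where "w = v *\<^sub>R cis m"
  have w: "Re w < 0" using v cos_stable_angle by (simp add: w_def m_def mult_pos_neg)
  have e: "set_integrable lborel {0<..} (\<lambda>r. cis m * exp (complex_of_real r * w))"
    using exp_ray_integral(1)[OF w] by (rule set_integrable_mult_right)
  have "(LBINT r:{0<..}. cis m * exp (complex_of_real r * w)) = cis m * (- 1 / w)"
    using exp_ray_integral(2)[OF w] by simp
  also have "\<dots> = complex_of_real (- 1 / v)" using v by (simp add: w_def scaleR_conv_of_real)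
  finally have z: "Im (LBINT r:{0<..}. cis m * exp (complex_of_real r * w)) = 0" by simp
  define D where "D r = stable_integrand s v r - cis m * exp (complex_of_real r * w)" for r
  have Di: "set_integrable lborel {0<..} D"
    unfolding D_def using set_integrable_stable_integrand[of v] e v by (intro set_integral_diff) auto
  have "Im (LBINT r:{0<..}. stable_integrand s v r) = Im (LBINT r:{0<..}. D r)"
    unfolding D_def using set_integrable_stable_integrand[of v] e v z by (subst set_integral_diff) auto
  also have "\<bar>\<dots>\<bar> \<le> cmod (LBINT r:{0<..}. D r)" by (rule abs_Im_le_cmod)
  also have "\<dots> \<le> (LBINT r:{0<..}. norm (D r))" by (rule set_integral_norm_bound[OF Di])
  also have "\<dots> \<le> (LBINT r:{0<..}. r powr s * exp (- (c * v) * r))"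
  proof (rule set_integral_mono)
    show "set_integrable lborel {0<..} (\<lambda>r. norm (D r))" by (rule set_integrable_norm[OF Di])
    show "set_integrable lborel {0<..} (\<lambda>r. r powr s * exp (- (c * v) * r))"
      using c v s by (intro set_integrable_powr_exp) auto
    fix r :: real assume "r \<in> {0<..}"
    then have r: "0 < r" by simp
    have "D r = cis m * exp (complex_of_real r * w) * (exp (- (complex_of_real (r powr s) * cis (s * m))) - 1)"
      by (simp add: D_def stable_integrand_def m_def[symmetric] w_def exp_diff exp_minus scaleR_conv_of_real algebra_simps field_simps)
    then have "norm (D r) = exp (- (c * v) * r) * cmod (exp (- (complex_of_real (r powr s) * cis (s * m))) - 1)"
      by (simp add: norm_mult w_def c_def mult_ac)
    also have "\<dots> \<le> exp (- (c * v) * r) * cmod (- (complex_of_real (r powr s) * cis (s * m)))"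
      using cos_stable_angle by (intro mult_left_mono norm_exp_diff_one_le) (auto simp: m_def)
    also have "\<dots> = r powr s * exp (- (c * v) * r)" by (simp add: norm_mult)
    finally show "norm (D r) \<le> r powr s * exp (- (c * v) * r)" .
  qed
  also have "\<dots> = C * v powr (- 1 - s)"
  proof -
    have "C = (LINT r|lborel. indicator {0<..} r *\<^sub>R (r powr s * exp (- c * r)))" by (simp add: C_def set_lebesgue_integral_def)
    also have "\<dots> = v * (LINT r|lborel. indicator {0<..} (v * r) *\<^sub>R ((v * r) powr s * exp (- c * (v * r))))"
      using lborel_integral_real_affine[of v "\<lambda>r. indicator {0<..} r *\<^sub>R (r powr s * exp (- c * r))" 0] v by simp
    also have "\<dots> = v * (LINT r|lborel. v powr s * (indicator {0<..} r *\<^sub>R (r powr s * exp (- (c * v) * r))))"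
      using v by (intro arg_cong2[where f = "(*)"] Bochner_Integration.integral_cong refl)
        (auto simp: indicator_def zero_less_mult_iff powr_mult mult_ac)
    also have "\<dots> = v powr (1 + s) * (LBINT r:{0<..}. r powr s * exp (- (c * v) * r))"
      using v by (simp add: set_lebesgue_integral_def powr_add)
    finally show ?thesis using v by (simp add: powr_diff powr_minus powr_add field_simps)
  qed
  finally have "\<bar>Im (LBINT r:{0<..}. stable_integrand s v r)\<bar> \<le> C * v powr (- 1 - s)" .
  then show "\<bar>stable_density s v\<bar> \<le> C / pi * v powr (- 1 - s)"
    by (simp add: stable_density_def divide_right_mono)
qed

text \<open>Boundedness of the density pays for the singularity \<open>v powr - \<kappa>\<close> at
  0, its decay \<open>v powr (- 1 - s)\<close> for integrability at infinity. Exponents up to 1/2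
  will arise from the derivative of the heat semigroup.\<close>

lemma stable_density_moment:
  assumes "0 \<le> \<kappa>" "\<kappa> < 1"
  shows "set_integrable lborel {0<..} (\<lambda>v. v powr - \<kappa> * stable_density s v)"
proof -
  obtain C where C: "0 \<le> C" "\<And>v. 0 < v \<Longrightarrow> \<bar>stable_density s v\<bar> \<le> C" using stable_density_bounded by blast
  obtain D where D: "0 \<le> D" "\<And>v. 0 < v \<Longrightarrow> \<bar>stable_density s v\<bar> \<le> D * v powr (- 1 - s)" using stable_density_decay by blast
  define w where "w v = C * (indicator {0<..1} v *\<^sub>R v powr - \<kappa>) + D * (indicator {1<..} v *\<^sub>R v powr - (1 + s))" for v :: real
  have "integrable lborel w"
    unfolding w_def using powr_integral_at_0(1)[OF assms(2), of 1] powr_integral_at_top(1)[of "1 + s" 1] s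
    by (intro Bochner_Integration.integrable_add integrable_mult_right) (auto simp: set_integrable_def)
  then show ?thesis
    unfolding set_integrable_def
  proof (rule Bochner_Integration.integrable_bound)
    have "v powr - \<kappa> * \<bar>stable_density s v\<bar> \<le> D * v powr - (1 + s)" if "1 < v" for v
    proof -
      have "v powr - \<kappa> \<le> v powr 0" using that assms by (intro powr_mono) auto
      then have "v powr - \<kappa> * \<bar>stable_density s v\<bar> \<le> 1 * (D * v powr (- 1 - s))"
        using that D by (intro mult_mono) auto
      then show ?thesis by simp
    qed
    moreover have "v powr - \<kappa> * \<bar>stable_density s v\<bar> \<le> C * v powr - \<kappa>" if "0 < v" for v
      using C(2)[OF that] by (subst mult.commute) (intro mult_right_mono, auto)
    ultimately show "AE v in lborel. norm (indicator {0<..} v *\<^sub>R (v powr - \<kappa> * stable_density s v)) \<le> norm (w v)"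
      using C(1) D(1) by (intro AE_I2) (auto simp: w_def indicator_def abs_mult)
  qed measurable
qed

end

context
  fixes s :: real
  assumes s: "0 < s" "s < 1"
begin

text \<open>The integrand is the derivative of \<open>Ln (1 + z) - Ln (l - z)\<close> along the ray.
  Its imaginary part moves from 0, at the real value \<open>- ln l\<close>, to
  \<open>m - (m - pi) = pi\<close> at infinity. This function will serve to remove a pole at
  \<open>l\<close>; the factor \<open>(l + 1) / (z + 1)\<close> is 1 at \<open>l\<close> and makes
  it integrable at infinity.\<close>

lemma log_ray_integral:
  assumes "0 < l" "pi / 2 < m" "m < pi"
  defines "k \<equiv> \<lambda>r. cis m * (complex_of_real (l + 1) / ((r *\<^sub>R cis m + 1) * (complex_of_real l - r *\<^sub>R cis m)))"
  shows "set_integrable lborel {0<..} k" and "Im (LBINT r:{0<..}. k r) = pi"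
proof -
  have sin: "0 < sin m" using assms by (intro sin_gt_zero) auto
  have "0 < cos (pi - m)" using assms by (intro cos_gt_zero) auto
  then have cos: "cos m < 0" by simp
  have b1: "sin m \<le> cmod (r *\<^sub>R cis m + 1)" "r * sin m \<le> cmod (r *\<^sub>R cis m + 1)" if "0 \<le> r" for r
  proof -
    show "r * sin m \<le> cmod (r *\<^sub>R cis m + 1)"
      using abs_Im_le_cmod[of "r *\<^sub>R cis m + 1"] by simp
    have "sin m \<le> \<bar>Im ((r *\<^sub>R cis m + 1) * cis (- m))\<bar>"
      by (simp add: algebra_simps)
    also have "\<dots> \<le> cmod ((r *\<^sub>R cis m + 1) * cis (- m))" by (rule abs_Im_le_cmod)
    finally show "sin m \<le> cmod (r *\<^sub>R cis m + 1)" by (simp add: norm_mult)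
  qed
  have b2: "l \<le> cmod (complex_of_real l - r *\<^sub>R cis m)" "r * (- cos m) \<le> cmod (complex_of_real l - r *\<^sub>R cis m)" if "0 \<le> r" for r
  proof -
    have "r * cos m \<le> 0" using that cos by (intro mult_nonneg_nonpos) auto
    then show "l \<le> cmod (complex_of_real l - r *\<^sub>R cis m)" "r * (- cos m) \<le> cmod (complex_of_real l - r *\<^sub>R cis m)"
      using abs_Re_le_cmod[of "complex_of_real l - r *\<^sub>R cis m"] \<open>0 < l\<close> by auto
  qed
  have nz: "r *\<^sub>R cis m + 1 \<noteq> 0" "complex_of_real l - r *\<^sub>R cis m \<noteq> 0" if "0 \<le> r" for r
    using b1(1)[OF that] b2(1)[OF that] sin \<open>0 < l\<close> by auto
  define c1 c3 where "c1 = (l + 1) / (sin m * l)" and "c3 = (l + 1) / (sin m * (- cos m))"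
  have c: "0 \<le> c1" "0 \<le> c3"
    unfolding c1_def c3_def using sin cos \<open>0 < l\<close> by (intro divide_nonneg_pos mult_pos_pos; simp)+
  define w where "w r = c1 * indicator {0<..1} r + c3 * (indicator {1<..} r *\<^sub>R r powr - 2)" for r :: real
  have "integrable lborel w"
    unfolding w_def using powr_integral_at_top(1)[of 2 1, unfolded set_integrable_def]
    by (intro Bochner_Integration.integrable_add integrable_mult_right) (auto simp: integrable_indicator_iff)
  then show int: "set_integrable lborel {0<..} k"
    unfolding set_integrable_def
  proof (rule Bochner_Integration.integrable_bound)
    show "(\<lambda>r. indicator {0<..} r *\<^sub>R k r) \<in> borel_measurable lborel" unfolding k_def by measurable
    have nk: "cmod (k r) = (l + 1) / (cmod (r *\<^sub>R cis m + 1) * cmod (complex_of_real l - r *\<^sub>R cis m))" for r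
      using \<open>0 < l\<close> by (simp add: k_def norm_mult norm_divide del: of_real_add)
    have k1: "cmod (k r) \<le> c1" if "0 < r" for r
      unfolding nk c1_def using b1(1)[of r] b2(1)[of r] sin \<open>0 < l\<close> that nz[of r]
      by (intro divide_left_mono mult_mono mult_pos_pos) auto
    have k2: "cmod (k r) \<le> c3 * r powr - 2" if "1 < r" for r
    proof -
      have "cmod (k r) \<le> (l + 1) / ((r * sin m) * (r * (- cos m)))"
        unfolding nk using b1(2)[of r] b2(2)[of r] sin cos \<open>0 < l\<close> that nz[of r]
        by (intro divide_left_mono mult_mono mult_pos_pos mult_nonneg_nonneg) auto
      also have "\<dots> = c3 * r powr - 2"
        using that by (simp add: c3_def powr_minus power2_eq_square field_simps)
      finally show ?thesis .
    qed
    show "AE r in lborel. norm (indicator {0<..} r *\<^sub>R k r) \<le> norm (w r)"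
    proof (intro AE_I2)
      fix r :: real
      consider "r \<le> 0" | "0 < r" "r \<le> 1" | "1 < r" by linarith
      then show "norm (indicator {0<..} r *\<^sub>R k r) \<le> norm (w r)"
      proof cases
        case 2
        then show ?thesis using k1[of r] c by (simp add: w_def)
      next
        case 3
        then show ?thesis using k2[of r] c by (simp add: w_def abs_mult)
      qed simp
    qed
  qed
  define F where "F r = Ln (1 + r *\<^sub>R cis m) - Ln (complex_of_real l - r *\<^sub>R cis m)" for r
  have n1: "1 + r *\<^sub>R cis m \<notin> \<real>\<^sub>\<le>\<^sub>0" if "0 < r" for r
    using sin that by (auto simp: complex_nonpos_Reals_iff)
  have n2: "complex_of_real l - r *\<^sub>R cis m \<notin> \<real>\<^sub>\<le>\<^sub>0" if "0 < r" for r
    using sin that by (auto simp: complex_nonpos_Reals_iff)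
  have "(LBINT r:{0<..}. k r) = (\<i> * pi) - (- complex_of_real (ln l))"
  proof (rule set_lebesgue_integral_FTC_Ioi[where F = F])
    fix r :: real assume r: "0 < r"
    have "((\<lambda>z. Ln (1 + z * cis m) - Ln (complex_of_real l - z * cis m)) has_field_derivative
        (cis m / (1 + complex_of_real r * cis m) - (- cis m) / (complex_of_real l - complex_of_real r * cis m))) (at (complex_of_real r))"
      using n1[OF r] n2[OF r] by (auto intro!: derivative_eq_intros simp: scaleR_conv_of_real divide_inverse mult.commute)
    then have "(F has_vector_derivative
        (cis m / (1 + complex_of_real r * cis m) - (- cis m) / (complex_of_real l - complex_of_real r * cis m))) (at r)"
      unfolding F_def scaleR_conv_of_real by (rule has_vector_derivative_real_field)
    moreover have "cis m / (1 + complex_of_real r * cis m) - (- cis m) / (complex_of_real l - complex_of_real r * cis m) = k r"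
    proof -
      have "C / (1 + Z) - (- C) / (L - Z) = C * ((L + 1) / ((Z + 1) * (L - Z)))" if "Z + 1 \<noteq> 0" "L - Z \<noteq> 0" for C Z L :: complex
        using that by (simp add: field_simps)
      from this[of "complex_of_real r * cis m" "complex_of_real l" "cis m"] nz[of r] r show ?thesis
        by (simp add: k_def scaleR_conv_of_real)
    qed
    ultimately show "(F has_vector_derivative k r) (at r)" by simp
    show "isCont k r" unfolding k_def using nz[of r] r by (intro continuous_intros) auto
  next
    have "(F \<longlongrightarrow> Ln (1 + 0 *\<^sub>R cis m) - Ln (complex_of_real l - 0 *\<^sub>R cis m)) (at_right 0)"
      unfolding F_def using \<open>0 < l\<close> by (intro tendsto_intros) (auto simp: complex_nonpos_Reals_iff)
    then show "(F \<longlongrightarrow> - complex_of_real (ln l)) (at_right 0)" using \<open>0 < l\<close> by (simp add: Ln_of_real)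
  next
    \<comment> \<open>A positive factor \<open>r\<close> is taken out of both arguments; its
      logarithm cancels in the difference.\<close>
    have inv: "((\<lambda>r::real. 1 / r) \<longlongrightarrow> 0) at_top" "((\<lambda>r::real. l / r) \<longlongrightarrow> 0) at_top" by real_asymp+
    have "((\<lambda>r. Ln (complex_of_real (1 / r) + cis m) - Ln (complex_of_real (l / r) - cis m)) \<longlongrightarrow>
        Ln (complex_of_real 0 + cis m) - Ln (complex_of_real 0 - cis m)) at_top"
      using sin by (intro tendsto_intros inv) (auto simp: complex_nonpos_Reals_iff)
    moreover have "Ln (cis m) = \<i> * m"
      using assms by (intro Ln_unique) (auto simp: cis_conv_exp)
    moreover have "Ln (- cis m) = \<i> * (m - pi)"
    proof (rule Ln_unique)
      have "cis (m - pi) = - cis m" by (simp add: complex_eq_iff)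
      then show "exp (\<i> * complex_of_real (m - pi)) = - cis m" by (simp only: cis_conv_exp)
    qed (use assms in auto)
    ultimately have "((\<lambda>r. Ln (complex_of_real (1 / r) + cis m) - Ln (complex_of_real (l / r) - cis m)) \<longlongrightarrow> \<i> * pi) at_top"
      by (simp add: algebra_simps)
    moreover have "eventually (\<lambda>r. Ln (complex_of_real (1 / r) + cis m) - Ln (complex_of_real (l / r) - cis m) = F r) at_top"
      using eventually_gt_at_top[of 0]
    proof eventually_elim
      case (elim r)
      have e: "1 + r *\<^sub>R cis m = complex_of_real r * (complex_of_real (1 / r) + cis m)"
        "complex_of_real l - r *\<^sub>R cis m = complex_of_real r * (complex_of_real (l / r) - cis m)"
        using elim by (simp_all add: scaleR_conv_of_real field_simps)
      have "complex_of_real (1 / r) + cis m \<noteq> 0" "complex_of_real (l / r) - cis m \<noteq> 0"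
        using e nz[of r] elim by (auto simp: add.commute)
      then show ?case unfolding F_def e using elim by (simp add: Ln_times_of_real)
    qed
    ultimately show "(F \<longlongrightarrow> \<i> * pi) at_top" by (rule Lim_transform_eventually)
  qed (rule int)
  then show "Im (LBINT r:{0<..}. k r) = pi" by simp
qed

text \<open>The pole of \<open>exp (- z^s) / (l - z)\<close> at \<open>l\<close> is cancelled by
  subtracting \<open>exp (- l^s)\<close> times the integrand of \<open>log_ray_integral\<close>. The
  difference \<open>K\<close> is holomorphic in the sector and real on the axis, so its integral
  over the rotated ray has no imaginary part, and the value comes from the subtracted term.\<close>

lemma stable_ray_integral:
  assumes l: "0 < l"
  defines "m \<equiv> stable_angle s"
  defines "E \<equiv> \<lambda>r. cis m * exp (- (complex_of_real (r powr s) * cis (s * m))) / (complex_of_real l - r *\<^sub>R cis m)"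
  shows "Im (LBINT r:{0<..}. E r) = pi * exp (- (l powr s))"
proof -
  note m = stable_angle[OF s, folded m_def]
  define c2 where "c2 = cos (s * m)"
  have c2: "0 < c2" using cos_stable_angle(2)[OF s] by (simp add: c2_def m_def)
  define U where "U = {z. 0 < Re (z * cis (- (m / 2)))}"
  have oU: "open U" unfolding U_def by (intro open_Collect_less continuous_intros)
  have Un: "z \<notin> \<real>\<^sub>\<le>\<^sub>0" if "z \<in> U" for z
  proof
    assume "z \<in> \<real>\<^sub>\<le>\<^sub>0"
    then obtain x where x: "z = complex_of_real x" "x \<le> 0" by (auto elim!: nonpos_Reals_cases)
    have "0 < cos (m / 2)" using m by (intro cos_gt_zero) auto
    then have "Re (z * cis (- (m / 2))) \<le> 0" using x by (simp add: mult_nonpos_nonneg)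
    then show False using that by (simp add: U_def)
  qed
  have U1: "z + 1 \<noteq> 0" if "z \<in> U" for z
    using Un[OF that] by (metis add.commute add_eq_0_iff nonpos_Reals_of_real_iff of_real_1 of_real_minus
        le_minus_one_simps(1))
  define L where "L = complex_of_real l"
  have LU: "L \<in> U"
  proof -
    have "0 < cos (m / 2)" using m by (intro cos_gt_zero) auto
    then show ?thesis using l by (simp add: U_def L_def)
  qed
  define g where "g z = complex_of_real (exp (- (l powr s))) * (L + 1) / (z + 1) - exp (- (z powr of_real s))" for z
  have gL: "g L = 0"
    using U1[OF LU] l by (simp add: g_def L_def powr_of_real exp_of_real flip: of_real_minus)
  \<comment> \<open>Since \<open>g\<close> vanishes at \<open>L\<close>, its difference quotient
    there is the wanted difference of the two integrands, with the singularity removed.\<close>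
  define K where "K = (\<lambda>z. if z = L then deriv g L else (g z - g L) / (z - L))"
  have gh: "g holomorphic_on U"
    unfolding g_def using U1 Un by (intro holomorphic_intros) auto
  then have Kh: "K holomorphic_on U" unfolding K_def by (intro pole_lemma_open oU)
  have Keq: "K z = exp (- (z powr of_real s)) / (L - z) - complex_of_real (exp (- (l powr s))) * ((L + 1) / ((z + 1) * (L - z)))"
    if "z \<in> U" "z \<noteq> L" for z
  proof -
    have "(E * (L + 1) / (z + 1) - X) / (z - L) = X / (L - z) - E * ((L + 1) / ((z + 1) * (L - z)))" for E X
    proof -
      have "(E * (L + 1) / (z + 1) - X) / (z - L) = (X - E * (L + 1) / (z + 1)) / (L - z)"
        by (metis minus_diff_eq minus_divide_divide)
      then show ?thesis by (simp add: diff_divide_distrib)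
    qed
    moreover have "K z = g z / (z - L)" using that gL by (simp add: K_def)
    ultimately show ?thesis by (simp only: g_def)
  qed
  have rU: "complex_of_real r \<in> U" if "0 < r" for r
  proof -
    have "0 < cos (m / 2)" using m by (intro cos_gt_zero) auto
    then show ?thesis using that by (simp add: U_def)
  qed
  have Kreal: "Im (K (complex_of_real r)) = 0" if "0 < r" "r \<noteq> l" for r
  proof -
    have "K (complex_of_real r) = complex_of_real (exp (- (r powr s)) / (l - r) - exp (- (l powr s)) * ((l + 1) / ((r + 1) * (l - r))))"
      using Keq[OF rU[OF that(1)]] that by (simp add: L_def powr_of_real exp_of_real flip: of_real_minus)
    then show ?thesis by simp
  qed
  have real: "Im (K (complex_of_real r)) = 0" if "0 < r" for r
  proof (cases "r = l")
    case True
    \<comment> \<open>At the removed singularity the value is real by continuity.\<close>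
    have "isCont K L" using Kh oU LU by (meson continuous_on_eq_continuous_at holomorphic_on_imp_continuous_on)
    then have "isCont (\<lambda>r. Im (K (complex_of_real r))) l"
      unfolding L_def by (intro continuous_intros isCont_o2[of _ complex_of_real]) auto
    then have "((\<lambda>r. Im (K (complex_of_real r))) \<longlongrightarrow> Im (K (complex_of_real l))) (at l)"
      by (simp add: isCont_def)
    moreover have "((\<lambda>r. Im (K (complex_of_real r))) \<longlongrightarrow> 0) (at l)"
    proof (rule tendsto_eventually)
      have "eventually (\<lambda>r. r \<in> {0<..} - {l}) (at l)"
        using eventually_at_in_open[of "{0<..}" l] l by simp
      then show "eventually (\<lambda>r. Im (K (complex_of_real r)) = 0) (at l)"
        by eventually_elim (use Kreal in auto)
    qed
    ultimately show ?thesis using True tendsto_unique[of "at l"] by auto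
  qed (use Kreal that in auto)
  have polU: "r *\<^sub>R cis \<phi> \<in> U" if "0 < r" "0 \<le> \<phi>" "\<phi> \<le> m" for r \<phi>
  proof -
    have "0 < cos (\<phi> - m / 2)" using that m by (intro cos_gt_zero_pi) auto
    moreover have "Re (r *\<^sub>R cis \<phi> * cis (- (m / 2))) = r * cos (\<phi> - m / 2)"
      by (simp add: cos_diff algebra_simps)
    ultimately show ?thesis using that by (simp add: U_def del: times_complex.sel)
  qed
  have polpow: "(r *\<^sub>R cis \<phi>) powr of_real s = complex_of_real (r powr s) * cis (s * \<phi>)"
    if "0 < r" "0 \<le> \<phi>" "\<phi> \<le> m" for r \<phi>
  proof -
    have "Ln (r *\<^sub>R cis \<phi>) = complex_of_real (ln r) + \<i> * \<phi>"
      using that m by (intro Ln_unique) (auto simp: exp_add cis_conv_exp exp_of_real scaleR_conv_of_real)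
    then show ?thesis
      using that by (simp add: powr_def exp_add[symmetric] cis_conv_exp algebra_simps flip: exp_of_real)
  qed
  have expb: "cmod (exp (- ((r *\<^sub>R cis \<phi>) powr of_real s))) \<le> exp (- c2 * r powr s)"
    if "0 < r" "0 \<le> \<phi>" "\<phi> \<le> m" for r \<phi>
  proof -
    have "c2 \<le> cos (s * \<phi>)" unfolding c2_def using that m s by (intro cos_monotone_0_pi_le mult_left_mono) auto
    then have "c2 * r powr s \<le> cos (s * \<phi>) * r powr s" by (rule mult_right_mono) simp
    then show ?thesis by (simp add: polpow[OF that] mult.commute)
  qed
  define el where "el = exp (- (l powr s))"
  \<comment> \<open>For small \<open>r\<close> the moduli of \<open>z + 1\<close> and
    \<open>L - z\<close> are at least 1/2 and \<open>l / 2\<close>; for large \<open>r\<close> both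
    are at least \<open>r / 2\<close>.\<close>
  define b where "b r = (if r < min (l / 2) (1 / 2) then r * ((1 + el * ((l + 1) / (1 / 2))) / (l / 2))
       else r * ((exp (- c2 * r powr s) + el * ((l + 1) / (r / 2))) / (r / 2)))" for r
  have Kb: "cmod (K z) \<le> (cmod (exp (- (z powr of_real s))) + el * ((l + 1) / A)) / D"
    if "z \<in> U" "z \<noteq> L" "0 < A" "A \<le> cmod (z + 1)" "0 < D" "D \<le> cmod (L - z)" for z A D
  proof -
    have "K z = (exp (- (z powr of_real s)) - complex_of_real el * ((L + 1) / (z + 1))) / (L - z)"
    proof -
      have "X / (L - z) - E * ((L + 1) / ((z + 1) * (L - z))) = (X - E * ((L + 1) / (z + 1))) / (L - z)" for X E
        by (simp add: diff_divide_distrib)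
      then show ?thesis by (simp only: Keq[OF that(1,2)] el_def)
    qed
    then have "cmod (K z) = cmod (exp (- (z powr of_real s)) - complex_of_real el * ((L + 1) / (z + 1))) / cmod (L - z)"
      by (simp add: norm_divide)
    also have "\<dots> \<le> (cmod (exp (- (z powr of_real s))) + cmod (complex_of_real el * ((L + 1) / (z + 1)))) / D"
      using that by (intro frac_le norm_triangle_ineq4) auto
    also have "cmod (complex_of_real el * ((L + 1) / (z + 1))) = el * ((l + 1) / cmod (z + 1))"
    proof -
      have "cmod (L + 1) = l + 1" using l unfolding L_def by (metis abs_of_pos add_pos_pos norm_of_real of_real_1 of_real_add zero_less_one)
      then show ?thesis by (simp add: norm_mult norm_divide el_def)
    qed
    also have "el * ((l + 1) / cmod (z + 1)) \<le> el * ((l + 1) / A)"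
      using that l by (intro mult_left_mono divide_left_mono mult_pos_pos) (auto simp: el_def)
    finally show ?thesis using that by (simp add: divide_right_mono)
  qed
  have bound: "r * cmod (K (r *\<^sub>R cis \<phi>)) \<le> b r"
    if r: "0 < r" "r < min (l / 2) (1 / 2) \<or> max (2 * l) 2 < r" and \<phi>: "0 \<le> \<phi>" "\<phi> \<le> m" for r \<phi>
  proof -
    define z where "z = r *\<^sub>R cis \<phi>"
    have zU: "z \<in> U" and nz: "cmod z = r" using polU[OF r(1) \<phi>] r by (auto simp: z_def)
    have e: "cmod (exp (- (z powr of_real s))) \<le> exp (- c2 * r powr s)" using expb[OF r(1) \<phi>] by (simp add: z_def)
    have nL: "cmod L = l" using l by (simp add: L_def)
    have t: "cmod z - 1 \<le> cmod (z + 1)" "1 - cmod z \<le> cmod (z + 1)" "cmod z - cmod L \<le> cmod (L - z)" "cmod L - cmod z \<le> cmod (L - z)"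
      using norm_triangle_ineq2[of z "- 1"] norm_triangle_ineq2[of 1 "- z"] norm_triangle_ineq2[of z L] norm_triangle_ineq2[of L z]
      by (auto simp: norm_minus_commute add.commute)
    show ?thesis
    proof (cases "r < min (l / 2) (1 / 2)")
      case True
      have "cmod (K z) \<le> (cmod (exp (- (z powr of_real s))) + el * ((l + 1) / (1 / 2))) / (l / 2)"
        using t True nz nL l by (intro Kb zU) auto
      also have "\<dots> \<le> (1 + el * ((l + 1) / (1 / 2))) / (l / 2)"
      proof -
        have "exp (- c2 * r powr s) \<le> 1" using c2 by simp
        then show ?thesis using e l by (intro divide_right_mono add_right_mono) auto
      qed
      finally have "r * cmod (K z) \<le> r * ((1 + el * ((l + 1) / (1 / 2))) / (l / 2))"
        by (rule mult_left_mono) (use r in simp)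
      then show ?thesis using True by (simp only: b_def z_def if_True)
    next
      case False
      then have "max (2 * l) 2 < r" using r by blast
      then have "cmod (K z) \<le> (cmod (exp (- (z powr of_real s))) + el * ((l + 1) / (r / 2))) / (r / 2)"
        using t nz nL l by (intro Kb zU) auto
      also have "\<dots> \<le> (exp (- c2 * r powr s) + el * ((l + 1) / (r / 2))) / (r / 2)"
        using e r by (intro divide_right_mono add_right_mono) auto
      finally have "r * cmod (K z) \<le> r * ((exp (- c2 * r powr s) + el * ((l + 1) / (r / 2))) / (r / 2))"
        by (rule mult_left_mono) (use r in simp)
      then show ?thesis using False by (simp only: b_def z_def if_False)
    qed
  qed
  have b0: "(b \<longlongrightarrow> 0) (at_right 0)"
  proof (rule Lim_transform_eventually)
    have "((\<lambda>r. r * ((1 + el * ((l + 1) / (1 / 2))) / (l / 2))) \<longlongrightarrow> 0 * ((1 + el * ((l + 1) / (1 / 2))) / (l / 2))) (at_right 0)"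
      by (intro tendsto_intros)
    then show "((\<lambda>r. r * ((1 + el * ((l + 1) / (1 / 2))) / (l / 2))) \<longlongrightarrow> 0) (at_right 0)" by simp
    have "eventually (\<lambda>r. r < min (l / 2) (1 / 2)) (at_right 0)"
      using l by (intro eventually_at_rightI[of 0 "min (l / 2) (1 / 2)"]) auto
    then show "eventually (\<lambda>r. r * ((1 + el * ((l + 1) / (1 / 2))) / (l / 2)) = b r) (at_right 0)"
      by eventually_elim (simp add: b_def)
  qed
  have binf: "(b \<longlongrightarrow> 0) at_top"
  proof (rule Lim_transform_eventually)
    show "((\<lambda>r. 2 * exp (- c2 * r powr s) + 4 * (el * (l + 1)) / r) \<longlongrightarrow> 0) at_top"
    proof -
      have "((\<lambda>r. exp (- c2 * r powr s)) \<longlongrightarrow> 0) at_top" using c2 s by real_asymp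
      moreover have "((\<lambda>r. 4 * (el * (l + 1)) / r) \<longlongrightarrow> 0) at_top"
        by (intro tendsto_divide_0[OF tendsto_const] filterlim_at_top_imp_at_infinity filterlim_ident)
      ultimately have "((\<lambda>r. 2 * exp (- c2 * r powr s) + 4 * (el * (l + 1)) / r) \<longlongrightarrow> 2 * 0 + 0) at_top"
        by (intro tendsto_add tendsto_mult tendsto_const)
      then show ?thesis by simp
    qed
    show "eventually (\<lambda>r. 2 * exp (- c2 * r powr s) + 4 * (el * (l + 1)) / r = b r) at_top"
      using eventually_ge_at_top[of "1 :: real"] by eventually_elim (simp add: b_def field_simps)
  qed
  note log = log_ray_integral[OF l m(1,2)]
  have Eint: "set_integrable lborel {0<..} E"
    unfolding set_integrable_def
  proof (rule Bochner_Integration.integrable_bound)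
    show "integrable lborel (\<lambda>r. 1 / l * (indicator {0<..} r *\<^sub>R exp (- c2 * r powr s)))"
      using set_integrable_exp_powr[OF c2 s(1)] by (auto simp: set_integrable_def)
    show "(\<lambda>r. indicator {0<..} r *\<^sub>R E r) \<in> borel_measurable lborel" unfolding E_def by measurable
    have "cmod (E r) \<le> 1 / l * exp (- c2 * r powr s)" if "0 < r" for r
    proof -
      have "r * cos m \<le> 0" using that cos_stable_angle(1)[OF s] by (intro mult_nonneg_nonpos) (auto simp: m_def)
      then have "l \<le> cmod (complex_of_real l - r *\<^sub>R cis m)"
        using abs_Re_le_cmod[of "complex_of_real l - r *\<^sub>R cis m"] l by auto
      moreover have "cmod (E r) = exp (- c2 * r powr s) / cmod (complex_of_real l - r *\<^sub>R cis m)"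
        by (simp add: E_def norm_mult norm_divide c2_def mult.commute)
      ultimately show ?thesis using l by (simp add: frac_le)
    qed
    then show "AE r in lborel. norm (indicator {0<..} r *\<^sub>R E r) \<le> norm (1 / l * (indicator {0<..} r *\<^sub>R exp (- c2 * r powr s)))"
      using l by (intro AE_I2) (auto simp: indicator_def)
  qed
  have Kray: "cis m * K (r *\<^sub>R cis m) = E r - complex_of_real el *
      (cis m * (complex_of_real (l + 1) / ((r *\<^sub>R cis m + 1) * (complex_of_real l - r *\<^sub>R cis m))))" if "0 < r" for r
  proof -
    have "r *\<^sub>R cis m \<noteq> L"
    proof
      assume "r *\<^sub>R cis m = L"
      then have "Im (r *\<^sub>R cis m) = 0" by (simp add: L_def)
      moreover have "0 < sin m" using m by (intro sin_gt_zero) auto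
      ultimately show False using that by simp
    qed
    then have Kr: "K (r *\<^sub>R cis m) = exp (- (complex_of_real (r powr s) * cis (s * m))) / (complex_of_real l - r *\<^sub>R cis m)
        - complex_of_real el * (complex_of_real (l + 1) / ((r *\<^sub>R cis m + 1) * (complex_of_real l - r *\<^sub>R cis m)))"
      using Keq[OF polU[of r m]] polpow[of r m] that m by (simp add: L_def el_def)
    have "C * (X / D - e * Y) = C * X / D - e * (C * Y)" for C X D e Y :: complex
      by (simp add: right_diff_distrib)
    then show ?thesis by (simp only: Kr E_def)
  qed
  have KEint: "set_integrable lborel {0<..} (\<lambda>r. cis m * K (r *\<^sub>R cis m))"
  proof (rule set_integrable_cong[THEN iffD1, OF refl refl])
    show "set_integrable lborel {0<..} (\<lambda>r. E r - complex_of_real el *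
      (cis m * (complex_of_real (l + 1) / ((r *\<^sub>R cis m + 1) * (complex_of_real l - r *\<^sub>R cis m)))))"
      by (intro set_integral_diff Eint set_integrable_mult_right log(1))
  qed (simp add: Kray)
  have "0 = Im (LBINT r:{0<..}. cis m * K (r *\<^sub>R cis m))"
  proof (rule ray_integral_imaginary_part[symmetric, where \<delta> = "min (l / 2) (1 / 2)" and \<Delta> = "max (2 * l) 2" and b = b])
    show "K holomorphic_on {z. 0 < Re (z * cis (- (m / 2)))}" using Kh by (simp only: U_def)
    show "0 < min (l / 2) (1 / 2)" using l by simp
  qed (fact m real bound b0 binf KEint)+
  also have "(LBINT r:{0<..}. cis m * K (r *\<^sub>R cis m)) = (LBINT r:{0<..}. E r - complex_of_real el *
      (cis m * (complex_of_real (l + 1) / ((r *\<^sub>R cis m + 1) * (complex_of_real l - r *\<^sub>R cis m)))))"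
    by (intro set_lebesgue_integral_cong) (auto simp: Kray)
  also have "\<dots> = (LBINT r:{0<..}. E r) - complex_of_real el * (LBINT r:{0<..}.
      cis m * (complex_of_real (l + 1) / ((r *\<^sub>R cis m + 1) * (complex_of_real l - r *\<^sub>R cis m))))"
    by (subst set_integral_diff(2)[OF Eint set_integrable_mult_right[OF log(1)]]) (simp only: set_integral_mult_right)
  finally show ?thesis using log(2) by (simp add: el_def mult.commute)
qed

end

text \<open>By Fubini's theorem: integrating in \<open>v\<close> first turns
  \<open>exp (v z)\<close> into \<open>1 / (l - z)\<close> along the ray, and
  \<open>stable_ray_integral\<close> gives the value.\<close>

lemma stable_density_Laplace:
  assumes s: "0 < s" "s < 1" and l: "0 < l"
  shows "set_integrable lborel {0<..} (\<lambda>v. exp (- l * v) * stable_density s v)"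
    and "(LBINT v:{0<..}. exp (- l * v) * stable_density s v) = exp (- (l powr s))"
proof -
  define m where "m = stable_angle s"
  define c2 where "c2 = cos (s * m)"
  have c2: "0 < c2" and c1: "cos m < 0" using cos_stable_angle[OF s] by (simp_all add: c2_def m_def)
  note [measurable] = measurable_stable_integrand[OF s] measurable_stable_density[OF s]
  have i0: "set_integrable lborel {0<..} (\<lambda>v. v powr - 0 * stable_density s v)"
    by (rule stable_density_moment[OF s]) auto
  show "set_integrable lborel {0<..} (\<lambda>v. exp (- l * v) * stable_density s v)"
    unfolding set_integrable_def
    by (rule Bochner_Integration.integrable_bound[OF i0[unfolded set_integrable_def]])
      (use l in \<open>auto intro!: AE_I2 simp: indicator_def abs_mult mult_left_le_one_le\<close>)
  define J where "J = (\<lambda>(v, r). (indicator {0<..} v * exp (- l * v)) *\<^sub>R (indicator {0<..} r *\<^sub>R stable_integrand s v r))"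
  have nJ: "norm (J (v, r)) \<le> (indicator {0<..} v * exp (- l * v)) * (indicator {0<..} r * exp (- c2 * r powr s))" for v r
  proof (cases "0 < v \<and> 0 < r")
    case True
    then have "v * r * cos m \<le> 0" using c1 by (intro mult_nonneg_nonpos) auto
    then show ?thesis using True
      by (simp add: J_def norm_stable_integrand[OF s] m_def[symmetric] c2_def mult_le_cancel_right1)
  qed (auto simp: J_def)
  have e1: "integrable lborel (\<lambda>v. indicator {0<..} v * exp (- l * v))"
    using set_integrable_powr_exp[OF l, of 0] unfolding set_integrable_def
    by (rule Bochner_Integration.integrable_cong[THEN iffD1, rotated -1]) (auto simp: indicator_def)
  have e2: "integrable lborel (\<lambda>r. indicator {0<..} r * exp (- c2 * r powr s))"
    using set_integrable_exp_powr[OF c2 s(1)] by (simp add: set_integrable_def)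
  have "integrable (lborel \<Otimes>\<^sub>M lborel) (\<lambda>(v, r). (indicator {0<..} v * exp (- l * v)) * (indicator {0<..} r * exp (- c2 * r powr s)))"
  proof (rule lborel_pair.Fubini_integrable)
    have "(LINT r|lborel. norm (case (v, r) of (v, r) \<Rightarrow> (indicator {0<..} v * exp (- l * v)) * (indicator {0<..} r * exp (- c2 * r powr s))))
        = (indicator {0<..} v * exp (- l * v)) * (LINT r|lborel. indicator {0<..} r * exp (- c2 * r powr s))" for v :: real
      by (simp add: abs_mult)
    then show "integrable lborel (\<lambda>v. LINT r|lborel. norm (case (v, r) of (v, r) \<Rightarrow> (indicator {0<..} v * exp (- l * v)) * (indicator {0<..} r * exp (- c2 * r powr s))))"
      using e1 by simp
    show "AE v in lborel. integrable lborel (\<lambda>r. case (v, r) of (v, r) \<Rightarrow> (indicator {0<..} v * exp (- l * v)) * (indicator {0<..} r * exp (- c2 * r powr s)))"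
      using e2 by (intro AE_I2) auto
  qed measurable
  then have Ji: "integrable (lborel \<Otimes>\<^sub>M lborel) J"
  proof (rule Bochner_Integration.integrable_bound)
    have "(\<lambda>p. (indicator {0<..} (fst p) * exp (- l * fst p)) *\<^sub>R (indicator {0<..} (snd p) *\<^sub>R stable_integrand s (fst p) (snd p))) \<in> borel_measurable (lborel \<Otimes>\<^sub>M lborel)"
      by measurable
    then show "J \<in> borel_measurable (lborel \<Otimes>\<^sub>M lborel)" by (simp add: J_def case_prod_unfold)
    show "AE p in lborel \<Otimes>\<^sub>M lborel. norm (J p) \<le> norm (case p of (v, r) \<Rightarrow> (indicator {0<..} v * exp (- l * v)) * (indicator {0<..} r * exp (- c2 * r powr s)))"
      using nJ by (intro AE_I2) (auto simp: abs_mult)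
  qed
  have inner_r: "(LINT r|lborel. J (v, r)) = (indicator {0<..} v * exp (- l * v)) *\<^sub>R (LBINT r:{0<..}. stable_integrand s v r)" for v
    unfolding J_def set_lebesgue_integral_def prod.case by (rule integral_scaleR_right)
  have inner_v: "(LINT v|lborel. J (v, r)) = indicator {0<..} r *\<^sub>R
      (cis m * exp (- (complex_of_real (r powr s) * cis (s * m))) / (complex_of_real l - r *\<^sub>R cis m))" for r
  proof (cases "0 < r")
    case True
    define w where "w = r *\<^sub>R cis m - complex_of_real l"
    have "r * cos m \<le> 0" using True c1 by (intro mult_nonneg_nonpos) auto
    then have w: "Re w < 0" using l by (simp add: w_def)
    have "J (v, r) = (cis m * exp (- (complex_of_real (r powr s) * cis (s * m)))) * (indicator {0<..} v *\<^sub>R exp (complex_of_real v * w))" for v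
    proof (cases "0 < v")
      case True
      have "complex_of_real (v * r) * cis m - complex_of_real (r powr s) * cis (s * m)
          = - (complex_of_real (r powr s) * cis (s * m)) + complex_of_real v * w + complex_of_real (l * v)"
        by (simp add: w_def algebra_simps scaleR_conv_of_real)
      then have "stable_integrand s v r = cis m * (exp (- (complex_of_real (r powr s) * cis (s * m))) * exp (complex_of_real v * w) * complex_of_real (exp (l * v)))"
        unfolding stable_integrand_def m_def[symmetric] by (simp only: exp_add exp_of_real)
      moreover have "complex_of_real (exp (- l * v)) * complex_of_real (exp (l * v)) = 1"
        by (simp flip: of_real_mult exp_add)
      ultimately show ?thesis using True \<open>0 < r\<close>
        by (simp add: J_def scaleR_conv_of_real mult_ac)
    qed (simp add: J_def)
    then have "(LINT v|lborel. J (v, r)) = (cis m * exp (- (complex_of_real (r powr s) * cis (s * m)))) * (LBINT v:{0<..}. exp (complex_of_real v * w))"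
      by (simp only: set_lebesgue_integral_def integral_mult_right_zero)
    also have "(LBINT v:{0<..}. exp (complex_of_real v * w)) = - 1 / w" by (rule exp_ray_integral(2)[OF s w])
    also have "- 1 / w = 1 / (complex_of_real l - r *\<^sub>R cis m)" unfolding w_def by (metis minus_diff_eq minus_divide_divide minus_minus)
    finally show ?thesis using True by simp
  qed (simp add: J_def)
  have "complex_of_real (indicator {0<..} v *\<^sub>R (exp (- l * v) * stable_density s v)) = complex_of_real (Im (LINT r|lborel. J (v, r)) / pi)" for v
    by (simp add: inner_r stable_density_def)
  then have "(LBINT v:{0<..}. exp (- l * v) * stable_density s v) = (LINT v|lborel. Im (LINT r|lborel. J (v, r)) / pi)"
    unfolding set_lebesgue_integral_def by (simp only: of_real_eq_iff)
  also have "\<dots> = Im (LINT v|lborel. (LINT r|lborel. J (v, r))) / pi"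
    using lborel_pair.integrable_fst'[OF Ji] by simp
  also have "(LINT v|lborel. (LINT r|lborel. J (v, r))) = (LINT r|lborel. (LINT v|lborel. J (v, r)))"
    using lborel_pair.Fubini_integral[of "\<lambda>v r. J (v, r)"] Ji by (simp add: case_prod_unfold)
  also have "\<dots> = (LBINT r:{0<..}. cis m * exp (- (complex_of_real (r powr s) * cis (s * m))) / (complex_of_real l - r *\<^sub>R cis m))"
    by (simp only: inner_v set_lebesgue_integral_def)
  also have "Im \<dots> = pi * exp (- (l powr s))" unfolding m_def by (rule stable_ray_integral[OF s l])
  finally show "(LBINT v:{0<..}. exp (- l * v) * stable_density s v) = exp (- (l powr s))" by simp
qed

section \<open>Uniqueness of Laplace transforms\<close>

text \<open>Substituting \<open>x = exp (- v)\<close> turns the Laplace transform at the integers into the moments of a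
  signed measure on the unit interval.\<close>

lemma Laplace_zero_imp_AE_zero:
  assumes int: "\<And>l. 0 < l \<Longrightarrow> set_integrable lborel {0<..} (\<lambda>v. exp (- l * v) * d v)"
    and zero: "\<And>l. 0 < l \<Longrightarrow> (LBINT v:{0<..}. exp (- l * v) * d v) = (0 :: real)"
  shows "AE v in lborel. 0 < v \<longrightarrow> d v = 0"
proof -
  define D where "D v = indicator {0<..} v *\<^sub>R (exp (- 1 * v) * d v)" for v
  have Di: "integrable lborel D" using int[of 1] by (simp add: D_def[abs_def] set_integrable_def)
  then have [measurable]: "D \<in> borel_measurable borel" by auto
  have Dmom: "(LINT v|lborel. exp (- v) ^ n * D v) = 0" for n :: nat
  proof -
    have "exp (- v) ^ n * D v = indicator {0<..} v *\<^sub>R (exp (- (real n + 1) * v) * d v)" for v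
    proof -
      have "exp (- v) ^ n * exp (- 1 * v) = exp (- (real n + 1) * v)"
        by (simp add: exp_of_nat_mult[symmetric] exp_add[symmetric] algebra_simps)
      then show ?thesis unfolding D_def by (simp add: mult.commute)
    qed
    then show ?thesis using zero[of "real n + 1"] by (simp add: set_lebesgue_integral_def)
  qed
  have Dbound: "integrable lborel (\<lambda>v. \<phi> (exp (- v)) * D v)" if \<phi>: "continuous_on {0..1} \<phi>" for \<phi> :: "real \<Rightarrow> real"
  proof -
    have "bounded (\<phi> ` {0..1})" by (intro compact_imp_bounded compact_continuous_image \<phi> compact_Icc)
    then obtain B where "\<forall>y\<in>\<phi> ` {0..1}. \<bar>y\<bar> \<le> B" unfolding bounded_iff real_norm_def by blast
    then have B: "\<And>x. x \<in> {0..1} \<Longrightarrow> \<bar>\<phi> x\<bar> \<le> B" by blast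
    have cm: "(\<lambda>x. indicator {0..1} x *\<^sub>R \<phi> x) \<in> borel_measurable borel"
      by (rule borel_measurable_continuous_on_indicator[OF _ \<phi>]) simp
    have eq: "\<phi> (exp (- v)) * D v = (indicator {0..1} (exp (- v)) *\<^sub>R \<phi> (exp (- v))) * D v" for v
      by (auto simp: D_def indicator_def)
    show ?thesis
    proof (rule Bochner_Integration.integrable_bound)
      show "integrable lborel (\<lambda>v. B * D v)" using Di by simp
      show "(\<lambda>v. \<phi> (exp (- v)) * D v) \<in> borel_measurable lborel"
        unfolding eq by (intro borel_measurable_times measurable_compose[OF _ cm]) measurable
      have "\<bar>\<phi> (exp (- v)) * D v\<bar> \<le> \<bar>B * D v\<bar>" for v
      proof (cases "0 < v")
        case True
        then have "\<bar>\<phi> (exp (- v))\<bar> \<le> \<bar>B\<bar>" using B[of "exp (- v)"] by simp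
        then show ?thesis unfolding abs_mult by (rule mult_right_mono) simp
      qed (simp add: D_def)
      then show "AE v in lborel. norm (\<phi> (exp (- v)) * D v) \<le> norm (B * D v)" by simp
    qed
  qed
  have Dcont: "(LINT v|lborel. \<phi> (exp (- v)) * D v) = 0" if \<phi>: "continuous_on {0..1} \<phi>" for \<phi> :: "real \<Rightarrow> real"
  proof (rule ccontr)
    define I where "I = (LINT v|lborel. \<phi> (exp (- v)) * D v)"
    assume "(LINT v|lborel. \<phi> (exp (- v)) * D v) \<noteq> 0"
    then have I0: "0 < \<bar>I\<bar>" by (simp add: I_def)
    define N where "N = (LINT v|lborel. \<bar>D v\<bar>)"
    have N0: "0 \<le> N" unfolding N_def by (rule Bochner_Integration.integral_nonneg) simp
    \<comment> \<open>This makes \<open>e * N < \<bar>I\<bar>\<close>, where \<open>N\<close> is the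
      total variation; a polynomial within \<open>e\<close> of \<open>\<phi>\<close> then
      contradicts \<open>I \<noteq> 0\<close>.\<close>
    define e where "e = \<bar>I\<bar> / (N + 1)"
    have e: "0 < e" using I0 N0 by (simp add: e_def)
    obtain p where p: "real_polynomial_function p" "\<And>x. x \<in> {0..1} \<Longrightarrow> \<bar>\<phi> x - p x\<bar> < e"
      using Stone_Weierstrass_real_polynomial_function[OF compact_Icc \<phi> e] by blast
    obtain a n where an: "p = (\<lambda>x. \<Sum>i\<le>n. a i * x ^ i)"
      using p(1) real_polynomial_function_iff_sum by blast
    have "(LINT v|lborel. p (exp (- v)) * D v) = (\<Sum>i\<le>n. a i * (LINT v|lborel. exp (- v) ^ i * D v))"
      unfolding an sum_distrib_right
      by (subst Bochner_Integration.integral_sum) (auto simp: mult.assoc intro!: integrable_mult_right Dbound[of "\<lambda>x. x ^ _"] continuous_intros)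
    then have p0: "(LINT v|lborel. p (exp (- v)) * D v) = 0" by (simp add: Dmom)
    have pc: "continuous_on {0..1} p" unfolding an by (intro continuous_intros)
    have "I = (LINT v|lborel. \<phi> (exp (- v)) * D v - p (exp (- v)) * D v)"
      using Dbound[OF \<phi>] Dbound[OF pc] p0 by (simp add: I_def)
    also have "\<bar>\<dots>\<bar> \<le> (LINT v|lborel. \<bar>\<phi> (exp (- v)) * D v - p (exp (- v)) * D v\<bar>)" by (rule integral_abs_bound)
    also have "\<dots> \<le> (LINT v|lborel. e * \<bar>D v\<bar>)"
    proof (rule integral_mono)
      show "integrable lborel (\<lambda>v. \<bar>\<phi> (exp (- v)) * D v - p (exp (- v)) * D v\<bar>)"
        using Dbound[OF \<phi>] Dbound[OF pc] by auto
      show "integrable lborel (\<lambda>v. e * \<bar>D v\<bar>)" using Di by auto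
      fix v
      show "\<bar>\<phi> (exp (- v)) * D v - p (exp (- v)) * D v\<bar> \<le> e * \<bar>D v\<bar>"
      proof (cases "0 < v")
        case True
        then show ?thesis using p(2)[of "exp (- v)"]
          by (simp add: abs_mult mult_right_mono flip: left_diff_distrib)
      qed (simp add: D_def)
    qed
    also have "\<dots> = e * N" by (simp add: N_def)
    finally have "\<bar>I\<bar> \<le> e * N" .
    then have "\<bar>I\<bar> * (N + 1) \<le> \<bar>I\<bar> * N" using N0 by (simp add: e_def field_simps)
    then show False using I0 by (simp add: distrib_left)
  qed
  \<comment> \<open>\<open>P 1\<close> and \<open>P (- 1)\<close> have the positive and the negative
    part of \<open>D\<close> as densities. Their images under \<open>exp (- v)\<close> sit in the
    unit interval, where cosine and sine are continuous test functions, so the characters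
    agree.\<close>
  define P where "P e = density lborel (\<lambda>v. ennreal (max 0 (e * D v)))" for e :: real
  have Pint: "integrable lborel (\<lambda>v. max 0 (e * D v))" for e
    using Di by (intro integrable_max) auto
  have fin: "finite_measure (P e)" for e
  proof (rule finite_measureI)
    have "emeasure (P e) (space (P e)) = (\<integral>\<^sup>+ v. ennreal (max 0 (e * D v)) \<partial>lborel)"
      by (simp add: P_def emeasure_density)
    also have "\<dots> = ennreal (LINT v|lborel. max 0 (e * D v))" by (rule nn_integral_eq_integral[OF Pint]) simp
    finally show "emeasure (P e) (space (P e)) \<noteq> \<infinity>" by simp
  qed
  define R where "R e = distr (P e) borel (\<lambda>v. exp (- v))" for e
  have "R 1 = R (- 1)"
  proof (rule finite_measure_eqI_char)
    have "finite_measure (R e)" for e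
      unfolding R_def by (rule finite_measure.finite_measure_distr[OF fin]) (simp add: P_def)
    then show "finite_measure (R 1)" "finite_measure (R (- 1))" by auto
    show "sets (R 1) = sets borel" "sets (R (- 1)) = sets borel" by (simp_all add: R_def)
    fix t :: real
    have ch: "(LINT x|R e. cis (t * x)) = (LINT v|lborel. max 0 (e * D v) *\<^sub>R cis (t * exp (- v)))" for e
    proof -
      have "(LINT x|R e. cis (t * x)) = (LINT v|P e. cis (t * exp (- v)))"
        unfolding R_def by (rule integral_distr) (simp_all add: P_def)
      also have "\<dots> = (LINT v|lborel. max 0 (e * D v) *\<^sub>R cis (t * exp (- v)))"
        unfolding P_def by (rule integral_density) auto
      finally show ?thesis .
    qed
    have ci: "integrable lborel (\<lambda>v. max 0 (e * D v) *\<^sub>R cis (t * exp (- v)))" for e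
      by (rule Bochner_Integration.integrable_bound[OF Pint[of e]]) auto
    have "(LINT x|R 1. cis (t * x)) - (LINT x|R (- 1). cis (t * x))
        = (LINT v|lborel. max 0 (1 * D v) *\<^sub>R cis (t * exp (- v)) - max 0 (- 1 * D v) *\<^sub>R cis (t * exp (- v)))"
      unfolding ch using ci[of 1] ci[of "- 1"] by simp
    also have "\<dots> = (LINT v|lborel. complex_of_real (cos (t * exp (- v)) * D v) + \<i> * complex_of_real (sin (t * exp (- v)) * D v))"
      by (intro Bochner_Integration.integral_cong refl) (auto simp: complex_eq_iff max_def)
    also have "\<dots> = (LINT v|lborel. complex_of_real (cos (t * exp (- v)) * D v)) + (LINT v|lborel. \<i> * complex_of_real (sin (t * exp (- v)) * D v))"
      by (intro Bochner_Integration.integral_add integrable_mult_right integrable_of_real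
          Dbound[of "\<lambda>x. cos (t * x)"] Dbound[of "\<lambda>x. sin (t * x)"] continuous_intros)
    also have "\<dots> = 0"
      using Dcont[of "\<lambda>x. cos (t * x)"] Dcont[of "\<lambda>x. sin (t * x)"]
      by (simp only: integral_mult_right_zero integral_complex_of_real) (simp add: continuous_intros)
    finally show "(LINT x|R 1. cis (t * x)) = (LINT x|R (- 1). cis (t * x))" by simp
  qed
  moreover have "P e = distr (R e) borel (\<lambda>x. - ln x)" for e
  proof -
    have "distr (R e) borel (\<lambda>x. - ln x) = distr (P e) borel ((\<lambda>x. - ln x) \<circ> (\<lambda>v. exp (- v)))"
      unfolding R_def by (rule distr_distr) (simp_all add: P_def)
    also have "\<dots> = P e" by (simp add: comp_def distr_id2 P_def)
    finally show ?thesis by simp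
  qed
  ultimately have "P 1 = P (- 1)" by metis
  then have "AE v in lborel. ennreal (max 0 (1 * D v)) = ennreal (max 0 (- 1 * D v))"
    unfolding P_def by (intro sigma_finite_measure.density_unique[OF lborel.sigma_finite_measure_axioms]) auto
  then show ?thesis
    by eventually_elim (auto simp: D_def max_def split: if_splits)
qed

section \<open>The subordinator\<close>

text \<open>Self-similarity of the stable law: the density at time \<open>t\<close> is the one at
  time 1, stretched by \<open>t powr (1 / s)\<close>.\<close>

definition subord :: "real \<Rightarrow> real \<Rightarrow> real \<Rightarrow> real" where
  "subord s t v = indicator {0<..} v * (t powr (- 1 / s) * stable_density s (t powr (- 1 / s) * v))"

context
  fixes s :: real
  assumes s: "0 < s" "s < 1"
begin

lemma stable_density_integrable: "set_integrable lborel {0<..} (stable_density s)"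
  using stable_density_moment[OF s, of 0] by (rule set_integrable_cong[THEN iffD1, rotated -1]) auto

lemma subord_measurable [measurable]: "subord s t \<in> borel_measurable borel"
proof -
  note [measurable] = measurable_stable_density[OF s]
  show ?thesis unfolding subord_def by measurable
qed

lemma subord_integral:
  assumes "0 < t"
  shows "(LINT v|lborel. G v * subord s t v) = (LBINT v:{0<..}. G (t powr (1 / s) * v) * stable_density s v)"
proof -
  define c where "c = t powr (1 / s)"
  have c: "0 < c" "t powr (- 1 / s) = 1 / c" using assms by (simp_all add: c_def powr_minus divide_inverse)
  have "(LINT v|lborel. G v * subord s t v) = c * (LINT v|lborel. G (c * v) * subord s t (c * v))"
    using lborel_integral_real_affine[of c "\<lambda>v. G v * subord s t v" 0] c by simp
  also have "\<dots> = (LINT v|lborel. c * (G (c * v) * subord s t (c * v)))" by simp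
  also have "\<dots> = (LINT v|lborel. indicator {0<..} v *\<^sub>R (G (c * v) * stable_density s v))"
    using c by (intro Bochner_Integration.integral_cong refl) (auto simp: subord_def indicator_def zero_less_mult_iff)
  finally show ?thesis by (simp add: set_lebesgue_integral_def c_def)
qed

lemma subord_integrable:
  assumes "0 < t"
  shows "integrable lborel (subord s t)"
proof -
  define c where "c = t powr (- 1 / s)"
  have c: "0 < c" using assms by (simp add: c_def)
  have "integrable lborel (\<lambda>v. c * (indicator {0<..} (0 + c * v) *\<^sub>R stable_density s (0 + c * v)))"
    using stable_density_integrable c unfolding set_integrable_def
    by (intro integrable_mult_right lborel_integrable_real_affine) auto
  then show ?thesis
    by (rule Bochner_Integration.integrable_cong[THEN iffD1, rotated -1])
      (use c in \<open>auto simp: subord_def c_def indicator_def zero_less_mult_iff\<close>)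
qed

lemma subord_Laplace:
  assumes "0 < t" "0 < l"
  shows "(LINT v|lborel. exp (- l * v) * subord s t v) = exp (- t * l powr s)"
proof -
  have "(LINT v|lborel. exp (- l * v) * subord s t v) = (LBINT v:{0<..}. exp (- (l * t powr (1 / s)) * v) * stable_density s v)"
    by (simp add: subord_integral[OF assms(1)] mult.assoc)
  also have "\<dots> = exp (- ((l * t powr (1 / s)) powr s))"
    using assms by (intro stable_density_Laplace(2)[OF s]) auto
  also have "(l * t powr (1 / s)) powr s = t * l powr s"
    using assms s by (simp add: powr_mult powr_powr)
  finally show ?thesis by simp
qed

lemma subord_zero [simp]: "v \<le> 0 \<Longrightarrow> subord s t v = 0"
  by (simp add: subord_def)

lemma subord_set_integrable_exp:
  assumes "0 < t" "0 < l"
  shows "set_integrable lborel {0<..} (\<lambda>v. exp (- l * v) * subord s t v)"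
  unfolding set_integrable_def
  by (rule Bochner_Integration.integrable_bound[OF subord_integrable[OF assms(1)]])
    (use assms in \<open>auto intro!: AE_I2 simp: indicator_def abs_mult mult_left_le_one_le\<close>)

lemma subord_set_Laplace:
  assumes "0 < t" "0 < l"
  shows "(LBINT v:{0<..}. exp (- l * v) * subord s t v) = exp (- t * l powr s)"
  unfolding subord_Laplace[OF assms, symmetric] set_lebesgue_integral_def
  by (intro Bochner_Integration.integral_cong refl) (auto simp: indicator_def)

lemma subordinator_density_Laplace:
  assumes "0 < t" "0 < l"
  shows "set_integrable lborel {0<..} (\<lambda>v. exp (- l * v) * subordinator_density s t v)"
    and "(LBINT v:{0<..}. exp (- l * v) * subordinator_density s t v) = exp (- t * l powr s)"
proof -
  have "\<exists>\<eta>. \<forall>l>0. set_integrable lborel {0<..} (\<lambda>v. exp (- l * v) * \<eta> v) \<and>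
      (LBINT v:{0<..}. exp (- l * v) * \<eta> v) = exp (- t * l powr s)"
    using subord_set_integrable_exp[OF assms(1)] subord_set_Laplace[OF assms(1)] by blast
  from someI_ex[OF this]
  show "set_integrable lborel {0<..} (\<lambda>v. exp (- l * v) * subordinator_density s t v)"
    "(LBINT v:{0<..}. exp (- l * v) * subordinator_density s t v) = exp (- t * l powr s)"
    using assms(2) unfolding subordinator_density_def by auto
qed

text \<open>\<open>subordinator_density\<close> is some function with the right Laplace transform;
  uniqueness identifies it almost everywhere with the explicit density.\<close>

lemma subordinator_density_AE:
  assumes "0 < t"
  shows "AE v in lborel. 0 < v \<longrightarrow> subordinator_density s t v = subord s t v"
proof -
  note * = subordinator_density_Laplace[OF assms]
  have "AE v in lborel. 0 < v \<longrightarrow> subordinator_density s t v - subord s t v = 0"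
  proof (rule Laplace_zero_imp_AE_zero)
    fix l :: real assume l: "0 < l"
    show "set_integrable lborel {0<..} (\<lambda>v. exp (- l * v) * (subordinator_density s t v - subord s t v))"
      unfolding right_diff_distrib by (intro set_integral_diff *[OF l] subord_set_integrable_exp[OF assms l])
    show "(LBINT v:{0<..}. exp (- l * v) * (subordinator_density s t v - subord s t v)) = 0"
      unfolding right_diff_distrib
      by (subst set_integral_diff(2)[OF *(1)[OF l] subord_set_integrable_exp[OF assms l]])
        (simp only: *(2)[OF l] subord_set_Laplace[OF assms l] diff_self)
  qed
  then show ?thesis by simp
qed

lemma subordinator_density_integral:
  assumes "0 < t" and [measurable]: "(\<lambda>v. indicator {0<..} v * G v) \<in> borel_measurable borel"
  shows "(LBINT v:{0<..}. G v * subordinator_density s t v) = (LBINT v:{0<..}. G (t powr (1 / s) * v) * stable_density s v)"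
proof -
  \<comment> \<open>Measurability of the chosen function is recovered from the integrability of its
    product with \<open>exp (- v)\<close>; multiplication by \<open>exp v\<close> undoes the
    weight.\<close>
  have [measurable]: "(\<lambda>v. indicator {0<..} v *\<^sub>R (exp (- 1 * v) * subordinator_density s t v)) \<in> borel_measurable borel"
    using subordinator_density_Laplace(1)[OF assms(1), of 1] unfolding set_integrable_def by auto
  have "(LBINT v:{0<..}. G v * subordinator_density s t v) = (LINT v|lborel. (indicator {0<..} v * G v) * subord s t v)"
    unfolding set_lebesgue_integral_def
  proof (rule integral_cong_AE)
    have eq: "indicator {0<..} v *\<^sub>R (G v * subordinator_density s t v)
      = (indicator {0<..} v * G v) * (exp v * (indicator {0<..} v *\<^sub>R (exp (- 1 * v) * subordinator_density s t v)))" for v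
      by (simp add: indicator_def exp_minus)
    show "(\<lambda>v. indicator {0<..} v *\<^sub>R (G v * subordinator_density s t v)) \<in> borel_measurable lborel"
      unfolding eq by measurable
    show "AE v in lborel. indicator {0<..} v *\<^sub>R (G v * subordinator_density s t v) = (indicator {0<..} v * G v) * subord s t v"
      using subordinator_density_AE[OF assms(1)] by eventually_elim (auto simp: indicator_def)
  qed measurable
  also have "\<dots> = (LBINT v:{0<..}. (indicator {0<..} (t powr (1 / s) * v) * G (t powr (1 / s) * v)) * stable_density s v)"
    by (rule subord_integral[OF assms(1)])
  also have "\<dots> = (LBINT v:{0<..}. G (t powr (1 / s) * v) * stable_density s v)"
    using assms(1) by (intro set_lebesgue_integral_cong) auto
  finally show ?thesis .
qed

section \<open>The subordinator densities form a convolution semigroup\<close>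

lemma subord_shift_integrable:
  assumes "0 < a" "0 < b"
  shows "integrable (lborel \<Otimes>\<^sub>M lborel) (\<lambda>(u, w). subord s a (w - u) * subord s b u)"
proof (rule lborel_pair.Fubini_integrable)
  have i: "integrable lborel (\<lambda>w. subord s a (w - u))" for u
    using lborel_integrable_real_affine[OF subord_integrable[OF assms(1)], of 1 "- u"] by simp
  have "(LINT w|lborel. norm (case (u, w) of (u, w) \<Rightarrow> subord s a (w - u) * subord s b u))
      = (LINT w|lborel. \<bar>subord s a w\<bar>) * \<bar>subord s b u\<bar>" for u
    using lborel_integral_real_affine[of 1 "\<lambda>w. \<bar>subord s a w\<bar>" "- u"] by (simp add: abs_mult)
  then show "integrable lborel (\<lambda>u. LINT w|lborel. norm (case (u, w) of (u, w) \<Rightarrow> subord s a (w - u) * subord s b u))"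
    using subord_integrable[OF assms(2)] by simp
  show "AE u in lborel. integrable lborel (\<lambda>w. case (u, w) of (u, w) \<Rightarrow> subord s a (w - u) * subord s b u)"
    using i by auto
qed measurable

lemma subord_convolution:
  assumes a: "0 < a" and b: "0 < b" and H [measurable]: "H \<in> borel_measurable borel" and K: "\<And>w. \<bar>H w\<bar> \<le> K"
  shows "(LINT w|lborel. H w * (LINT u|lborel. subord s a (w - u) * subord s b u))
      = (LINT u|lborel. (LINT v|lborel. H (v + u) * subord s a v) * subord s b u)"
    and "integrable lborel (\<lambda>w. LINT u|lborel. subord s a (w - u) * subord s b u)"
proof -
  have "integrable (lborel \<Otimes>\<^sub>M lborel) (\<lambda>p. K * (case p of (u, w) \<Rightarrow> subord s a (w - u) * subord s b u))"
    by (intro integrable_mult_right subord_shift_integrable a b)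
  then have i: "integrable (lborel \<Otimes>\<^sub>M lborel) (\<lambda>(u, w). H w * (subord s a (w - u) * subord s b u))"
  proof (rule Bochner_Integration.integrable_bound)
    have "\<bar>H w * x\<bar> \<le> \<bar>K * x\<bar>" for w x
      unfolding abs_mult using K[of w] by (intro mult_right_mono) auto
    then show "AE p in lborel \<Otimes>\<^sub>M lborel. norm (case p of (u, w) \<Rightarrow> H w * (subord s a (w - u) * subord s b u))
        \<le> norm (K * (case p of (u, w) \<Rightarrow> subord s a (w - u) * subord s b u))"
      by (intro AE_I2) (auto simp: split_beta)
  qed measurable
  have "(LINT w|lborel. H w * (LINT u|lborel. subord s a (w - u) * subord s b u))
      = (LINT w|lborel. (LINT u|lborel. H w * (subord s a (w - u) * subord s b u)))"
    by (simp only: integral_mult_right_zero)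
  also have "\<dots> = (LINT u|lborel. (LINT w|lborel. H w * (subord s a (w - u) * subord s b u)))"
    by (rule lborel_pair.Fubini_integral[OF i])
  also have "\<dots> = (LINT u|lborel. (LINT v|lborel. H (v + u) * subord s a v) * subord s b u)"
  proof (rule Bochner_Integration.integral_cong[OF refl])
    fix u
    have "(LINT w|lborel. H w * (subord s a (w - u) * subord s b u)) = (LINT w|lborel. (H w * subord s a (w - u)) * subord s b u)"
      by (simp only: mult.assoc)
    also have "\<dots> = (LINT w|lborel. H w * subord s a (w - u)) * subord s b u" by (rule integral_mult_left_zero)
    also have "(LINT w|lborel. H w * subord s a (w - u)) = (LINT v|lborel. H (v + u) * subord s a v)"
      using lborel_integral_real_affine[of 1 "\<lambda>w. H w * subord s a (w - u)" u] by (simp add: add.commute)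
    finally show "(LINT w|lborel. H w * (subord s a (w - u) * subord s b u)) = (LINT v|lborel. H (v + u) * subord s a v) * subord s b u" .
  qed
  finally show "(LINT w|lborel. H w * (LINT u|lborel. subord s a (w - u) * subord s b u))
      = (LINT u|lborel. (LINT v|lborel. H (v + u) * subord s a v) * subord s b u)" .
  have "integrable (lborel \<Otimes>\<^sub>M lborel) (\<lambda>(w, u). subord s a (w - u) * subord s b u)"
    using subord_shift_integrable[OF a b] by (subst lborel_pair.integrable_product_swap_iff[symmetric]) (simp add: case_prod_unfold)
  from lborel_pair.integrable_fst'[OF this]
  show "integrable lborel (\<lambda>w. LINT u|lborel. subord s a (w - u) * subord s b u)" by simp
qed

text \<open>The Laplace transform of the convolution is the product of the two transforms, so
  uniqueness of Laplace transforms applies.\<close>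

lemma subord_semigroup_AE:
  assumes a: "0 < a" and b: "0 < b"
  shows "AE w in lborel. 0 < w \<longrightarrow> (LINT u|lborel. subord s a (w - u) * subord s b u) = subord s (a + b) w"
proof -
  define \<zeta> where "\<zeta> w = (LINT u|lborel. subord s a (w - u) * subord s b u)" for w
  have zi: "integrable lborel \<zeta>"
    unfolding \<zeta>_def by (rule subord_convolution(2)[OF a b, of "\<lambda>_. 0" 0]) auto
  have ab: "0 < a + b" using a b by simp
  have "AE w in lborel. 0 < w \<longrightarrow> \<zeta> w - subord s (a + b) w = 0"
  proof (rule Laplace_zero_imp_AE_zero)
    fix l :: real assume l: "0 < l"
    have 1: "set_integrable lborel {0<..} (\<lambda>w. exp (- l * w) * \<zeta> w)"
      unfolding set_integrable_def
      by (rule Bochner_Integration.integrable_bound[OF zi])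
        (use l zi in \<open>auto intro!: AE_I2 simp: indicator_def abs_mult mult_left_le_one_le\<close>)
    then show "set_integrable lborel {0<..} (\<lambda>w. exp (- l * w) * (\<zeta> w - subord s (a + b) w))"
      unfolding right_diff_distrib by (intro set_integral_diff subord_set_integrable_exp[OF ab l])
    define H where "H w = indicator {0<..} w * exp (- l * w)" for w :: real
    have Hm: "H \<in> borel_measurable borel" unfolding H_def by measurable
    have "(LBINT w:{0<..}. exp (- l * w) * \<zeta> w) = (LINT w|lborel. H w * \<zeta> w)"
      by (simp add: set_lebesgue_integral_def H_def mult.assoc)
    also have "\<dots> = (LINT u|lborel. (LINT v|lborel. H (v + u) * subord s a v) * subord s b u)"
      unfolding \<zeta>_def by (rule subord_convolution(1)[OF a b Hm, of 1]) (use l in \<open>auto simp: H_def indicator_def\<close>)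
    also have "\<dots> = (LINT u|lborel. exp (- a * l powr s) * (exp (- l * u) * subord s b u))"
    proof (rule Bochner_Integration.integral_cong[OF refl])
      fix u :: real
      show "(LINT v|lborel. H (v + u) * subord s a v) * subord s b u = exp (- a * l powr s) * (exp (- l * u) * subord s b u)"
      proof (cases "0 < u")
        case True
        have "H (v + u) * subord s a v = exp (- l * u) * (exp (- l * v) * subord s a v)" for v
          using True by (cases "0 < v") (simp_all add: H_def exp_add[symmetric] algebra_simps)
        then have "(LINT v|lborel. H (v + u) * subord s a v) = exp (- l * u) * exp (- a * l powr s)"
          using subord_Laplace[OF a l] by (simp only: integral_mult_right_zero)
        then show ?thesis by simp
      qed simp
    qed
    also have "\<dots> = exp (- a * l powr s) * exp (- b * l powr s)"
      using subord_Laplace[OF b l] by (simp only: integral_mult_right_zero)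
    also have "\<dots> = exp (- (a + b) * l powr s)" by (simp add: exp_add[symmetric] algebra_simps)
    finally have 2: "(LBINT w:{0<..}. exp (- l * w) * \<zeta> w) = exp (- (a + b) * l powr s)" .
    show "(LBINT w:{0<..}. exp (- l * w) * (\<zeta> w - subord s (a + b) w)) = 0"
      unfolding right_diff_distrib
      by (subst set_integral_diff(2)[OF 1 subord_set_integrable_exp[OF ab l]])
        (simp only: 2 subord_set_Laplace[OF ab l] diff_self)
  qed
  then show ?thesis by (simp add: \<zeta>_def)
qed

lemma subord_semigroup:
  assumes a: "0 < a" and b: "0 < b" and H [measurable]: "H \<in> borel_measurable borel" and K: "\<And>w. \<bar>H w\<bar> \<le> K"
  shows "(LINT u|lborel. (LINT v|lborel. H (v + u) * subord s a v) * subord s b u) = (LINT w|lborel. H w * subord s (a + b) w)"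
proof -
  have [measurable]: "(\<lambda>w. LINT u|lborel. subord s a (w - u) * subord s b u) \<in> borel_measurable borel"
    using subord_convolution(2)[OF a b H K] by auto
  have "(LINT u|lborel. (LINT v|lborel. H (v + u) * subord s a v) * subord s b u)
    = (LINT w|lborel. H w * (LINT u|lborel. subord s a (w - u) * subord s b u))"
    by (rule subord_convolution(1)[OF a b H K, symmetric])
  also have "\<dots> = (LINT w|lborel. H w * subord s (a + b) w)"
  proof (rule integral_cong_AE)
    have z: "subord s a (w - u) * subord s b u = 0" if "w \<le> 0" for w u
      using that by (cases "0 < u") auto
    show "AE w in lborel. H w * (LINT u|lborel. subord s a (w - u) * subord s b u) = H w * subord s (a + b) w"
      using subord_semigroup_AE[OF a b]
    proof eventually_elim
      case (elim w)
      then show ?case by (cases "0 < w") (simp_all add: z)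
    qed
  qed measurable
  finally show ?thesis .
qed

end

section \<open>The fractional semigroup\<close>

lemma directional_mean_value:
  fixes F :: "'a::real_normed_vector \<Rightarrow> real"
  assumes "\<And>y. ((\<lambda>u. F (y + u *\<^sub>R a)) has_real_derivative D y) (at 0)" and "\<And>y. \<bar>D y\<bar> \<le> B"
  shows "\<bar>F (x + u *\<^sub>R a) - F x\<bar> \<le> \<bar>u\<bar> * B"
proof -
  have d: "((\<lambda>u. F (x + u *\<^sub>R a)) has_real_derivative D (x + u *\<^sub>R a)) (at u)" for u
  proof -
    have "((\<lambda>r. F (x + (u + r) *\<^sub>R a)) has_real_derivative D (x + u *\<^sub>R a)) (at 0)"
      using assms(1)[of "x + u *\<^sub>R a"] by (simp add: scaleR_add_left add.assoc)
    then show ?thesis using DERIV_shift[of "\<lambda>u. F (x + u *\<^sub>R a)" "D (x + u *\<^sub>R a)" 0 u] by (simp add: add.commute)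
  qed
  have "norm (F (x + u *\<^sub>R a) - F (x + 0 *\<^sub>R a)) \<le> B * norm (u - 0)"
    by (rule field_differentiable_bound[of UNIV "\<lambda>u. F (x + u *\<^sub>R a)" "\<lambda>u. D (x + u *\<^sub>R a)"]) (use d assms(2) in auto)
  then show ?thesis by (simp add: mult.commute)
qed

lemma Cb_lincomb:
  assumes "f \<in> Cb" "g \<in> Cb"
  shows "(\<lambda>y. c * f y + d * g y) \<in> Cb"
proof -
  obtain K where K: "K \<ge> 0" "\<And>x. \<bar>f x\<bar> \<le> K" using CbE[OF assms(1)] by blast
  obtain L where L: "L \<ge> 0" "\<And>x. \<bar>g x\<bar> \<le> L" using CbE[OF assms(2)] by blast
  have "\<bar>c * f y + d * g y\<bar> \<le> \<bar>c\<bar> * K + \<bar>d\<bar> * L" for y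
  proof -
    have "\<bar>c * f y + d * g y\<bar> \<le> \<bar>c\<bar> * \<bar>f y\<bar> + \<bar>d\<bar> * \<bar>g y\<bar>"
      using abs_triangle_ineq[of "c * f y" "d * g y"] by (simp add: abs_mult)
    also have "\<dots> \<le> \<bar>c\<bar> * K + \<bar>d\<bar> * L" by (intro add_mono mult_left_mono K L) auto
    finally show ?thesis .
  qed
  moreover have "continuous_on UNIV (\<lambda>y. c * f y + d * g y)"
    by (intro continuous_intros Cb_continuous assms)
  ultimately show ?thesis by (rule CbI[rotated])
qed

lemma Cb_translate:
  fixes f :: "'a::real_normed_vector \<Rightarrow> real"
  assumes "f \<in> Cb"
  shows "(\<lambda>y. f (y + h)) \<in> Cb"
proof -
  obtain K where K: "\<And>x. \<bar>f x\<bar> \<le> K" using CbE[OF assms] by blast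
  have "continuous_on UNIV (\<lambda>y. f (y + h))"
    by (rule continuous_on_compose2[OF Cb_continuous[OF assms, of UNIV]]) (auto intro!: continuous_intros)
  then show ?thesis using K by (rule CbI)
qed

section \<open>Moments and total mass of the stable density\<close>

context
  fixes s :: real
  assumes s: "0 < s" "s < 1"
begin

text \<open>One constant serves all exponents up to 1/2 because
  \<open>v powr - \<kappa> \<le> 1 + v powr - (1 / 2)\<close>.\<close>

lemma stable_density_moment_le:
  obtains C where "0 \<le> C" "\<And>\<kappa>. 0 \<le> \<kappa> \<Longrightarrow> \<kappa> \<le> 1 / 2 \<Longrightarrow> (LBINT v:{0<..}. v powr - \<kappa> * \<bar>stable_density s v\<bar>) \<le> C"
    "\<And>\<kappa>. 0 \<le> \<kappa> \<Longrightarrow> \<kappa> \<le> 1 / 2 \<Longrightarrow> set_integrable lborel {0<..} (\<lambda>v. v powr - \<kappa> * \<bar>stable_density s v\<bar>)"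
proof -
  have i: "set_integrable lborel {0<..} (\<lambda>v. v powr - \<kappa> * \<bar>stable_density s v\<bar>)" if "0 \<le> \<kappa>" "\<kappa> \<le> 1 / 2" for \<kappa>
    using set_integrable_abs[OF stable_density_moment[OF s, of \<kappa>]] that by (simp add: abs_mult)
  define C where "C = (LBINT v:{0<..}. v powr - 0 * \<bar>stable_density s v\<bar> + v powr - (1 / 2) * \<bar>stable_density s v\<bar>)"
  have "(LBINT v:{0<..}. v powr - \<kappa> * \<bar>stable_density s v\<bar>) \<le> C" if "0 \<le> \<kappa>" "\<kappa> \<le> 1 / 2" for \<kappa>
    unfolding C_def
  proof (rule set_integral_mono)
    show "set_integrable lborel {0<..} (\<lambda>v. v powr - 0 * \<bar>stable_density s v\<bar> + v powr - (1 / 2) * \<bar>stable_density s v\<bar>)"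
      by (intro set_integral_add i) auto
    fix v :: real assume "v \<in> {0<..}"
    then have v: "0 < v" by simp
    have "v powr - \<kappa> \<le> v powr - 0 + v powr - (1 / 2)"
    proof (cases "1 \<le> v")
      case True
      then have "v powr - \<kappa> \<le> v powr - 0" using that by (intro powr_mono) auto
      then show ?thesis using powr_ge_zero[of v "- (1 / 2)"] by linarith
    next
      case False
      then have "v powr - \<kappa> \<le> v powr - (1 / 2)" using that v by (intro powr_mono') auto
      then show ?thesis using powr_ge_zero[of v "- 0"] by linarith
    qed
    then show "v powr - \<kappa> * \<bar>stable_density s v\<bar> \<le> v powr - 0 * \<bar>stable_density s v\<bar> + v powr - (1 / 2) * \<bar>stable_density s v\<bar>"
      unfolding distrib_right[symmetric] by (rule mult_right_mono) simp
  qed (use i that in auto)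
  moreover have "0 \<le> C" unfolding C_def set_lebesgue_integral_def by (rule Bochner_Integration.integral_nonneg) (auto simp: indicator_def)
  ultimately show thesis using that i by blast
qed

text \<open>The limit of the Laplace transform at \<open>l = 1 / (n + 1)\<close>. Total mass 1 is
  what makes the subordination formula correct at time 0.\<close>

lemma stable_density_integral: "(LBINT v:{0<..}. stable_density s v) = 1"
proof -
  have si: "integrable lborel (\<lambda>v. indicator {0<..} v *\<^sub>R stable_density s v)"
    using stable_density_integrable[OF s] by (simp add: set_integrable_def)
  then have [measurable]: "(\<lambda>v. indicator {0<..} v *\<^sub>R stable_density s v) \<in> borel_measurable borel" by auto
  have eq: "indicator {0<..} v *\<^sub>R (exp (- l * v) * stable_density s v) = exp (- l * v) * (indicator {0<..} v *\<^sub>R stable_density s v)" for l v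
    by simp
  have "(\<lambda>n. LBINT v:{0<..}. exp (- (1 / real (Suc n)) * v) * stable_density s v) \<longlonglongrightarrow> (LBINT v:{0<..}. stable_density s v)"
    unfolding set_lebesgue_integral_def eq
  proof (rule integral_dominated_convergence[where w = "\<lambda>v. norm (indicator {0<..} v *\<^sub>R stable_density s v)"])
    show "integrable lborel (\<lambda>v. norm (indicator {0<..} v *\<^sub>R stable_density s v))" using si by (rule integrable_norm)
    show "AE v in lborel. (\<lambda>n. exp (- (1 / real (Suc n)) * v) * (indicator {0<..} v *\<^sub>R stable_density s v)) \<longlonglongrightarrow> indicator {0<..} v *\<^sub>R stable_density s v"
    proof (rule AE_I2)
      fix v :: real
      have "(\<lambda>n. 1 / real (Suc n)) \<longlonglongrightarrow> 0" using LIMSEQ_inverse_real_of_nat by (simp add: inverse_eq_divide)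
      then have "(\<lambda>n. exp (- (1 / real (Suc n)) * v) * (indicator {0<..} v *\<^sub>R stable_density s v)) \<longlonglongrightarrow> exp (- 0 * v) * (indicator {0<..} v *\<^sub>R stable_density s v)"
        by (intro tendsto_intros)
      then show "(\<lambda>n. exp (- (1 / real (Suc n)) * v) * (indicator {0<..} v *\<^sub>R stable_density s v)) \<longlonglongrightarrow> indicator {0<..} v *\<^sub>R stable_density s v" by simp
    qed
    show "AE v in lborel. norm (exp (- (1 / real (Suc n)) * v) * (indicator {0<..} v *\<^sub>R stable_density s v)) \<le> norm (indicator {0<..} v *\<^sub>R stable_density s v)" for n
      by (intro AE_I2) (auto simp: indicator_def abs_mult mult_left_le_one_le)
  qed measurable
  moreover have "(LBINT v:{0<..}. exp (- (1 / real (Suc n)) * v) * stable_density s v) = exp (- ((1 / real (Suc n)) powr s))" for n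
    by (rule stable_density_Laplace(2)[OF s]) simp
  ultimately have "(\<lambda>n. exp (- ((1 / real (Suc n)) powr s))) \<longlonglongrightarrow> (LBINT v:{0<..}. stable_density s v)" by simp
  moreover have "(\<lambda>n. exp (- ((1 / real (Suc n)) powr s))) \<longlonglongrightarrow> exp (- 0)"
  proof -
    have "(\<lambda>n. (1 / real (Suc n)) powr s) \<longlonglongrightarrow> 0" using s by real_asymp
    then show ?thesis by (intro tendsto_intros)
  qed
  ultimately show ?thesis using LIMSEQ_unique by fastforce
qed

end

text \<open>Integration of a family of operators against the stable density; below \<open>E\<close> is the heat
  semigroup, with \<open>J c \<longleftrightarrow> 0 \<le> c\<close>, or its derivative, with \<open>J c \<longleftrightarrow> 0 < c\<close>.\<close>

locale subordination =
  fixes s :: real and E :: "real \<Rightarrow> ('a::real_normed_vector \<Rightarrow> real) \<Rightarrow> 'a \<Rightarrow> real" and J :: "real \<Rightarrow> bool" and \<beta> :: "real \<Rightarrow> real" and \<kappa> :: real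
  assumes s: "0 < s" "s < 1" and \<kappa>: "0 \<le> \<kappa>" "\<kappa> \<le> 1 / 2"
    and J: "\<And>c v. J c \<Longrightarrow> 0 < v \<Longrightarrow> J (c * v)"
    and E: "\<And>F f r r0 X x. cconv F f \<Longrightarrow> r \<longlonglongrightarrow> r0 \<Longrightarrow> (\<And>i. J (r i)) \<Longrightarrow> J r0 \<Longrightarrow> X \<longlonglongrightarrow> x \<Longrightarrow>
      (\<lambda>i. E (r i) (F i) (X i)) \<longlonglongrightarrow> E r0 f x"
    and E_bound: "\<And>c v f K x. J c \<Longrightarrow> 0 < v \<Longrightarrow> f \<in> Cb \<Longrightarrow> 0 \<le> K \<Longrightarrow> (\<And>y. \<bar>f y\<bar> \<le> K) \<Longrightarrow>
      \<bar>E (c * v) f x\<bar> \<le> \<beta> c * K * v powr - \<kappa>"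
begin

lemma measurable:
  assumes "J c" "f \<in> Cb"
  shows "set_borel_measurable lborel {0<..} (\<lambda>v. E (c * v) f x * stable_density s v)"
proof -
  have "continuous_on {0<..} (\<lambda>v. E (c * v) f x)"
    unfolding continuous_on_sequentially comp_def
    using assms J by (intro allI ballI impI E[OF cconv_const]) (auto intro!: tendsto_intros)
  then have [measurable]: "(\<lambda>v. indicator {0<..} v *\<^sub>R E (c * v) f x) \<in> borel_measurable borel"
    by (intro borel_measurable_continuous_on_indicator) auto
  note [measurable] = measurable_stable_density[OF s]
  have "(\<lambda>v. (indicator {0<..} v *\<^sub>R E (c * v) f x) * stable_density s v) \<in> borel_measurable borel" by measurable
  then show ?thesis by (simp add: set_borel_measurable_def mult.assoc)
qed

lemma integrable:
  assumes "J c" "f \<in> Cb"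
  shows "set_integrable lborel {0<..} (\<lambda>v. E (c * v) f x * stable_density s v)"
proof -
  obtain K where K: "K \<ge> 0" "\<And>x. \<bar>f x\<bar> \<le> K" using CbE[OF assms(2)] by blast
  have b: "\<bar>E (c * v) f x * stable_density s v\<bar> \<le> \<bar>\<beta> c * K * (v powr - \<kappa> * \<bar>stable_density s v\<bar>)\<bar>" if "0 < v" for v
  proof -
    have "\<bar>E (c * v) f x\<bar> * \<bar>stable_density s v\<bar> \<le> (\<beta> c * K * v powr - \<kappa>) * \<bar>stable_density s v\<bar>"
      by (intro mult_right_mono E_bound assms that K) simp
    then show ?thesis using abs_ge_self[of "\<beta> c * K * (v powr - \<kappa> * \<bar>stable_density s v\<bar>)"] by (simp add: abs_mult mult.assoc)
  qed
  have "set_integrable lborel {0<..} (\<lambda>v. \<beta> c * K * (v powr - \<kappa> * \<bar>stable_density s v\<bar>))"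
    using stable_density_moment_le[OF s] \<kappa> by (metis set_integrable_mult_right)
  then show ?thesis
    by (rule set_integrable_bound[OF _ measurable[OF assms]]) (use b in auto)
qed

lemma LIMSEQ:
  assumes F: "cconv F f" and c: "c \<longlonglongrightarrow> c0" "\<And>i. J (c i)" "J c0" "\<And>i. \<beta> (c i) \<le> M" and X: "X \<longlonglongrightarrow> x"
  shows "(\<lambda>i. LBINT v:{0<..}. E (c i * v) (F i) (X i) * stable_density s v) \<longlonglongrightarrow> (LBINT v:{0<..}. E (c0 * v) f x * stable_density s v)"
proof -
  obtain K where K: "K \<ge> 0" "\<And>i x. \<bar>F i x\<bar> \<le> K" using cconvE[OF F] by metis
  let ?w = "\<lambda>v. indicator {0<..} v *\<^sub>R (M * K * (v powr - \<kappa> * \<bar>stable_density s v\<bar>))"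
  show ?thesis
    unfolding set_lebesgue_integral_def
  proof (rule integral_dominated_convergence[where w = ?w])
    show "integrable lborel ?w"
      using stable_density_moment_le[OF s] \<kappa> unfolding set_integrable_def[symmetric] by (metis set_integrable_mult_right)
    show "AE v in lborel. (\<lambda>i. indicator {0<..} v *\<^sub>R (E (c i * v) (F i) (X i) * stable_density s v))
        \<longlonglongrightarrow> indicator {0<..} v *\<^sub>R (E (c0 * v) f x * stable_density s v)"
    proof (rule AE_I2, goal_cases)
      case (1 v)
      show ?case using J c
        by (cases "0 < v") (auto intro!: tendsto_intros E[OF F _ _ _ X])
    qed
    show "AE v in lborel. norm (indicator {0<..} v *\<^sub>R (E (c i * v) (F i) (X i) * stable_density s v)) \<le> ?w v" for i
    proof (rule AE_I2, goal_cases)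
      case (1 v)
      have "\<bar>E (c i * v) (F i) (X i)\<bar> \<le> M * K * v powr - \<kappa>" if "0 < v"
        by (rule order_trans[OF E_bound[OF c(2) that cconv_Cb(1)[OF F] K] mult_right_mono[OF mult_right_mono[OF c(4)]]]) (use K in auto)
      then show ?case by (auto simp: indicator_def abs_mult mult.assoc[symmetric] intro!: mult_right_mono)
    qed
  qed (use measurable c cconv_Cb[OF F] in \<open>simp_all add: set_borel_measurable_def\<close>)
qed

lemma bound:
  assumes "J c" "f \<in> Cb" "0 \<le> \<kappa>'" "\<kappa>' \<le> 1 / 2" "0 \<le> M" and b: "\<And>v. 0 < v \<Longrightarrow> \<bar>E (c * v) f x\<bar> \<le> M * v powr - \<kappa>'"
    and C: "(LBINT v:{0<..}. v powr - \<kappa>' * \<bar>stable_density s v\<bar>) \<le> C"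
  shows "\<bar>LBINT v:{0<..}. E (c * v) f x * stable_density s v\<bar> \<le> M * C"
proof -
  note i = integrable[OF assms(1,2)]
  have "\<bar>LBINT v:{0<..}. E (c * v) f x * stable_density s v\<bar> \<le> (LBINT v:{0<..}. norm (E (c * v) f x * stable_density s v))"
    unfolding real_norm_def[symmetric] by (rule set_integral_norm_bound[OF i])
  also have "\<dots> \<le> (LBINT v:{0<..}. M * (v powr - \<kappa>' * \<bar>stable_density s v\<bar>))"
  proof (rule set_integral_mono[OF set_integrable_norm[OF i]])
    show "set_integrable lborel {0<..} (\<lambda>v. M * (v powr - \<kappa>' * \<bar>stable_density s v\<bar>))"
      using stable_density_moment_le[OF s] assms(3,4) by (metis set_integrable_mult_right)
    show "norm (E (c * v) f x * stable_density s v) \<le> M * (v powr - \<kappa>' * \<bar>stable_density s v\<bar>)" if "v \<in> {0<..}" for v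
      using b[of v] that by (simp add: abs_mult mult.assoc[symmetric] mult_right_mono)
  qed
  also have "\<dots> \<le> M * C" unfolding set_integral_mult_right using C assms(5) by (intro mult_left_mono)
  finally show ?thesis .
qed

end

section \<open>The heat semigroup subordinated by the stable density\<close>

context
  fixes Q :: "'a::{real_inner, banach, second_countable_topology} \<Rightarrow> 'a" and s :: real
  assumes Q: "positive_operator Q" and tr: "finite_trace Q" and s: "0 < s" "s < 1"
begin

text \<open>Times are clamped by \<open>max 0\<close> since Gaussian laws are available for
  nonnegative times; the clamp gives measurability in time on the whole line.\<close>

lemma heat_sg_continuous:
  assumes "f \<in> Cb"
  shows "continuous_on UNIV (\<lambda>(v, x). heat_sg Q (max 0 v) f x)"
proof -
  have "(\<lambda>n. heat_sg Q (max 0 (fst (Y n))) f (snd (Y n))) \<longlonglongrightarrow> heat_sg Q (max 0 (fst y)) f (snd y)" if "Y \<longlonglongrightarrow> y" for Y y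
    by (rule heat_sg_LIMSEQ[OF Q tr cconv_const[OF assms]]) (use that in \<open>auto intro!: tendsto_intros\<close>)
  then show ?thesis by (auto simp: continuous_on_sequentially comp_def case_prod_unfold)
qed

lemma heat_sg_measurable_time:
  assumes "f \<in> Cb"
  shows "(\<lambda>v. heat_sg Q (max 0 v) f x) \<in> borel_measurable borel"
proof -
  have "continuous_on UNIV (\<lambda>v. (\<lambda>(v, x). heat_sg Q (max 0 v) f x) (v, x))"
    by (rule continuous_on_compose2[OF heat_sg_continuous[OF assms]]) (auto intro!: continuous_intros)
  then show ?thesis by (intro borel_measurable_continuous_onI) simp
qed

lemma heat_sg_0: "f \<in> Cb \<Longrightarrow> heat_sg Q 0 f x = f x"
  using prob_space.prob_space[OF prob_space_gaussian[OF Q tr]] by (simp add: heat_sg_scale[OF Q tr] Cb_measurable)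

text \<open>Scaling of the subordinator moves the time into the heat semigroup and leaves a fixed
  density. The formula includes \<open>t = 0\<close>, where \<open>0 powr (1 / s) = 0\<close> and
  the density has mass 1.\<close>

lemma frac_sg_eq:
  assumes "0 \<le> t" "f \<in> Cb"
  shows "frac_sg Q s t f x = (LBINT v:{0<..}. heat_sg Q (t powr (1 / s) * v) f x * stable_density s v)"
proof (cases "t = 0")
  case True
  then show ?thesis using heat_sg_0[OF assms(2)] stable_density_integral[OF s] by (simp add: frac_sg_def)
next
  case False
  note [measurable] = heat_sg_measurable_time[OF assms(2)]
  have "(\<lambda>v. indicator {0<..} v * heat_sg Q (max 0 v) f x) \<in> borel_measurable borel" by measurable
  also have "(\<lambda>v. indicator {0<..} v * heat_sg Q (max 0 v) f x) = (\<lambda>v. indicator {0<..} v * heat_sg Q v f x)"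
    by (auto simp: indicator_def max_def)
  finally show ?thesis
    using subordinator_density_integral[OF s, of t "\<lambda>v. heat_sg Q v f x"] False assms by (simp add: frac_sg_def)
qed

interpretation heat: subordination s "heat_sg Q" "\<lambda>c. 0 \<le> c" "\<lambda>_. 1" 0
proof
  fix c v x K :: real and f :: "'a \<Rightarrow> real" and y assume "0 \<le> c" "0 < v" "f \<in> Cb" "\<And>y. \<bar>f y\<bar> \<le> K"
  then show "\<bar>heat_sg Q (c * v) f y\<bar> \<le> 1 * K * v powr - 0"
    using heat_sg_bound[OF Q tr, of "c * v" f K y] Cb_measurable[of f] by simp
qed (use s heat_sg_LIMSEQ[OF Q tr] in auto)

lemmas frac_sg_integrable = heat.integrable

lemma frac_sg_bound:
  obtains C where "0 \<le> C" "\<And>t f x M. 0 \<le> t \<Longrightarrow> f \<in> Cb \<Longrightarrow> (\<And>y. \<bar>f y\<bar> \<le> M) \<Longrightarrow> \<bar>frac_sg Q s t f x\<bar> \<le> C * M"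
proof -
  obtain C where C: "0 \<le> C" "\<And>\<kappa>. 0 \<le> \<kappa> \<Longrightarrow> \<kappa> \<le> 1 / 2 \<Longrightarrow> (LBINT v:{0<..}. v powr - \<kappa> * \<bar>stable_density s v\<bar>) \<le> C"
    using stable_density_moment_le[OF s] by metis
  show thesis
  proof (rule that[OF C(1)])
    fix t :: real and f :: "'a \<Rightarrow> real" and x M assume t: "0 \<le> t" and f: "f \<in> Cb" and M: "\<And>y. \<bar>f y\<bar> \<le> M"
    have M0: "0 \<le> M" using M[of 0] by linarith
    have "\<bar>frac_sg Q s t f x\<bar> \<le> M * C"
      unfolding frac_sg_eq[OF t f]
      by (rule heat.bound[of _ _ 0, OF _ f _ _ M0 _ C(2)])
        (use heat_sg_bound[OF Q tr _ Cb_measurable[OF f] M] in auto)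
    then show "\<bar>frac_sg Q s t f x\<bar> \<le> C * M" by (simp add: mult.commute)
  qed
qed

lemma frac_sg_LIMSEQ:
  assumes F: "cconv F f" and t: "t \<longlonglongrightarrow> t0" "\<And>n. 0 \<le> t n" and X: "X \<longlonglongrightarrow> x"
  shows "(\<lambda>n. frac_sg Q s (t n) (F n) (X n)) \<longlonglongrightarrow> frac_sg Q s t0 f x"
proof -
  have t0: "0 \<le> t0" using t by (intro LIMSEQ_le_const) auto
  have "(\<lambda>n. t n powr (1 / s)) \<longlonglongrightarrow> t0 powr (1 / s)"
    using t s by (intro tendsto_powr') auto
  from heat.LIMSEQ[OF F this _ _ order_refl X]
  show ?thesis using frac_sg_eq t t0 cconv_Cb[OF F] by simp
qed

lemma frac_sg_Cb:
  assumes "0 \<le> t" "f \<in> Cb"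
  shows "frac_sg Q s t f \<in> Cb"
proof -
  obtain K where K: "\<And>x. \<bar>f x\<bar> \<le> K" using CbE[OF assms(2)] by blast
  obtain C where "\<And>x. \<bar>frac_sg Q s t f x\<bar> \<le> C * K" using frac_sg_bound assms K by metis
  then show ?thesis
    using frac_sg_LIMSEQ[OF cconv_const[OF assms(2)] tendsto_const assms(1)] by (intro CbI_sequentially) auto
qed

lemma frac_sg_lincomb:
  assumes "0 \<le> t" "f \<in> Cb" "g \<in> Cb"
  shows "frac_sg Q s t (\<lambda>y. c * f y + d * g y) x = c * frac_sg Q s t f x + d * frac_sg Q s t g x"
proof -
  have fg: "(\<lambda>y. c * f y + d * g y) \<in> Cb" by (rule Cb_lincomb[OF assms(2,3)])
  have c0: "0 \<le> t powr (1 / s)" by simp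
  note i = frac_sg_integrable[OF c0]
  have "frac_sg Q s t (\<lambda>y. c * f y + d * g y) x = (LBINT v:{0<..}. c * (heat_sg Q (t powr (1 / s) * v) f x * stable_density s v)
      + d * (heat_sg Q (t powr (1 / s) * v) g x * stable_density s v))"
    unfolding frac_sg_eq[OF assms(1) fg]
    by (intro set_lebesgue_integral_cong) (auto simp: heat_sg_lincomb[OF Q tr _ assms(2,3)] algebra_simps)
  also have "\<dots> = (LBINT v:{0<..}. c * (heat_sg Q (t powr (1 / s) * v) f x * stable_density s v))
      + (LBINT v:{0<..}. d * (heat_sg Q (t powr (1 / s) * v) g x * stable_density s v))"
    by (intro set_integral_add(2) set_integrable_mult_right i assms)
  also have "\<dots> = c * frac_sg Q s t f x + d * frac_sg Q s t g x"
    by (simp only: set_integral_mult_right frac_sg_eq[OF assms(1,2)] frac_sg_eq[OF assms(1,3)])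
  finally show ?thesis .
qed

lemma frac_sg_translate: "frac_sg Q s t (\<lambda>y. f (y + h)) x = frac_sg Q s t f (x + h)"
  by (simp add: frac_sg_def heat_sg_translate[OF Q tr])

end

context
  fixes Q :: "'a::{real_inner, banach, second_countable_topology} \<Rightarrow> 'a" and s :: real
  assumes Q: "positive_operator Q" and tr: "finite_trace Q" and s: "0 < s" "s < 1"
begin

text \<open>Fubini's theorem and the semigroup law of the heat semigroup. The heat times add, which
  reduces the semigroup law of \<open>frac_sg\<close> to a convolution of densities.\<close>

lemma frac_sg_heat_exchange:
  assumes "0 \<le> v" "0 \<le> a" "f \<in> Cb"
  shows "heat_sg Q v (frac_sg Q s a f) x = (LBINT u:{0<..}. heat_sg Q (v + a powr (1 / s) * u) f x * stable_density s u)"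
proof -
  interpret prob_space "gaussian Q" by (rule prob_space_gaussian[OF Q tr])
  have [measurable_cong]: "sets (gaussian Q) = sets borel" by (rule sets_gaussian[OF Q tr])
  interpret P: pair_sigma_finite "gaussian Q" lborel ..
  note [measurable] = measurable_stable_density[OF s]
  obtain K where K: "K \<ge> 0" "\<And>x. \<bar>f x\<bar> \<le> K" using CbE[OF assms(3)] by blast
  define c where "c = a powr (1 / s)"
  have c: "0 \<le> c" by (simp add: c_def)
  define g where "g = (\<lambda>(y, u). indicator {0<..} u *\<^sub>R (heat_sg Q (c * u) f (x + sqrt v *\<^sub>R y) * stable_density s u))"
  have hm: "(\<lambda>p. heat_sg Q (max 0 (fst p)) f (snd p)) \<in> borel_measurable (borel \<Otimes>\<^sub>M borel)"
    using borel_measurable_continuous_onI[OF heat_sg_continuous[OF Q tr s assms(3)]]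
    by (simp add: case_prod_unfold borel_prod)
  have [measurable]: "(\<lambda>p. heat_sg Q (max 0 (c * snd p)) f (x + sqrt v *\<^sub>R fst p)) \<in> borel_measurable (gaussian Q \<Otimes>\<^sub>M lborel)"
    using measurable_compose[OF _ hm, of "\<lambda>p. (c * snd p, x + sqrt v *\<^sub>R fst p)" "gaussian Q \<Otimes>\<^sub>M lborel"] by simp
  have "(\<lambda>p. indicator {0<..} (snd p) *\<^sub>R (heat_sg Q (max 0 (c * snd p)) f (x + sqrt v *\<^sub>R fst p) * stable_density s (snd p))) \<in> borel_measurable (gaussian Q \<Otimes>\<^sub>M lborel)"
    by measurable
  also have "(\<lambda>p. indicator {0<..} (snd p) *\<^sub>R (heat_sg Q (max 0 (c * snd p)) f (x + sqrt v *\<^sub>R fst p) * stable_density s (snd p))) = g"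
    using c by (auto simp: g_def indicator_def max_def fun_eq_iff mult_le_0_iff)
  finally have gm: "g \<in> borel_measurable (gaussian Q \<Otimes>\<^sub>M lborel)" .
  have hb: "\<bar>heat_sg Q (c * u) f z\<bar> \<le> K" if "0 < u" for u z
    using heat_sg_bound[OF Q tr _ Cb_measurable[OF assms(3)] K(2)] c that by simp
  have gi: "integrable (gaussian Q \<Otimes>\<^sub>M lborel) g"
  proof (rule Bochner_Integration.integrable_bound[OF _ gm])
    define w where "w u = K * (indicator {0<..} u *\<^sub>R \<bar>stable_density s u\<bar>)" for u
    have wi: "integrable lborel w"
      unfolding w_def using set_integrable_abs[OF stable_density_integrable[OF s]] by (simp add: set_integrable_def)
    have [measurable]: "w \<in> borel_measurable borel" unfolding w_def by measurable
    show "integrable (gaussian Q \<Otimes>\<^sub>M lborel) (\<lambda>(y, u). w u)"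
      by (rule P.Fubini_integrable) (use wi in auto)
    show "AE p in gaussian Q \<Otimes>\<^sub>M lborel. norm (g p) \<le> norm (case p of (y, u) \<Rightarrow> w u)"
      using hb K(1) by (intro AE_I2) (auto simp: g_def w_def indicator_def abs_mult intro!: mult_right_mono)
  qed
  have "heat_sg Q v (frac_sg Q s a f) x = (LINT y|gaussian Q. frac_sg Q s a f (x + sqrt v *\<^sub>R y))"
    by (rule heat_sg_scale[OF Q tr assms(1) Cb_measurable[OF frac_sg_Cb[OF Q tr s assms(2,3)]]])
  also have "\<dots> = (LINT y|gaussian Q. (LINT u|lborel. g (y, u)))"
    by (simp add: frac_sg_eq[OF Q tr s assms(2,3)] g_def set_lebesgue_integral_def c_def)
  also have "\<dots> = (LINT u|lborel. (LINT y|gaussian Q. g (y, u)))"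
    using P.Fubini_integral[of "\<lambda>y u. g (y, u)"] gi by simp
  also have "\<dots> = (LBINT u:{0<..}. heat_sg Q (v + c * u) f x * stable_density s u)"
    unfolding set_lebesgue_integral_def
  proof (rule Bochner_Integration.integral_cong[OF refl])
    fix u :: real
    show "(LINT y|gaussian Q. g (y, u)) = indicator {0<..} u *\<^sub>R (heat_sg Q (v + c * u) f x * stable_density s u)"
    proof (cases "0 < u")
      case True
      have "(LINT y|gaussian Q. heat_sg Q (c * u) f (x + sqrt v *\<^sub>R y)) = heat_sg Q v (heat_sg Q (c * u) f) x"
        using heat_sg_scale[OF Q tr assms(1) Cb_measurable[OF heat_sg_Cb[OF Q tr _ assms(3)]], of "c * u"] c True by simp
      also have "\<dots> = heat_sg Q (v + c * u) f x"
        using c True by (intro heat_sg_semigroup[OF Q tr assms(1) _ assms(3)]) simp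
      finally show ?thesis using True by (simp add: g_def)
    qed (simp add: g_def)
  qed
  finally show ?thesis by (simp add: c_def)
qed

lemma frac_sg_semigroup:
  assumes "0 < a" "0 < b" "f \<in> Cb"
  shows "frac_sg Q s b (frac_sg Q s a f) x = frac_sg Q s (a + b) f x"
proof -
  obtain K where K: "K \<ge> 0" "\<And>x. \<bar>f x\<bar> \<le> K" using CbE[OF assms(3)] by blast
  define H where "H \<rho> = heat_sg Q (max 0 \<rho>) f x" for \<rho>
  have Hm: "H \<in> borel_measurable borel" unfolding H_def by (rule heat_sg_measurable_time[OF Q tr s assms(3)])
  have Hb: "\<bar>H \<rho>\<bar> \<le> K" for \<rho>
    unfolding H_def by (rule heat_sg_bound[OF Q tr _ Cb_measurable[OF assms(3)] K(2)]) simp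
  have H: "H \<rho> = heat_sg Q \<rho> f x" if "0 < \<rho>" for \<rho> using that by (simp add: H_def)
  have "frac_sg Q s b (frac_sg Q s a f) x
      = (LBINT u:{0<..}. (LBINT v:{0<..}. H (a powr (1 / s) * v + b powr (1 / s) * u) * stable_density s v) * stable_density s u)"
    unfolding frac_sg_eq[OF Q tr s less_imp_le[OF assms(2)] frac_sg_Cb[OF Q tr s less_imp_le[OF assms(1)] assms(3)]]
  proof (intro set_lebesgue_integral_cong allI impI)
    fix u :: real assume u: "u \<in> {0<..}"
    have "heat_sg Q (b powr (1 / s) * u) (frac_sg Q s a f) x
      = (LBINT v:{0<..}. heat_sg Q (b powr (1 / s) * u + a powr (1 / s) * v) f x * stable_density s v)"
      using u assms by (intro frac_sg_heat_exchange) auto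
    also have "\<dots> = (LBINT v:{0<..}. H (a powr (1 / s) * v + b powr (1 / s) * u) * stable_density s v)"
    proof (intro set_lebesgue_integral_cong allI impI)
      fix v :: real assume "v \<in> {0<..}"
      then have "0 < a powr (1 / s) * v + b powr (1 / s) * u" using u assms by (intro add_pos_pos mult_pos_pos) auto
      then show "heat_sg Q (b powr (1 / s) * u + a powr (1 / s) * v) f x * stable_density s v = H (a powr (1 / s) * v + b powr (1 / s) * u) * stable_density s v"
        by (simp add: H add.commute)
    qed simp
    finally show "heat_sg Q (b powr (1 / s) * u) (frac_sg Q s a f) x * stable_density s u
        = (LBINT v:{0<..}. H (a powr (1 / s) * v + b powr (1 / s) * u) * stable_density s v) * stable_density s u" by simp
  qed simp
  also have "\<dots> = (LBINT u:{0<..}. (LINT v|lborel. H (v + b powr (1 / s) * u) * subord s a v) * stable_density s u)"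
    by (simp only: subord_integral[OF s assms(1)])
  also have "\<dots> = (LINT u|lborel. (LINT v|lborel. H (v + u) * subord s a v) * subord s b u)"
    by (rule subord_integral[OF s assms(2), symmetric])
  also have "\<dots> = (LINT \<rho>|lborel. H \<rho> * subord s (a + b) \<rho>)"
    by (rule subord_semigroup[OF s assms(1,2) Hm Hb])
  also have "\<dots> = (LBINT v:{0<..}. H ((a + b) powr (1 / s) * v) * stable_density s v)"
    using assms by (intro subord_integral[OF s]) simp
  also have "\<dots> = frac_sg Q s (a + b) f x"
    unfolding frac_sg_eq[OF Q tr s _ assms(3), of "a + b"]
  proof -
    have "frac_sg Q s (a + b) f x = (LBINT v:{0<..}. heat_sg Q ((a + b) powr (1 / s) * v) f x * stable_density s v)"
      using assms by (intro frac_sg_eq[OF Q tr s]) auto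
    also have "\<dots> = (LBINT v:{0<..}. H ((a + b) powr (1 / s) * v) * stable_density s v)"
      using assms by (intro set_lebesgue_integral_cong) (auto simp: H_def)
    finally show "(LBINT v:{0<..}. H ((a + b) powr (1 / s) * v) * stable_density s v) = frac_sg Q s (a + b) f x" by simp
  qed
  finally show ?thesis .
qed

end

text \<open>The derivative of \<open>frac_sg Q s t f\<close> in a direction \<open>h\<close> of the Cameron--Martin space, reduced to
  the unit direction \<open>h / CM_norm Q h\<close>.\<close>

definition frac_deriv :: "('a::{real_inner, banach, second_countable_topology} \<Rightarrow> 'a) \<Rightarrow> real \<Rightarrow> real \<Rightarrow> 'a \<Rightarrow> ('a \<Rightarrow> real) \<Rightarrow> 'a \<Rightarrow> real" where
  "frac_deriv Q s t h f x =
     (let a = (1 / CM_norm Q h) *\<^sub>R h; \<nu> = (SOME \<nu>. gaussian_law (\<lambda>x. Q x \<bullet> x - (x \<bullet> a)\<^sup>2) \<nu>)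
      in CM_norm Q h * (LBINT v:{0<..}. gauss_deriv \<nu> a (t powr (1 / s) * v) f x * stable_density s v))"

context
  fixes Q :: "'a::{real_inner, banach, second_countable_topology} \<Rightarrow> 'a" and s :: real
  assumes Q: "positive_operator Q" and tr: "finite_trace Q" and s: "0 < s" "s < 1"
begin

context
  fixes z a :: 'a and \<nu>
  assumes z: "norm z = 1" and a: "a = op_sqrt Q z"
    and \<nu>: "gaussian_law (\<lambda>x. Q x \<bullet> x - (x \<bullet> a)\<^sup>2) \<nu>"
begin

text \<open>Case \<open>\<alpha> = 0\<close> of the oscillation bound: a bounded function oscillates
  by at most twice its supremum.\<close>

lemma gauss_deriv_bound_sup:
  assumes "0 < v" "f \<in> Cb" "0 \<le> K" "\<And>x. \<bar>f x\<bar> \<le> K"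
  shows "\<bar>gauss_deriv \<nu> a v f x\<bar> \<le> 4 * K * v powr - (1 / 2)"
proof -
  have "\<bar>f (x + t *\<^sub>R a) - f x\<bar> \<le> 2 * K * \<bar>t\<bar> powr 0" for x t
    using assms(4)[of x] assms(4)[of "x + t *\<^sub>R a"] by (cases "t = 0") auto
  then have "\<bar>gauss_deriv \<nu> a v f x\<bar> \<le> 2 * (2 * K) * v powr ((0 - 1) / 2)"
    using assms by (intro gauss_deriv_bound[OF Q tr z a \<nu>]) auto
  then show ?thesis by simp
qed

interpretation gauss: subordination s "gauss_deriv \<nu> a" "\<lambda>c. 0 < c" "\<lambda>c. 4 * c powr - (1 / 2)" "1 / 2"
proof
  fix c v K :: real and f :: "'a \<Rightarrow> real" and y assume "0 < c" "0 < v" "f \<in> Cb" "0 \<le> K" "\<And>y. \<bar>f y\<bar> \<le> K"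
  then show "\<bar>gauss_deriv \<nu> a (c * v) f y\<bar> \<le> 4 * c powr - (1 / 2) * K * v powr - (1 / 2)"
    using gauss_deriv_bound_sup[of "c * v" f K y] by (simp add: powr_mult mult_ac)
qed (use s gauss_deriv_LIMSEQ[OF Q tr z a \<nu>] in auto)

text \<open>Differentiation under the integral. The quotients are dominated by the sup estimate of
  the heat derivative, whose singularity \<open>v powr - (1 / 2)\<close> is integrable against the
  density.\<close>

lemma frac_sg_unit_derivative:
  assumes "0 < t" "f \<in> Cb"
  shows "((\<lambda>u. frac_sg Q s t f (x + u *\<^sub>R a)) has_real_derivative
    (LBINT v:{0<..}. gauss_deriv \<nu> a (t powr (1 / s) * v) f x * stable_density s v)) (at 0)"
proof -
  obtain K where K: "K \<ge> 0" "\<And>x. \<bar>f x\<bar> \<le> K" using CbE[OF assms(2)] by blast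
  define c where "c = t powr (1 / s)"
  have c: "0 < c" using assms by (simp add: c_def)
  have i: "set_integrable lborel {0<..} (\<lambda>v. L * (v powr - (1 / 2) * \<bar>stable_density s v\<bar>))" for L
    using stable_density_moment_le[OF s] by (metis set_integrable_mult_right gauss.\<kappa>)
  have "((\<lambda>u. LINT v|lborel. indicator {0<..} v *\<^sub>R (heat_sg Q (c * v) f (x + u *\<^sub>R a) * stable_density s v)) has_real_derivative
      (LINT v|lborel. indicator {0<..} v *\<^sub>R (gauss_deriv \<nu> a (c * v) f x * stable_density s v))) (at 0)"
  proof (rule has_real_derivative_integral(2))
    show "integrable lborel (\<lambda>v. indicator {0<..} v *\<^sub>R (heat_sg Q (c * v) f (x + u *\<^sub>R a) * stable_density s v))" for u
      using frac_sg_integrable[OF Q tr s _ assms(2), of c] c by (simp add: set_integrable_def)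
    show "integrable lborel (\<lambda>v. indicator {0<..} v *\<^sub>R (4 * K * (c * v) powr - (1 / 2) * \<bar>stable_density s v\<bar>))"
      unfolding set_integrable_def[symmetric]
      by (rule set_integrable_cong[THEN iffD1, OF refl refl _ i[of "4 * K * c powr - (1 / 2)"]]) (use c in \<open>simp add: powr_mult\<close>)
    fix v :: real
    show "((\<lambda>u. indicator {0<..} v *\<^sub>R (heat_sg Q (c * v) f (x + u *\<^sub>R a) * stable_density s v)) has_real_derivative
        indicator {0<..} v *\<^sub>R (gauss_deriv \<nu> a (c * v) f x * stable_density s v)) (at 0)"
    proof (cases "0 < v")
      case True
      have "((\<lambda>u. heat_sg Q (c * v) f (x + u *\<^sub>R a)) has_real_derivative gauss_deriv \<nu> a (c * v) f x) (at 0)"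
        using True c by (intro heat_sg_has_derivative[OF Q tr z a \<nu> _ assms(2)]) simp
      then show ?thesis using True by (auto intro!: derivative_eq_intros)
    qed simp
    fix u :: real
    show "\<bar>indicator {0<..} v *\<^sub>R (heat_sg Q (c * v) f (x + u *\<^sub>R a) * stable_density s v) - indicator {0<..} v *\<^sub>R (heat_sg Q (c * v) f (x + 0 *\<^sub>R a) * stable_density s v)\<bar>
      \<le> \<bar>u\<bar> * (indicator {0<..} v *\<^sub>R (4 * K * (c * v) powr - (1 / 2) * \<bar>stable_density s v\<bar>))"
    proof (cases "0 < v")
      case True
      then have "\<bar>heat_sg Q (c * v) f (x + u *\<^sub>R a) - heat_sg Q (c * v) f x\<bar> \<le> \<bar>u\<bar> * (4 * K * (c * v) powr - (1 / 2))"
        using c K by (intro directional_mean_value[OF heat_sg_has_derivative[OF Q tr z a \<nu> _ assms(2)] gauss_deriv_bound_sup[OF _ assms(2)]]) auto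
      then have "\<bar>heat_sg Q (c * v) f (x + u *\<^sub>R a) - heat_sg Q (c * v) f x\<bar> * \<bar>stable_density s v\<bar>
          \<le> \<bar>u\<bar> * (4 * K * (c * v) powr - (1 / 2)) * \<bar>stable_density s v\<bar>" by (rule mult_right_mono) simp
      then show ?thesis using True by (simp add: abs_mult[symmetric] left_diff_distrib mult.assoc)
    qed simp
  qed
  then show ?thesis using frac_sg_eq[OF Q tr s less_imp_le[OF assms(1)] assms(2)] by (simp add: set_lebesgue_integral_def c_def)
qed

text \<open>The heat bound at time \<open>t powr (1 / s) * v\<close> separates into a power of
  \<open>t\<close> and a moment of the density; the exponent is \<open>1 / s\<close> times
  \<open>(1 - \<alpha>) / 2\<close>.\<close>

lemma unit_bound:
  assumes "0 < t" "f \<in> Cb" "0 \<le> \<alpha>" "\<alpha> < 1" "0 \<le> K"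
    and osc: "\<And>x r. \<bar>f (x + r *\<^sub>R a) - f x\<bar> \<le> K * \<bar>r\<bar> powr \<alpha>"
    and C: "(LBINT v:{0<..}. v powr - ((1 - \<alpha>) / 2) * \<bar>stable_density s v\<bar>) \<le> C"
  shows "\<bar>LBINT v:{0<..}. gauss_deriv \<nu> a (t powr (1 / s) * v) f x * stable_density s v\<bar> \<le> 2 * C * K * t powr - ((1 - \<alpha>) / (2 * s))"
proof -
  define c where "c = t powr (1 / s)"
  have c: "0 < c" using assms by (simp add: c_def)
  have "\<bar>LBINT v:{0<..}. gauss_deriv \<nu> a (c * v) f x * stable_density s v\<bar> \<le> 2 * K * c powr - ((1 - \<alpha>) / 2) * C"
  proof (rule gauss.bound[OF c assms(2) _ _ _ _ C])
    fix v :: real assume "0 < v"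
    then have "\<bar>gauss_deriv \<nu> a (c * v) f x\<bar> \<le> 2 * K * (c * v) powr ((\<alpha> - 1) / 2)"
      using c assms by (intro gauss_deriv_bound[OF Q tr z a \<nu>]) auto
    also have "(\<alpha> - 1) / 2 = - ((1 - \<alpha>) / 2)" by (simp add: field_simps)
    finally show "\<bar>gauss_deriv \<nu> a (c * v) f x\<bar> \<le> 2 * K * c powr - ((1 - \<alpha>) / 2) * v powr - ((1 - \<alpha>) / 2)"
      using c \<open>0 < v\<close> by (simp add: powr_mult)
  qed (use assms in auto)
  also have "c powr - ((1 - \<alpha>) / 2) = t powr - ((1 - \<alpha>) / (2 * s))"
    unfolding c_def using s by (simp add: powr_powr field_simps)
  finally show ?thesis by (simp add: c_def mult_ac)
qed

lemma unit_LIMSEQ: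
  assumes F: "cconv F f" and t: "t \<longlonglongrightarrow> t0" "0 < \<delta>" "\<And>n. \<delta> \<le> t n" and X: "X \<longlonglongrightarrow> x"
  shows "(\<lambda>n. LBINT v:{0<..}. gauss_deriv \<nu> a (t n powr (1 / s) * v) (F n) (X n) * stable_density s v)
    \<longlonglongrightarrow> (LBINT v:{0<..}. gauss_deriv \<nu> a (t0 powr (1 / s) * v) f x * stable_density s v)"
proof -
  have t0: "\<delta> \<le> t0" using t by (intro LIMSEQ_le_const) auto
  have tn: "0 < t n" for n using t(2) t(3)[of n] by simp
  have "(\<lambda>n. t n powr (1 / s)) \<longlonglongrightarrow> t0 powr (1 / s)" using t t0 by (intro tendsto_powr) auto
  moreover have "4 * (t n powr (1 / s)) powr - (1 / 2) \<le> 4 * (\<delta> powr (1 / s)) powr - (1 / 2)" for n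
    using t tn s by (intro mult_left_mono powr_mono2' powr_mono2) auto
  moreover have "0 < t n powr (1 / s)" "0 < t0 powr (1 / s)" for n using tn[of n] t t0 by simp_all
  ultimately show ?thesis
    by (intro gauss.LIMSEQ[OF F _ _ _ _ X])
qed

end

text \<open>Reduction to unit directions. The vector 0 has none and is separated; there the norm and
  the derivative both vanish.\<close>

lemma frac_deriv_cases:
  assumes "h \<in> CM_space Q"
  obtains "CM_norm Q h = 0" "h = 0" "\<And>t f x. frac_deriv Q s t h f x = 0"
  | z a \<nu> where "norm z = 1" "a = op_sqrt Q z" "gaussian_law (\<lambda>x. Q x \<bullet> x - (x \<bullet> a)\<^sup>2) \<nu>"
    "h = CM_norm Q h *\<^sub>R a" "a \<in> CM_space Q" "CM_norm Q a = 1" "0 < CM_norm Q h"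
    "\<And>t f x. frac_deriv Q s t h f x = CM_norm Q h * (LBINT v:{0<..}. gauss_deriv \<nu> a (t powr (1 / s) * v) f x * stable_density s v)"
proof (cases "h = 0")
  case True
  have "CM_norm Q (0 *\<^sub>R h) = 0" using CM_norm_scaleR[OF Q assms, of 0] by simp
  then have "CM_norm Q h = 0" using True by simp
  then show thesis using that(1) True by (simp add: frac_deriv_def)
next
  case False
  then have pos: "0 < CM_norm Q h" by (rule CM_norm_pos[OF Q assms])
  obtain w where w: "op_sqrt Q w = h" "norm w = CM_norm Q h" using CM_representative[OF Q assms] by blast
  define z where "z = (1 / CM_norm Q h) *\<^sub>R w"
  define a where "a = (1 / CM_norm Q h) *\<^sub>R h"
  define \<nu> where "\<nu> = (SOME \<nu>. gaussian_law (\<lambda>x. Q x \<bullet> x - (x \<bullet> a)\<^sup>2) \<nu>)"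
  have z: "norm z = 1" using pos w by (simp add: z_def)
  have a: "a = op_sqrt Q z"
    using w bounded_linear_op_sqrt[OF Q] by (simp add: a_def z_def linear_cmul bounded_linear.linear)
  have "\<exists>\<nu>. gaussian_law (\<lambda>x. Q x \<bullet> x - (x \<bullet> a)\<^sup>2) \<nu>"
    unfolding a using gaussian_law_complement_exists[OF Q tr, of z] z by (metis order_refl)
  then have \<nu>: "gaussian_law (\<lambda>x. Q x \<bullet> x - (x \<bullet> a)\<^sup>2) \<nu>" unfolding \<nu>_def by (rule someI_ex)
  show thesis
    by (rule that(2)[OF z a \<nu>])
      (use pos assms CM_space_scaleR[OF Q assms] CM_norm_scaleR[OF Q assms, of "1 / CM_norm Q h"] in
        \<open>auto simp: a_def frac_deriv_def Let_def \<nu>_def\<close>)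
qed

end

section \<open>Smoothing semigroups\<close>

text \<open>The properties of \<open>frac_sg Q s\<close> on which the Schauder estimates rest: \<open>H\<close> and \<open>n\<close> stand for
  the Cameron--Martin space and its norm, \<open>B t h\<close> for the derivative of \<open>S t\<close> along \<open>h\<close>, and
  \<open>p = 1 / (2 s)\<close>.\<close>

locale smoothing_semigroup =
  fixes S :: "real \<Rightarrow> ('a::real_normed_vector \<Rightarrow> real) \<Rightarrow> 'a \<Rightarrow> real"
    and B :: "real \<Rightarrow> 'a \<Rightarrow> ('a \<Rightarrow> real) \<Rightarrow> 'a \<Rightarrow> real"
    and H :: "'a set" and n :: "'a \<Rightarrow> real" and p C :: real
  assumes p_pos: "0 < p" and C_ge_1: "1 \<le> C"
    and H_scaleR: "h \<in> H \<Longrightarrow> a *\<^sub>R h \<in> H"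
    and n_scaleR: "h \<in> H \<Longrightarrow> n (a *\<^sub>R h) = \<bar>a\<bar> * n h"
    and n_nonneg: "0 \<le> n h"
    and n_pos: "h \<in> H \<Longrightarrow> h \<noteq> 0 \<Longrightarrow> 0 < n h"
    and S_bound: "0 \<le> t \<Longrightarrow> f \<in> Cb \<Longrightarrow> (\<And>y. \<bar>f y\<bar> \<le> M) \<Longrightarrow> \<bar>S t f x\<bar> \<le> C * M"
    and S_LIMSEQ: "cconv F f \<Longrightarrow> r \<longlonglongrightarrow> t \<Longrightarrow> (\<And>i. 0 \<le> r i) \<Longrightarrow> X \<longlonglongrightarrow> x \<Longrightarrow>
      (\<lambda>i. S (r i) (F i) (X i)) \<longlonglongrightarrow> S t f x"
    and S_lincomb: "0 \<le> t \<Longrightarrow> f \<in> Cb \<Longrightarrow> g \<in> Cb \<Longrightarrow> S t (\<lambda>y. c * f y + d * g y) x = c * S t f x + d * S t g x"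
    and S_translate: "S t (\<lambda>y. f (y + h)) x = S t f (x + h)"
    and S_semigroup: "0 < a \<Longrightarrow> 0 < b \<Longrightarrow> f \<in> Cb \<Longrightarrow> S b (S a f) x = S (a + b) f x"
    and B_derivative: "0 < t \<Longrightarrow> f \<in> Cb \<Longrightarrow> h \<in> H \<Longrightarrow>
      ((\<lambda>\<tau>. S t f (x + \<tau> *\<^sub>R h)) has_real_derivative B t h f x) (at 0)"
    and B_bound: "0 < t \<Longrightarrow> f \<in> Cb \<Longrightarrow> h \<in> H \<Longrightarrow> 0 \<le> \<alpha> \<Longrightarrow> \<alpha> < 1 \<Longrightarrow> 0 \<le> K \<Longrightarrow>
      (\<And>x k. k \<in> H \<Longrightarrow> \<bar>f (x + k) - f x\<bar> \<le> K * n k powr \<alpha>) \<Longrightarrow>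
      \<bar>B t h f x\<bar> \<le> C * t powr - (p * (1 - \<alpha>)) * n h * K"
    and B_LIMSEQ: "cconv F f \<Longrightarrow> h \<in> H \<Longrightarrow> r \<longlonglongrightarrow> t \<Longrightarrow> 0 < \<delta> \<Longrightarrow> (\<And>i. \<delta> \<le> r i) \<Longrightarrow> X \<longlonglongrightarrow> x \<Longrightarrow>
      (\<lambda>i. B (r i) h (F i) (X i)) \<longlonglongrightarrow> B t h f x"

context
  fixes Q :: "'a::{real_inner, banach, second_countable_topology} \<Rightarrow> 'a" and s :: real
  assumes Q: "positive_operator Q" and tr: "finite_trace Q" and s: "0 < s" "s < 1"
begin

lemma frac_sg_has_derivative:
  assumes "0 < t" "f \<in> Cb" "h \<in> CM_space Q"
  shows "((\<lambda>\<tau>. frac_sg Q s t f (x + \<tau> *\<^sub>R h)) has_real_derivative frac_deriv Q s t h f x) (at 0)"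
proof (rule frac_deriv_cases[OF Q tr s assms(3)])
  assume "h = 0" "\<And>t f x. frac_deriv Q s t h f x = 0"
  then show ?thesis by simp
next
  fix z a \<nu>
  assume u: "norm z = 1" "a = op_sqrt Q z" "gaussian_law (\<lambda>x. Q x \<bullet> x - (x \<bullet> a)\<^sup>2) \<nu>"
    and h: "h = CM_norm Q h *\<^sub>R a"
    and d: "\<And>t f x. frac_deriv Q s t h f x = CM_norm Q h * (LBINT v:{0<..}. gauss_deriv \<nu> a (t powr (1 / s) * v) f x * stable_density s v)"
  define c where "c = CM_norm Q h"
  have "((\<lambda>\<tau>. frac_sg Q s t f (x + \<tau> *\<^sub>R a)) has_real_derivative
      (LBINT v:{0<..}. gauss_deriv \<nu> a (t powr (1 / s) * v) f x * stable_density s v)) (at (0 * c))"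
    using frac_sg_unit_derivative[OF Q tr s u assms(1,2)] by simp
  then have "((\<lambda>\<tau>. frac_sg Q s t f (x + (\<tau> * c) *\<^sub>R a)) has_real_derivative
      (LBINT v:{0<..}. gauss_deriv \<nu> a (t powr (1 / s) * v) f x * stable_density s v) * c) (at 0)"
    by (rule DERIV_chain2) (auto intro!: derivative_eq_intros)
  moreover have "(\<tau> * c) *\<^sub>R a = \<tau> *\<^sub>R h" for \<tau> using h by (metis c_def scaleR_scaleR)
  ultimately show ?thesis by (simp add: d c_def mult.commute)
qed

lemma frac_deriv_LIMSEQ:
  assumes F: "cconv F f" and h: "h \<in> CM_space Q" and t: "t \<longlonglongrightarrow> t0" "0 < \<delta>" "\<And>i. \<delta> \<le> t i" and X: "X \<longlonglongrightarrow> x"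
  shows "(\<lambda>i. frac_deriv Q s (t i) h (F i) (X i)) \<longlonglongrightarrow> frac_deriv Q s t0 h f x"
proof (rule frac_deriv_cases[OF Q tr s h])
  assume "\<And>t f x. frac_deriv Q s t h f x = 0"
  then show ?thesis by simp
next
  fix z a \<nu>
  assume u: "norm z = 1" "a = op_sqrt Q z" "gaussian_law (\<lambda>x. Q x \<bullet> x - (x \<bullet> a)\<^sup>2) \<nu>"
    and d: "\<And>t f x. frac_deriv Q s t h f x = CM_norm Q h * (LBINT v:{0<..}. gauss_deriv \<nu> a (t powr (1 / s) * v) f x * stable_density s v)"
  show ?thesis unfolding d by (intro tendsto_mult_left unit_LIMSEQ[OF Q tr s u F t X])
qed

lemma frac_deriv_bound:
  assumes "0 \<le> C" "\<And>\<kappa>. 0 \<le> \<kappa> \<Longrightarrow> \<kappa> \<le> 1 / 2 \<Longrightarrow> (LBINT v:{0<..}. v powr - \<kappa> * \<bar>stable_density s v\<bar>) \<le> C"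
    and "0 < t" "f \<in> Cb" and h: "h \<in> CM_space Q" and "0 \<le> \<alpha>" "\<alpha> < 1" "0 \<le> K"
    and osc: "\<And>x k. k \<in> CM_space Q \<Longrightarrow> \<bar>f (x + k) - f x\<bar> \<le> K * CM_norm Q k powr \<alpha>"
  shows "\<bar>frac_deriv Q s t h f x\<bar> \<le> 2 * C * t powr - (1 / (2 * s) * (1 - \<alpha>)) * CM_norm Q h * K"
proof (rule frac_deriv_cases[OF Q tr s h])
  assume "CM_norm Q h = 0" "\<And>t f x. frac_deriv Q s t h f x = 0"
  then show ?thesis by simp
next
  fix z a \<nu>
  assume u: "norm z = 1" "a = op_sqrt Q z" "gaussian_law (\<lambda>x. Q x \<bullet> x - (x \<bullet> a)\<^sup>2) \<nu>"
    and a: "a \<in> CM_space Q" "CM_norm Q a = 1" and pos: "0 < CM_norm Q h"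
    and d: "\<And>t f x. frac_deriv Q s t h f x = CM_norm Q h * (LBINT v:{0<..}. gauss_deriv \<nu> a (t powr (1 / s) * v) f x * stable_density s v)"
  have "\<bar>f (x + r *\<^sub>R a) - f x\<bar> \<le> K * \<bar>r\<bar> powr \<alpha>" for x r
    using osc[OF CM_space_scaleR[OF Q a(1)], of x r] CM_norm_scaleR[OF Q a(1)] a(2) by simp
  then have "\<bar>LBINT v:{0<..}. gauss_deriv \<nu> a (t powr (1 / s) * v) f x * stable_density s v\<bar>
      \<le> 2 * C * K * t powr - ((1 - \<alpha>) / (2 * s))"
    using assms by (intro unit_bound[OF Q tr s u]) auto
  then have "\<bar>frac_deriv Q s t h f x\<bar> \<le> CM_norm Q h * (2 * C * K * t powr - ((1 - \<alpha>) / (2 * s)))"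
    unfolding d using pos by (simp add: abs_mult)
  then show ?thesis by (simp add: mult_ac)
qed

proposition smoothing_semigroup_frac_sg:
  obtains C where "smoothing_semigroup (frac_sg Q s) (frac_deriv Q s) (CM_space Q) (CM_norm Q) (1 / (2 * s)) C"
proof -
  obtain C1 where C1: "0 \<le> C1" "\<And>t f x M. 0 \<le> t \<Longrightarrow> f \<in> Cb \<Longrightarrow> (\<And>y. \<bar>f y\<bar> \<le> M) \<Longrightarrow> \<bar>frac_sg Q s t f x\<bar> \<le> C1 * M"
    using frac_sg_bound[OF Q tr s] by blast
  obtain C2 where C2: "0 \<le> C2" "\<And>\<kappa>. 0 \<le> \<kappa> \<Longrightarrow> \<kappa> \<le> 1 / 2 \<Longrightarrow> (LBINT v:{0<..}. v powr - \<kappa> * \<bar>stable_density s v\<bar>) \<le> C2"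
    using stable_density_moment_le[OF s] by metis
  \<comment> \<open>The summand 1 ensures \<open>C \<ge> 1\<close>, \<open>C1\<close> bounds the
    semigroup and \<open>2 * C2\<close> its derivative.\<close>
  define C where "C = 1 + C1 + 2 * C2"
  have "smoothing_semigroup (frac_sg Q s) (frac_deriv Q s) (CM_space Q) (CM_norm Q) (1 / (2 * s)) C"
  proof
    show "\<bar>frac_sg Q s t f x\<bar> \<le> C * M" if "0 \<le> t" "f \<in> Cb" "\<And>y. \<bar>f y\<bar> \<le> M" for t f M x
    proof -
      have "0 \<le> M" using that(3)[of 0] by linarith
      then have "C1 * M \<le> C * M" using C1 C2 by (intro mult_right_mono) (auto simp: C_def)
      then show ?thesis using C1(2)[OF that, of x] by linarith
    qed
    show "\<bar>frac_deriv Q s t h f x\<bar> \<le> C * t powr - (1 / (2 * s) * (1 - \<alpha>)) * CM_norm Q h * K"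
      if "0 < t" "f \<in> Cb" "h \<in> CM_space Q" "0 \<le> \<alpha>" "\<alpha> < 1" "0 \<le> K"
        "\<And>x k. k \<in> CM_space Q \<Longrightarrow> \<bar>f (x + k) - f x\<bar> \<le> K * CM_norm Q k powr \<alpha>" for t f h \<alpha> K x
    proof -
      have "2 * C2 * t powr - (1 / (2 * s) * (1 - \<alpha>)) * CM_norm Q h * K \<le> C * t powr - (1 / (2 * s) * (1 - \<alpha>)) * CM_norm Q h * K"
        using C1 C2 that CM_norm_nonneg[OF Q, of h] by (intro mult_right_mono) (auto simp: C_def)
      then show ?thesis using frac_deriv_bound[OF C2 that, of x] by linarith
    qed
  qed (use s C1 C2 in \<open>simp_all add: C_def CM_space_scaleR[OF Q] CM_norm_scaleR[OF Q] CM_norm_nonneg[OF Q] CM_norm_pos[OF Q]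
      frac_sg_LIMSEQ[OF Q tr s] frac_sg_lincomb[OF Q tr s] frac_sg_translate[OF Q tr s] frac_sg_semigroup[OF Q tr s]
      frac_sg_has_derivative frac_deriv_LIMSEQ\<close>)
  then show thesis by (rule that)
qed

end

subsection \<open>Derivatives and differences of the semigroup\<close>

definition has_directional_derivative :: "('a::real_normed_vector \<Rightarrow> real) \<Rightarrow> 'a \<Rightarrow> ('a \<Rightarrow> real) \<Rightarrow> bool" where
  "has_directional_derivative F h F' \<longleftrightarrow>
     (\<forall>x. ((\<lambda>u. F (x + u *\<^sub>R h)) has_real_derivative F' x) (at 0))"

lemma has_directional_derivativeD:
  assumes "has_directional_derivative F h F'"
  shows "((\<lambda>u. F (x + u *\<^sub>R h)) has_real_derivative F' (x + u *\<^sub>R h)) (at u)"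
proof -
  have "((\<lambda>r. F (x + (u + r) *\<^sub>R h)) has_real_derivative F' (x + u *\<^sub>R h)) (at 0)"
    using assms[unfolded has_directional_derivative_def, rule_format, of "x + u *\<^sub>R h"] by (simp add: algebra_simps)
  then show ?thesis using DERIV_shift[of "\<lambda>r. F (x + r *\<^sub>R h)" "F' (x + u *\<^sub>R h)" 0 u]
    by (simp add: add.commute)
qed

lemma has_directional_derivative_unique:
  "has_directional_derivative F h F' \<Longrightarrow> has_directional_derivative F h F'' \<Longrightarrow> F' = F''"
  unfolding has_directional_derivative_def by (auto intro!: ext DERIV_unique)

lemma has_directional_derivative_bound:
  assumes "has_directional_derivative F h F'" and "\<And>y. \<bar>F' y\<bar> \<le> M"
  shows "\<bar>F (x + u *\<^sub>R h) - F x\<bar> \<le> \<bar>u\<bar> * M"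
  using assms by (intro directional_mean_value) (auto simp: has_directional_derivative_def)

lemma has_directional_derivative_mvt:
  assumes d: "has_directional_derivative F h F'" and "u \<noteq> 0"
  obtains \<xi> where "\<bar>\<xi>\<bar> \<le> \<bar>u\<bar>" "F (x + u *\<^sub>R h) - F x = u * F' (x + \<xi> *\<^sub>R h)"
proof (cases "0 < u")
  case True
  obtain z where "0 < z" "z < u" "F (x + u *\<^sub>R h) - F (x + 0 *\<^sub>R h) = (u - 0) * F' (x + z *\<^sub>R h)"
    using MVT2[OF True, of "\<lambda>u. F (x + u *\<^sub>R h)" "\<lambda>u. F' (x + u *\<^sub>R h)"] has_directional_derivativeD[OF d] by blast
  then show thesis by (intro that[of z]) auto
next
  case False
  then have neg: "u < 0" using assms by simp
  obtain z where "u < z" "z < 0" "F (x + 0 *\<^sub>R h) - F (x + u *\<^sub>R h) = (0 - u) * F' (x + z *\<^sub>R h)"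
    using MVT2[OF neg, of "\<lambda>u. F (x + u *\<^sub>R h)" "\<lambda>u. F' (x + u *\<^sub>R h)"] has_directional_derivativeD[OF d] by blast
  then show thesis by (intro that[of z]) auto
qed

text \<open>By the mean value theorem a quotient is a value of \<open>F'\<close> at a nearby point;
  this gives the uniform bound and the continuous convergence at once. The quotient is written as a
  combination of translates so that linearity of the semigroup applies.\<close>

lemma quotients_cconv:
  assumes d: "has_directional_derivative F h F'" and F: "F \<in> Cb" "F' \<in> Cb"
    and u: "u \<longlonglongrightarrow> 0" "\<And>i. u i \<noteq> 0"
  shows "cconv (\<lambda>i y. 1 / u i * F (y + u i *\<^sub>R h) + - (1 / u i) * F y) F'"
proof -
  obtain M where M: "M \<ge> 0" "\<And>x. \<bar>F' x\<bar> \<le> M" using CbE[OF F(2)] by blast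
  have eq: "1 / u i * F (y + u i *\<^sub>R h) + - (1 / u i) * F y = (F (y + u i *\<^sub>R h) - F y) / u i" for i y
    by (simp add: diff_divide_distrib)
  show ?thesis
  proof (rule cconvI)
    show "(\<lambda>y. 1 / u i * F (y + u i *\<^sub>R h) + - (1 / u i) * F y) \<in> Cb" for i
      by (intro Cb_lincomb Cb_translate F)
    show "\<bar>1 / u i * F (y + u i *\<^sub>R h) + - (1 / u i) * F y\<bar> \<le> M" for i y
      using has_directional_derivative_bound[OF d M(2), of y "u i"] u(2)[of i]
      by (simp add: eq field_simps)
    fix X :: "nat \<Rightarrow> 'a" and x assume X: "X \<longlonglongrightarrow> x"
    have "\<exists>\<xi>. \<bar>\<xi>\<bar> \<le> \<bar>u i\<bar> \<and> F (X i + u i *\<^sub>R h) - F (X i) = u i * F' (X i + \<xi> *\<^sub>R h)" for i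
      using has_directional_derivative_mvt[OF d u(2)[of i], of "X i"] by metis
    then obtain \<xi> where \<xi>: "\<And>i. \<bar>\<xi> i\<bar> \<le> \<bar>u i\<bar>" "\<And>i. F (X i + u i *\<^sub>R h) - F (X i) = u i * F' (X i + \<xi> i *\<^sub>R h)"
      by metis
    have "\<xi> \<longlonglongrightarrow> 0"
      by (rule tendsto_rabs_zero_cancel, rule tendsto_sandwich[OF _ _ tendsto_const tendsto_rabs_zero[OF u(1)]])
        (use \<xi>(1) in auto)
    then have "(\<lambda>i. X i + \<xi> i *\<^sub>R h) \<longlonglongrightarrow> x + 0 *\<^sub>R h" by (intro tendsto_intros X)
    then have "(\<lambda>i. F' (X i + \<xi> i *\<^sub>R h)) \<longlonglongrightarrow> F' x" using Cb_LIMSEQ[OF F(2)] by simp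
    then show "(\<lambda>i. 1 / u i * F (X i + u i *\<^sub>R h) + - (1 / u i) * F (X i)) \<longlonglongrightarrow> F' x"
      unfolding eq \<xi>(2) using u(2) by simp
  qed (rule F)
qed

context smoothing_semigroup
begin

lemma S_Cb: "0 \<le> t \<Longrightarrow> f \<in> Cb \<Longrightarrow> S t f \<in> Cb"
proof -
  assume t: "0 \<le> t" and f: "f \<in> Cb"
  obtain K where "\<And>x. \<bar>f x\<bar> \<le> K" using CbE[OF f] by blast
  then have "\<bar>S t f x\<bar> \<le> C * K" for x by (rule S_bound[OF t f])
  moreover have "(\<lambda>i. S t f (X i)) \<longlonglongrightarrow> S t f x" if "X \<longlonglongrightarrow> x" for X x
    using S_LIMSEQ[OF cconv_const[OF f] tendsto_const _ that] t by simp
  ultimately show "S t f \<in> Cb" by (rule CbI_sequentially[rotated])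
qed

lemma S_has_directional_derivative: "0 < t \<Longrightarrow> f \<in> Cb \<Longrightarrow> h \<in> H \<Longrightarrow> has_directional_derivative (S t f) h (B t h f)"
  by (simp add: has_directional_derivative_def B_derivative)

lemma B_bound_sup:
  assumes "0 < t" "f \<in> Cb" "h \<in> H" "0 \<le> M" "\<And>y. \<bar>f y\<bar> \<le> M"
  shows "\<bar>B t h f x\<bar> \<le> 2 * C * t powr - p * n h * M"
proof -
  have "\<bar>f (x + k) - f x\<bar> \<le> 2 * M * n k powr 0" if "k \<in> H" for x k
  proof (cases "k = 0")
    case False
    then have "n k powr 0 = 1" using n_pos[OF that] by simp
    moreover have "\<bar>f (x + k) - f x\<bar> \<le> \<bar>f (x + k)\<bar> + \<bar>f x\<bar>" by linarith
    ultimately show ?thesis using assms(5)[of x] assms(5)[of "x + k"] by simp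
  qed (use assms in simp)
  then have "\<bar>B t h f x\<bar> \<le> C * t powr - (p * (1 - 0)) * n h * (2 * M)"
    using assms by (intro B_bound) auto
  then show ?thesis by (simp add: mult_ac)
qed

lemma B_Cb:
  assumes t: "0 < t" and f: "f \<in> Cb" and h: "h \<in> H"
  shows "B t h f \<in> Cb"
proof -
  obtain K where K: "0 \<le> K" "\<And>x. \<bar>f x\<bar> \<le> K" using CbE[OF f] by blast
  then have "\<bar>B t h f x\<bar> \<le> 2 * C * t powr - p * n h * K" for x by (rule B_bound_sup[OF t f h])
  moreover have "(\<lambda>i. B t h f (X i)) \<longlonglongrightarrow> B t h f x" if "X \<longlonglongrightarrow> x" for X x
    using B_LIMSEQ[OF cconv_const[OF f] h tendsto_const t _ that] by simp
  ultimately show ?thesis by (rule CbI_sequentially[rotated])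
qed

lemma B_cconv:
  assumes F: "cconv F f" and h: "h \<in> H" and r: "r \<longlonglongrightarrow> t" "0 < \<delta>" "\<And>i. \<delta> \<le> r i"
  shows "cconv (\<lambda>i. B (r i) h (F i)) (B t h f)"
proof -
  obtain K where K: "0 \<le> K" "\<And>i x. \<bar>F i x\<bar> \<le> K" using cconvE[OF F] by metis
  have rpos: "0 < r i" for i using r(2) r(3)[of i] by simp
  have tpos: "0 < t" using r LIMSEQ_le_const[OF r(1), of \<delta>] by force
  show ?thesis
  proof (rule cconvI)
    show "\<bar>B (r i) h (F i) x\<bar> \<le> 2 * C * \<delta> powr - p * n h * K" for i x
    proof -
      have "\<bar>B (r i) h (F i) x\<bar> \<le> 2 * C * r i powr - p * n h * K"
        using rpos cconv_Cb[OF F] h K by (intro B_bound_sup) auto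
      also have "\<dots> \<le> 2 * C * \<delta> powr - p * n h * K"
        using r p_pos C_ge_1 n_nonneg K by (intro mult_right_mono mult_left_mono powr_mono2') auto
      finally show ?thesis .
    qed
  qed (use F h r rpos tpos in \<open>auto intro: B_LIMSEQ B_Cb cconv_Cb\<close>)
qed

text \<open>Difference quotients converge continuously, and \<open>S t\<close> respects this
  convergence, is linear and commutes with translations.\<close>

lemma S_preserves_directional_derivative:
  assumes t: "0 \<le> t" and d: "has_directional_derivative F h F'" and F: "F \<in> Cb" "F' \<in> Cb"
  shows "has_directional_derivative (S t F) h (S t F')"
  unfolding has_directional_derivative_def DERIV_def tendsto_at_iff_sequentially
proof (intro allI impI)
  fix x and u :: "nat \<Rightarrow> real" assume "\<forall>i. u i \<in> UNIV - {0}" and u0: "u \<longlonglongrightarrow> 0"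
  then have u: "u i \<noteq> 0" for i by simp
  have "(\<lambda>i. S t (\<lambda>y. 1 / u i * F (y + u i *\<^sub>R h) + - (1 / u i) * F y) x) \<longlonglongrightarrow> S t F' x"
    using t by (intro S_LIMSEQ[OF quotients_cconv[OF d F u0 u]]) auto
  moreover have "S t (\<lambda>y. 1 / u i * F (y + u i *\<^sub>R h) + - (1 / u i) * F y) x = (S t F (x + u i *\<^sub>R h) - S t F x) / u i" for i
    using S_lincomb[OF t Cb_translate[OF F(1), of "u i *\<^sub>R h"] F(1), of "1 / u i" "- (1 / u i)" x]
    by (simp add: diff_divide_distrib S_translate)
  ultimately show "((\<lambda>u. (S t F (x + (0 + u) *\<^sub>R h) - S t F (x + 0 *\<^sub>R h)) / u) \<circ> u) \<longlonglongrightarrow> S t F' x"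
    by (simp add: comp_def)
qed

text \<open>Both expressions are the derivative of \<open>S (a + b) f\<close> along
  \<open>h\<close>, which is unique. A derivative may thus be placed before or after a part of the
  evolution.\<close>

lemma B_add:
  assumes "0 < a" "0 < b" "f \<in> Cb" "h \<in> H"
  shows "B (a + b) h f = S b (B a h f)" and "B (a + b) h f = B b h (S a f)"
proof -
  have eq: "S b (S a f) = S (a + b) f" using S_semigroup assms by auto
  have 1: "has_directional_derivative (S (a + b) f) h (B (a + b) h f)"
    using assms by (intro S_has_directional_derivative) auto
  have "has_directional_derivative (S (a + b) f) h (S b (B a h f))"
    unfolding eq[symmetric] using assms
    by (intro S_preserves_directional_derivative S_has_directional_derivative S_Cb B_Cb) auto
  then show "B (a + b) h f = S b (B a h f)" by (rule has_directional_derivative_unique[OF 1])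
  have "has_directional_derivative (S (a + b) f) h (B b h (S a f))"
    unfolding eq[symmetric] using assms by (intro S_has_directional_derivative S_Cb) auto
  then show "B (a + b) h f = B b h (S a f)" by (rule has_directional_derivative_unique[OF 1])
qed

end

section \<open>Iterated differences and iterated derivatives of the semigroup\<close>

primrec fdiff :: "nat \<Rightarrow> 'a::real_normed_vector \<Rightarrow> ('a \<Rightarrow> real) \<Rightarrow> 'a \<Rightarrow> real" where
  "fdiff 0 l F = F"
| "fdiff (Suc m) l F = (\<lambda>x. fdiff m l F (x + l) - fdiff m l F x)"

lemma fdiff_2: "fdiff 2 l F x = F (x + 2 *\<^sub>R l) - 2 * F (x + l) + F x"
  by (simp add: numeral_2_eq_2 scaleR_2 add.assoc)

lemma fdiff_bound: "(\<And>x. \<bar>F x\<bar> \<le> M) \<Longrightarrow> \<bar>fdiff m l F x\<bar> \<le> 2 ^ m * M"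
proof (induction m arbitrary: x)
  case (Suc m)
  have "2 ^ Suc m * M = 2 * (2 ^ m * M)" "fdiff (Suc m) l F x = fdiff m l F (x + l) - fdiff m l F x" by simp_all
  then show ?case using Suc.IH[OF Suc.prems, of x] Suc.IH[OF Suc.prems, of "x + l"] by linarith
qed simp

text \<open>The hypothesis covers the first difference; each further one doubles the bound.\<close>

lemma fdiff_Suc_bound: "(\<And>x. \<bar>F (x + l) - F x\<bar> \<le> M) \<Longrightarrow> \<bar>fdiff (Suc m) l F x\<bar> \<le> 2 ^ m * M"
proof (induction m arbitrary: x)
  case (Suc m)
  have "2 ^ Suc m * M = 2 * (2 ^ m * M)"
    "fdiff (Suc (Suc m)) l F x = fdiff (Suc m) l F (x + l) - fdiff (Suc m) l F x" by simp_all
  then show ?case using Suc.IH[OF Suc.prems, of x] Suc.IH[OF Suc.prems, of "x + l"] by linarith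
qed simp

lemma fdiff_Cb: "F \<in> Cb \<Longrightarrow> fdiff m l F \<in> Cb"
proof (induction m)
  case (Suc m)
  then show ?case using Cb_lincomb[OF Cb_translate[of "fdiff m l F" l], of "fdiff m l F" 1 "- 1"] by simp
qed simp

lemma fdiff_has_directional_derivative:
  "has_directional_derivative F h F' \<Longrightarrow> has_directional_derivative (fdiff m l F) h (fdiff m l F')"
proof (induction m)
  case (Suc m)
  then have "((\<lambda>\<tau>. fdiff m l F (x + \<tau> *\<^sub>R h)) has_real_derivative fdiff m l F' x) (at 0)" for x
    by (simp add: has_directional_derivative_def)
  from this this[of "_ + l"] show ?case
    by (auto simp: has_directional_derivative_def add.assoc add.left_commute add.commute[of _ l] intro!: derivative_intros)
qed simp

lemma fdiff_set_integral:
  assumes "\<And>x. set_integrable lborel X (\<lambda>r. \<phi> r x)"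
  shows "set_integrable lborel X (\<lambda>r. fdiff m l (\<phi> r) x)"
    and "fdiff m l (\<lambda>x. LBINT r:X. \<phi> r x) x = (LBINT r:X. fdiff m l (\<phi> r) x)"
proof (induction m arbitrary: x)
  case (Suc m)
  { case 1 show ?case using Suc by (simp add: set_integral_diff) }
  { case 2 show ?case using Suc by (simp add: set_integral_diff) }
qed (use assms in simp_all)

context smoothing_semigroup
begin

text \<open>The iterated derivative of \<open>S r\<close>: each direction takes half of the time
  still available, so every factor \<open>B\<close> comes with a smoothing time comparable to
  \<open>r\<close>.\<close>

primrec D :: "'a list \<Rightarrow> real \<Rightarrow> ('a \<Rightarrow> real) \<Rightarrow> 'a \<Rightarrow> real" where
  "D [] r = S r"
| "D (h # hs) r = (\<lambda>f. B (r / 2) h (D hs (r / 2) f))"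

abbreviation P :: "'a list \<Rightarrow> real" where "P hs \<equiv> prod_list (map n hs)"

text \<open>One constant bounds supremum and oscillation. At \<open>\<alpha> = 0\<close> the power
  is 1 for \<open>k \<noteq> 0\<close>, so merely bounded data are included, with twice their
  supremum.\<close>

definition holder_bound :: "real \<Rightarrow> real \<Rightarrow> ('a \<Rightarrow> real) \<Rightarrow> bool" where
  "holder_bound \<alpha> K g \<longleftrightarrow> g \<in> Cb \<and> (\<forall>x. \<bar>g x\<bar> \<le> K) \<and> (\<forall>x. \<forall>k\<in>H. \<bar>g (x + k) - g x\<bar> \<le> K * n k powr \<alpha>)"

lemma holder_boundD:
  assumes "holder_bound \<alpha> K g"
  shows "g \<in> Cb" "\<And>x. \<bar>g x\<bar> \<le> K" "\<And>x k. k \<in> H \<Longrightarrow> \<bar>g (x + k) - g x\<bar> \<le> K * n k powr \<alpha>" "0 \<le> K"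
  using assms abs_ge_zero order_trans unfolding holder_bound_def by blast+

lemma P_nonneg: "0 \<le> P hs"
  by (rule prod_list_nonneg) (use n_nonneg in auto)

lemma n_0: "l \<in> H \<Longrightarrow> n 0 = 0"
  using n_scaleR[of l 0] by simp

lemma D_Cb: "0 < r \<Longrightarrow> f \<in> Cb \<Longrightarrow> set hs \<subseteq> H \<Longrightarrow> D hs r f \<in> Cb"
  by (induction hs arbitrary: r) (auto intro: S_Cb B_Cb)

lemma D_single: "0 < r \<Longrightarrow> f \<in> Cb \<Longrightarrow> h \<in> H \<Longrightarrow> D [h] r f = B r h f"
  using B_add(2)[of "r / 2" "r / 2" f h] by simp

text \<open>The additional time \<open>a\<close> is halved like the time \<open>b\<close>: by
  \<open>B_add\<close> one half goes to the outer factor and the other is passed on to the inner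
  ones.\<close>

lemma S_D: "0 < a \<Longrightarrow> 0 < b \<Longrightarrow> f \<in> Cb \<Longrightarrow> set hs \<subseteq> H \<Longrightarrow> S a (D hs b f) = D hs (a + b) f"
proof (induction hs arbitrary: a b)
  case Nil
  then show ?case using S_semigroup[of b a f] by (auto simp: add.commute)
next
  case (Cons h hs)
  then have h: "h \<in> H" and DC: "D hs (b / 2) f \<in> Cb" by (auto intro: D_Cb)
  have "S a (B (b / 2) h (D hs (b / 2) f)) = B (b / 2 + a) h (D hs (b / 2) f)"
    using Cons.prems h DC B_add(1)[of "b / 2" a "D hs (b / 2) f" h] by simp
  also have "\<dots> = B ((a + b) / 2) h (S (a / 2) (D hs (b / 2) f))"
    using Cons.prems h DC B_add(2)[of "a / 2" "(a + b) / 2" "D hs (b / 2) f" h] by (simp add: field_simps)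
  also have "S (a / 2) (D hs (b / 2) f) = D hs ((a + b) / 2) f"
    using Cons.IH[of "a / 2" "b / 2"] Cons.prems by (simp add: add_divide_distrib)
  finally show ?case by simp
qed

text \<open>In the form \<open>S (r / 2) (D hs (r / 2) f)\<close> the new derivative falls on the
  outer semigroup.\<close>

lemma D_has_directional_derivative:
  assumes "0 < r" "f \<in> Cb" "set hs \<subseteq> H" "h \<in> H"
  shows "has_directional_derivative (D hs r f) h (D (h # hs) r f)"
  using S_has_directional_derivative[of "r / 2" "D hs (r / 2) f" h] S_D[of "r / 2" "r / 2" f hs] assms
  by (simp add: D_Cb)

lemma D_cconv:
  assumes F: "cconv F f" and hs: "set hs \<subseteq> H" and r: "r \<longlonglongrightarrow> t" "0 < \<delta>" "\<And>i. \<delta> \<le> r i"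
  shows "cconv (\<lambda>i. D hs (r i) (F i)) (D hs t f)"
  using hs r
proof (induction hs arbitrary: r t \<delta>)
  case Nil
  obtain K where K: "0 \<le> K" "\<And>i x. \<bar>F i x\<bar> \<le> K" using cconvE[OF F] by metis
  have r: "0 \<le> r i" for i using Nil(3) Nil(4)[of i] by simp
  have "0 \<le> t" by (rule LIMSEQ_le_const[OF Nil(2)]) (use r in auto)
  then show ?case
    using r K cconv_Cb[OF F] by (intro cconvI[where K = "C * K"]) (auto intro: S_Cb S_bound S_LIMSEQ[OF F Nil(2)])
next
  case (Cons h hs)
  have r: "(\<lambda>i. r i / 2) \<longlonglongrightarrow> t / 2" "0 < \<delta> / 2" "\<And>i. \<delta> / 2 \<le> r i / 2"
    using Cons.prems by (auto intro!: tendsto_intros)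
  show ?case unfolding D.simps by (rule B_cconv[OF Cons.IH[OF _ r] _ r]) (use Cons.prems in auto)
qed

lemma half_powr: "0 < (r::real) \<Longrightarrow> (r / 2) powr - a = 2 powr a * r powr - a"
  by (simp add: powr_divide powr_minus_divide)

text \<open>The innermost derivative exploits the Hoelder bound and costs
  \<open>r powr - (p * (1 - \<alpha>))\<close>; every further one acts on a merely bounded function
  and costs \<open>r powr - p\<close>.\<close>

lemma D_bound:
  assumes \<alpha>: "0 \<le> \<alpha>" "\<alpha> < 1"
  shows "\<exists>c\<ge>0. \<forall>r hs g K x. 0 < r \<longrightarrow> set hs \<subseteq> H \<longrightarrow> length hs = Suc j \<longrightarrow> holder_bound \<alpha> K g \<longrightarrow>
    \<bar>D hs r g x\<bar> \<le> c * r powr - (p * (real (Suc j) - \<alpha>)) * (P hs * K)"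
proof (induction j)
  case 0
  have "\<bar>D hs r g x\<bar> \<le> C * r powr - (p * (real (Suc 0) - \<alpha>)) * (P hs * K)"
    if "0 < r" and hs: "set hs \<subseteq> H" "length hs = Suc 0" and g: "holder_bound \<alpha> K g" for r hs g K x
  proof -
    obtain h where h: "hs = [h]" "h \<in> H" using hs by (auto simp: length_Suc_conv)
    have "\<bar>B r h g x\<bar> \<le> C * r powr - (p * (1 - \<alpha>)) * n h * K"
      using that(1) h(2) \<alpha> holder_boundD[OF g] by (intro B_bound) auto
    then show ?thesis using that h D_single holder_boundD(1)[OF g] by (simp add: mult.assoc del: D.simps)
  qed
  then show ?case using C_ge_1 by (intro exI[of _ C]) auto
next
  case (Suc j)
  then obtain c where c: "c \<ge> 0" "\<And>r hs g K x. 0 < r \<Longrightarrow> set hs \<subseteq> H \<Longrightarrow> length hs = Suc j \<Longrightarrow> holder_bound \<alpha> K g \<Longrightarrow>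
    \<bar>D hs r g x\<bar> \<le> c * r powr - (p * (real (Suc j) - \<alpha>)) * (P hs * K)" by blast
  let ?a = "p * (real (Suc (Suc j)) - \<alpha>)" and ?b = "p * (real (Suc j) - \<alpha>)"
  have "\<bar>D hs r g x\<bar> \<le> (2 * C * c * 2 powr ?a) * r powr - ?a * (P hs * K)"
    if r: "0 < r" and hs: "set hs \<subseteq> H" "length hs = Suc (Suc j)" and g: "holder_bound \<alpha> K g" for r hs g K x
  proof -
    obtain h ks where h: "hs = h # ks" "h \<in> H" "set ks \<subseteq> H" "length ks = Suc j"
      using hs by (auto simp: length_Suc_conv)
    have "\<bar>B (r / 2) h (D ks (r / 2) g) x\<bar> \<le> 2 * C * (r / 2) powr - p * n h * (c * (r / 2) powr - ?b * (P ks * K))"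
      using r g h c holder_boundD[OF g] P_nonneg by (intro B_bound_sup D_Cb) auto
    also have "\<dots> = 2 * C * c * ((r / 2) powr - p * (r / 2) powr - ?b) * (n h * P ks * K)" by simp
    also have "(r / 2) powr - p * (r / 2) powr - ?b = (r / 2) powr - ?a"
      unfolding powr_add[symmetric] by (simp add: algebra_simps)
    finally show ?thesis using r h(1) by (simp add: half_powr mult_ac)
  qed
  then show ?case using c(1) C_ge_1 by (intro exI[of _ "2 * C * c * 2 powr ?a"]) auto
qed

text \<open>Every difference is bounded by a derivative, so only the total order matters.\<close>

lemma D_fdiff_bound:
  assumes \<alpha>: "0 \<le> \<alpha>" "\<alpha> < 1"
  obtains c where "c \<ge> 0" "\<And>r hs g K x m l. 0 < r \<Longrightarrow> set hs \<subseteq> H \<Longrightarrow> length hs + m = Suc j \<Longrightarrow> holder_bound \<alpha> K g \<Longrightarrow> l \<in> H \<Longrightarrow>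
    \<bar>fdiff m l (D hs r g) x\<bar> \<le> c * r powr - (p * (real (Suc j) - \<alpha>)) * (n l ^ m * P hs * K)"
proof -
  obtain c where c: "c \<ge> 0" "\<And>r hs g K x. 0 < r \<Longrightarrow> set hs \<subseteq> H \<Longrightarrow> length hs = Suc j \<Longrightarrow> holder_bound \<alpha> K g \<Longrightarrow>
    \<bar>D hs r g x\<bar> \<le> c * r powr - (p * (real (Suc j) - \<alpha>)) * (P hs * K)" using D_bound[OF \<alpha>] by metis
  have "\<bar>fdiff m l (D hs r g) x\<bar> \<le> c * r powr - (p * (real (Suc j) - \<alpha>)) * (n l ^ m * P hs * K)"
    if r: "0 < r" and hs: "set hs \<subseteq> H" "length hs + m = Suc j" and g: "holder_bound \<alpha> K g" and l: "l \<in> H" for r hs g K x m l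
    using hs
  proof (induction m arbitrary: hs x)
    case 0
    then show ?case using c(2)[OF r _ _ g] by simp
  next
    case (Suc m)
    have "has_directional_derivative (fdiff m l (D hs r g)) l (fdiff m l (D (l # hs) r g))"
      using D_has_directional_derivative[OF r holder_boundD(1)[OF g]] Suc.prems l by (intro fdiff_has_directional_derivative) simp
    from has_directional_derivative_bound[OF this Suc.IH, of x 1]
    show ?case using Suc.prems l by (simp add: mult_ac del: D.simps)
  qed
  then show thesis using that c(1) by blast
qed

lemma S_fdiff:
  assumes "0 \<le> t" "F \<in> Cb"
  shows "fdiff m l (S t F) x = S t (fdiff m l F) x"
proof (induction m arbitrary: x)
  case (Suc m)
  have DC: "fdiff m l F \<in> Cb" by (rule fdiff_Cb[OF assms(2)])
  show ?case using Suc S_lincomb[OF assms(1) Cb_translate[OF DC] DC, of 1 l "- 1" x] by (simp add: S_translate)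
qed simp

lemma S_fdiff_bound:
  "0 \<le> t \<Longrightarrow> F \<in> Cb \<Longrightarrow> (\<And>y. \<bar>fdiff m l F y\<bar> \<le> M) \<Longrightarrow> \<bar>fdiff m l (S t F) x\<bar> \<le> C * M"
  by (simp add: S_fdiff S_bound fdiff_Cb)

end

section \<open>Convolution in time\<close>

text \<open>Joint continuity at times bounded away from 0, where the derivatives of the semigroup
  are not singular.\<close>

definition continuous_kernel :: "(real \<Rightarrow> ('a::real_normed_vector \<Rightarrow> real) \<Rightarrow> 'a \<Rightarrow> real) \<Rightarrow> bool" where
  "continuous_kernel E \<longleftrightarrow> (\<forall>F f r t \<delta> X x. cconv F f \<longrightarrow> r \<longlonglongrightarrow> t \<longrightarrow> 0 < \<delta> \<longrightarrow> (\<forall>i. \<delta> \<le> r i) \<longrightarrow> X \<longlonglongrightarrow> x \<longrightarrow>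
     (\<lambda>i. E (r i) (F i) (X i)) \<longlonglongrightarrow> E t f x)"

text \<open>Families live on all real times, so that \<open>g (t - r)\<close> needs no case
  distinction; data on the time interval are extended by clamping.\<close>

definition bounded_family :: "(real \<Rightarrow> 'a::real_normed_vector \<Rightarrow> real) \<Rightarrow> bool" where
  "bounded_family g \<longleftrightarrow> continuous_on UNIV (\<lambda>(t, x). g t x) \<and> (\<exists>K. \<forall>t x. \<bar>g t x\<bar> \<le> K)"

text \<open>Time is reversed against the mild solution: the singular argument of the kernel becomes
  the variable of integration, and the end point 0 is left out.\<close>

definition duhamel :: "(real \<Rightarrow> ('a \<Rightarrow> real) \<Rightarrow> 'a \<Rightarrow> real) \<Rightarrow> (real \<Rightarrow> 'a \<Rightarrow> real) \<Rightarrow> real \<Rightarrow> 'a \<Rightarrow> real" where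
  "duhamel E g t x = (LBINT r:{0<..t}. E r (g (t - r)) x)"

lemma bounded_family_cconv:
  assumes g: "bounded_family g" and \<tau>: "\<tau> \<longlonglongrightarrow> \<tau>0"
  shows "cconv (\<lambda>i. g (\<tau> i)) (g \<tau>0)"
proof -
  obtain K where K: "\<And>t x. \<bar>g t x\<bar> \<le> K" using g by (auto simp: bounded_family_def)
  have c: "(\<lambda>i. g (\<sigma> i) (X i)) \<longlonglongrightarrow> g \<sigma>0 x" if "\<sigma> \<longlonglongrightarrow> \<sigma>0" "X \<longlonglongrightarrow> x" for \<sigma> \<sigma>0 X x
    using continuous_on_tendsto_compose[of UNIV "\<lambda>(t, x). g t x", OF _ tendsto_Pair[OF that]] g
    by (simp add: bounded_family_def)
  have "g t \<in> Cb" for t by (rule CbI_sequentially[of _ K]) (use c[OF tendsto_const] K in auto)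
  then show ?thesis using c[OF \<tau>] K by (intro cconvI) auto
qed

lemma bounded_family_Cb: "bounded_family g \<Longrightarrow> g t \<in> Cb"
  using bounded_family_cconv[of g "\<lambda>_. t" t] cconv_Cb(2) by blast

lemma continuous_kernelD:
  assumes "continuous_kernel E" "cconv F f" "r \<longlonglongrightarrow> t" "0 < \<delta>" "\<And>i. \<delta> \<le> r i" "X \<longlonglongrightarrow> x"
  shows "(\<lambda>i. E (r i) (F i) (X i)) \<longlonglongrightarrow> E t f x"
  using assms unfolding continuous_kernel_def by blast

text \<open>Both bounds hold on the whole half line and the integration is extended to it, which
  makes the result uniform in \<open>t\<close>.\<close>

lemma abs_set_integral_le_split:
  fixes a b R A B :: real
  assumes a: "a < 1" and b: "1 < b" and R: "0 < R" and AB: "0 \<le> A" "0 \<le> B"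
    and int: "set_integrable lborel {0<..t} f"
    and small: "\<And>r. 0 < r \<Longrightarrow> \<bar>f r\<bar> \<le> A * r powr - a" and large: "\<And>r. 0 < r \<Longrightarrow> \<bar>f r\<bar> \<le> B * r powr - b"
  shows "\<bar>LBINT r:{0<..t}. f r\<bar> \<le> A * (R powr (1 - a) / (1 - a)) + B * (R powr (1 - b) / (b - 1))"
proof -
  let ?u = "\<lambda>r. indicator {0<..R} r *\<^sub>R (A * r powr - a)" and ?v = "\<lambda>r. indicator {R<..} r *\<^sub>R (B * r powr - b)"
  have u: "integrable lborel ?u" and v: "integrable lborel ?v"
    using set_integrable_mult_right[of A, OF powr_integral_at_0(1)[OF a R]]
      set_integrable_mult_right[of B, OF powr_integral_at_top(1)[OF b R]] by (simp_all add: set_integrable_def)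
  have "\<bar>LBINT r:{0<..t}. f r\<bar> \<le> (LINT r|lborel. \<bar>indicator {0<..t} r *\<^sub>R f r\<bar>)"
    unfolding set_lebesgue_integral_def by (rule integral_abs_bound)
  also have "\<dots> \<le> (LINT r|lborel. ?u r + ?v r)"
  proof (rule integral_mono)
    show "integrable lborel (\<lambda>r. \<bar>indicator {0<..t} r *\<^sub>R f r\<bar>)"
      using int by (simp add: set_integrable_def)
    show "\<bar>indicator {0<..t} r *\<^sub>R f r\<bar> \<le> ?u r + ?v r" for r
      using small[of r] large[of r] AB R by (auto simp: indicator_def)
  qed (intro Bochner_Integration.integrable_add u v)
  also have "\<dots> = (LBINT r:{0<..R}. A * r powr - a) + (LBINT r:{R<..}. B * r powr - b)"
    unfolding set_lebesgue_integral_def by (rule Bochner_Integration.integral_add[OF u v])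
  finally show ?thesis
    by (simp add: powr_integral_at_0(2)[OF a R] powr_integral_at_top(2)[OF b R])
qed

context
  fixes g :: "real \<Rightarrow> 'a::real_normed_vector \<Rightarrow> real" and E M q
  assumes g: "bounded_family g" and E: "continuous_kernel E" and M: "0 \<le> M" and q: "q < 1"
    and bound: "\<And>r t x. 0 < r \<Longrightarrow> \<bar>E r (g t) x\<bar> \<le> M * r powr - q"
begin

lemma duhamel_integrand_measurable: "(\<lambda>r. indicator {0<..t} r *\<^sub>R E r (g (t - r)) x) \<in> borel_measurable borel"
proof -
  have "continuous_on {0<..} (\<lambda>r. E r (g (t - r)) x)"
  proof (rule continuous_at_imp_continuous_on, rule ballI)
    fix r :: real assume "r \<in> {0<..}"
    then have r: "0 < r" by simp
    have "continuous_on {r / 2..} (\<lambda>r. E r (g (t - r)) x)"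
      unfolding continuous_on_sequentially comp_def
    proof (intro allI ballI impI, elim conjE)
      fix u and v :: "nat \<Rightarrow> real" assume v: "\<forall>i. v i \<in> {r / 2..}" "v \<longlonglongrightarrow> u"
      then show "(\<lambda>i. E (v i) (g (t - v i)) x) \<longlonglongrightarrow> E u (g (t - u)) x"
        using r by (intro continuous_kernelD[OF E bounded_family_cconv[OF g], of _ _ _ _ "r / 2"] tendsto_intros) auto
    qed
    then have "continuous_on {r / 2<..} (\<lambda>r. E r (g (t - r)) x)" by (rule continuous_on_subset) auto
    then show "isCont (\<lambda>r. E r (g (t - r)) x) r"
      using r by (simp add: continuous_on_eq_continuous_at)
  qed
  then have "(\<lambda>r. indicator {0<..} r *\<^sub>R E r (g (t - r)) x) \<in> borel_measurable borel"
    by (intro borel_measurable_continuous_on_indicator) auto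
  then have "(\<lambda>r. indicator {..t} r *\<^sub>R (indicator {0<..} r *\<^sub>R E r (g (t - r)) x)) \<in> borel_measurable borel" by measurable
  also have "(\<lambda>r. indicator {..t} r *\<^sub>R (indicator {0<..} r *\<^sub>R E r (g (t - r)) x)) = (\<lambda>r. indicator {0<..t} r *\<^sub>R E r (g (t - r)) x)"
    by (auto simp: indicator_def)
  finally show ?thesis .
qed

lemma duhamel_dominated:
  assumes "t \<le> T"
  shows "\<bar>indicator {0<..t} r *\<^sub>R E r (g (t - r)) x\<bar> \<le> indicator {0<..T} r *\<^sub>R (M * r powr - q)"
  using bound[of r "t - r" x] M assms by (auto simp: indicator_def)

lemma duhamel_dominating_integrable: "0 < T \<Longrightarrow> integrable lborel (\<lambda>r. indicator {0<..T} r *\<^sub>R (M * r powr - q))"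
  using set_integrable_mult_right[of M, OF powr_integral_at_0(1)[OF q, of T]] by (simp add: set_integrable_def)

lemma duhamel_integrable: "set_integrable lborel {0<..t} (\<lambda>r. E r (g (t - r)) x)"
  unfolding set_integrable_def
proof (rule Bochner_Integration.integrable_bound)
  show "integrable lborel (\<lambda>r. indicator {0<..max t 1} r *\<^sub>R (M * r powr - q))"
    by (intro duhamel_dominating_integrable) auto
  show "AE r in lborel. norm (indicator {0<..t} r *\<^sub>R E r (g (t - r)) x) \<le> norm (indicator {0<..max t 1} r *\<^sub>R (M * r powr - q))"
    using order_trans[OF duhamel_dominated[of t "max t 1"] abs_ge_self] by (intro AE_I2) simp
qed (use duhamel_integrand_measurable in simp)

lemma duhamel_bound:
  assumes "t \<le> T" "0 < T"
  shows "\<bar>duhamel E g t x\<bar> \<le> M * (T powr (1 - q) / (1 - q))"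
proof -
  have "\<bar>duhamel E g t x\<bar> \<le> (LINT r|lborel. \<bar>indicator {0<..t} r *\<^sub>R E r (g (t - r)) x\<bar>)"
    unfolding duhamel_def set_lebesgue_integral_def by (rule integral_abs_bound)
  also have "\<dots> \<le> (LINT r|lborel. indicator {0<..T} r *\<^sub>R (M * r powr - q))"
    using duhamel_integrable assms duhamel_dominated[OF assms(1)]
    by (intro integral_mono duhamel_dominating_integrable) (auto simp: set_integrable_def)
  also have "\<dots> = M * (T powr (1 - q) / (1 - q))"
    using powr_integral_at_0(2)[OF q assms(2)] by (simp add: set_lebesgue_integral_def mult.left_commute)
  finally show ?thesis .
qed

lemma duhamel_LIMSEQ:
  assumes t: "t \<longlonglongrightarrow> t0" "\<And>i. t i \<le> T" and T: "0 < T" and X: "X \<longlonglongrightarrow> x"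
  shows "(\<lambda>i. duhamel E g (t i) (X i)) \<longlonglongrightarrow> duhamel E g t0 x"
  unfolding duhamel_def set_lebesgue_integral_def
proof (rule integral_dominated_convergence[where w = "\<lambda>r. indicator {0<..T} r *\<^sub>R (M * r powr - q)"])
  \<comment> \<open>At \<open>r = t0\<close> the indicators of \<open>{0<..t i}\<close> may fail to
    converge; a single point is negligible.\<close>
  have "(\<lambda>i. indicator {0<..t i} r *\<^sub>R E r (g (t i - r)) (X i)) \<longlonglongrightarrow> indicator {0<..t0} r *\<^sub>R E r (g (t0 - r)) x"
    if "r \<noteq> t0" for r
  proof (cases "0 < r")
    case True
    have "(\<lambda>i. E r (g (t i - r)) (X i)) \<longlonglongrightarrow> E r (g (t0 - r)) x"
      using True by (intro continuous_kernelD[OF E bounded_family_cconv[OF g] tendsto_const, of _ _ r] tendsto_intros t X) auto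
    moreover have "(\<lambda>i. indicator {0<..t i} r :: real) \<longlonglongrightarrow> indicator {0<..t0} r"
    proof (rule tendsto_eventually)
      show "eventually (\<lambda>i. indicator {0<..t i} r = (indicator {0<..t0} r :: real)) sequentially"
      proof (cases "r < t0")
        case True
        then show ?thesis using order_tendstoD(1)[OF t(1) True]
          by (auto elim!: eventually_mono simp: indicator_def)
      next
        case False
        then have "t0 < r" using that by simp
        then show ?thesis using order_tendstoD(2)[OF t(1), of r]
          by (auto elim!: eventually_mono simp: indicator_def)
      qed
    qed
    ultimately show ?thesis by (intro tendsto_intros)
  qed simp
  then show "AE r in lborel. (\<lambda>i. indicator {0<..t i} r *\<^sub>R E r (g (t i - r)) (X i)) \<longlonglongrightarrow> indicator {0<..t0} r *\<^sub>R E r (g (t0 - r)) x"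
    using AE_lborel_singleton[of t0] by (auto elim: AE_mp)
  show "AE r in lborel. norm (indicator {0<..t i} r *\<^sub>R E r (g (t i - r)) (X i)) \<le> indicator {0<..T} r *\<^sub>R (M * r powr - q)" for i
    using duhamel_dominated[OF t(2)[of i]] by (intro AE_I2) simp
qed (use duhamel_integrand_measurable duhamel_dominating_integrable[OF T] in simp_all)

lemma duhamel_Cb: "duhamel E g t \<in> Cb"
proof (rule CbI_sequentially)
  show "\<bar>duhamel E g t x\<bar> \<le> M * ((max t 1) powr (1 - q) / (1 - q))" for x by (rule duhamel_bound) auto
  show "(\<lambda>i. duhamel E g t (X i)) \<longlonglongrightarrow> duhamel E g t x" if "X \<longlonglongrightarrow> x" for X x
    by (rule duhamel_LIMSEQ[where T = "max t 1", OF tendsto_const _ _ that]) auto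
qed

lemma duhamel_fdiff_bound:
  assumes "a < 1" "1 < b" "0 < R" "0 \<le> A" "0 \<le> B"
    and small: "\<And>r \<tau>. 0 < r \<Longrightarrow> \<bar>fdiff m l (E r (g \<tau>)) x\<bar> \<le> A * r powr - a"
    and large: "\<And>r \<tau>. 0 < r \<Longrightarrow> \<bar>fdiff m l (E r (g \<tau>)) x\<bar> \<le> B * r powr - b"
  shows "\<bar>fdiff m l (duhamel E g t) x\<bar> \<le> A * (R powr (1 - a) / (1 - a)) + B * (R powr (1 - b) / (b - 1))"
proof -
  have "duhamel E g t = (\<lambda>x. LBINT r:{0<..t}. E r (g (t - r)) x)" by (rule ext) (simp add: duhamel_def)
  then have "fdiff m l (duhamel E g t) x = (LBINT r:{0<..t}. fdiff m l (E r (g (t - r))) x)"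
    using fdiff_set_integral(2)[OF duhamel_integrable] by simp
  then show ?thesis
    using abs_set_integral_le_split[OF assms(1-5) fdiff_set_integral(1)[OF duhamel_integrable] small large] by simp
qed

end

text \<open>The bound on \<open>E'\<close> is integrable at time 0 because \<open>q' < 1\<close>,
  and through the mean value theorem it dominates the difference quotients.\<close>

lemma duhamel_has_directional_derivative:
  assumes g: "bounded_family g" and E: "continuous_kernel E" "0 \<le> M" "q < 1" "\<And>r t x. 0 < r \<Longrightarrow> \<bar>E r (g t) x\<bar> \<le> M * r powr - q"
    and E': "continuous_kernel E'" "0 \<le> M'" "q' < 1" "\<And>r t x. 0 < r \<Longrightarrow> \<bar>E' r (g t) x\<bar> \<le> M' * r powr - q'"
    and d: "\<And>r t. 0 < r \<Longrightarrow> has_directional_derivative (E r (g t)) h (E' r (g t))"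
  shows "has_directional_derivative (duhamel E g t) h (duhamel E' g t)"
  unfolding has_directional_derivative_def duhamel_def set_lebesgue_integral_def
proof (intro allI has_real_derivative_integral(2))
  fix x
  show "integrable lborel (\<lambda>r. indicator {0<..t} r *\<^sub>R E r (g (t - r)) (x + \<tau> *\<^sub>R h))" for \<tau>
    using duhamel_integrable[OF g E] by (simp add: set_integrable_def)
  show "integrable lborel (\<lambda>r. indicator {0<..max t 1} r *\<^sub>R (M' * r powr - q'))"
    by (rule duhamel_dominating_integrable[OF g E']) auto
  fix r :: real
  show "((\<lambda>\<tau>. indicator {0<..t} r *\<^sub>R E r (g (t - r)) (x + \<tau> *\<^sub>R h)) has_real_derivative indicator {0<..t} r *\<^sub>R E' r (g (t - r)) x) (at 0)"
  proof (cases "0 < r")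
    case True
    then have "((\<lambda>\<tau>. E r (g (t - r)) (x + \<tau> *\<^sub>R h)) has_real_derivative E' r (g (t - r)) x) (at 0)"
      using d[of r "t - r"] by (auto simp: has_directional_derivative_def)
    then show ?thesis by (auto intro!: derivative_eq_intros)
  qed simp
  fix \<tau> :: real
  show "\<bar>indicator {0<..t} r *\<^sub>R E r (g (t - r)) (x + \<tau> *\<^sub>R h) - indicator {0<..t} r *\<^sub>R E r (g (t - r)) (x + 0 *\<^sub>R h)\<bar>
      \<le> \<bar>\<tau>\<bar> * (indicator {0<..max t 1} r *\<^sub>R (M' * r powr - q'))"
  proof (cases "0 < r")
    case True
    then have "\<bar>E r (g (t - r)) (x + \<tau> *\<^sub>R h) - E r (g (t - r)) x\<bar> \<le> \<bar>\<tau>\<bar> * (M' * r powr - q')"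
      by (intro has_directional_derivative_bound[OF d E'(4)])
    then show ?thesis using E'(2) by (auto simp: indicator_def)
  qed simp
qed

lemma Cb_add: "f \<in> Cb \<Longrightarrow> g \<in> Cb \<Longrightarrow> (\<lambda>x. f x + g x) \<in> Cb"
  using Cb_lincomb[of f g 1 1] by simp

lemma has_directional_derivative_add:
  "has_directional_derivative F h F' \<Longrightarrow> has_directional_derivative G h G' \<Longrightarrow>
    has_directional_derivative (\<lambda>x. F x + G x) h (\<lambda>x. F' x + G' x)"
  by (auto simp: has_directional_derivative_def intro!: derivative_intros)

lemma fdiff_add: "fdiff m l (\<lambda>x. F x + G x) x = fdiff m l F x + fdiff m l G x"
  by (induction m arbitrary: x) simp_all

section \<open>Regularity of the convolution and of the mild solution\<close>

context smoothing_semigroup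
begin

lemma continuous_kernel_D: "set hs \<subseteq> H \<Longrightarrow> continuous_kernel (D hs)"
  unfolding continuous_kernel_def using cconvD[OF D_cconv] by blast

text \<open>The bound of order \<open>j\<close> is a power of the time with exponent
  \<open>- p (j - \<alpha>)\<close>. The condition \<open>j < \<theta>\<close> makes it integrable
  at 0, and \<open>\<theta> < j\<close> makes it integrable at infinity.\<close>

lemma time_exponent:
  assumes "\<theta> = \<alpha> + 1 / p"
  shows "p * (j - \<alpha>) < 1 \<longleftrightarrow> j < \<theta>" and "1 < p * (j - \<alpha>) \<longleftrightarrow> \<theta> < j"
  using p_pos by (auto simp: assms field_simps)

text \<open>The split point \<open>N powr (1 / p)\<close> balances the estimates for small and for large times.\<close>

lemma balanced_split:
  fixes N a b e m \<kappa> :: real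
  assumes "0 < N" "(1 - a) / p + e = \<kappa>" "(1 - b) / p + m = \<kappa>"
  shows "A * N powr e * ((N powr (1 / p)) powr (1 - a) / (1 - a)) + B' * N powr m * ((N powr (1 / p)) powr (1 - b) / (b - 1))
    = (A / (1 - a) + B' / (b - 1)) * N powr \<kappa>"
proof -
  have 1: "N powr e * (N powr (1 / p)) powr (1 - a) = N powr \<kappa>" and 2: "N powr m * (N powr (1 / p)) powr (1 - b) = N powr \<kappa>"
    using assms by (simp_all add: powr_powr powr_add[symmetric] add.commute)
  have "A * N powr e * ((N powr (1 / p)) powr (1 - a) / (1 - a)) + B' * N powr m * ((N powr (1 / p)) powr (1 - b) / (b - 1))
      = A * (N powr e * (N powr (1 / p)) powr (1 - a)) / (1 - a) + B' * (N powr m * (N powr (1 / p)) powr (1 - b)) / (b - 1)"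
    by simp
  then show ?thesis unfolding 1 2 by (simp add: algebra_simps)
qed

text \<open>One constant for all orders that occur: in the application \<open>\<theta> < 3\<close>,
  so at most two derivatives and differences of order at most two arise. The condition
  \<open>C \<le> c\<close> lets the same constant bound the contribution of the initial
  datum.\<close>

definition schauder_const :: "real \<Rightarrow> real \<Rightarrow> real \<Rightarrow> real \<Rightarrow> bool" where
  "schauder_const \<alpha> \<theta> T c \<longleftrightarrow> C \<le> c \<and> (\<forall>g K hs t x. bounded_family g \<longrightarrow> (\<forall>\<tau>. holder_bound \<alpha> K (g \<tau>)) \<longrightarrow>
     set hs \<subseteq> H \<longrightarrow> length hs \<le> 2 \<longrightarrow> real (length hs) < \<theta> \<longrightarrow>
     (t \<le> T \<longrightarrow> \<bar>duhamel (D hs) g t x\<bar> \<le> c * (K * P hs)) \<and>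
     (\<forall>m l. m \<le> 2 \<longrightarrow> \<theta> < real (length hs + m) \<longrightarrow> l \<in> H \<longrightarrow>
       \<bar>fdiff m l (duhamel (D hs) g t) x\<bar> \<le> c * (K * (P hs * n l powr (\<theta> - real (length hs))))))"

definition solution :: "('a list \<Rightarrow> 'a \<Rightarrow> real) \<Rightarrow> (real \<Rightarrow> 'a \<Rightarrow> real) \<Rightarrow> 'a list \<Rightarrow> real \<Rightarrow> 'a \<Rightarrow> real" where
  "solution F g hs t x = S t (F hs) x + duhamel (D hs) g t x"

context
  fixes \<alpha> \<theta> T :: real
  assumes \<alpha>: "0 \<le> \<alpha>" "\<alpha> < 1" and \<theta>: "\<theta> = \<alpha> + 1 / p" and T: "0 < T"
begin

text \<open>For \<open>j = 0\<close> the kernel is merely bounded, so the exponent \<open>q\<close>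
  is 0 and not the value \<open>- p \<alpha>\<close> that the formula for positive orders would
  give.\<close>

lemma kernel_bound:
  assumes j: "real j < \<theta>"
  obtains c q where "0 \<le> c" "q < 1" "0 < j \<Longrightarrow> q = p * (real j - \<alpha>)"
    "\<And>r hs g K x. 0 < r \<Longrightarrow> set hs \<subseteq> H \<Longrightarrow> length hs = j \<Longrightarrow> holder_bound \<alpha> K g \<Longrightarrow> \<bar>D hs r g x\<bar> \<le> c * (P hs * K) * r powr - q"
proof (cases j)
  case 0
  have "\<bar>D hs r g x\<bar> \<le> C * (P hs * K) * r powr - 0" if "0 < r" "length hs = j" "holder_bound \<alpha> K g" for r hs g K x
    using that 0 S_bound[of r g K x] holder_boundD[OF that(3)] by simp
  then show thesis using that[of C 0] C_ge_1 0 by simp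
next
  case (Suc i)
  obtain c where c: "c \<ge> 0" "\<And>r hs g K x. 0 < r \<Longrightarrow> set hs \<subseteq> H \<Longrightarrow> length hs = Suc i \<Longrightarrow> holder_bound \<alpha> K g \<Longrightarrow>
    \<bar>D hs r g x\<bar> \<le> c * r powr - (p * (real (Suc i) - \<alpha>)) * (P hs * K)" using D_bound[OF \<alpha>] by metis
  show thesis
    by (rule that[of c "p * (real j - \<alpha>)"]) (use c j Suc time_exponent(1)[OF \<theta>] in \<open>auto simp: mult_ac\<close>)
qed

lemma duhamel_D_bound:
  assumes j: "real j < \<theta>"
  shows "\<exists>c\<ge>0. \<forall>g K hs t x. bounded_family g \<longrightarrow> (\<forall>\<tau>. holder_bound \<alpha> K (g \<tau>)) \<longrightarrow> set hs \<subseteq> H \<longrightarrow> length hs = j \<longrightarrow> t \<le> T \<longrightarrow>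
    \<bar>duhamel (D hs) g t x\<bar> \<le> c * (K * P hs)"
proof -
  obtain c q where c: "0 \<le> c" "q < 1" and b: "\<And>r hs g K x. 0 < r \<Longrightarrow> set hs \<subseteq> H \<Longrightarrow> length hs = j \<Longrightarrow> holder_bound \<alpha> K g \<Longrightarrow>
      \<bar>D hs r g x\<bar> \<le> c * (P hs * K) * r powr - q" by (rule kernel_bound[OF j]) (rule that, assumption+)
  let ?c = "c * (T powr (1 - q) / (1 - q))"
  have "\<bar>duhamel (D hs) g t x\<bar> \<le> ?c * (K * P hs)"
    if g: "bounded_family g" "\<forall>\<tau>. holder_bound \<alpha> K (g \<tau>)" and hs: "set hs \<subseteq> H" "length hs = j" and t: "t \<le> T" for g K hs t x
  proof -
    have "\<bar>duhamel (D hs) g t x\<bar> \<le> c * (P hs * K) * (T powr (1 - q) / (1 - q))"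
      using c hs g(2) b P_nonneg holder_boundD(4)[OF g(2)[rule_format]]
      by (intro duhamel_bound[where E = "D hs", OF g(1) continuous_kernel_D[OF hs(1)] _ c(2) _ t T]) (auto intro!: mult_nonneg_nonneg)
    then show ?thesis by (simp add: mult_ac)
  qed
  then show ?thesis using c by (intro exI[of _ ?c]) auto
qed

lemma duhamel_D_fdiff:
  assumes j: "real j < \<theta>" "\<theta> < real (j + m)"
  shows "\<exists>c\<ge>0. \<forall>g K hs l t x. bounded_family g \<longrightarrow> (\<forall>\<tau>. holder_bound \<alpha> K (g \<tau>)) \<longrightarrow> set hs \<subseteq> H \<longrightarrow> length hs = j \<longrightarrow> l \<in> H \<longrightarrow>
    \<bar>fdiff m l (duhamel (D hs) g t) x\<bar> \<le> c * (K * (P hs * n l powr (\<theta> - real j)))"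
proof -
  obtain m' where m: "m = Suc m'" using j by (cases m) auto
  obtain c q where c: "0 \<le> c" "q < 1" "0 < j \<Longrightarrow> q = p * (real j - \<alpha>)" and b: "\<And>r hs g K x. 0 < r \<Longrightarrow> set hs \<subseteq> H \<Longrightarrow> length hs = j \<Longrightarrow> holder_bound \<alpha> K g \<Longrightarrow>
      \<bar>D hs r g x\<bar> \<le> c * (P hs * K) * r powr - q" by (rule kernel_bound[OF j(1)]) (rule that, assumption+)
  obtain d where d: "d \<ge> 0" "\<And>r hs g K x m l. 0 < r \<Longrightarrow> set hs \<subseteq> H \<Longrightarrow> length hs + m = Suc (j + m') \<Longrightarrow> holder_bound \<alpha> K g \<Longrightarrow> l \<in> H \<Longrightarrow>
    \<bar>fdiff m l (D hs r g) x\<bar> \<le> d * r powr - (p * (real (Suc (j + m')) - \<alpha>)) * (n l ^ m * P hs * K)" by (rule D_fdiff_bound[OF \<alpha>, of "j + m'"]) (rule that, assumption+)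
  \<comment> \<open>Small times. For \<open>j = 0\<close> one difference is estimated by the Hoelder
    bound of the data, giving \<open>n l powr \<alpha>\<close> and no singularity in
    \<open>r\<close>; for \<open>j > 0\<close> the differences are estimated by the supremum of the
    kernel. Either way \<open>(1 - a) / p + e = \<theta> - j\<close>, as the balance at the split
    point demands.\<close>
  define a where "a = (if j = 0 then 0 else p * (real j - \<alpha>))"
  define e where "e = (if j = 0 then \<alpha> else 0)"
  define u where "u = (if j = 0 then C * 2 ^ m' else 2 ^ m * c)"
  let ?b = "p * (real (j + m) - \<alpha>)"
  have a: "a < 1" "(1 - a) / p + e = \<theta> - real j" and b1: "1 < ?b" "(1 - ?b) / p + real m = \<theta> - real j"
    using j time_exponent[OF \<theta>] p_pos by (auto simp: a_def e_def \<theta> field_simps)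
  have u: "0 \<le> u" using c C_ge_1 by (simp add: u_def)
  have "\<bar>fdiff m l (duhamel (D hs) g t) x\<bar> \<le> (u / (1 - a) + d / (?b - 1)) * (K * (P hs * n l powr (\<theta> - real j)))"
    if g: "bounded_family g" "\<forall>\<tau>. holder_bound \<alpha> K (g \<tau>)" and hs: "set hs \<subseteq> H" "length hs = j" and l: "l \<in> H" for g K hs l t x
  proof (cases "l = 0")
    case True
    then show ?thesis using n_0[OF l] by (simp add: m)
  next
    case False
    then have N: "0 < n l" by (rule n_pos[OF l])
    note h = g(2)[rule_format]
    have K: "0 \<le> K" by (rule holder_boundD(4)[OF h])
    have "\<bar>fdiff m l (duhamel (D hs) g t) x\<bar>
      \<le> (u * (P hs * K)) * n l powr e * ((n l powr (1 / p)) powr (1 - a) / (1 - a))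
        + (d * (P hs * K)) * n l powr real m * ((n l powr (1 / p)) powr (1 - ?b) / (?b - 1))"
    proof (rule duhamel_fdiff_bound[where E = "D hs", OF g(1) continuous_kernel_D[OF hs(1)] _ c(2) b[OF _ hs h] a(1) b1(1)])
      fix r \<tau> :: real assume r: "0 < r"
      show "\<bar>fdiff m l (D hs r (g \<tau>)) x\<bar> \<le> (u * (P hs * K)) * n l powr e * r powr - a"
      proof (cases "j = 0")
        case True
        then have "\<bar>fdiff m l (D hs r (g \<tau>)) x\<bar> \<le> C * (2 ^ m' * (K * n l powr \<alpha>))"
          using r hs holder_boundD[OF h] l unfolding m by (simp del: fdiff.simps) (intro S_fdiff_bound fdiff_Suc_bound, auto)
        then show ?thesis using True hs r by (simp add: u_def e_def a_def mult_ac)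
      next
        case j0: False
        have "\<bar>fdiff m l (D hs r (g \<tau>)) x\<bar> \<le> 2 ^ m * (c * (P hs * K) * r powr - q)"
          by (rule fdiff_bound) (rule b[OF r hs h])
        then show ?thesis using j0 c(3) N by (simp add: u_def e_def a_def mult_ac)
      qed
      show "\<bar>fdiff m l (D hs r (g \<tau>)) x\<bar> \<le> (d * (P hs * K)) * n l powr real m * r powr - ?b"
        using d(2)[OF r hs(1) _ h l, of m \<tau> x] hs(2) unfolding powr_realpow[OF N] by (simp add: m mult_ac del: fdiff.simps D.simps)
    qed (use c u d K N P_nonneg in \<open>auto intro!: mult_nonneg_nonneg\<close>)
    also have "\<dots> = ((u * (P hs * K)) / (1 - a) + (d * (P hs * K)) / (?b - 1)) * n l powr (\<theta> - real j)"
      by (rule balanced_split[OF N a(2) b1(2)])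
    finally show ?thesis by (simp add: algebra_simps)
  qed
  moreover have "0 \<le> u / (1 - a) + d / (?b - 1)" using u d a b1 by (intro add_nonneg_nonneg divide_nonneg_nonneg) auto
  ultimately show ?thesis by (intro exI[of _ "u / (1 - a) + d / (?b - 1)"]) auto
qed

lemma schauder_const_exists: "\<exists>c. schauder_const \<alpha> \<theta> T c"
proof -
  have "\<forall>j. \<exists>c. 0 \<le> c \<and> (real j < \<theta> \<longrightarrow> (\<forall>g K hs t x. bounded_family g \<longrightarrow> (\<forall>\<tau>. holder_bound \<alpha> K (g \<tau>)) \<longrightarrow> set hs \<subseteq> H \<longrightarrow> length hs = j \<longrightarrow> t \<le> T \<longrightarrow>
    \<bar>duhamel (D hs) g t x\<bar> \<le> c * (K * P hs)))" using duhamel_D_bound by (metis order_refl)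
  then obtain A where A: "\<And>j. 0 \<le> A j" "\<And>g K hs t x. real (length hs) < \<theta> \<Longrightarrow> bounded_family g \<Longrightarrow> (\<forall>\<tau>. holder_bound \<alpha> K (g \<tau>)) \<Longrightarrow> set hs \<subseteq> H \<Longrightarrow> t \<le> T \<Longrightarrow>
    \<bar>duhamel (D hs) g t x\<bar> \<le> A (length hs) * (K * P hs)" by metis
  have "\<forall>j m. \<exists>c. 0 \<le> c \<and> (real j < \<theta> \<and> \<theta> < real (j + m) \<longrightarrow> (\<forall>g K hs l t x. bounded_family g \<longrightarrow> (\<forall>\<tau>. holder_bound \<alpha> K (g \<tau>)) \<longrightarrow> set hs \<subseteq> H \<longrightarrow> length hs = j \<longrightarrow> l \<in> H \<longrightarrow>
    \<bar>fdiff m l (duhamel (D hs) g t) x\<bar> \<le> c * (K * (P hs * n l powr (\<theta> - real j)))))" using duhamel_D_fdiff by (metis order_refl)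
  then obtain A' where A': "\<And>j m. 0 \<le> A' j m" "\<And>m g K hs l t x. real (length hs) < \<theta> \<Longrightarrow> \<theta> < real (length hs + m) \<Longrightarrow> bounded_family g \<Longrightarrow> (\<forall>\<tau>. holder_bound \<alpha> K (g \<tau>)) \<Longrightarrow> set hs \<subseteq> H \<Longrightarrow> l \<in> H \<Longrightarrow>
    \<bar>fdiff m l (duhamel (D hs) g t) x\<bar> \<le> A' (length hs) m * (K * (P hs * n l powr (\<theta> - real (length hs))))" by metis
  define c where "c = C + (\<Sum>j\<le>2. A j + (\<Sum>m\<le>2. A' j m))"
  have nn: "0 \<le> (\<Sum>m\<le>2. A' j m)" for j using A' by (intro sum_nonneg)
  have 1: "A j + (\<Sum>m\<le>2. A' j m) \<le> c" if "j \<le> 2" for j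
    using member_le_sum[of j "{..2}" "\<lambda>j. A j + (\<Sum>m\<le>2. A' j m)"] that A nn C_ge_1 by (auto simp: c_def)
  have 2: "A' j m \<le> (\<Sum>m\<le>2. A' j m)" if "m \<le> 2" for j m
    using member_le_sum[of m "{..2}" "A' j"] that A' by auto
  have c: "A j \<le> c" "m \<le> 2 \<Longrightarrow> A' j m \<le> c" if "j \<le> 2" for j m
    using 1[OF that] 2[of m j] nn[of j] A(1)[of j] by linarith+
  have "C \<le> c" using A(1) A'(1) by (auto simp: c_def intro!: sum_nonneg add_nonneg_nonneg)
  moreover have "0 \<le> K * P hs" "0 \<le> K * (P hs * n l powr y)" if "\<forall>\<tau>. holder_bound \<alpha> K (g \<tau>)" for K hs l y and g :: "real \<Rightarrow> _"
    using holder_boundD(4) that P_nonneg by (auto intro!: mult_nonneg_nonneg)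
  ultimately show ?thesis unfolding schauder_const_def
    using order_trans[OF A(2) mult_right_mono[OF c(1)]] order_trans[OF A'(2) mult_right_mono[OF c(2)]] by (intro exI[of _ c]) auto
qed

text \<open>\<open>F hs\<close> is the derivative of the initial datum along \<open>hs\<close>.\<close>

context
  fixes c A K :: real and F g N
  assumes c: "schauder_const \<alpha> \<theta> T c" and g: "bounded_family g" and holder: "\<And>t. holder_bound \<alpha> K (g t)"
    and A: "0 \<le> A" and N: "N \<le> 2" "real N < \<theta>"
    and F: "\<And>hs. set hs \<subseteq> H \<Longrightarrow> length hs \<le> N \<Longrightarrow> F hs \<in> Cb"
    and F_bound: "\<And>hs x. set hs \<subseteq> H \<Longrightarrow> length hs \<le> N \<Longrightarrow> \<bar>F hs x\<bar> \<le> A * P hs"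
    and F_derivative: "\<And>h hs. h \<in> H \<Longrightarrow> set hs \<subseteq> H \<Longrightarrow> length hs < N \<Longrightarrow> has_directional_derivative (F hs) h (F (h # hs))"
begin

lemma K0: "0 \<le> K"
  by (rule holder_boundD(4)[OF holder])

lemma combine_bounds:
  assumes "\<bar>u\<bar> \<le> C * (A * y)" "\<bar>v\<bar> \<le> c * (K * y)" "0 \<le> y"
  shows "\<bar>u + v\<bar> \<le> c * (A + K) * y"
proof -
  have "C * (A * y) \<le> c * (A * y)" using c A assms(3) by (intro mult_right_mono) (auto simp: schauder_const_def)
  then have "\<bar>u + v\<bar> \<le> c * (A * y) + c * (K * y)" using assms by linarith
  then show ?thesis by (simp add: algebra_simps)
qed

lemma solution_eq: "solution F g hs t = (\<lambda>x. S t (F hs) x + duhamel (D hs) g t x)"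
  by (rule ext) (simp add: solution_def)

context
  fixes hs
  assumes hs: "set hs \<subseteq> H" "length hs \<le> N"
begin

lemma kernel:
  obtains M q where "0 \<le> M" "q < 1" "\<And>r t x. 0 < r \<Longrightarrow> \<bar>D hs r (g t) x\<bar> \<le> M * r powr - q"
proof -
  have "real (length hs) < \<theta>" using hs N by simp
  then show thesis using kernel_bound[of "length hs"] hs holder that P_nonneg K0 mult_nonneg_nonneg by metis
qed

lemma solution_Cb: "0 \<le> t \<Longrightarrow> solution F g hs t \<in> Cb"
  unfolding solution_eq
  by (rule kernel, rule Cb_add, rule S_Cb, assumption, rule F[OF hs], rule duhamel_Cb[where E = "D hs", OF g continuous_kernel_D[OF hs(1)]])

lemma solution_continuous: "continuous_on ({0..T} \<times> UNIV) (\<lambda>(t, x). solution F g hs t x)"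
  unfolding continuous_on_sequentially
proof (intro allI ballI impI, elim conjE)
  fix z X assume X: "\<forall>i. X i \<in> {0..T} \<times> (UNIV :: 'a set)" "X \<longlonglongrightarrow> z"
  have t: "0 \<le> fst (X i)" "fst (X i) \<le> T" for i using X(1)[rule_format, of i] by (auto simp: mem_Times_iff)
  obtain M q where k: "0 \<le> M" "q < 1" "\<And>r t x. 0 < r \<Longrightarrow> \<bar>D hs r (g t) x\<bar> \<le> M * r powr - q" by (rule kernel) (rule that, assumption+)
  have "(\<lambda>i. solution F g hs (fst (X i)) (snd (X i))) \<longlonglongrightarrow> solution F g hs (fst z) (snd z)"
    unfolding solution_def using X(2) t
    by (intro tendsto_add S_LIMSEQ[OF cconv_const[OF F[OF hs]]] duhamel_LIMSEQ[where E = "D hs", OF g continuous_kernel_D[OF hs(1)] k _ _ T] tendsto_fst tendsto_snd)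
  then show "((\<lambda>(t, x). solution F g hs t x) \<circ> X) \<longlonglongrightarrow> (case z of (t, x) \<Rightarrow> solution F g hs t x)"
    by (simp add: case_prod_unfold comp_def)
qed

lemma solution_bound:
  assumes "0 \<le> t" "t \<le> T"
  shows "\<bar>solution F g hs t x\<bar> \<le> c * (A + K) * P hs"
  unfolding solution_def
proof (rule combine_bounds)
  show "\<bar>duhamel (D hs) g t x\<bar> \<le> c * (K * P hs)"
    using c g holder hs N assms(2) unfolding schauder_const_def by auto
qed (intro S_bound assms F F_bound hs P_nonneg)+

lemma solution_fdiff:
  assumes t: "0 \<le> t" and m: "m \<le> 2" "\<theta> < length hs + m" and l: "l \<in> H"
    and Fl: "\<And>x. \<bar>fdiff m l (F hs) x\<bar> \<le> A * (P hs * n l powr (\<theta> - length hs))"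
  shows "\<bar>fdiff m l (solution F g hs t) x\<bar> \<le> c * (A + K) * (P hs * n l powr (\<theta> - length hs))"
  unfolding solution_eq fdiff_add
proof (rule combine_bounds)
  show "\<bar>fdiff m l (duhamel (D hs) g t) x\<bar> \<le> c * (K * (P hs * n l powr (\<theta> - length hs)))"
    using c g holder hs N m l unfolding schauder_const_def by auto
qed (use P_nonneg t in \<open>auto intro!: S_fdiff_bound F hs Fl\<close>)

end

lemma solution_derivative:
  assumes "h \<in> H" "set hs \<subseteq> H" "length hs < N" "0 \<le> t"
  shows "has_directional_derivative (solution F g hs t) h (solution F g (h # hs) t)"
proof -
  have h: "set (h # hs) \<subseteq> H" "length (h # hs) \<le> N" using assms by auto
  obtain M q where k: "0 \<le> M" "q < 1" "\<And>r t x. 0 < r \<Longrightarrow> \<bar>D hs r (g t) x\<bar> \<le> M * r powr - q"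
    by (rule kernel[OF assms(2) less_imp_le[OF assms(3)]]) (rule that, assumption+)
  obtain M' q' where k': "0 \<le> M'" "q' < 1" "\<And>r t x. 0 < r \<Longrightarrow> \<bar>D (h # hs) r (g t) x\<bar> \<le> M' * r powr - q'" by (rule kernel[OF h]) (rule that, assumption+)
  have "has_directional_derivative (duhamel (D hs) g t) h (duhamel (D (h # hs)) g t)"
  proof (rule duhamel_has_directional_derivative[where E = "D hs" and E' = "D (h # hs)" and M = M and q = q and M' = M' and q' = q', OF g])
    show "continuous_kernel (D hs)" "continuous_kernel (D (h # hs))" by (rule continuous_kernel_D, rule assms h)+
    show "has_directional_derivative (D hs r (g t)) h (D (h # hs) r (g t))" if "0 < r" for r t
      by (rule D_has_directional_derivative[OF that bounded_family_Cb[OF g] assms(2,1)])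
  qed (fact k k')+
  moreover have "has_directional_derivative (S t (F hs)) h (S t (F (h # hs)))"
    using assms h by (intro S_preserves_directional_derivative F F_derivative) auto
  ultimately show ?thesis unfolding solution_eq by (rule has_directional_derivative_add[rotated])
qed

end

end

end

section \<open>Forms on the Cameron--Martin space\<close>

lemma H_tuples_0 [simp]: "H_tuples Q 0 = {[]}"
  by (auto simp: H_tuples_def)

lemma H_tuples_Suc [simp]: "h # hs \<in> H_tuples Q (Suc n) \<longleftrightarrow> h \<in> CM_space Q \<and> hs \<in> H_tuples Q n"
  by (auto simp: H_tuples_def)

lemma H_tuples_SucE:
  assumes "hs \<in> H_tuples Q (Suc n)"
  obtains h ks where "hs = h # ks" "h \<in> CM_space Q" "ks \<in> H_tuples Q n"
  using assms by (cases hs) (auto simp: H_tuples_def)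

lemma form_norm_0: "form_norm Q 0 M = ennreal \<bar>M []\<bar>"
proof -
  have "{hs \<in> H_tuples Q 0. \<forall>h\<in>set hs. CM_norm Q h \<le> 1} = {[]}" by auto
  then show ?thesis by (simp add: form_norm_def)
qed

lemma form_norm_ge:
  "hs \<in> H_tuples Q n \<Longrightarrow> (\<And>h. h \<in> set hs \<Longrightarrow> CM_norm Q h \<le> 1) \<Longrightarrow> ennreal \<bar>M hs\<bar> \<le> form_norm Q n M"
  unfolding form_norm_def by (rule SUP_upper) auto

text \<open>The form norm is a supremum over tuples from the unit ball, so the limit is read off
  there; other tuples are reached by homogeneity.\<close>

lemma tendsto_form_norm_imp:
  assumes F: "((\<lambda>\<tau>. form_norm Q n (\<lambda>hs. q \<tau> hs - G hs)) \<longlongrightarrow> 0) F"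
    and "hs \<in> H_tuples Q n" "\<And>h. h \<in> set hs \<Longrightarrow> CM_norm Q h \<le> 1"
  shows "((\<lambda>\<tau>. q \<tau> hs) \<longlongrightarrow> G hs) F"
proof -
  have "((\<lambda>\<tau>. ennreal \<bar>q \<tau> hs - G hs\<bar>) \<longlongrightarrow> ennreal 0) F"
    unfolding ennreal_0
    by (rule tendsto_sandwich[OF _ _ tendsto_const F]) (auto intro!: form_norm_ge assms always_eventually)
  then have "((\<lambda>\<tau>. \<bar>q \<tau> hs - G hs\<bar>) \<longlongrightarrow> 0) F" by (rule tendsto_ennrealD) auto
  then show ?thesis using Lim_null tendsto_rabs_zero_cancel by blast
qed

context
  fixes Q :: "'a::{real_inner, banach, second_countable_topology} \<Rightarrow> 'a"
  assumes Q: "positive_operator Q"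
begin

lemma prod_list_CM_norm_nonneg: "0 \<le> prod_list (map (CM_norm Q) hs)"
  by (rule prod_list_nonneg) (auto simp: CM_norm_nonneg[OF Q])

lemma form_norm_le:
  assumes "0 \<le> c" "\<And>hs. hs \<in> H_tuples Q n \<Longrightarrow> \<bar>M hs\<bar> \<le> c * prod_list (map (CM_norm Q) hs)"
  shows "form_norm Q n M \<le> ennreal c"
  unfolding form_norm_def
proof (rule SUP_least, clarsimp)
  fix hs assume hs: "hs \<in> H_tuples Q n" "\<forall>h\<in>set hs. CM_norm Q h \<le> 1"
  have "prod_list (map (CM_norm Q) hs) \<le> 1"
    using hs(2) by (induction hs) (auto intro!: mult_le_one prod_list_CM_norm_nonneg simp: CM_norm_nonneg[OF Q])
  then have "c * prod_list (map (CM_norm Q) hs) \<le> c * 1" using assms(1) by (rule mult_left_mono)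
  then show "ennreal \<bar>M hs\<bar> \<le> ennreal c" using assms(2)[OF hs(1)] by (intro ennreal_leI) simp
qed

text \<open>\<open>u\<close> stands for \<open>h / CM_norm Q h\<close>, in a form that includes
  \<open>h = 0\<close>.\<close>

lemma normalize:
  assumes "h \<in> CM_space Q"
  obtains u where "u \<in> CM_space Q" "CM_norm Q u \<le> 1" "h = CM_norm Q h *\<^sub>R u"
proof (cases "h = 0")
  case True
  then show thesis using that[of 0] assms CM_norm_scaleR[OF Q assms, of 0] by simp
next
  case False
  then have pos: "0 < CM_norm Q h" by (rule CM_norm_pos[OF Q assms])
  show thesis
    by (rule that[of "(1 / CM_norm Q h) *\<^sub>R h"])
      (use pos assms CM_space_scaleR[OF Q assms] CM_norm_scaleR[OF Q assms] in auto)
qed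

lemma form_norm_apply_1:
  assumes "form_norm Q (Suc 0) M \<le> ennreal c" "0 \<le> c" "h \<in> CM_space Q"
    and "\<And>a u. u \<in> CM_space Q \<Longrightarrow> M [a *\<^sub>R u] = a * M [u]"
  shows "\<bar>M [h]\<bar> \<le> c * CM_norm Q h"
proof -
  obtain u where u: "u \<in> CM_space Q" "CM_norm Q u \<le> 1" "h = CM_norm Q h *\<^sub>R u" by (rule normalize[OF assms(3)])
  have "ennreal \<bar>M [u]\<bar> \<le> ennreal c"
    using form_norm_ge[of "[u]" Q "Suc 0" M] u assms(1) by (auto intro: order_trans)
  then have "\<bar>M [u]\<bar> \<le> c" using assms(2) by simp
  moreover have "M [h] = CM_norm Q h * M [u]" using assms(4)[OF u(1)] u(3) by metis
  ultimately show ?thesis using CM_norm_nonneg[OF Q, of h] mult_right_mono[of "\<bar>M [u]\<bar>" c "CM_norm Q h"]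
    by (simp add: abs_mult mult.commute)
qed

lemma form_norm_apply_2:
  assumes "form_norm Q (Suc (Suc 0)) M \<le> ennreal c" "0 \<le> c" "h \<in> CM_space Q" "k \<in> CM_space Q"
    and "\<And>a b u v. u \<in> CM_space Q \<Longrightarrow> v \<in> CM_space Q \<Longrightarrow> M [a *\<^sub>R u, b *\<^sub>R v] = a * b * M [u, v]"
  shows "\<bar>M [h, k]\<bar> \<le> c * (CM_norm Q h * CM_norm Q k)"
proof -
  obtain u where u: "u \<in> CM_space Q" "CM_norm Q u \<le> 1" "h = CM_norm Q h *\<^sub>R u" by (rule normalize[OF assms(3)])
  obtain v where v: "v \<in> CM_space Q" "CM_norm Q v \<le> 1" "k = CM_norm Q k *\<^sub>R v" by (rule normalize[OF assms(4)])
  have "ennreal \<bar>M [u, v]\<bar> \<le> ennreal c"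
    using form_norm_ge[of "[u, v]" Q "Suc (Suc 0)" M] u v assms(1) by (auto intro: order_trans)
  then have "\<bar>M [u, v]\<bar> \<le> c" using assms(2) by simp
  then have "(CM_norm Q h * CM_norm Q k) * \<bar>M [u, v]\<bar> \<le> (CM_norm Q h * CM_norm Q k) * c"
    using CM_norm_nonneg[OF Q] by (intro mult_left_mono mult_nonneg_nonneg)
  moreover have "M [h, k] = CM_norm Q h * CM_norm Q k * M [u, v]" using assms(5)[OF u(1) v(1)] u(3) v(3) by metis
  ultimately show ?thesis using CM_norm_nonneg[OF Q] by (simp add: abs_mult mult.commute)
qed

lemma multilinear_formsD:
  assumes "M \<in> multilinear_forms Q n" "hs \<in> H_tuples Q n" "i < n" "h \<in> CM_space Q" "k \<in> CM_space Q"
  shows "M (hs[i := a *\<^sub>R h + b *\<^sub>R k]) = a * M (hs[i := h]) + b * M (hs[i := k])"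
    and "M (hs[i := a *\<^sub>R h]) = a * M (hs[i := h])"
proof -
  have *: "M (hs[i := a *\<^sub>R h + b *\<^sub>R k]) = a * M (hs[i := h]) + b * M (hs[i := k])" if "k \<in> CM_space Q" for a b k
    using assms that unfolding multilinear_forms_def by blast
  show "M (hs[i := a *\<^sub>R h + b *\<^sub>R k]) = a * M (hs[i := h]) + b * M (hs[i := k])" by (rule *[OF assms(5)])
  show "M (hs[i := a *\<^sub>R h]) = a * M (hs[i := h])" using *[OF assms(4), of a 0] by simp
qed

lemma multilinear_forms_1_scaleR:
  "M \<in> multilinear_forms Q (Suc 0) \<Longrightarrow> h \<in> CM_space Q \<Longrightarrow> M [a *\<^sub>R h] = a * M [h]"
  using multilinear_formsD(2)[of M "Suc 0" "[h]" 0 h h a] by simp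

lemma multilinear_forms_2_scaleR:
  assumes M: "M \<in> multilinear_forms Q (Suc (Suc 0))" and h: "h \<in> CM_space Q" "k \<in> CM_space Q"
  shows "M [a *\<^sub>R h, b *\<^sub>R k] = a * b * M [h, k]"
proof -
  have "M [a *\<^sub>R h, b *\<^sub>R k] = a * M [h, b *\<^sub>R k]"
    using multilinear_formsD(2)[OF M, of "[h, b *\<^sub>R k]" 0 h h a] h CM_space_scaleR[OF Q] by simp
  moreover have "M [h, b *\<^sub>R k] = b * M [h, k]"
    using multilinear_formsD(2)[OF M, of "[h, k]" "Suc 0" k k b] h by simp
  ultimately show ?thesis by simp
qed

lemma multilinear_forms_vanish: "M \<in> multilinear_forms Q n \<Longrightarrow> hs \<notin> H_tuples Q n \<Longrightarrow> M hs = 0"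
  by (simp add: multilinear_forms_def)

lemma multilinear_forms_eqI:
  assumes "M \<in> multilinear_forms Q n" "M' \<in> multilinear_forms Q n" "\<And>hs. hs \<in> H_tuples Q n \<Longrightarrow> M hs = M' hs"
  shows "M = M'"
  using assms multilinear_forms_vanish by (metis ext)

lemma multilinear_forms_1I:
  assumes "\<And>hs. hs \<notin> H_tuples Q (Suc 0) \<Longrightarrow> M hs = 0" "0 \<le> c"
    and "\<And>h. h \<in> CM_space Q \<Longrightarrow> \<bar>M [h]\<bar> \<le> c * CM_norm Q h"
    and "\<And>a b h k. h \<in> CM_space Q \<Longrightarrow> k \<in> CM_space Q \<Longrightarrow> M [a *\<^sub>R h + b *\<^sub>R k] = a * M [h] + b * M [k]"
  shows "M \<in> multilinear_forms Q (Suc 0)"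
proof -
  have "form_norm Q (Suc 0) M \<le> ennreal c"
    using assms(2,3) by (intro form_norm_le) (auto elim!: H_tuples_SucE)
  then have "form_norm Q (Suc 0) M < \<infinity>" using le_less_trans by fastforce
  then show ?thesis
    using assms unfolding multilinear_forms_def by (auto elim!: H_tuples_SucE)
qed

lemma multilinear_forms_2I:
  assumes "\<And>hs. hs \<notin> H_tuples Q (Suc (Suc 0)) \<Longrightarrow> M hs = 0" "0 \<le> c"
    and "\<And>h k. h \<in> CM_space Q \<Longrightarrow> k \<in> CM_space Q \<Longrightarrow> \<bar>M [h, k]\<bar> \<le> c * (CM_norm Q h * CM_norm Q k)"
    and "\<And>a b h k l. h \<in> CM_space Q \<Longrightarrow> k \<in> CM_space Q \<Longrightarrow> l \<in> CM_space Q \<Longrightarrow>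
      M [a *\<^sub>R h + b *\<^sub>R k, l] = a * M [h, l] + b * M [k, l]"
    and "\<And>a b h k l. h \<in> CM_space Q \<Longrightarrow> k \<in> CM_space Q \<Longrightarrow> l \<in> CM_space Q \<Longrightarrow>
      M [l, a *\<^sub>R h + b *\<^sub>R k] = a * M [l, h] + b * M [l, k]"
  shows "M \<in> multilinear_forms Q (Suc (Suc 0))"
proof -
  have "form_norm Q (Suc (Suc 0)) M \<le> ennreal c"
    using assms(2,3) by (intro form_norm_le) (auto elim!: H_tuples_SucE)
  then have "form_norm Q (Suc (Suc 0)) M < \<infinity>" using le_less_trans by fastforce
  then show ?thesis
    using assms unfolding multilinear_forms_def by (auto elim!: H_tuples_SucE simp: less_Suc_eq)
qed

section \<open>Derivatives as forms\<close>

lemma has_H_derivativeD: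
  assumes G: "has_H_derivative Q n F x G" and h: "h \<in> CM_space Q" and hs: "hs \<in> H_tuples Q n" "\<And>h. h \<in> set hs \<Longrightarrow> CM_norm Q h \<le> 1"
  shows "((\<lambda>\<tau>. (F (x + \<tau> *\<^sub>R h) hs - F x hs) / \<tau>) \<longlongrightarrow> G (h # hs)) (at 0)"
  using G h unfolding has_H_derivative_def by (intro tendsto_form_norm_imp[OF _ hs, of _ "\<lambda>hs. G (h # hs)"]) auto

lemma has_H_derivative_unique_0:
  assumes "has_H_derivative Q 0 F x G" "has_H_derivative Q 0 F x G'"
  shows "G = G'"
proof (rule multilinear_forms_eqI)
  show "G \<in> multilinear_forms Q (Suc 0)" "G' \<in> multilinear_forms Q (Suc 0)" using assms by (auto simp: has_H_derivative_def)
  show "G hs = G' hs" if "hs \<in> H_tuples Q (Suc 0)" for hs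
    using that tendsto_unique[OF _ has_H_derivativeD[OF assms(1)] has_H_derivativeD[OF assms(2)]]
    by (auto elim!: H_tuples_SucE)
qed

text \<open>\<open>DH\<close> is a definite description, so it can be evaluated only after
  uniqueness. Limits fix the form when the second entry lies in the unit ball, multilinearity
  extends this to all pairs, and off the pairs forms vanish.\<close>

lemma has_H_derivative_unique_1:
  assumes "has_H_derivative Q (Suc 0) F x G" "has_H_derivative Q (Suc 0) F x G'"
  shows "G = G'"
proof (rule multilinear_forms_eqI)
  show M: "G \<in> multilinear_forms Q (Suc (Suc 0))" "G' \<in> multilinear_forms Q (Suc (Suc 0))" using assms by (auto simp: has_H_derivative_def)
  fix hs assume "hs \<in> H_tuples Q (Suc (Suc 0))"
  then obtain h k where hs: "hs = [h, k]" "h \<in> CM_space Q" "k \<in> CM_space Q" by (auto elim!: H_tuples_SucE)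
  obtain v where v: "v \<in> CM_space Q" "CM_norm Q v \<le> 1" "k = CM_norm Q k *\<^sub>R v" by (rule normalize[OF hs(3)])
  have "G [h, v] = G' [h, v]"
    using tendsto_unique[OF _ has_H_derivativeD[OF assms(1) hs(2)] has_H_derivativeD[OF assms(2) hs(2)], of "[v]"] v by simp
  moreover have "N [h, k] = CM_norm Q k * N [h, v]" if "N \<in> multilinear_forms Q (Suc (Suc 0))" for N
    using multilinear_forms_2_scaleR[OF that hs(2) v(1), of 1 "CM_norm Q k"] v(3) by simp
  ultimately show "G hs = G' hs" unfolding hs(1) using M by metis
qed

lemma DH_eqI_1: "has_H_derivative Q 0 (DH Q 0 f) x G \<Longrightarrow> DH Q (Suc 0) f x = G"
  by (simp del: DH.simps(1)) (blast intro: the_equality has_H_derivative_unique_0)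

lemma DH_eqI_2: "has_H_derivative Q (Suc 0) (DH Q (Suc 0) f) x G \<Longrightarrow> DH Q (Suc (Suc 0)) f x = G"
  by (subst DH.simps(2)) (blast intro: the_equality has_H_derivative_unique_1)

end

text \<open>These are the data from which the derivative as a form is built; linearity in
  \<open>h\<close> follows from the continuity of the derivatives.\<close>

definition derivative_family :: "'a set \<Rightarrow> ('a \<Rightarrow> real) \<Rightarrow> real \<Rightarrow> ('a::real_normed_vector \<Rightarrow> real) \<Rightarrow> ('a \<Rightarrow> 'a \<Rightarrow> real) \<Rightarrow> bool" where
  "derivative_family H n M u D \<longleftrightarrow>
     (\<forall>h\<in>H. has_directional_derivative u h (D h) \<and> D h \<in> Cb \<and> (\<forall>x. \<bar>D h x\<bar> \<le> M * n h))"

lemma has_directional_derivative_scaleR: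
  assumes "has_directional_derivative F h F'"
  shows "has_directional_derivative F (a *\<^sub>R h) (\<lambda>x. a * F' x)"
  unfolding has_directional_derivative_def
proof
  fix x
  have "((\<lambda>\<tau>. F (x + \<tau> *\<^sub>R h)) has_real_derivative F' x) (at (0 * a))"
    using assms by (simp add: has_directional_derivative_def)
  then have "((\<lambda>\<tau>. F (x + (\<tau> * a) *\<^sub>R h)) has_real_derivative F' x * a) (at 0)"
    by (rule DERIV_chain2) (auto intro!: derivative_eq_intros)
  then show "((\<lambda>\<tau>. F (x + \<tau> *\<^sub>R a *\<^sub>R h)) has_real_derivative a * F' x) (at 0)"
    by (simp add: mult.commute)
qed

lemma has_directional_derivative_scale:
  "has_directional_derivative F h F' \<Longrightarrow> has_directional_derivative (\<lambda>x. a * F x) h (\<lambda>x. a * F' x)"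
  by (auto simp: has_directional_derivative_def intro!: DERIV_cmult)

text \<open>A step along \<open>h + k\<close> is a step along \<open>h\<close> followed by one along
  \<open>k\<close> from a moving base point, and continuous convergence of the quotients along
  \<open>k\<close> copes with the moving point.\<close>

lemma has_directional_derivative_direction_add:
  assumes h: "has_directional_derivative F h F'" and k: "has_directional_derivative F k F''" and F: "F \<in> Cb" "F'' \<in> Cb"
  shows "has_directional_derivative F (h + k) (\<lambda>x. F' x + F'' x)"
  unfolding has_directional_derivative_def DERIV_def tendsto_at_iff_sequentially
proof (intro allI impI)
  fix x and \<tau> :: "nat \<Rightarrow> real" assume "\<forall>i. \<tau> i \<in> UNIV - {0}" and \<tau>0: "\<tau> \<longlonglongrightarrow> 0"
  then have \<tau>: "\<tau> i \<noteq> 0" for i by simp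
  have "(\<lambda>i. x + \<tau> i *\<^sub>R h) \<longlonglongrightarrow> x + 0 *\<^sub>R h" by (intro tendsto_intros \<tau>0)
  then have 1: "(\<lambda>i. 1 / \<tau> i * F (x + \<tau> i *\<^sub>R h + \<tau> i *\<^sub>R k) + - (1 / \<tau> i) * F (x + \<tau> i *\<^sub>R h)) \<longlonglongrightarrow> F'' x"
    by (intro cconvD[OF quotients_cconv[OF k F \<tau>0 \<tau>]]) simp
  have 2: "(\<lambda>i. (F (x + \<tau> i *\<^sub>R h) - F x) / \<tau> i) \<longlonglongrightarrow> F' x"
    using h[unfolded has_directional_derivative_def DERIV_def tendsto_at_iff_sequentially, rule_format, of \<tau> x] \<tau> \<tau>0
    by (simp add: comp_def)
  have "(F (x + \<tau> i *\<^sub>R (h + k)) - F x) / \<tau> i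
      = (F (x + \<tau> i *\<^sub>R h) - F x) / \<tau> i + (1 / \<tau> i * F (x + \<tau> i *\<^sub>R h + \<tau> i *\<^sub>R k) + - (1 / \<tau> i) * F (x + \<tau> i *\<^sub>R h))" for i
    by (simp add: scaleR_add_right add.assoc diff_divide_distrib)
  then show "((\<lambda>\<tau>. (F (x + (0 + \<tau>) *\<^sub>R (h + k)) - F (x + 0 *\<^sub>R (h + k))) / \<tau>) \<circ> \<tau>) \<longlonglongrightarrow> F' x + F'' x"
    using tendsto_add[OF 2 1] by (simp add: comp_def)
qed

lemma Cb_scale: "f \<in> Cb \<Longrightarrow> (\<lambda>x. a * f x) \<in> Cb"
  using Cb_lincomb[of f f a 0] by simp

definition first_form :: "('a::real_inner \<Rightarrow> 'a) \<Rightarrow> ('a \<Rightarrow> 'a \<Rightarrow> real) \<Rightarrow> 'a \<Rightarrow> 'a list \<Rightarrow> real" where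
  "first_form Q D x hs = (if hs \<in> H_tuples Q (Suc 0) then D (hd hs) x else 0)"

definition second_form :: "('a::real_inner \<Rightarrow> 'a) \<Rightarrow> ('a \<Rightarrow> 'a \<Rightarrow> 'a \<Rightarrow> real) \<Rightarrow> 'a \<Rightarrow> 'a list \<Rightarrow> real" where
  "second_form Q D x hs = (if hs \<in> H_tuples Q (Suc (Suc 0)) then D (hd hs) (hd (tl hs)) x else 0)"

context
  fixes Q :: "'a::{real_inner, banach, second_countable_topology} \<Rightarrow> 'a"
  assumes Q: "positive_operator Q"
begin

lemma derivative_family_linear:
  assumes u: "u \<in> Cb" and D: "derivative_family (CM_space Q) (CM_norm Q) M u D" and h: "h \<in> CM_space Q" "k \<in> CM_space Q"
  shows "D (a *\<^sub>R h + b *\<^sub>R k) x = a * D h x + b * D k x"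
proof -
  have d: "has_directional_derivative u h (D h)" "D h \<in> Cb" if "h \<in> CM_space Q" for h
    using D that by (auto simp: derivative_family_def)
  have "has_directional_derivative u (a *\<^sub>R h + b *\<^sub>R k) (\<lambda>x. a * D h x + b * D k x)"
    by (intro has_directional_derivative_direction_add has_directional_derivative_scaleR Cb_scale d h u)
  moreover have "has_directional_derivative u (a *\<^sub>R h + b *\<^sub>R k) (D (a *\<^sub>R h + b *\<^sub>R k))"
    using h CM_space_add[OF Q] CM_space_scaleR[OF Q] by (intro d(1)) auto
  ultimately show ?thesis by (metis has_directional_derivative_unique)
qed

context
  fixes u :: "'a \<Rightarrow> real" and D1 M
  assumes u: "u \<in> Cb" and D1: "derivative_family (CM_space Q) (CM_norm Q) M u D1" and M: "0 \<le> M"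
begin

lemma DH_1: "DH Q (Suc 0) u x = first_form Q D1 x"
  and has_H_derivative_1: "has_H_derivative Q 0 (DH Q 0 u) x (first_form Q D1 x)"
proof -
  have mf: "first_form Q D1 x \<in> multilinear_forms Q (Suc 0)"
    using D1 derivative_family_linear[OF u D1] CM_space_add[OF Q] CM_space_scaleR[OF Q]
    by (intro multilinear_forms_1I[OF Q _ M]) (auto simp: first_form_def derivative_family_def)
  have "((\<lambda>t. form_norm Q 0 (\<lambda>hs. (DH Q 0 u (x + t *\<^sub>R h) hs - DH Q 0 u x hs) / t - first_form Q D1 x (h # hs))) \<longlongrightarrow> 0) (at 0)"
    if h: "h \<in> CM_space Q" for h
  proof -
    have "((\<lambda>\<tau>. u (x + \<tau> *\<^sub>R h)) has_real_derivative D1 h x) (at 0)"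
      using D1 h by (auto simp: derivative_family_def has_directional_derivative_def)
    then have "((\<lambda>\<tau>. \<bar>(u (x + \<tau> *\<^sub>R h) - u x) / \<tau> - D1 h x\<bar>) \<longlongrightarrow> 0) (at 0)"
      by (intro tendsto_rabs_zero) (simp add: DERIV_def LIM_zero)
    then have "((\<lambda>\<tau>. ennreal \<bar>(u (x + \<tau> *\<^sub>R h) - u x) / \<tau> - D1 h x\<bar>) \<longlongrightarrow> ennreal 0) (at 0)"
      by (rule tendsto_ennrealI)
    then show ?thesis using h by (simp add: form_norm_0 first_form_def)
  qed
  then show "has_H_derivative Q 0 (DH Q 0 u) x (first_form Q D1 x)" using mf unfolding has_H_derivative_def by blast
  then show "DH Q (Suc 0) u x = first_form Q D1 x" by (rule DH_eqI_1[OF Q])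
qed

lemma CHn_1: "u \<in> CHn Q (Suc 0)"
proof -
  have "\<forall>hs\<in>H_tuples Q (Suc 0). (\<lambda>x. DH Q (Suc 0) u x hs) \<in> Cb"
    using D1 unfolding DH_1 by (auto elim!: H_tuples_SucE simp: first_form_def derivative_family_def)
  then show ?thesis using u has_H_derivative_1 by (auto simp: CHn_def le_Suc_eq)
qed

context
  fixes D2 \<beta> L
  assumes D2: "\<And>k. k \<in> CM_space Q \<Longrightarrow> derivative_family (CM_space Q) (CM_norm Q) (M * CM_norm Q k) (D1 k) (\<lambda>h. D2 h k)"
    and \<beta>: "0 < \<beta>" and L: "0 \<le> L"
    and D2_holder: "\<And>h k l x. h \<in> CM_space Q \<Longrightarrow> k \<in> CM_space Q \<Longrightarrow> l \<in> CM_space Q \<Longrightarrow>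
      \<bar>D2 h k (x + l) - D2 h k x\<bar> \<le> L * (CM_norm Q l powr \<beta> * (CM_norm Q h * CM_norm Q k))"
begin

lemma D2_facts:
  assumes "h \<in> CM_space Q" "k \<in> CM_space Q"
  shows "has_directional_derivative (D1 k) h (D2 h k)" "D2 h k \<in> Cb" "\<bar>D2 h k x\<bar> \<le> M * (CM_norm Q h * CM_norm Q k)"
  using D2[OF assms(2), unfolded derivative_family_def, rule_format, OF assms(1)] by (simp_all add: mult_ac)

lemma D1_Cb: "h \<in> CM_space Q \<Longrightarrow> D1 h \<in> Cb"
  using D1 by (auto simp: derivative_family_def)

lemma second_form_multilinear: "second_form Q D2 x \<in> multilinear_forms Q (Suc (Suc 0))"
proof (rule multilinear_forms_2I[OF Q _ M])
  fix h k l :: 'a and a b :: real assume h: "h \<in> CM_space Q" "k \<in> CM_space Q" and l: "l \<in> CM_space Q"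
  have hk: "a *\<^sub>R h + b *\<^sub>R k \<in> CM_space Q" by (intro CM_space_add[OF Q] CM_space_scaleR[OF Q] h)
  show "second_form Q D2 x [a *\<^sub>R h + b *\<^sub>R k, l] = a * second_form Q D2 x [h, l] + b * second_form Q D2 x [k, l]"
    using h l hk derivative_family_linear[OF D1_Cb[OF l] D2[OF l] h] by (simp add: second_form_def)
  have "D1 (a *\<^sub>R h + b *\<^sub>R k) = (\<lambda>x. a * D1 h x + b * D1 k x)"
    by (rule ext) (rule derivative_family_linear[OF u D1 h])
  then have "has_directional_derivative (D1 (a *\<^sub>R h + b *\<^sub>R k)) l (\<lambda>x. a * D2 l h x + b * D2 l k x)"
    by (auto intro!: has_directional_derivative_add has_directional_derivative_scale D2_facts h l)
  then have "D2 l (a *\<^sub>R h + b *\<^sub>R k) = (\<lambda>x. a * D2 l h x + b * D2 l k x)"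
    by (rule has_directional_derivative_unique[OF D2_facts(1)[OF l hk]])
  then show "second_form Q D2 x [l, a *\<^sub>R h + b *\<^sub>R k] = a * second_form Q D2 x [l, h] + b * second_form Q D2 x [l, k]"
    using h l hk by (simp add: second_form_def)
qed (use D2_facts in \<open>auto simp: second_form_def\<close>)

text \<open>The Hoelder continuity of the second derivative makes the convergence of the difference
  quotients uniform in the remaining direction.\<close>

lemma DH_2: "DH Q (Suc (Suc 0)) u x = second_form Q D2 x"
  and has_H_derivative_2: "has_H_derivative Q (Suc 0) (DH Q (Suc 0) u) x (second_form Q D2 x)"
proof -
  have "((\<lambda>t. form_norm Q (Suc 0) (\<lambda>hs. (DH Q (Suc 0) u (x + t *\<^sub>R h) hs - DH Q (Suc 0) u x hs) / t - second_form Q D2 x (h # hs))) \<longlongrightarrow> 0) (at 0)"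
    if h: "h \<in> CM_space Q" for h
  proof -
    let ?m = "\<lambda>t. L * ((\<bar>t\<bar> * CM_norm Q h) powr \<beta> * CM_norm Q h)"
    have b: "form_norm Q (Suc 0) (\<lambda>hs. (DH Q (Suc 0) u (x + t *\<^sub>R h) hs - DH Q (Suc 0) u x hs) / t - second_form Q D2 x (h # hs)) \<le> ennreal (?m t)"
      if t: "t \<noteq> 0" for t
    proof (rule form_norm_le[OF Q])
      show "0 \<le> ?m t" using L CM_norm_nonneg[OF Q] by simp
      fix hs assume "hs \<in> H_tuples Q (Suc 0)"
      then obtain k where k: "hs = [k]" "k \<in> CM_space Q" by (auto elim!: H_tuples_SucE)
      \<comment> \<open>The point \<open>\<xi>\<close> depends on \<open>k\<close>, but the Hoelder
        estimate uses only \<open>\<bar>\<xi>\<bar> \<le> \<bar>t\<bar>\<close> and is therefore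
        uniform in \<open>k\<close>.\<close>
      obtain \<xi> where \<xi>: "\<bar>\<xi>\<bar> \<le> \<bar>t\<bar>" "D1 k (x + t *\<^sub>R h) - D1 k x = t * D2 h k (x + \<xi> *\<^sub>R h)"
        using has_directional_derivative_mvt[OF D2_facts(1)[OF h k(2)] t] by blast
      have "\<bar>D2 h k (x + \<xi> *\<^sub>R h) - D2 h k x\<bar> \<le> L * (CM_norm Q (\<xi> *\<^sub>R h) powr \<beta> * (CM_norm Q h * CM_norm Q k))"
        by (intro D2_holder h k CM_space_scaleR[OF Q])
      also have "\<dots> \<le> L * ((\<bar>t\<bar> * CM_norm Q h) powr \<beta> * (CM_norm Q h * CM_norm Q k))"
        using \<xi>(1) L \<beta> CM_norm_nonneg[OF Q] CM_norm_scaleR[OF Q h]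
        by (intro mult_left_mono mult_right_mono powr_mono2) (auto intro: mult_right_mono)
      finally show "\<bar>(DH Q (Suc 0) u (x + t *\<^sub>R h) hs - DH Q (Suc 0) u x hs) / t - second_form Q D2 x (h # hs)\<bar>
          \<le> ?m t * prod_list (map (CM_norm Q) hs)"
        using k h t \<xi>(2) unfolding DH_1 by (simp add: first_form_def second_form_def mult_ac)
    qed
    have "(?m \<longlongrightarrow> L * ((\<bar>0\<bar> * CM_norm Q h) powr \<beta> * CM_norm Q h)) (at 0)"
      using \<beta> CM_norm_nonneg[OF Q] by (intro tendsto_intros tendsto_powr') auto
    then have "((\<lambda>t. ennreal (?m t)) \<longlongrightarrow> ennreal 0) (at 0)" using \<beta> by (intro tendsto_ennrealI) simp
    then have m: "((\<lambda>t. ennreal (?m t)) \<longlongrightarrow> 0) (at 0)" by simp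
    show ?thesis
      by (rule tendsto_sandwich[OF _ _ tendsto_const m]) (use b in \<open>auto simp: eventually_at_filter\<close>)
  qed
  then show "has_H_derivative Q (Suc 0) (DH Q (Suc 0) u) x (second_form Q D2 x)"
    using second_form_multilinear unfolding has_H_derivative_def by blast
  then show "DH Q (Suc (Suc 0)) u x = second_form Q D2 x" by (rule DH_eqI_2[OF Q])
qed

lemma CHn_2: "u \<in> CHn Q (Suc (Suc 0))"
proof -
  have "\<forall>hs\<in>H_tuples Q (Suc (Suc 0)). (\<lambda>x. DH Q (Suc (Suc 0)) u x hs) \<in> Cb"
    using D2_facts unfolding DH_2 by (auto elim!: H_tuples_SucE simp: second_form_def)
  then show ?thesis using CHn_1 has_H_derivative_2 unfolding CHn_def
    by (auto simp: le_Suc_eq less_Suc_eq simp del: DH.simps)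
qed

end

end

end

lemma ennreal_divide_leD:
  assumes "N / ennreal e \<le> ennreal c" "0 < e" "0 \<le> c"
  shows "N \<le> ennreal (c * e)"
proof -
  have "N / ennreal e * ennreal e \<le> ennreal c * ennreal e" using assms(1) by (rule mult_right_mono) simp
  then show ?thesis using assms by (simp add: ennreal_divide_times ennreal_mult'' ennreal_times_divide)
qed

section \<open>Pointwise bounds from norms and seminorms, and conversely\<close>

context
  fixes Q :: "'a::{real_inner, banach, second_countable_topology} \<Rightarrow> 'a"
  assumes Q: "positive_operator Q"
begin

lemma CHn_Cb: "f \<in> CHn Q n \<Longrightarrow> f \<in> Cb"
  by (simp add: CHn_def)

lemma CHn_has_H_derivative_0:
  assumes "f \<in> CHn Q (Suc m)"
  shows "has_H_derivative Q 0 (DH Q 0 f) x (DH Q (Suc 0) f x)"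
proof -
  obtain G where "has_H_derivative Q 0 (DH Q 0 f) x G" using assms unfolding CHn_def by blast
  then show ?thesis using DH_eqI_1[OF Q] by metis
qed

lemma CHn_has_H_derivative_1:
  assumes "f \<in> CHn Q (Suc (Suc m))"
  shows "has_H_derivative Q (Suc 0) (DH Q (Suc 0) f) x (DH Q (Suc (Suc 0)) f x)"
proof -
  have "Suc 0 < Suc (Suc m)" by simp
  then obtain G where "has_H_derivative Q (Suc 0) (DH Q (Suc 0) f) x G" using assms unfolding CHn_def by blast
  then show ?thesis using DH_eqI_2[OF Q] by metis
qed

lemma CHn_DH_Cb: "f \<in> CHn Q n \<Longrightarrow> 0 < k \<Longrightarrow> k \<le> n \<Longrightarrow> hs \<in> H_tuples Q k \<Longrightarrow> (\<lambda>x. DH Q k f x hs) \<in> Cb"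
  unfolding CHn_def by auto

lemma CHn_multilinear_1: "f \<in> CHn Q (Suc m) \<Longrightarrow> DH Q (Suc 0) f x \<in> multilinear_forms Q (Suc 0)"
  using CHn_has_H_derivative_0 unfolding has_H_derivative_def by blast

lemma CHn_multilinear_2: "f \<in> CHn Q (Suc (Suc m)) \<Longrightarrow> DH Q (Suc (Suc 0)) f x \<in> multilinear_forms Q (Suc (Suc 0))"
  using CHn_has_H_derivative_1 unfolding has_H_derivative_def by blast

lemma CHn_directional_derivative_1:
  assumes f: "f \<in> CHn Q (Suc m)" and h: "h \<in> CM_space Q"
  shows "has_directional_derivative f h (\<lambda>x. DH Q (Suc 0) f x [h])"
  using has_H_derivativeD[OF Q CHn_has_H_derivative_0[OF f] h, of "[]"]
  by (simp add: has_directional_derivative_def DERIV_def)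

text \<open>Convergence in form norm controls unit vectors \<open>v\<close>; the general
  \<open>k\<close> follows by homogeneity.\<close>

lemma CHn_directional_derivative_2:
  assumes f: "f \<in> CHn Q (Suc (Suc m))" and h: "h \<in> CM_space Q" and k: "k \<in> CM_space Q"
  shows "has_directional_derivative (\<lambda>x. DH Q (Suc 0) f x [k]) h (\<lambda>x. DH Q (Suc (Suc 0)) f x [h, k])"
proof -
  obtain v where v: "v \<in> CM_space Q" "CM_norm Q v \<le> 1" "k = CM_norm Q k *\<^sub>R v" by (rule normalize[OF Q k])
  have "has_directional_derivative (\<lambda>x. DH Q (Suc 0) f x [v]) h (\<lambda>x. DH Q (Suc (Suc 0)) f x [h, v])"
    unfolding has_directional_derivative_def DERIV_def
    using has_H_derivativeD[OF Q CHn_has_H_derivative_1[OF f] h, of "[v]"] v by (simp del: DH.simps)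
  then have "has_directional_derivative (\<lambda>x. CM_norm Q k * DH Q (Suc 0) f x [v]) h (\<lambda>x. CM_norm Q k * DH Q (Suc (Suc 0)) f x [h, v])"
    by (rule has_directional_derivative_scale)
  moreover have "CM_norm Q k * DH Q (Suc 0) f x [v] = DH Q (Suc 0) f x [k]" for x
    using multilinear_forms_1_scaleR[OF Q CHn_multilinear_1[OF f, of x] v(1), of "CM_norm Q k"] v(3) by simp
  moreover have "CM_norm Q k * DH Q (Suc (Suc 0)) f x [h, v] = DH Q (Suc (Suc 0)) f x [h, k]" for x
    using multilinear_forms_2_scaleR[OF Q CHn_multilinear_2[OF f, of x] h v(1), of 1 "CM_norm Q k"] v(3) by simp
  ultimately show ?thesis by (simp only:)
qed

lemma holder_seminorm_le:
  assumes "0 \<le> c" "\<And>x h hs. h \<in> CM_space Q \<Longrightarrow> hs \<in> H_tuples Q n \<Longrightarrow>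
      \<bar>F (x + h) hs - F x hs\<bar> \<le> c * (CM_norm Q h powr \<sigma> * prod_list (map (CM_norm Q) hs))"
  shows "holder_seminorm Q n \<sigma> F \<le> ennreal c"
  unfolding holder_seminorm_def
proof (intro SUP_least)
  fix x h assume h: "h \<in> CM_space Q - {0}"
  then have pos: "0 < CM_norm Q h powr \<sigma>" using CM_norm_pos[OF Q, of h] by simp
  have "form_norm Q n (\<lambda>hs. F (x + h) hs - F x hs) \<le> ennreal (c * CM_norm Q h powr \<sigma>)"
    using assms h by (intro form_norm_le[OF Q]) (auto simp: mult.assoc)
  then have "form_norm Q n (\<lambda>hs. F (x + h) hs - F x hs) \<le> ennreal c * ennreal (CM_norm Q h powr \<sigma>)"
    using assms(1) by (simp add: ennreal_mult)
  then show "form_norm Q n (\<lambda>hs. F (x + h) hs - F x hs) / ennreal (CM_norm Q h powr \<sigma>) \<le> ennreal c"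
    using pos by (simp add: divide_le_posI_ennreal mult.commute)
qed

lemma zygmund_seminorm_le:
  assumes "0 \<le> c" "\<And>x h hs. h \<in> CM_space Q \<Longrightarrow> hs \<in> H_tuples Q n \<Longrightarrow>
      \<bar>F (x + 2 *\<^sub>R h) hs - 2 * F (x + h) hs + F x hs\<bar> \<le> c * (CM_norm Q h * prod_list (map (CM_norm Q) hs))"
  shows "zygmund_seminorm Q n F \<le> ennreal c"
  unfolding zygmund_seminorm_def
proof (intro SUP_least)
  fix x h assume h: "h \<in> CM_space Q - {0}"
  then have pos: "0 < CM_norm Q h" using CM_norm_pos[OF Q, of h] by simp
  have "form_norm Q n (\<lambda>hs. F (x + 2 *\<^sub>R h) hs - 2 * F (x + h) hs + F x hs) \<le> ennreal (c * CM_norm Q h)"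
    using assms h pos by (intro form_norm_le[OF Q]) (auto simp: mult.assoc)
  then have "form_norm Q n (\<lambda>hs. F (x + 2 *\<^sub>R h) hs - 2 * F (x + h) hs + F x hs) \<le> ennreal c * ennreal (CM_norm Q h)"
    using assms(1) pos by (simp add: ennreal_mult)
  then show "form_norm Q n (\<lambda>hs. F (x + 2 *\<^sub>R h) hs - 2 * F (x + h) hs + F x hs) / ennreal (CM_norm Q h) \<le> ennreal c"
    using pos by (simp add: divide_le_posI_ennreal mult.commute)
qed

lemma form_norm_le_holder:
  assumes "holder_seminorm Q n \<sigma> F \<le> ennreal c" "0 \<le> c" "h \<in> CM_space Q" "h \<noteq> 0"
  shows "form_norm Q n (\<lambda>hs. F (x + h) hs - F x hs) \<le> ennreal (c * CM_norm Q h powr \<sigma>)"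
proof -
  have pos: "0 < CM_norm Q h powr \<sigma>" using CM_norm_pos[OF Q, of h] assms by simp
  have "form_norm Q n (\<lambda>hs. F (x + h) hs - F x hs) / ennreal (CM_norm Q h powr \<sigma>) \<le> holder_seminorm Q n \<sigma> F"
    unfolding holder_seminorm_def using assms by (intro SUP_upper2[of x] SUP_upper2[of h]) auto
  then have "form_norm Q n (\<lambda>hs. F (x + h) hs - F x hs) / ennreal (CM_norm Q h powr \<sigma>) \<le> ennreal c"
    using assms(1) by simp
  then show ?thesis using pos assms(2) by (rule ennreal_divide_leD)
qed

lemma form_norm_le_zygmund:
  assumes "zygmund_seminorm Q n F \<le> ennreal c" "0 \<le> c" "h \<in> CM_space Q" "h \<noteq> 0"
  shows "form_norm Q n (\<lambda>hs. F (x + 2 *\<^sub>R h) hs - 2 * F (x + h) hs + F x hs) \<le> ennreal (c * CM_norm Q h)"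
proof -
  let ?N = "form_norm Q n (\<lambda>hs. F (x + 2 *\<^sub>R h) hs - 2 * F (x + h) hs + F x hs)"
  have pos: "0 < CM_norm Q h" using CM_norm_pos[OF Q, of h] assms by simp
  have "?N / ennreal (CM_norm Q h) \<le> zygmund_seminorm Q n F"
    unfolding zygmund_seminorm_def using assms by (intro SUP_upper2[of x] SUP_upper2[of h]) auto
  then have "?N / ennreal (CM_norm Q h) \<le> ennreal c" using assms(1) by simp
  then show ?thesis using pos assms(2) by (rule ennreal_divide_leD)
qed

lemma sup_norm_apply: "sup_norm f \<le> ennreal c \<Longrightarrow> 0 \<le> c \<Longrightarrow> \<bar>f x\<bar> \<le> c"
  unfolding sup_norm_def by (meson SUP_le_iff UNIV_I ennreal_le_iff)

lemma sup_norm_le: "(\<And>x. \<bar>f x\<bar> \<le> c) \<Longrightarrow> sup_norm f \<le> ennreal c"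
  unfolding sup_norm_def by (intro SUP_least ennreal_leI) auto

lemma holder_bound_0:
  assumes "holder_seminorm Q 0 \<sigma> (DH Q 0 f) \<le> ennreal c" "0 \<le> c" "h \<in> CM_space Q"
  shows "\<bar>f (x + h) - f x\<bar> \<le> c * CM_norm Q h powr \<sigma>"
proof (cases "h = 0")
  case False
  then show ?thesis using form_norm_le_holder[OF assms False, of x] assms CM_norm_nonneg[OF Q] by (simp add: form_norm_0)
qed (use assms in simp)

lemma zygmund_bound_0:
  assumes "zygmund_seminorm Q 0 (DH Q 0 f) \<le> ennreal c" "0 \<le> c" "h \<in> CM_space Q"
  shows "\<bar>f (x + 2 *\<^sub>R h) - 2 * f (x + h) + f x\<bar> \<le> c * CM_norm Q h"
proof (cases "h = 0")
  case False
  then show ?thesis using form_norm_le_zygmund[OF assms False, of x] assms CM_norm_nonneg[OF Q] by (simp add: form_norm_0)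
qed (use assms CM_norm_nonneg[OF Q] in simp)

lemma holder_bound_1:
  assumes f: "f \<in> CHn Q (Suc m)" and "holder_seminorm Q (Suc 0) \<sigma> (DH Q (Suc 0) f) \<le> ennreal c" "0 \<le> c" "l \<in> CM_space Q" "h \<in> CM_space Q"
  shows "\<bar>DH Q (Suc 0) f (x + l) [h] - DH Q (Suc 0) f x [h]\<bar> \<le> c * (CM_norm Q l powr \<sigma> * CM_norm Q h)"
proof (cases "l = 0")
  case False
  have "\<bar>DH Q (Suc 0) f (x + l) [h] - DH Q (Suc 0) f x [h]\<bar> \<le> c * CM_norm Q l powr \<sigma> * CM_norm Q h"
    using assms(3) by (intro form_norm_apply_1[OF Q form_norm_le_holder[OF assms(2-4) False] _ assms(5)])
      (auto simp: multilinear_forms_1_scaleR[OF Q CHn_multilinear_1[OF f]] right_diff_distrib simp del: DH.simps)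
  then show ?thesis by (simp add: mult.assoc)
qed (use assms CM_norm_nonneg[OF Q] in simp)

lemma zygmund_bound_1:
  assumes f: "f \<in> CHn Q (Suc m)" and "zygmund_seminorm Q (Suc 0) (DH Q (Suc 0) f) \<le> ennreal c" "0 \<le> c" "l \<in> CM_space Q" "h \<in> CM_space Q"
  shows "\<bar>DH Q (Suc 0) f (x + 2 *\<^sub>R l) [h] - 2 * DH Q (Suc 0) f (x + l) [h] + DH Q (Suc 0) f x [h]\<bar> \<le> c * (CM_norm Q l * CM_norm Q h)"
proof (cases "l = 0")
  case False
  have "\<bar>DH Q (Suc 0) f (x + 2 *\<^sub>R l) [h] - 2 * DH Q (Suc 0) f (x + l) [h] + DH Q (Suc 0) f x [h]\<bar> \<le> c * CM_norm Q l * CM_norm Q h"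
    using assms(3) CM_norm_nonneg[OF Q] by (intro form_norm_apply_1[OF Q form_norm_le_zygmund[OF assms(2-4) False] _ assms(5)])
      (auto simp: multilinear_forms_1_scaleR[OF Q CHn_multilinear_1[OF f]] algebra_simps simp del: DH.simps)
  then show ?thesis by (simp add: mult.assoc)
qed (use assms CM_norm_nonneg[OF Q] in simp)

lemma holder_bound_2:
  assumes f: "f \<in> CHn Q (Suc (Suc m))" and "holder_seminorm Q (Suc (Suc 0)) \<sigma> (DH Q (Suc (Suc 0)) f) \<le> ennreal c" "0 \<le> c" "l \<in> CM_space Q"
    "h \<in> CM_space Q" "k \<in> CM_space Q"
  shows "\<bar>DH Q (Suc (Suc 0)) f (x + l) [h, k] - DH Q (Suc (Suc 0)) f x [h, k]\<bar> \<le> c * (CM_norm Q l powr \<sigma> * (CM_norm Q h * CM_norm Q k))"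
proof (cases "l = 0")
  case False
  have "\<bar>DH Q (Suc (Suc 0)) f (x + l) [h, k] - DH Q (Suc (Suc 0)) f x [h, k]\<bar> \<le> c * CM_norm Q l powr \<sigma> * (CM_norm Q h * CM_norm Q k)"
    using assms(3) by (intro form_norm_apply_2[OF Q form_norm_le_holder[OF assms(2-4) False] _ assms(5,6)])
      (auto simp: multilinear_forms_2_scaleR[OF Q CHn_multilinear_2[OF f]] right_diff_distrib simp del: DH.simps)
  then show ?thesis by (simp add: mult.assoc)
qed (use assms CM_norm_nonneg[OF Q] in simp)

end

section \<open>Interpolation\<close>

lemma derivative_family_mono:
  "derivative_family H n M u D \<Longrightarrow> M \<le> M' \<Longrightarrow> (\<And>h. 0 \<le> n h) \<Longrightarrow> derivative_family H n M' u D"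
  unfolding derivative_family_def by (meson mult_right_mono order_trans)

text \<open>The auxiliary function \<open>\<phi>\<close> has the symmetric second difference of
  \<open>D\<close> as derivative, so the central difference of \<open>f\<close> over a unit step
  equals \<open>2 * D x\<close> up to \<open>A'\<close>.\<close>

lemma derivative_bound_second_difference:
  assumes d: "has_directional_derivative f h D" and f: "\<And>x. \<bar>f x\<bar> \<le> A"
    and D: "\<And>r. 0 \<le> r \<Longrightarrow> r \<le> 1 \<Longrightarrow> \<bar>D (x + r *\<^sub>R h) + D (x - r *\<^sub>R h) - 2 * D x\<bar> \<le> A'"
  shows "\<bar>D x\<bar> \<le> A + A'"
proof -
  define \<phi> where "\<phi> = (\<lambda>r. f (x + r *\<^sub>R h) - f (x - r *\<^sub>R h) - 2 * r * D x)"
  have d1: "((\<lambda>r. f (x + r *\<^sub>R h)) has_real_derivative D (x + r *\<^sub>R h)) (at r)" for r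
    by (rule has_directional_derivativeD[OF d])
  have d2: "((\<lambda>r. f (x - r *\<^sub>R h)) has_real_derivative - D (x - r *\<^sub>R h)) (at r)" for r
  proof -
    have "((\<lambda>r. f (x + (- r) *\<^sub>R h)) has_real_derivative D (x + (- r) *\<^sub>R h) * (- 1)) (at r)"
      by (rule DERIV_chain2[of "\<lambda>r. f (x + r *\<^sub>R h)", OF d1]) (auto intro!: derivative_eq_intros)
    then show ?thesis by simp
  qed
  have "(\<phi> has_real_derivative D (x + r *\<^sub>R h) + D (x - r *\<^sub>R h) - 2 * D x) (at r)" for r
    unfolding \<phi>_def by (auto intro!: derivative_eq_intros d1 d2)
  then obtain z where z: "0 < z" "z < 1" "\<phi> 1 - \<phi> 0 = (1 - 0) * (D (x + z *\<^sub>R h) + D (x - z *\<^sub>R h) - 2 * D x)"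
    using MVT2[of 0 1 \<phi> "\<lambda>r. D (x + r *\<^sub>R h) + D (x - r *\<^sub>R h) - 2 * D x"] by auto
  then have "\<bar>\<phi> 1 - \<phi> 0\<bar> \<le> A'" using D[of z] by simp
  moreover have "\<phi> 1 - \<phi> 0 = f (x + h) - f (x - h) - 2 * D x" by (simp add: \<phi>_def)
  moreover have "\<bar>f (x + h)\<bar> \<le> A" "\<bar>f (x - h)\<bar> \<le> A" by (rule f)+
  ultimately show ?thesis by linarith
qed

context
  fixes Q :: "'a::{real_inner, banach, second_countable_topology} \<Rightarrow> 'a" and f :: "'a \<Rightarrow> real" and A :: real
  assumes Q: "positive_operator Q" and A: "0 \<le> A" and sup: "\<And>x. \<bar>f x\<bar> \<le> A"
begin

lemma derivative_family_1I:
  assumes f: "f \<in> CHn Q (Suc m)" and b: "\<And>u x. u \<in> CM_space Q \<Longrightarrow> CM_norm Q u \<le> 1 \<Longrightarrow> \<bar>DH Q (Suc 0) f x [u]\<bar> \<le> M"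
  shows "derivative_family (CM_space Q) (CM_norm Q) M f (\<lambda>h x. DH Q (Suc 0) f x [h])"
  unfolding derivative_family_def
proof (intro ballI conjI allI)
  fix h assume h: "h \<in> CM_space Q"
  show "has_directional_derivative f h (\<lambda>x. DH Q (Suc 0) f x [h])" by (rule CHn_directional_derivative_1[OF Q f h])
  show "(\<lambda>x. DH Q (Suc 0) f x [h]) \<in> Cb" using h by (intro CHn_DH_Cb[OF Q f]) auto
  fix x
  obtain u where u: "u \<in> CM_space Q" "CM_norm Q u \<le> 1" "h = CM_norm Q h *\<^sub>R u" by (rule normalize[OF Q h])
  have "DH Q (Suc 0) f x [h] = CM_norm Q h * DH Q (Suc 0) f x [u]"
    using multilinear_forms_1_scaleR[OF Q CHn_multilinear_1[OF Q f, of x] u(1), of "CM_norm Q h"] u(3) by simp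
  then show "\<bar>DH Q (Suc 0) f x [h]\<bar> \<le> M * CM_norm Q h"
    using b[OF u(1,2), of x] mult_right_mono[of "\<bar>DH Q (Suc 0) f x [u]\<bar>" M "CM_norm Q h"] CM_norm_nonneg[OF Q, of h]
    by (simp add: abs_mult mult.commute del: DH.simps)
qed

text \<open>At some mean value point the derivative is a difference of two values of
  \<open>f\<close>, at most \<open>2 * A\<close>; the Hoelder bound moves it to \<open>x\<close> at
  the cost of another \<open>A\<close>.\<close>

lemma derivative_family_1_holder:
  assumes f: "f \<in> CHn Q (Suc 0)" and \<sigma>: "0 < \<sigma>" and h: "holder_seminorm Q (Suc 0) \<sigma> (DH Q (Suc 0) f) \<le> ennreal A"
  shows "derivative_family (CM_space Q) (CM_norm Q) (3 * A) f (\<lambda>h x. DH Q (Suc 0) f x [h])"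
proof (rule derivative_family_1I[OF f])
  fix u x assume u: "u \<in> CM_space Q" "CM_norm Q u \<le> 1"
  let ?D = "\<lambda>x. DH Q (Suc 0) f x [u]"
  obtain r where r: "\<bar>r\<bar> \<le> 1" "f (x + 1 *\<^sub>R u) - f x = 1 * ?D (x + r *\<^sub>R u)"
    using has_directional_derivative_mvt[OF CHn_directional_derivative_1[OF Q f u(1)], of 1 x] by (auto simp del: DH.simps)
  have "\<bar>?D (x + r *\<^sub>R u) - ?D x\<bar> \<le> A * (CM_norm Q (r *\<^sub>R u) powr \<sigma> * CM_norm Q u)"
    using u CM_space_scaleR[OF Q] by (intro holder_bound_1[OF Q f h A]) auto
  also have "\<dots> \<le> A * (1 * 1)"
    using r(1) u A \<sigma> CM_norm_scaleR[OF Q u(1)] CM_norm_nonneg[OF Q]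
    by (intro mult_left_mono mult_mono powr_le1) (auto intro: mult_le_one)
  finally show "\<bar>?D x\<bar> \<le> 3 * A" using r(2) sup[of x] sup[of "x + u"] by (simp del: DH.simps)
qed

text \<open>The Zygmund seminorm bounds second differences of the derivative, here centred at
  \<open>x\<close>, by \<open>A\<close>; interpolation adds the supremum \<open>A\<close> of
  \<open>f\<close>.\<close>

lemma derivative_family_1_zygmund:
  assumes f: "f \<in> CHn Q (Suc 0)" and h: "zygmund_seminorm Q (Suc 0) (DH Q (Suc 0) f) \<le> ennreal A"
  shows "derivative_family (CM_space Q) (CM_norm Q) (2 * A) f (\<lambda>h x. DH Q (Suc 0) f x [h])"
proof (rule derivative_family_1I[OF f])
  fix u x assume u: "u \<in> CM_space Q" "CM_norm Q u \<le> 1"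
  let ?D = "\<lambda>x. DH Q (Suc 0) f x [u]"
  have "\<bar>?D (x + r *\<^sub>R u) + ?D (x - r *\<^sub>R u) - 2 * ?D x\<bar> \<le> A" if r: "0 \<le> r" "r \<le> 1" for r
  proof -
    have eq: "x - r *\<^sub>R u + 2 *\<^sub>R r *\<^sub>R u = x + r *\<^sub>R u" "x - r *\<^sub>R u + r *\<^sub>R u = x" unfolding scaleR_2 by simp_all
    have "\<bar>?D (x - r *\<^sub>R u + 2 *\<^sub>R r *\<^sub>R u) - 2 * ?D (x - r *\<^sub>R u + r *\<^sub>R u) + ?D (x - r *\<^sub>R u)\<bar>
        \<le> A * (CM_norm Q (r *\<^sub>R u) * CM_norm Q u)"
      using u CM_space_scaleR[OF Q] by (intro zygmund_bound_1[OF Q f h A]) auto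
    also have "\<dots> \<le> A * (1 * 1)"
      using r u A CM_norm_scaleR[OF Q u(1)] CM_norm_nonneg[OF Q]
      by (intro mult_left_mono mult_mono) (auto intro: mult_le_one)
    finally show ?thesis unfolding eq by (simp add: algebra_simps del: DH.simps)
  qed
  then have "\<bar>?D x\<bar> \<le> A + A"
    by (rule derivative_bound_second_difference[OF CHn_directional_derivative_1[OF Q f u(1)] sup])
  then show "\<bar>?D x\<bar> \<le> 2 * A" by (simp del: DH.simps)
qed

context
  fixes \<sigma>
  assumes f: "f \<in> CHn Q (Suc (Suc 0))" and \<sigma>: "0 < \<sigma>" "\<sigma> < 1"
    and h: "holder_seminorm Q (Suc (Suc 0)) \<sigma> (DH Q (Suc (Suc 0)) f) \<le> ennreal A"
begin

text \<open>Lengths up to 2 occur as the distance of two mean value points in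
  \<open>[-1, 1]\<close>; the constant comes from \<open>2 powr \<sigma> \<le> 2\<close>.\<close>

lemma D2_oscillation:
  assumes u: "u \<in> CM_space Q" "CM_norm Q u \<le> 1" and v: "v \<in> CM_space Q" "CM_norm Q v \<le> 1" and r: "\<bar>r\<bar> \<le> 2"
  shows "\<bar>DH Q (Suc (Suc 0)) f (x + r *\<^sub>R u) [u, v] - DH Q (Suc (Suc 0)) f x [u, v]\<bar> \<le> 2 * A"
proof -
  let ?D2 = "\<lambda>h k x. DH Q (Suc (Suc 0)) f x [h, k]"
  have "CM_norm Q (r *\<^sub>R u) \<le> 2 * 1"
    unfolding CM_norm_scaleR[OF Q u(1)] using r u CM_norm_nonneg[OF Q] by (intro mult_mono) auto
  then have "CM_norm Q (r *\<^sub>R u) powr \<sigma> \<le> 2 powr \<sigma>" using \<sigma> CM_norm_nonneg[OF Q] by (intro powr_mono2) auto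
  also have "\<dots> \<le> 2 powr 1" using \<sigma> by (intro powr_mono) auto
  finally have 1: "CM_norm Q (r *\<^sub>R u) powr \<sigma> \<le> 2" by simp
  have "\<bar>?D2 u v (x + r *\<^sub>R u) - ?D2 u v x\<bar> \<le> A * (CM_norm Q (r *\<^sub>R u) powr \<sigma> * (CM_norm Q u * CM_norm Q v))"
    using u v CM_space_scaleR[OF Q] by (intro holder_bound_2[OF Q f h A]) auto
  also have "\<dots> \<le> A * (2 * (1 * 1))"
    using A u v 1 CM_norm_nonneg[OF Q] by (intro mult_left_mono mult_mono) auto
  finally show ?thesis by (simp del: DH.simps)
qed

text \<open>Two interpolations. The second difference of a first derivative is \<open>r\<close>
  times a difference of second derivatives, whence \<open>A + 2 * A\<close>. A second derivative at
  a mean value point is a difference of first derivatives, and moving it to \<open>x\<close> costs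
  an oscillation, whence \<open>3 * A + 3 * A + 2 * A\<close>.\<close>

lemma derivative_family_2_holder:
  shows "derivative_family (CM_space Q) (CM_norm Q) (3 * A) f (\<lambda>h x. DH Q (Suc 0) f x [h])"
    and "k \<in> CM_space Q \<Longrightarrow> derivative_family (CM_space Q) (CM_norm Q) (8 * A * CM_norm Q k)
      (\<lambda>x. DH Q (Suc 0) f x [k]) (\<lambda>h x. DH Q (Suc (Suc 0)) f x [h, k])"
proof -
  let ?D1 = "\<lambda>h x. DH Q (Suc 0) f x [h]" and ?D2 = "\<lambda>h k x. DH Q (Suc (Suc 0)) f x [h, k]"
  note d2 = CHn_directional_derivative_2[OF Q f]
  have b1: "\<bar>?D1 u x\<bar> \<le> 3 * A" if u: "u \<in> CM_space Q" "CM_norm Q u \<le> 1" for u x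
  proof -
    have "\<bar>?D1 u (x + r *\<^sub>R u) + ?D1 u (x - r *\<^sub>R u) - 2 * ?D1 u x\<bar> \<le> 2 * A" if r: "0 \<le> r" "r \<le> 1" for r
    proof (cases "r = 0")
      case False
      obtain \<eta> where \<eta>: "\<bar>\<eta>\<bar> \<le> \<bar>r\<bar>" "?D1 u (x + r *\<^sub>R u) - ?D1 u x = r * ?D2 u u (x + \<eta> *\<^sub>R u)"
        by (rule has_directional_derivative_mvt[OF d2[OF u(1) u(1)] False, of x])
      obtain \<zeta> where \<zeta>: "\<bar>\<zeta>\<bar> \<le> \<bar>- r\<bar>" "?D1 u (x + (- r) *\<^sub>R u) - ?D1 u x = - r * ?D2 u u (x + \<zeta> *\<^sub>R u)"
        by (rule has_directional_derivative_mvt[OF d2[OF u(1) u(1)], of "- r" x]) (use False in simp_all)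
      have eq: "x + \<zeta> *\<^sub>R u + (\<eta> - \<zeta>) *\<^sub>R u = x + \<eta> *\<^sub>R u" by (simp add: algebra_simps)
      have "\<bar>\<eta> - \<zeta>\<bar> \<le> 2" using \<eta>(1) \<zeta>(1) r by simp
      from D2_oscillation[OF u u this, of "x + \<zeta> *\<^sub>R u"]
      have "\<bar>?D2 u u (x + \<eta> *\<^sub>R u) - ?D2 u u (x + \<zeta> *\<^sub>R u)\<bar> \<le> 2 * A" unfolding eq .
      then have "r * \<bar>?D2 u u (x + \<eta> *\<^sub>R u) - ?D2 u u (x + \<zeta> *\<^sub>R u)\<bar> \<le> 1 * (2 * A)"
        using r by (intro mult_mono) auto
      moreover have "?D1 u (x + r *\<^sub>R u) + ?D1 u (x - r *\<^sub>R u) - 2 * ?D1 u x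
          = r * (?D2 u u (x + \<eta> *\<^sub>R u) - ?D2 u u (x + \<zeta> *\<^sub>R u))"
        using \<eta>(2) \<zeta>(2) by (simp add: right_diff_distrib del: DH.simps)
      ultimately show ?thesis using r by (simp add: abs_mult del: DH.simps)
    qed (use A in simp)
    then have "\<bar>?D1 u x\<bar> \<le> A + 2 * A"
      by (rule derivative_bound_second_difference[OF CHn_directional_derivative_1[OF Q f u(1)] sup])
    then show ?thesis by (simp del: DH.simps)
  qed
  then show "derivative_family (CM_space Q) (CM_norm Q) (3 * A) f ?D1" by (rule derivative_family_1I[OF f])
  assume k: "k \<in> CM_space Q"
  show "derivative_family (CM_space Q) (CM_norm Q) (8 * A * CM_norm Q k) (?D1 k) (\<lambda>h. ?D2 h k)"
    unfolding derivative_family_def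
  proof (intro ballI conjI allI)
    fix h assume h: "h \<in> CM_space Q"
    show "has_directional_derivative (?D1 k) h (?D2 h k)" by (rule d2[OF h k])
    show "?D2 h k \<in> Cb" using h k by (intro CHn_DH_Cb[OF Q f]) auto
    fix x
    obtain u where u: "u \<in> CM_space Q" "CM_norm Q u \<le> 1" "h = CM_norm Q h *\<^sub>R u" by (rule normalize[OF Q h])
    obtain v where v: "v \<in> CM_space Q" "CM_norm Q v \<le> 1" "k = CM_norm Q k *\<^sub>R v" by (rule normalize[OF Q k])
    obtain r where r: "\<bar>r\<bar> \<le> \<bar>1\<bar>" "?D1 v (x + 1 *\<^sub>R u) - ?D1 v x = 1 * ?D2 u v (x + r *\<^sub>R u)"
      by (rule has_directional_derivative_mvt[OF d2[OF u(1) v(1)], of 1 x]) auto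
    have "\<bar>?D2 u v (x + r *\<^sub>R u) - ?D2 u v x\<bar> \<le> 2 * A" using r(1) by (intro D2_oscillation u v) simp
    then have "\<bar>?D2 u v x\<bar> \<le> 8 * A" using r(2) b1[OF v(1,2), of x] b1[OF v(1,2), of "x + u"] by (simp del: DH.simps)
    then have "(CM_norm Q h * CM_norm Q k) * \<bar>?D2 u v x\<bar> \<le> (CM_norm Q h * CM_norm Q k) * (8 * A)"
      using CM_norm_nonneg[OF Q] by (intro mult_left_mono mult_nonneg_nonneg)
    moreover have "?D2 h k x = CM_norm Q h * CM_norm Q k * ?D2 u v x"
      using multilinear_forms_2_scaleR[OF Q CHn_multilinear_2[OF Q f] u(1) v(1)] u(3) v(3) by metis
    ultimately show "\<bar>?D2 h k x\<bar> \<le> 8 * A * CM_norm Q k * CM_norm Q h"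
      using CM_norm_nonneg[OF Q] by (simp add: abs_mult mult_ac del: DH.simps)
  qed
qed

end

end

section \<open>The Schauder estimate\<close>

text \<open>The substitution of \<open>t - r\<close> for \<open>r\<close>. The closed interval
  differs from the half-open one by a point, and only times in \<open>[0, t]\<close> enter, so the
  clamped data may replace the given ones.\<close>

lemma (in smoothing_semigroup) mild_solution_eq:
  assumes g: "bounded_family g" and holder: "\<And>t. holder_bound \<alpha> K (g t)"
    and t: "0 \<le> t" and eq: "\<And>r. 0 \<le> r \<Longrightarrow> r \<le> t \<Longrightarrow> g' r = g r"
  shows "mild_solution S (F []) g' t = solution F g [] t"
proof
  fix x
  define \<phi> where "\<phi> r = S r (g (t - r)) x" for r
  have CK: "0 \<le> C * K" using holder_boundD(4)[OF holder] C_ge_1 by simp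
  have b: "\<bar>S r (g \<tau>) x\<bar> \<le> (C * K) * r powr - 0" if "0 < r" for r \<tau> x
    using that S_bound[OF _ holder_boundD(1,2)[OF holder], of r \<tau> x] by simp
  have kernel: "continuous_kernel S" using continuous_kernel_D[of "[]"] by (simp add: continuous_kernel_def)
  have [measurable]: "(\<lambda>r. indicator {0<..t} r * \<phi> r) \<in> borel_measurable borel"
    using duhamel_integrand_measurable[where E = S, OF g kernel CK zero_less_one b] by (simp add: \<phi>_def)
  have "(LBINT r:{0..t}. S (t - r) (g' r) x) = (LINT r|lborel. indicator {0..t} (t - r) * \<phi> (t - r))"
    unfolding set_lebesgue_integral_def
    by (rule Bochner_Integration.integral_cong) (auto simp: \<phi>_def indicator_def eq)
  also have "\<dots> = (LINT r|lborel. indicator {0..t} r * \<phi> r)"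
    using lborel_integral_real_affine[of "- 1" "\<lambda>r. indicator {0..t} r * \<phi> r" t] by simp
  also have "\<dots> = (LINT r|lborel. indicator {0<..t} r * \<phi> r)"
  proof (rule integral_cong_AE)
    have "(\<lambda>r. indicator {0<..t} r * \<phi> r + indicator {0} r * \<phi> 0) \<in> borel_measurable lborel" by measurable
    also have "(\<lambda>r. indicator {0<..t} r * \<phi> r + indicator {0} r * \<phi> 0) = (\<lambda>r. indicator {0..t} r * \<phi> r)"
      using t by (auto simp: indicator_def)
    finally show "(\<lambda>r. indicator {0..t} r * \<phi> r) \<in> borel_measurable lborel" .
    show "AE r in lborel. indicator {0..t} r * \<phi> r = indicator {0<..t} r * \<phi> r"
      using AE_lborel_singleton[of 0] by eventually_elim (auto simp: indicator_def)
  qed measurable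
  finally show "mild_solution S (F []) g' t x = solution F g [] t x"
    by (simp add: mild_solution_def solution_def duhamel_def set_lebesgue_integral_def \<phi>_def)
qed

lemma bounded_family_clamp:
  assumes "g \<in> CbT T" "0 \<le> T"
  shows "bounded_family (\<lambda>t. g (max 0 (min T t)))"
proof -
  have "continuous_on UNIV (\<lambda>z. case (max 0 (min T (fst z)), snd z) of (t, x) \<Rightarrow> g t x)"
  proof (rule continuous_on_compose2[where f = "\<lambda>z. (max 0 (min T (fst z)), snd z)"])
    show "continuous_on ({0..T} \<times> UNIV) (\<lambda>(t, x). g t x)" using assms by (simp add: CbT_def)
    show "continuous_on UNIV (\<lambda>z. (max 0 (min T (fst z)), snd z))" by (intro continuous_intros)
  qed (use assms in auto)
  moreover obtain K where K: "\<And>t x. t \<in> {0..T} \<Longrightarrow> \<bar>g t x\<bar> \<le> K"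
    using assms(1) unfolding CbT_def bounded_iff by fastforce
  have "\<bar>g (max 0 (min T t)) x\<bar> \<le> K" for t x using assms(2) by (intro K) auto
  ultimately show ?thesis unfolding bounded_family_def case_prod_unfold by auto
qed

text \<open>The factor 3 counts the supremum and at most two derivatives.\<close>

lemma CHn_norm_le:
  fixes W :: real
  assumes "n \<le> 2" "0 \<le> W" "sup_norm u \<le> ennreal W" "\<And>k x. k \<in> {1..n} \<Longrightarrow> form_norm Q k (DH Q k u x) \<le> ennreal W"
  shows "CHn_norm Q n u \<le> ennreal (3 * W)"
proof -
  have "(\<Sum>k=1..n. SUP x. form_norm Q k (DH Q k u x)) \<le> (\<Sum>k=1..n. ennreal W)"
    using assms(4) by (intro sum_mono SUP_least) auto
  also have "\<dots> = ennreal (real n * W)" using assms(2) by (simp add: ennreal_mult ennreal_of_nat_eq_real_of_nat)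
  also have "\<dots> \<le> ennreal (2 * W)" using assms(1,2) by (intro ennreal_leI mult_right_mono) auto
  finally have "CHn_norm Q n u \<le> ennreal W + ennreal (2 * W)"
    unfolding CHn_norm_def using assms(3) by (intro add_mono)
  also have "\<dots> = ennreal (W + 2 * W)" using assms(2) by (intro ennreal_plus[symmetric]) auto
  finally show ?thesis by simp
qed

text \<open>\<open>A\<close> gathers what membership guarantees to be finite, the supremum and the
  top seminorm \<open>N\<close>; bounds for the derivatives come from interpolation
  afterwards.\<close>

lemma size_of_datum:
  fixes Q :: "'a::{real_inner, banach, second_countable_topology} \<Rightarrow> 'a"
  assumes Q: "positive_operator Q" and "f \<in> Cb" "N < \<infinity>"
  obtains A where "0 \<le> A" "\<And>x. \<bar>f x\<bar> \<le> A" "N \<le> ennreal A" "ennreal A = sup_norm f + N"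
proof
  obtain K where "\<And>x. \<bar>f x\<bar> \<le> K" using CbE[OF assms(2)] by blast
  then have "sup_norm f < \<infinity>" using le_less_trans[OF sup_norm_le[OF Q], of f K \<infinity>] by simp
  then show fin: "ennreal (enn2real (sup_norm f + N)) = sup_norm f + N"
    using assms(3) by (simp add: less_top[symmetric])
  show "N \<le> ennreal (enn2real (sup_norm f + N))" unfolding fin by simp
  show "\<bar>f x\<bar> \<le> enn2real (sup_norm f + N)" for x
    by (rule sup_norm_apply[OF Q]) (auto simp: fin)
qed simp

lemma add_ennreal_le: "u \<le> ennreal (3 * W) \<Longrightarrow> v \<le> ennreal W \<Longrightarrow> 0 \<le> W \<Longrightarrow> u + v \<le> ennreal (4 * W)"
  using add_mono[of u "ennreal (3 * W)" v "ennreal W"] ennreal_plus[of "3 * W" W] by simp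

context
  fixes Q :: "'a::{real_inner, banach, second_countable_topology} \<Rightarrow> 'a" and T s \<alpha> \<theta> C c :: real
  assumes Q: "positive_operator Q" and T: "0 < T" and s: "0 < s" "s < 1" and \<alpha>: "0 \<le> \<alpha>" "\<alpha> < 1" and \<theta>: "\<theta> = \<alpha> + 2 * s"
    and smoothing: "smoothing_semigroup (frac_sg Q s) (frac_deriv Q s) (CM_space Q) (CM_norm Q) (1 / (2 * s)) C"
    and c: "smoothing_semigroup.schauder_const (frac_sg Q s) (frac_deriv Q s) (CM_space Q) (CM_norm Q) C \<alpha> \<theta> T c"
begin

interpretation smoothing_semigroup "frac_sg Q s" "frac_deriv Q s" "CM_space Q" "CM_norm Q" "1 / (2 * s)" C
  by (rule smoothing)

lemma \<theta>': "\<theta> = \<alpha> + 1 / (1 / (2 * s))"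
  using \<theta> by simp

text \<open>The factor 2 is for \<open>\<alpha> = 0\<close>, where the norm of \<open>g\<close> is a
  supremum and bounds oscillations only after doubling.\<close>

lemma holder_bound_data:
  assumes g: "g \<in> CHT Q T \<alpha>" and K: "K = enn2real (CHT_norm Q T \<alpha> g)" and t: "t \<in> {0..T}"
  shows "holder_bound \<alpha> (2 * K) (g t)"
proof -
  have \<alpha>0: "nat \<lfloor>\<alpha>\<rfloor> = 0" using \<alpha> by (simp add: floor_less_iff)
  have fin: "CHT_norm Q T \<alpha> g = ennreal K" using g K by (simp add: CHT_def less_top[symmetric])
  have K0: "0 \<le> K" by (simp add: K)
  have le: "CH_norm Q \<alpha> (g t) \<le> ennreal K" unfolding fin[symmetric] CHT_norm_def using t by (rule SUP_upper)
  have gt: "g t \<in> CH Q \<alpha>" using g t by (simp add: CHT_def)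
  have Cb: "g t \<in> Cb" using gt by (simp add: CH_def \<alpha>0 CHn_def)
  have "sup_norm (g t) \<le> CH_norm Q \<alpha> (g t)" by (simp add: CH_norm_def \<alpha>0 CHn_norm_def)
  then have sup: "\<bar>g t x\<bar> \<le> K" for x using le K0 by (intro sup_norm_apply[OF Q]) (auto intro: order_trans)
  have "\<bar>g t (x + k) - g t x\<bar> \<le> 2 * K * CM_norm Q k powr \<alpha>" if k: "k \<in> CM_space Q" for x k
  proof (cases "k = 0 \<or> \<alpha> = 0")
    case True
    then show ?thesis using CM_norm_pos[OF Q k] K0 sup[of x] sup[of "x + k"] by (cases "k = 0") auto
  next
    case False
    then have "holder_seminorm Q 0 \<alpha> (DH Q 0 (g t)) \<le> CH_norm Q \<alpha> (g t)" by (simp add: CH_norm_def \<alpha>0)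
    then have "\<bar>g t (x + k) - g t x\<bar> \<le> K * CM_norm Q k powr \<alpha>"
      using le by (intro holder_bound_0[OF Q _ K0 k]) (auto intro: order_trans)
    also have "\<dots> \<le> 2 * K * CM_norm Q k powr \<alpha>" using K0 by (intro mult_right_mono) auto
    finally show ?thesis .
  qed
  then show ?thesis using Cb sup K0 unfolding holder_bound_def by (auto intro: order_trans[OF sup])
qed

text \<open>The factor 8 is the loss in the interpolation inequalities for the derivatives of \<open>f\<close>.\<close>

context
  fixes f :: "'a \<Rightarrow> real" and g :: "real \<Rightarrow> 'a \<Rightarrow> real" and A K W :: real and v G F N
  assumes v_def: "v = mild_solution (frac_sg Q s) f g" and G_def: "G = (\<lambda>t. g (max 0 (min T t)))"
    and K_def: "K = enn2real (CHT_norm Q T \<alpha> g)"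
    and W_def: "W = c * (8 * A + 2 * K)" and F_def: "F = (\<lambda>hs x. DH Q (length hs) f x hs)"
    and g: "g \<in> CHT Q T \<alpha>" and A: "0 \<le> A" and N: "N \<le> 2" "real N < \<theta>"
    and F: "\<And>hs. set hs \<subseteq> CM_space Q \<Longrightarrow> length hs \<le> N \<Longrightarrow> F hs \<in> Cb"
      "\<And>hs x. set hs \<subseteq> CM_space Q \<Longrightarrow> length hs \<le> N \<Longrightarrow> \<bar>F hs x\<bar> \<le> 8 * A * P hs"
      "\<And>h hs. h \<in> CM_space Q \<Longrightarrow> set hs \<subseteq> CM_space Q \<Longrightarrow> length hs < N \<Longrightarrow> has_directional_derivative (F hs) h (F (h # hs))"
    and F_holder: "\<And>hs l x. N = 2 \<Longrightarrow> set hs \<subseteq> CM_space Q \<Longrightarrow> length hs = 2 \<Longrightarrow> l \<in> CM_space Q \<Longrightarrow>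
      \<theta> < 3 \<and> \<bar>fdiff 1 l (F hs) x\<bar> \<le> 8 * A * (P hs * CM_norm Q l powr (\<theta> - 2))"
begin

lemma G: "bounded_family G" "holder_bound \<alpha> (2 * K) (G t)"
proof -
  show "bounded_family G" unfolding G_def using g T by (intro bounded_family_clamp) (auto simp: CHT_def)
  show "holder_bound \<alpha> (2 * K) (G t)" unfolding G_def using T by (intro holder_bound_data[OF g K_def]) auto
qed

lemma eight_A_nonneg: "0 \<le> 8 * A"
  using A by simp

lemmas solution_facts = \<alpha> \<theta>' T c G eight_A_nonneg N F

lemma W_nonneg: "0 \<le> W"
  using solution_bound[OF solution_facts, of "[]" 0 0] T abs_ge_zero[of "solution F G [] 0 0"] by (simp add: W_def)

lemma v_eq: "t \<in> {0..T} \<Longrightarrow> v t = solution F G [] t"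
  using mild_solution_eq[OF G, of t g F] T by (auto simp: v_def G_def F_def)

lemma solution_family:
  assumes t: "t \<in> {0..T}" and hs: "set hs \<subseteq> CM_space Q" "length hs < N"
  shows "derivative_family (CM_space Q) (CM_norm Q) (W * P hs) (solution F G hs t) (\<lambda>h. solution F G (h # hs) t)"
  unfolding derivative_family_def
proof (intro ballI conjI allI)
  fix h x assume h: "h \<in> CM_space Q"
  then have hhs: "set (h # hs) \<subseteq> CM_space Q" "length (h # hs) \<le> N" using hs by auto
  show "has_directional_derivative (solution F G hs t) h (solution F G (h # hs) t)"
    using t by (intro solution_derivative[OF solution_facts h hs]) auto
  show "solution F G (h # hs) t \<in> Cb" using t by (intro solution_Cb[OF solution_facts hhs]) auto
  show "\<bar>solution F G (h # hs) t x\<bar> \<le> W * P hs * CM_norm Q h"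
    using solution_bound[OF solution_facts hhs, of t x] t by (simp add: W_def mult_ac)
qed

text \<open>The forms \<open>DH\<close> of \<open>v t\<close> are identified with the directional
  derivatives order by order. At order 2 the difference quotients converge in norm thanks to the
  Hoelder exponent \<open>\<theta> - 2\<close>; this is the purpose of
  \<open>F_holder\<close>.\<close>

lemma v_regular:
  assumes t: "t \<in> {0..T}"
  shows "v t \<in> CHn Q N" and "k \<le> N \<Longrightarrow> hs \<in> H_tuples Q k \<Longrightarrow> DH Q k (v t) x hs = solution F G hs t x"
proof -
  have vC: "v t \<in> Cb" unfolding v_eq[OF t] using t by (intro solution_Cb[OF solution_facts]) auto
  have D1: "derivative_family (CM_space Q) (CM_norm Q) W (v t) (\<lambda>h. solution F G [h] t)" if "0 < N"
    using solution_family[OF t, of "[]"] that by (simp add: v_eq[OF t])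
  have h1: "DH Q (Suc 0) (v t) x [h] = solution F G [h] t x" if "0 < N" "h \<in> CM_space Q" for h x
    using DH_1[OF Q vC D1[OF that(1)] W_nonneg, of x] that(2) by (simp add: first_form_def del: DH.simps)
  have 2: "v t \<in> CHn Q (Suc (Suc 0)) \<and> DH Q (Suc (Suc 0)) (v t) x = second_form Q (\<lambda>h k. solution F G [h, k] t) x" if N2: "N = 2" for x
  proof -
    have D2: "derivative_family (CM_space Q) (CM_norm Q) (W * CM_norm Q k) (solution F G [k] t) (\<lambda>h. solution F G [h, k] t)"
      if "k \<in> CM_space Q" for k using solution_family[OF t, of "[k]"] that N2 by simp
    have L: "\<bar>solution F G [h, k] t (x + l) - solution F G [h, k] t x\<bar> \<le> W * (CM_norm Q l powr (\<theta> - 2) * (CM_norm Q h * CM_norm Q k))"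
      if "h \<in> CM_space Q" "k \<in> CM_space Q" "l \<in> CM_space Q" for h k l x
      using solution_fdiff[OF solution_facts, of "[h, k]" t 1 l x] F_holder[OF N2, of "[h, k]" l] that t N2 by (simp add: W_def mult_ac)
    have \<beta>: "0 < \<theta> - 2" using N N2 by simp
    have N0: "0 < N" using N2 by simp
    show ?thesis using CHn_2[OF Q vC D1[OF N0] W_nonneg D2 \<beta> W_nonneg L] DH_2[OF Q vC D1[OF N0] W_nonneg D2 \<beta> W_nonneg L] by blast
  qed
  consider "N = 0" | "N = Suc 0" | "N = 2" using N(1) by linarith
  then show "v t \<in> CHn Q N"
    by cases (use vC 2 CHn_1[OF Q vC D1 W_nonneg] in \<open>auto simp: CHn_def[of Q 0] numeral_2_eq_2\<close>)
  assume k: "k \<le> N" and hs: "hs \<in> H_tuples Q k"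
  consider "k = 0" | "k = Suc 0" | "N = 2" "k = Suc (Suc 0)" using N(1) k by linarith
  then show "DH Q k (v t) x hs = solution F G hs t x"
  proof cases
    case 1
    then show ?thesis using hs by (simp add: v_eq[OF t])
  next
    case 2
    then show ?thesis using hs h1 k by (auto elim!: H_tuples_SucE simp del: DH.simps)
  next
    case 3
    then show ?thesis using hs 2 by (auto elim!: H_tuples_SucE simp: second_form_def simp del: DH.simps)
  qed
qed

lemma v_CbT: "v \<in> CbT T"
proof -
  have "continuous_on ({0..T} \<times> UNIV) (\<lambda>(t, x). v t x)"
    by (rule continuous_on_eq[OF solution_continuous[OF solution_facts, of "[]"]]) (auto simp: v_eq)
  moreover have "\<bar>v t x\<bar> \<le> W" if "t \<in> {0..T}" for t x
    using solution_bound[OF solution_facts, of "[]" t x] that by (simp add: v_eq W_def)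
  ultimately show ?thesis by (auto simp: CbT_def bounded_iff intro!: exI[of _ W])
qed

lemma v_CHn_norm: "t \<in> {0..T} \<Longrightarrow> CHn_norm Q N (v t) \<le> ennreal (3 * W)"
proof -
  assume t: "t \<in> {0..T}"
  have b: "\<bar>solution F G hs t x\<bar> \<le> W * P hs" if "set hs \<subseteq> CM_space Q" "length hs \<le> N" for hs x
    using solution_bound[OF solution_facts that, of t x] t by (simp add: W_def)
  show ?thesis
  proof (rule CHn_norm_le[OF N(1) W_nonneg])
    show "sup_norm (v t) \<le> ennreal W" using b[of "[]"] by (intro sup_norm_le[OF Q]) (simp add: v_eq[OF t])
    show "form_norm Q k (DH Q k (v t) x) \<le> ennreal W" if "k \<in> {1..N}" for k x
      using that v_regular(2)[OF t, of k] b by (intro form_norm_le[OF Q W_nonneg]) (auto simp: H_tuples_def)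
  qed
qed

lemma v_continuous:
  assumes "k \<le> N" "hs \<in> H_tuples Q k"
  shows "continuous_on ({0..T} \<times> UNIV) (\<lambda>(t, x). DH Q k (v t) x hs)"
  by (rule continuous_on_eq[OF solution_continuous[OF solution_facts, of hs]]) (use assms in \<open>auto simp: v_regular(2) H_tuples_def\<close>)

lemma v_fdiff:
  assumes t: "t \<in> {0..T}" and m: "m \<le> 2" "\<theta> < N + m" and l: "l \<in> CM_space Q" and hs: "hs \<in> H_tuples Q N"
    and Fl: "\<And>x. \<bar>fdiff m l (F hs) x\<bar> \<le> 8 * A * (P hs * CM_norm Q l powr (\<theta> - N))"
  shows "\<bar>fdiff m l (\<lambda>x. DH Q N (v t) x hs) x\<bar> \<le> W * (CM_norm Q l powr (\<theta> - N) * P hs)"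
proof -
  have "(\<lambda>x. DH Q N (v t) x hs) = solution F G hs t" using v_regular(2)[OF t order_refl hs] by auto
  then show ?thesis
    using solution_fdiff[OF solution_facts, of hs t m l x] t m l hs Fl by (simp add: W_def H_tuples_def mult_ac)
qed

text \<open>The Zygmund space of order 2 in space and time includes membership in the integer space
  of order 1.\<close>

lemma v_CHT_integer:
  assumes "N = 1" shows "v \<in> CHT Q T 1"
proof -
  have "CHT_norm Q T 1 v \<le> ennreal (3 * W)"
    unfolding CHT_norm_def CH_norm_def using v_CHn_norm assms by (intro SUP_least) (simp add: Let_def)
  then have "CHT_norm Q T 1 v < \<infinity>" using le_less_trans by fastforce
  then show ?thesis using v_CbT v_regular(1) v_continuous assms by (auto simp: CHT_def CH_def simp del: DH.simps)
qed

text \<open>First differences of the derivatives of order \<open>N\<close> have total order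
  \<open>N + 1\<close>, strictly above the noninteger \<open>\<theta>\<close>.\<close>

lemma v_holder:
  assumes n: "nat \<lfloor>\<theta>\<rfloor> = N" and Fl: "\<And>hs l x. hs \<in> H_tuples Q N \<Longrightarrow> l \<in> CM_space Q \<Longrightarrow>
    \<bar>F hs (x + l) - F hs x\<bar> \<le> 8 * A * (P hs * CM_norm Q l powr (\<theta> - N))"
  shows "v \<in> CHT Q T \<theta> \<and> CHT_norm Q T \<theta> v \<le> ennreal (4 * W)"
proof -
  have N1: "\<theta> < N + 1" "\<theta> \<noteq> N" using n N(2) by linarith+
  have h: "holder_seminorm Q N (\<theta> - N) (DH Q N (v t)) \<le> ennreal W" if t: "t \<in> {0..T}" for t
    using v_fdiff[OF t, of 1] N1 Fl by (intro holder_seminorm_le[OF Q W_nonneg]) (simp del: DH.simps)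
  have le: "CHT_norm Q T \<theta> v \<le> ennreal (4 * W)"
    unfolding CHT_norm_def CH_norm_def Let_def n
    using N1 by (intro SUP_least) (auto intro!: add_ennreal_le v_CHn_norm h W_nonneg simp del: DH.simps)
  then have "CHT_norm Q T \<theta> v < \<infinity>" using le_less_trans by fastforce
  moreover have "v t \<in> CH Q \<theta>" if t: "t \<in> {0..T}" for t
    using v_regular(1)[OF t] le_less_trans[OF h[OF t], of \<infinity>] unfolding CH_def Let_def n by simp
  ultimately show ?thesis using v_CbT le v_continuous unfolding CHT_def n by auto
qed

text \<open>At integer \<open>\<theta>\<close> a first difference of the derivatives of order
  \<open>N\<close> has total order exactly \<open>\<theta>\<close>, and its bound
  \<open>r powr - 1\<close> is integrable at neither end. A second difference has total order
  \<open>\<theta> + 1\<close>.\<close>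

lemma v_zygmund:
  assumes n: "\<theta> = Suc N" "N \<le> 1" and Fl: "\<And>hs l x. hs \<in> H_tuples Q N \<Longrightarrow> l \<in> CM_space Q \<Longrightarrow>
    \<bar>F hs (x + 2 *\<^sub>R l) - 2 * F hs (x + l) + F hs x\<bar> \<le> 8 * A * (P hs * CM_norm Q l)"
  shows "v \<in> ZHT Q T (Suc N) \<and> ZHT_norm Q T (Suc N) v \<le> ennreal (4 * W)"
proof -
  have pw: "CM_norm Q l powr (\<theta> - N) = CM_norm Q l" for l using n CM_norm_nonneg[OF Q, of l] by simp
  have h: "zygmund_seminorm Q N (DH Q N (v t)) \<le> ennreal W" if t: "t \<in> {0..T}" for t
    using v_fdiff[OF t, of 2] n Fl unfolding pw fdiff_2 by (intro zygmund_seminorm_le[OF Q W_nonneg]) (simp del: DH.simps)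
  have le: "ZHT_norm Q T (Suc N) v \<le> ennreal (4 * W)"
    unfolding ZHT_norm_def ZH_norm_def
    by (intro SUP_least) (auto intro!: add_ennreal_le v_CHn_norm h W_nonneg simp del: DH.simps)
  then have "ZHT_norm Q T (Suc N) v < \<infinity>" using le_less_trans by fastforce
  moreover have "v t \<in> ZH Q (Suc N)" if t: "t \<in> {0..T}" for t
    using v_regular(1)[OF t] le_less_trans[OF h[OF t], of \<infinity>] by (simp add: ZH_def)
  moreover have "v \<in> CHT Q T (real (Suc N - 1))" if "2 \<le> Suc N" using v_CHT_integer that n(2) by simp
  ultimately show ?thesis using v_CbT le unfolding ZHT_def by auto
qed

end

end

text \<open>Supplies the hypotheses on the initial datum in the solution estimates, in both the
  Hoelder and the Zygmund case; 8 is the largest of the interpolation constants.\<close>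

lemma datum_family:
  fixes Q :: "'a::{real_inner, banach, second_countable_topology} \<Rightarrow> 'a"
  assumes f: "f \<in> Cb" "\<And>x. \<bar>f x\<bar> \<le> A" and A: "0 \<le> A" and N: "N \<le> 2"
    and D1: "0 < N \<Longrightarrow> derivative_family (CM_space Q) (CM_norm Q) (8 * A) f (\<lambda>h x. DH Q (Suc 0) f x [h])"
    and D2: "\<And>k. N = 2 \<Longrightarrow> k \<in> CM_space Q \<Longrightarrow> derivative_family (CM_space Q) (CM_norm Q) (8 * A * CM_norm Q k)
      (\<lambda>x. DH Q (Suc 0) f x [k]) (\<lambda>h x. DH Q (Suc (Suc 0)) f x [h, k])"
    and hs: "set hs \<subseteq> CM_space Q" "length hs \<le> N"
  defines "F \<equiv> \<lambda>hs x. DH Q (length hs) f x hs"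
  shows "F hs \<in> Cb" "\<bar>F hs x\<bar> \<le> 8 * A * prod_list (map (CM_norm Q) hs)"
    "h \<in> CM_space Q \<Longrightarrow> length hs < N \<Longrightarrow> has_directional_derivative (F hs) h (F (h # hs))"
proof -
  consider "hs = []" | h where "hs = [h]" "h \<in> CM_space Q" "0 < N" | h k where "hs = [h, k]" "h \<in> CM_space Q" "k \<in> CM_space Q" "N = 2"
  proof (cases hs)
    case (Cons h ks)
    then show thesis using hs N that by (cases ks) (auto simp: le_Suc_eq numeral_2_eq_2)
  qed (use that in auto)
  then have "F hs \<in> Cb \<and> \<bar>F hs x\<bar> \<le> 8 * A * prod_list (map (CM_norm Q) hs) \<and>
    (h \<in> CM_space Q \<longrightarrow> length hs < N \<longrightarrow> has_directional_derivative (F hs) h (F (h # hs)))"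
  proof cases
    case 1
    then show ?thesis using f A order_trans[OF f(2)[of x], of "8 * A"] D1
      by (auto simp: F_def derivative_family_def simp del: DH.simps(2))
  next
    case 2
    have "N = 2" if "length hs < N" using 2(1) N that by auto
    then show ?thesis using D1[OF 2(3)] D2[OF _ 2(2)] 2(1,2) by (auto simp: F_def derivative_family_def simp del: DH.simps)
  next
    case 3
    then show ?thesis using D2[OF 3(4,3)] by (auto simp: F_def derivative_family_def mult_ac simp del: DH.simps)
  qed
  then show "F hs \<in> Cb" "\<bar>F hs x\<bar> \<le> 8 * A * prod_list (map (CM_norm Q) hs)"
    "h \<in> CM_space Q \<Longrightarrow> length hs < N \<Longrightarrow> has_directional_derivative (F hs) h (F (h # hs))" by auto
qed

text \<open>The constant is \<open>4 * 8\<close>; the coefficient 2 of the norm of \<open>g\<close>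
  is enlarged to 8 so that both norms share one factor.\<close>

lemma ennreal_final_bound:
  fixes c :: real
  assumes le: "X \<le> ennreal (4 * (c * (8 * A + 2 * enn2real NG)))" and c: "0 \<le> c" and A: "0 \<le> A" "ennreal A \<le> NF" and NG: "NG < \<infinity>"
  shows "X \<le> ennreal (32 * c) * (NF + NG)"
proof -
  have "4 * (c * (8 * A + 2 * enn2real NG)) \<le> 4 * (c * (8 * (A + enn2real NG)))"
    using c by (intro mult_left_mono) auto
  then have "X \<le> ennreal (4 * (c * (8 * (A + enn2real NG))))"
    using le by (meson ennreal_leI order_trans)
  also have "\<dots> = ennreal (32 * c) * (ennreal A + ennreal (enn2real NG))"
    using c A by (simp add: ennreal_mult[symmetric] ennreal_plus[symmetric] mult.assoc del: ennreal_plus)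
  also have "\<dots> \<le> ennreal (32 * c) * (NF + NG)"
    using A(2) NG by (intro mult_left_mono add_mono) (auto simp: less_top[symmetric])
  finally show ?thesis .
qed

context
  fixes Q :: "'a::{real_inner, banach, second_countable_topology} \<Rightarrow> 'a" and T s \<alpha> \<theta> C c :: real
    and f :: "'a \<Rightarrow> real" and g :: "real \<Rightarrow> 'a \<Rightarrow> real"
  assumes Q: "positive_operator Q" and T: "0 < T" and s: "0 < s" "s < 1" and \<alpha>: "0 \<le> \<alpha>" "\<alpha> < 1" and \<theta>: "\<theta> = \<alpha> + 2 * s"
    and smoothing: "smoothing_semigroup (frac_sg Q s) (frac_deriv Q s) (CM_space Q) (CM_norm Q) (1 / (2 * s)) C"
    and c: "smoothing_semigroup.schauder_const (frac_sg Q s) (frac_deriv Q s) (CM_space Q) (CM_norm Q) C \<alpha> \<theta> T c"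
    and g: "g \<in> CHT Q T \<alpha>"
begin

abbreviation (input) P where "P hs \<equiv> prod_list (map (CM_norm Q) hs)"

lemma c_nonneg: "0 \<le> c"
  using smoothing_semigroup.C_ge_1[OF smoothing] c smoothing_semigroup.schauder_const_def[OF smoothing] by fastforce

lemma g_finite: "CHT_norm Q T \<alpha> g < \<infinity>"
  using g by (simp add: CHT_def)

lemma mild_solution_holder:
  assumes \<theta>12: "\<theta> \<noteq> 1" "\<theta> \<noteq> 2" and f: "f \<in> CH Q \<theta>"
  shows "mild_solution (frac_sg Q s) f g \<in> CHT Q T \<theta> \<and>
    CHT_norm Q T \<theta> (mild_solution (frac_sg Q s) f g) \<le> ennreal (32 * c) * (CH_norm Q \<theta> f + CHT_norm Q T \<alpha> g)"
proof -
  \<comment> \<open>Since \<open>\<theta>\<close> lies strictly between 0 and 3 and is neither 1 nor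
    2, \<open>N\<close> is strictly below \<open>\<theta>\<close> and the top derivative has a
    positive Hoelder exponent.\<close>
  define N where "N = nat \<lfloor>\<theta>\<rfloor>"
  have n: "nat \<lfloor>\<theta>\<rfloor> = N" by (simp add: N_def)
  have \<theta>3: "0 < \<theta>" "\<theta> < 3" using \<theta> s \<alpha> by auto
  then have N2: "N \<le> 2" unfolding N_def by linarith
  have "real N \<le> \<theta>" "\<theta> < real N + 1" using \<theta>3 unfolding N_def by linarith+
  moreover have "\<theta> \<noteq> real N" using \<theta>12 \<theta>3 N2 by (auto simp: le_Suc_eq numeral_2_eq_2)
  ultimately have N: "real N < \<theta>" "\<theta> < real N + 1" by auto
  have fN: "f \<in> CHn Q N" and fin: "holder_seminorm Q N (\<theta> - N) (DH Q N f) < \<infinity>"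
    using f N unfolding CH_def n Let_def by auto
  note fC = CHn_Cb[OF Q fN]
  obtain A where A: "0 \<le> A" "\<And>x. \<bar>f x\<bar> \<le> A" "holder_seminorm Q N (\<theta> - N) (DH Q N f) \<le> ennreal A"
    "ennreal A = sup_norm f + holder_seminorm Q N (\<theta> - N) (DH Q N f)" using size_of_datum[OF Q fC fin] by blast
  consider "N = 0" | "N = Suc 0" | "N = Suc (Suc 0)" using N2 by linarith
  note Ncases = this
  have N1: "derivative_family (CM_space Q) (CM_norm Q) (8 * A) f (\<lambda>h x. DH Q (Suc 0) f x [h])" if "0 < N"
    using Ncases
  proof cases
    case 2
    then show ?thesis using derivative_family_1_holder[OF Q A(1,2), where \<sigma> = "\<theta> - 1"] fN A(1,3) N CM_norm_nonneg[OF Q]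
      by (intro derivative_family_mono[of _ _ "3 * A" _ _ "8 * A"]) (auto simp del: DH.simps)
  next
    case 3
    then show ?thesis using derivative_family_2_holder(1)[OF Q A(1,2), where \<sigma> = "\<theta> - 2"] fN A(1,3) N CM_norm_nonneg[OF Q]
      by (intro derivative_family_mono[of _ _ "3 * A" _ _ "8 * A"]) (auto simp del: DH.simps)
  qed (use that in simp)
  have N2': "derivative_family (CM_space Q) (CM_norm Q) (8 * A * CM_norm Q k) (\<lambda>x. DH Q (Suc 0) f x [k]) (\<lambda>h x. DH Q (Suc (Suc 0)) f x [h, k])"
    if "N = 2" "k \<in> CM_space Q" for k
    using derivative_family_2_holder(2)[OF Q A(1,2), where \<sigma> = "\<theta> - 2" and k = k] that fN A(3) N by (auto simp: numeral_2_eq_2 simp del: DH.simps)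
  have hol: "\<bar>DH Q N f (x + l) hs - DH Q N f x hs\<bar> \<le> A * (P hs * CM_norm Q l powr (\<theta> - N))" if "hs \<in> H_tuples Q N" "l \<in> CM_space Q" for hs l x
    using Ncases
  proof cases
    case 1
    then show ?thesis using holder_bound_0[OF Q _ A(1) that(2), where f = f and x = x and \<sigma> = \<theta>] A(3) that by simp
  next
    case 2
    then show ?thesis using holder_bound_1[OF Q _ _ A(1) that(2), where f = f and m = 0 and x = x and \<sigma> = "\<theta> - 1"] fN A(3) that
      by (auto elim!: H_tuples_SucE simp: mult_ac simp del: DH.simps)
  next
    case 3
    then show ?thesis using holder_bound_2[OF Q _ _ A(1) that(2), where f = f and m = 0 and x = x and \<sigma> = "\<theta> - 2"] fN A(3) that
      by (auto elim!: H_tuples_SucE simp: mult_ac simp del: DH.simps)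
  qed
  have "A * (P hs * y) \<le> 8 * A * (P hs * y)" if "0 \<le> y" for hs y
    using A(1) that smoothing_semigroup.P_nonneg[OF smoothing, of hs] by (intro mult_right_mono mult_nonneg_nonneg) auto
  then have hol: "\<bar>DH Q (length hs) f (x + l) hs - DH Q (length hs) f x hs\<bar> \<le> 8 * A * (P hs * CM_norm Q l powr (\<theta> - N))"
    if "hs \<in> H_tuples Q N" "l \<in> CM_space Q" for hs l x
    using hol[OF that, of x] that(1) by (fastforce simp: H_tuples_def intro: order_trans)
  have "mild_solution (frac_sg Q s) f g \<in> CHT Q T \<theta> \<and> CHT_norm Q T \<theta> (mild_solution (frac_sg Q s) f g)
      \<le> ennreal (4 * (c * (8 * A + 2 * enn2real (CHT_norm Q T \<alpha> g))))"
  proof (rule v_holder[OF Q T s \<alpha> \<theta> smoothing c refl refl refl refl refl g A(1) N2 N(1) datum_family(1)[OF fC A(2,1) N2 N1 N2']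
        datum_family(2)[OF fC A(2,1) N2 N1 N2'] datum_family(3)[OF fC A(2,1) N2 N1 N2'] _ n hol])
    show "\<theta> < 3 \<and> \<bar>fdiff 1 l (\<lambda>x. DH Q (length hs) f x hs) x\<bar> \<le> 8 * A * (P hs * CM_norm Q l powr (\<theta> - 2))"
      if "N = 2" "set hs \<subseteq> CM_space Q" "length hs = 2" "l \<in> CM_space Q" for hs l x
      using hol[of hs l x] that \<theta>3 by (simp add: H_tuples_def del: DH.simps)
  qed (assumption | simp)+
  moreover have "ennreal A \<le> CH_norm Q \<theta> f"
    unfolding CH_norm_def n Let_def CHn_norm_def A(4) using N by (auto intro!: add_mono simp del: DH.simps)
  ultimately show ?thesis using ennreal_final_bound[OF _ c_nonneg A(1) _ g_finite] by blast
qed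

lemma mild_solution_zygmund:
  assumes k: "\<theta> = real k" "k \<in> {1, 2}" and f: "f \<in> ZH Q k"
  shows "mild_solution (frac_sg Q s) f g \<in> ZHT Q T k \<and>
    ZHT_norm Q T k (mild_solution (frac_sg Q s) f g) \<le> ennreal (32 * c) * (ZH_norm Q k f + CHT_norm Q T \<alpha> g)"
proof -
  \<comment> \<open>The Zygmund space of order \<open>k\<close> rests on \<open>k - 1\<close>
    derivatives.\<close>
  define N where "N = k - 1"
  have n: "k = Suc N" "N \<le> 1" and N2: "N \<le> 2" and N: "real N < \<theta>" using k by (auto simp: N_def)
  have fN: "f \<in> CHn Q N" and fin: "zygmund_seminorm Q N (DH Q N f) < \<infinity>" using f by (auto simp: ZH_def N_def)
  note fC = CHn_Cb[OF Q fN]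
  obtain A where A: "0 \<le> A" "\<And>x. \<bar>f x\<bar> \<le> A" "zygmund_seminorm Q N (DH Q N f) \<le> ennreal A"
    "ennreal A = sup_norm f + zygmund_seminorm Q N (DH Q N f)" using size_of_datum[OF Q fC fin] by blast
  have N1: "derivative_family (CM_space Q) (CM_norm Q) (8 * A) f (\<lambda>h x. DH Q (Suc 0) f x [h])" if "0 < N"
  proof -
    have "N = Suc 0" using that n by simp
    then show ?thesis using derivative_family_1_zygmund[OF Q A(1,2)] fN A(1,3) CM_norm_nonneg[OF Q]
      by (intro derivative_family_mono[of _ _ "2 * A" _ _ "8 * A"]) (auto simp del: DH.simps)
  qed
  have N2': "derivative_family (CM_space Q) (CM_norm Q) (8 * A * CM_norm Q k) (\<lambda>x. DH Q (Suc 0) f x [k]) (\<lambda>h x. DH Q (Suc (Suc 0)) f x [h, k])"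
    if "N = 2" "k \<in> CM_space Q" for k using that n by simp
  have zyg: "\<bar>DH Q N f (x + 2 *\<^sub>R l) hs - 2 * DH Q N f (x + l) hs + DH Q N f x hs\<bar> \<le> A * (P hs * CM_norm Q l)"
    if "hs \<in> H_tuples Q N" "l \<in> CM_space Q" for hs l x
  proof (cases N)
    case 0
    then show ?thesis using zygmund_bound_0[OF Q _ A(1) that(2), where f = f and x = x] A(3) that by simp
  next
    case (Suc N')
    then have "N = Suc 0" using n by simp
    then show ?thesis using zygmund_bound_1[OF Q _ _ A(1) that(2), where f = f and m = 0 and x = x] fN A(3) that
      by (auto elim!: H_tuples_SucE simp: mult_ac simp del: DH.simps)
  qed
  have "A * (P hs * y) \<le> 8 * A * (P hs * y)" if "0 \<le> y" for hs y
    using A(1) that smoothing_semigroup.P_nonneg[OF smoothing, of hs] by (intro mult_right_mono mult_nonneg_nonneg) auto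
  then have zyg: "\<bar>DH Q (length hs) f (x + 2 *\<^sub>R l) hs - 2 * DH Q (length hs) f (x + l) hs + DH Q (length hs) f x hs\<bar> \<le> 8 * A * (P hs * CM_norm Q l)"
    if "hs \<in> H_tuples Q N" "l \<in> CM_space Q" for hs l x
    using zyg[OF that, of x] that(1) CM_norm_nonneg[OF Q, of l] by (fastforce simp: H_tuples_def intro: order_trans)
  have \<theta>N: "\<theta> = real (Suc N)" using k n by simp
  have "mild_solution (frac_sg Q s) f g \<in> ZHT Q T (Suc N) \<and> ZHT_norm Q T (Suc N) (mild_solution (frac_sg Q s) f g)
      \<le> ennreal (4 * (c * (8 * A + 2 * enn2real (CHT_norm Q T \<alpha> g))))"
  proof (rule v_zygmund[OF Q T s \<alpha> \<theta> smoothing c refl refl refl refl refl g A(1) N2 N datum_family(1)[OF fC A(2,1) N2 N1 N2']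
        datum_family(2)[OF fC A(2,1) N2 N1 N2'] datum_family(3)[OF fC A(2,1) N2 N1 N2'] _ \<theta>N n(2) zyg])
    show "\<theta> < 3 \<and> \<bar>fdiff 1 l (\<lambda>x. DH Q (length hs) f x hs) x\<bar> \<le> 8 * A * (P hs * CM_norm Q l powr (\<theta> - 2))" if "N = 2" for hs l x
      using that n by simp
  qed (assumption | simp)+
  moreover have "ennreal A \<le> ZH_norm Q k f"
    unfolding ZH_norm_def CHn_norm_def A(4) N_def by (auto intro!: add_mono simp del: DH.simps)
  ultimately show ?thesis using ennreal_final_bound[OF _ c_nonneg A(1) _ g_finite] n(1) by blast
qed

end

theorem theorem5p12:
  fixes Q :: "'a::{real_inner, banach, second_countable_topology} \<Rightarrow> 'a"
    and T s \<alpha> :: real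
  assumes "positive_operator Q" and "finite_trace Q"
    and "T > 0" and "0 < s" and "s < 1" and "0 \<le> \<alpha>" and "\<alpha> < 1"
  shows "(\<alpha> + 2 * s \<notin> {1, 2} \<longrightarrow>
           (\<exists>C::real. C > 0 \<and>
             (\<forall>f\<in>CH Q (\<alpha> + 2 * s). \<forall>g\<in>CHT Q T \<alpha>.
                mild_solution (frac_sg Q s) f g \<in> CHT Q T (\<alpha> + 2 * s) \<and>
                CHT_norm Q T (\<alpha> + 2 * s) (mild_solution (frac_sg Q s) f g)
                  \<le> ennreal C * (CH_norm Q (\<alpha> + 2 * s) f + CHT_norm Q T \<alpha> g)))) \<and>
         (\<forall>k::nat. k \<in> {1, 2} \<and> \<alpha> + 2 * s = real k \<longrightarrow>
           (\<exists>C::real. C > 0 \<and>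
             (\<forall>f\<in>ZH Q k. \<forall>g\<in>CHT Q T \<alpha>.
                mild_solution (frac_sg Q s) f g \<in> ZHT Q T k \<and>
                ZHT_norm Q T k (mild_solution (frac_sg Q s) f g)
                  \<le> ennreal C * (ZH_norm Q k f + CHT_norm Q T \<alpha> g))))"
proof -
  obtain C where C: "smoothing_semigroup (frac_sg Q s) (frac_deriv Q s) (CM_space Q) (CM_norm Q) (1 / (2 * s)) C"
    using smoothing_semigroup_frac_sg[OF assms(1,2,4,5)] by blast
  interpret smoothing_semigroup "frac_sg Q s" "frac_deriv Q s" "CM_space Q" "CM_norm Q" "1 / (2 * s)" C by (rule C)
  \<comment> \<open>With \<open>p = 1 / (2 s)\<close> the gain of regularity \<open>1 / p\<close> is
    \<open>2 s\<close>.\<close>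
  have "\<alpha> + 2 * s = \<alpha> + 1 / (1 / (2 * s))" by simp
  from schauder_const_exists[OF assms(6,7) this assms(3)]
  obtain c where c: "schauder_const \<alpha> (\<alpha> + 2 * s) T c" by blast
  note facts = assms(1,3-7) refl C c
  have "0 < 32 * c" using C_ge_1 c by (simp add: schauder_const_def)
  then show ?thesis
    using mild_solution_holder[OF facts] mild_solution_zygmund[OF facts]
    by (intro conjI impI allI exI[of _ "32 * c"]) auto
qed

end
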